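(* Let $L>0$, $A\in\mathbb{C}^{n\times n}$ and $B\in\mathbb{C}^{n\times m}$, and assume that $m=1$. The one-dimensional system $$\left\{\begin{array}{ll} \partial_t y = \overrightarrow{\Delta} y + A y & \text{in } (0,T)\times(0,L),\\ y = 1_{\{0\}} B g & \text{on } (0,T)\times\{0,L\},\\ y(0)=y_0 & \text{in }(0,L),\end{array}\right.$$ is approximately controllable if and only if the following two conditions hold: 1. $\ker(\theta_i-A^* )\cap\ker B^*=\{0\}$ for every $i$. 2. For every eigenvalue $s\in\sigma(\overrightarrow{\Delta}+A^* )$ we have $r_s=1$, i.e. there is exactly one pair $(l,i)$ with $s=-\lambda_l+\theta_i$.
   Context: Here $\Omega=(0,L)$ and $\partial\Omega=\{0,L\}$. $\overrightarrow{\Delta}$ is the second derivative acting componentwise on $\mathbb{C}^n$-valued functions, $\Delta$ the scalar one, with domains $H^2\cap H^1_0$ when viewed as operators. $A^*,B^*$ are conjugate transposes and $\partial_n$ is the outward normal derivative. Solutions: for $y_0\in H^{-1}(\Omega)^n$ and $g\in L^2(0,T;L^2(\partial\Omega)^m)$ (i.e. an $L^2(0,T)^m$ function at each boundary point) there is a unique solution by transposition $y\in C^0([0,T];H^{-1}(\Omega)^n)\cap L^2(0,T;L^2(\Omega)^n)$, characterized by: for all $\tau\in[0,T]$ and $\zeta\in H^1_0(\Omega)^n$, $\langle y(\tau),\zeta\rangle-\langle y_0,z(0)\rangle=-\int_0^\tau (Bg\cdot\overline{\partial_n z})(t,0)\,dt$, where $z$ solves $-\partial_t z=\overrightarrow{\Delta}z+A^*z$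 in $(0,\tau)\times\Omega$, $z=0$ on $\partial\Omega$, $z(\tau)=\zeta$. Approximate controllability: the system is approximately controllable at time $T$ if for all $y_0,y_1\in H^{-1}(\Omega)^n$ and $\epsilon>0$ there is a control $g$ whose solution satisfies $\|y(T)-y_1\|_{H^{-1}(\Omega)^n}\le\epsilon$; it is approximately controllable if this holds for every $T>0$. Spectral notation: $\{-\lambda_l\}_l$ are the distinct Dirichlet eigenvalues of $\Delta$ on $(0,L)$ and $\{\theta_i\}_i\subset\mathbb{C}$ the distinct eigenvalues of $A^*$. One has $\sigma(\overrightarrow{\Delta}+A^* )=\{-\lambda_l+\theta_i\}_{l,i}$, and $r_s$ is the (finite) number of pairs $(l,i)$ such that $s=-\lambda_l+\theta_i$. *)

theory Defs
  imports "HOL-Analysis.Analysis"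
begin

section \<open>Linear algebra\<close>

definition conj_transpose :: "complex^'c^'r \<Rightarrow> complex^'r^'c" where
  "conj_transpose M = (\<chi> i j. cnj (M $ j $ i))"

definition ker :: "complex^'c^'r \<Rightarrow> (complex^'c) set" where
  "ker M = {v. M *v v = 0}"

definition eigenvalues :: "complex^'n^'n \<Rightarrow> complex set" where
  "eigenvalues M = {\<theta>. \<exists>v. v \<noteq> 0 \<and> M *v v = \<theta> *s v}"

definition cdot :: "complex^'n \<Rightarrow> complex^'n \<Rightarrow> complex" where
  "cdot v w = (\<Sum>i\<in>UNIV. v $ i * cnj (w $ i))"

section \<open>Function spaces on \<open>(0, L)\<close>\<close>

text \<open>Elements of \<open>L\<^sup>2\<close> are represented by functions; equality almost everywhere is
  not quotiented out.\<close>

definition L2_on :: "'b::euclidean_space set \<Rightarrow> ('b \<Rightarrow> 'a::euclidean_space) set" where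
  "L2_on S = {f. set_borel_measurable lborel S f \<and>
                 set_integrable lborel S (\<lambda>x. (norm (f x))\<^sup>2)}"

definition L2_norm :: "'b::euclidean_space set \<Rightarrow> ('b \<Rightarrow> 'a::euclidean_space) \<Rightarrow> real" where
  "L2_norm S f = sqrt (LINT x:S|lborel. (norm (f x))\<^sup>2)"

text \<open>On an interval, the \<open>H\<^sup>1\<close> functions (through their continuous representatives on
  \<open>[0, L]\<close>) are the absolutely continuous functions with derivative in \<open>L\<^sup>2\<close>, i.e. the
  primitives of \<open>L\<^sup>2\<close> functions. \<open>has_H1_deriv L u v\<close> says that \<open>u\<close> is such a
  representative and that \<open>v\<close> represents its weak derivative.\<close>

definition has_H1_deriv ::
    "real \<Rightarrow> (real \<Rightarrow> 'a::euclidean_space) \<Rightarrow> (real \<Rightarrow> 'a) \<Rightarrow> bool" where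
  "has_H1_deriv L u v \<longleftrightarrow> v \<in> L2_on {0<..<L} \<and>
     (\<forall>x\<in>{0..L}. u x = u 0 + (LINT s:{0..x}|lborel. v s))"

text \<open>Functions in \<open>H\<^sup>1\<^sub>0\<close> are extended by zero outside \<open>[0, L]\<close>, so that each element of the
  space is represented by exactly one function.\<close>

definition H10 :: "real \<Rightarrow> (real \<Rightarrow> 'a::euclidean_space) set" where
  "H10 L = {u. (\<exists>v. has_H1_deriv L u v) \<and> u 0 = 0 \<and> u L = 0 \<and> (\<forall>x. x \<notin> {0..L} \<longrightarrow> u x = 0)}"

text \<open>The weak derivative is unique up to null sets, so the choice below is immaterial.\<close>

definition H10_norm :: "real \<Rightarrow> (real \<Rightarrow> 'a::euclidean_space) \<Rightarrow> real" where
  "H10_norm L u = L2_norm {0<..<L} (SOME v. has_H1_deriv L u v)"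

text \<open>Graph of the (componentwise) second derivative with domain \<open>H\<^sup>2 \<inter> H\<^sup>1\<^sub>0\<close>; the value \<open>f\<close> is
  determined up to null sets.\<close>

definition dirichlet_laplacian ::
    "real \<Rightarrow> (real \<Rightarrow> 'a::euclidean_space) \<Rightarrow> (real \<Rightarrow> 'a) \<Rightarrow> bool" where
  "dirichlet_laplacian L u f \<longleftrightarrow> u \<in> H10 L \<and> (\<exists>p. has_H1_deriv L u p \<and> has_H1_deriv L p f)"

text \<open>For \<open>u\<close> in \<open>H\<^sup>2\<close> the trace of the derivative is the classical one-sided derivative, since
  \<open>u\<close> is continuously differentiable on \<open>[0, L]\<close>.\<close>

definition normal_deriv :: "real \<Rightarrow> (real \<Rightarrow> 'a::euclidean_space) \<Rightarrow> real \<Rightarrow> 'a" where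
  "normal_deriv L u x = (if x = 0 then - vector_derivative u (at x within {0..L})
                         else vector_derivative u (at x within {0..L}))"

text \<open>\<open>H\<^sup>-\<^sup>1\<close> is the space of bounded conjugate-linear functionals on \<open>H\<^sup>1\<^sub>0\<close>, an \<open>L\<^sup>2\<close> function \<open>f\<close>
  being identified with \<open>\<zeta> \<mapsto> \<integral> f \<cdot> \<zeta>\<close>, where the second factor is conjugated (see
  \<open>cdot\<close>). Values of a functional outside \<open>H\<^sup>1\<^sub>0\<close> are irrelevant.\<close>

type_synonym 'n functional = "(real \<Rightarrow> complex^'n) \<Rightarrow> complex"

definition Hm1 :: "real \<Rightarrow> ('n::finite) functional set" where
  "Hm1 L = {F. (\<forall>u\<in>H10 L. \<forall>v\<in>H10 L. F (\<lambda>x. u x + v x) = F u + F v) \<and>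
               (\<forall>c. \<forall>u\<in>H10 L. F (\<lambda>x. c *s u x) = cnj c * F u) \<and>
               (\<exists>C. \<forall>u\<in>H10 L. cmod (F u) \<le> C * H10_norm L u)}"

definition Hm1_norm :: "real \<Rightarrow> ('n::finite) functional \<Rightarrow> real" where
  "Hm1_norm L F = (SUP u\<in>{u \<in> H10 L. H10_norm L u \<le> 1}. cmod (F u))"

section \<open>The adjoint system\<close>

text \<open>\<open>z\<close> solves \<open>- \<partial>\<^sub>t z = \<Delta> z + A\<^sup>* z\<close>, \<open>z = 0\<close> on the boundary, \<open>z(\<tau>) = \<zeta>\<close>, as a classical
  solution of the abstract backward Cauchy problem in \<open>L\<^sup>2\<close>: continuous on \<open>[0, \<tau>]\<close> with values
  in \<open>H\<^sup>1\<^sub>0\<close>, and for \<open>t < \<tau>\<close> differentiable in \<open>L\<^sup>2\<close> with \<open>z(t)\<close> in the domain of the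
  Laplacian. For \<open>\<zeta>\<close> in \<open>H\<^sup>1\<^sub>0\<close> this is the orbit of the analytic semigroup generated by
  \<open>\<Delta> + A\<^sup>*\<close>.\<close>

definition adjoint_solution ::
    "real \<Rightarrow> complex^'n^'n \<Rightarrow> real \<Rightarrow> (real \<Rightarrow> complex^'n) \<Rightarrow>
     (real \<Rightarrow> real \<Rightarrow> complex^'n) \<Rightarrow> bool" where
  "adjoint_solution L A \<tau> \<zeta> z \<longleftrightarrow>
     (\<forall>t\<in>{0..\<tau>}. z t \<in> H10 L) \<and>
     (\<forall>t\<in>{0..\<tau>}. ((\<lambda>s. H10_norm L (\<lambda>x. z s x - z t x)) \<longlongrightarrow> 0) (at t within {0..\<tau>})) \<and>
     z \<tau> = \<zeta> \<and>
     (\<forall>t\<in>{0..<\<tau>}. \<exists>f. dirichlet_laplacian L (z t) f \<and>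
        ((\<lambda>s. L2_norm {0<..<L}
                (\<lambda>x. (1 / (s - t)) *\<^sub>R (z s x - z t x) + (f x + conj_transpose A *v z t x)))
          \<longlongrightarrow> 0) (at t within {0..\<tau>}))"

section \<open>The controlled system\<close>

text \<open>A control \<open>g\<close> in \<open>L\<^sup>2(0,T; L\<^sup>2(\<partial>\<Omega>)\<^sup>m)\<close> is written \<open>g t x\<close> with \<open>x\<close> a boundary point.\<close>

definition controls :: "real \<Rightarrow> real \<Rightarrow> (real \<Rightarrow> real \<Rightarrow> complex^'m) set" where
  "controls L T = {g. \<forall>x\<in>{0, L}. (\<lambda>t. g t x) \<in> L2_on {0<..<T}}"

text \<open>The third conjunct is \<open>y \<in> L\<^sup>2(0,T; L\<^sup>2(\<Omega>)\<^sup>n)\<close>, this space being identified with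
  \<open>L\<^sup>2((0,T) \<times> \<Omega>)\<^sup>n\<close>.\<close>

definition transposition_solution ::
    "real \<Rightarrow> real \<Rightarrow> complex^'n^'n \<Rightarrow> complex^'m^'n \<Rightarrow> 'n functional \<Rightarrow>
     (real \<Rightarrow> real \<Rightarrow> complex^'m) \<Rightarrow> (real \<Rightarrow> 'n functional) \<Rightarrow> bool" where
  "transposition_solution L T A B y0 g y \<longleftrightarrow>
     (\<forall>t\<in>{0..T}. y t \<in> Hm1 L) \<and>
     (\<forall>t\<in>{0..T}. ((\<lambda>s. Hm1_norm L (\<lambda>\<zeta>. y s \<zeta> - y t \<zeta>)) \<longlongrightarrow> 0) (at t within {0..T})) \<and>
     (\<exists>Y\<in>L2_on ({0<..<T} \<times> {0<..<L}).
        AE t in lborel. t \<in> {0<..<T} \<longrightarrow>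
          (\<lambda>x. Y (t, x)) \<in> L2_on {0<..<L} \<and>
          (\<forall>\<zeta>\<in>H10 L. y t \<zeta> = (LINT x:{0<..<L}|lborel. cdot (Y (t, x)) (\<zeta> x)))) \<and>
     (\<forall>\<tau>\<in>{0..T}. \<forall>\<zeta>\<in>H10 L. \<forall>z. adjoint_solution L A \<tau> \<zeta> z \<longrightarrow>
        y \<tau> \<zeta> - y0 (z 0) =
          - (LINT t:{0<..<\<tau>}|lborel. cdot (B *v g t 0) (normal_deriv L (z t) 0)))"

definition approx_controllable_at ::
    "real \<Rightarrow> complex^'n^'n \<Rightarrow> complex^'m^'n \<Rightarrow> real \<Rightarrow> bool" where
  "approx_controllable_at L A B T \<longleftrightarrow>
     (\<forall>y0\<in>Hm1 L. \<forall>y1\<in>Hm1 L. \<forall>\<epsilon>>0. \<exists>g\<in>controls L T. \<exists>y.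
        transposition_solution L T A B y0 g y \<and> Hm1_norm L (\<lambda>\<zeta>. y T \<zeta> - y1 \<zeta>) \<le> \<epsilon>)"

definition approx_controllable ::
    "real \<Rightarrow> complex^'n^'n \<Rightarrow> complex^'m^'n \<Rightarrow> bool" where
  "approx_controllable L A B \<longleftrightarrow> (\<forall>T>0. approx_controllable_at L A B T)"

section \<open>Spectra\<close>

definition laplacian_eigenvalues :: "real \<Rightarrow> complex set" where
  "laplacian_eigenvalues L =
     {\<mu>. \<exists>\<phi> f. \<phi> \<noteq> (\<lambda>x. 0) \<and> dirichlet_laplacian L \<phi> f \<and>
              (AE x in lborel. x \<in> {0<..<L} \<longrightarrow> f x = \<mu> * \<phi> x)}"

text \<open>Eigenvalues of the operator \<open>\<Delta> + M\<close> on vector-valued functions; its resolvent is compact,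
  so these form the whole spectrum.\<close>

definition system_eigenvalues :: "real \<Rightarrow> complex^'n^'n \<Rightarrow> complex set" where
  "system_eigenvalues L M =
     {s. \<exists>u f. u \<noteq> (\<lambda>x. 0) \<and> dirichlet_laplacian L u f \<and>
              (AE x in lborel. x \<in> {0<..<L} \<longrightarrow> f x + M *v u x = s *s u x)}"

text \<open>The number of ways of writing \<open>s = \<mu> + \<theta>\<close> with \<open>\<mu> = - \<lambda>\<^sub>l\<close> a Dirichlet eigenvalue of the scalar
  Laplacian and \<open>\<theta>\<close> an eigenvalue of \<open>M\<close>. Indexing pairs by the eigenvalues themselves is the
  same as indexing by \<open>(l, i)\<close> because the families are enumerated without repetition.\<close>

definition num_pairs :: "real \<Rightarrow> complex^'n^'n \<Rightarrow> complex \<Rightarrow> nat" where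
  "num_pairs L M s = card {(\<mu>, \<theta>). \<mu> \<in> laplacian_eigenvalues L \<and> \<theta> \<in> eigenvalues M \<and> s = \<mu> + \<theta>}"

end

theory Submission
  imports Defs "HOL-Complex_Analysis.Complex_Analysis"
begin

text \<open>The sine functions \<open>sin (\<omega>\<^sub>k x)\<close> with \<open>\<omega>\<^sub>k = (k + 1) \<pi> / L\<close> diagonalise the Dirichlet Laplacian and reduce
  the system to the modes \<open>y\<^sub>k' = (A - \<omega>\<^sub>k\<^sup>2) y\<^sub>k + \<omega>\<^sub>k g b\<close>, up to a common factor, where \<open>b\<close> is the only column
  of \<open>B\<close>.

  If one of the two conditions fails, some eigenfunction of the adjoint operator, composed of at most
  two modes, has a normal derivative at \<open>0\<close> orthogonal to \<open>b\<close>. Along the corresponding adjoint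
  solution no control has any effect.

  Conversely, it suffices to reach a dense set with \<open>C\<^sup>1\<close> controls vanishing at \<open>t = 0\<close>. A direction
  orthogonal to everything reachable is a sequence \<open>\<eta>\<close> with
  \<open>\<Sum>\<^sub>k exp (- \<omega>\<^sub>k\<^sup>2 t) (exp (t A\<^sup>*) \<eta>\<^sub>k \<cdot> b) = 0\<close> for \<open>0 < t < T\<close>, hence for all complex \<open>t\<close> with positive real
  part. Such sequences form a space invariant under the generator. Starting from some \<open>\<eta> \<noteq> 0\<close> and
  applying to it a suitable polynomial in the generator, one obtains an unobservable \<open>\<eta>\<close> whose
  truncation to the first modes is an eigenvector of the generator, supported on a single mode by the second
  condition. As \<open>t \<rightarrow> \<infinity>\<close> this truncation dominates the remaining series when the truncation point is a
  large spectral gap, so that the eigenvector is orthogonal to \<open>b\<close>, against the first condition.\<close>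

section \<open>Square-integrable functions and cosine polynomials\<close>

text \<open>Controllability is defined through full transposition solutions, with continuity in H^-1
  and an L^2 profile in space and time, so solutions must be constructed and not only estimated. C^1
  controls with \<open>\<gamma> 0 = 0\<close> make this possible: integrating Duhamel's formula by
  parts in time splits each forced mode into a trace part of size 1 / freq, summed in closed form as
  an affine function of x, and a remainder of size freq^-3. Adjoint solutions are not constructed:
  each one satisfies an ODE mode by mode, which fixes its coefficients. All norms are read off from
  Fourier coefficients; since the H^1_0 norm is the L^2 norm of a derivative and derivatives turn
  sines into cosines, completeness is proved for cosines, where it reduces to polynomial
  approximation in cos(pi x / L). The weight 1 / freq identifies H^-1 with plain l^2 in the density
  argument. The polynomial in the generator is kept as a list of roots, because the same list of
  shifts acts on sequences and, translated, on single modes; the last iterate with nonzero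
  truncation supplies the eigenvector.\<close>

definition square_integrable :: "'b measure \<Rightarrow> ('b \<Rightarrow> 'a::euclidean_space) \<Rightarrow> bool" where
  "square_integrable M f \<longleftrightarrow> f \<in> borel_measurable M \<and> integrable M (\<lambda>x. (norm (f x))\<^sup>2)"

lemma square_integrableD:
  assumes "square_integrable M f"
  shows "f \<in> borel_measurable M" "integrable M (\<lambda>x. (norm (f x))\<^sup>2)"
  using assms by (auto simp: square_integrable_def)

text \<open>Membership expressed with indicator functions becomes square integrability for the
  restricted measure, so that the rules for Bochner integrals apply without carrying indicators
  along.\<close>

lemma L2_on_iff:
  assumes "S \<in> sets borel"
  shows "f \<in> L2_on S \<longleftrightarrow> square_integrable (restrict_space lborel S) f"
  using assms
  by (simp add: L2_on_def square_integrable_def set_borel_measurable_def set_integrable_def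
      borel_measurable_restrict_space_iff integrable_restrict_space)

lemma set_integral_restrict_space:
  fixes f :: "'b::euclidean_space \<Rightarrow> 'a::{banach,second_countable_topology}"
  assumes "S \<in> sets borel"
  shows "(LINT x:S|lborel. f x) = integral\<^sup>L (restrict_space lborel S) f"
  using assms integral_restrict_space[of S lborel f] by (simp add: set_lebesgue_integral_def)

lemma L2_norm_restrict_space:
  assumes "S \<in> sets borel"
  shows "L2_norm S f = sqrt (\<integral>x. (norm (f x))\<^sup>2 \<partial>restrict_space lborel S)"
  using assms by (simp add: L2_norm_def set_integral_restrict_space)

lemma norm_add_sq_le: "(norm (a + b))\<^sup>2 \<le> 2 * (norm a)\<^sup>2 + 2 * (norm (b::'a::real_inner))\<^sup>2"
proof -
  have "(norm (a + b))\<^sup>2 + (norm (a - b))\<^sup>2 = 2 * (norm a)\<^sup>2 + 2 * (norm b)\<^sup>2"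
    by (simp add: power2_norm_eq_inner algebra_simps inner_commute)
  then show ?thesis using zero_le_power2[of "norm (a - b)"] by linarith
qed

lemma square_integrable_bound:
  assumes "square_integrable M f" "g \<in> borel_measurable M"
    and "\<And>x. x \<in> space M \<Longrightarrow> norm (g x) \<le> C * norm (f x)"
  shows "square_integrable M g"
proof -
  have "integrable M (\<lambda>x. (norm (g x))\<^sup>2)"
  proof (rule Bochner_Integration.integrable_bound)
    show "integrable M (\<lambda>x. C\<^sup>2 * (norm (f x))\<^sup>2)"
      using assms(1) by (simp add: square_integrable_def)
    show "AE x in M. norm ((norm (g x))\<^sup>2) \<le> norm (C\<^sup>2 * (norm (f x))\<^sup>2)"
      using assms(3) by (auto simp: power_mult_distrib[symmetric] intro!: AE_I2 power_mono)
  qed (use assms(2) in measurable)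
  then show ?thesis using assms(2) by (simp add: square_integrable_def)
qed

lemma square_integrable_add:
  assumes "square_integrable M f" "square_integrable M g"
  shows "square_integrable M (\<lambda>x. f x + g x)"
proof -
  note [measurable] = square_integrableD(1)[OF assms(1)] square_integrableD(1)[OF assms(2)]
  have "integrable M (\<lambda>x. (norm (f x + g x))\<^sup>2)"
  proof (rule Bochner_Integration.integrable_bound)
    show "integrable M (\<lambda>x. 2 * (norm (f x))\<^sup>2 + 2 * (norm (g x))\<^sup>2)"
      using assms by (simp add: square_integrable_def)
  qed (auto intro!: AE_I2 norm_add_sq_le)
  then show ?thesis by (simp add: square_integrable_def)
qed

lemma square_integrable_scaleR:
  "square_integrable M f \<Longrightarrow> square_integrable M (\<lambda>x. c *\<^sub>R f x)"
  by (rule square_integrable_bound[where C = "\<bar>c\<bar>"]) (auto simp: square_integrable_def)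

lemma square_integrable_diff:
  "square_integrable M f \<Longrightarrow> square_integrable M g \<Longrightarrow> square_integrable M (\<lambda>x. f x - g x)"
  using square_integrable_add[of M f "\<lambda>x. (-1) *\<^sub>R g x"] square_integrable_scaleR[of M g "-1"]
  by simp

lemma square_integrable_sum:
  "(\<And>i. i \<in> I \<Longrightarrow> square_integrable M (f i)) \<Longrightarrow> square_integrable M (\<lambda>x. \<Sum>i\<in>I. f i x)"
  by (induction I rule: infinite_finite_induct)
    (auto intro: square_integrable_add simp: square_integrable_def[of M "\<lambda>x. 0"])

lemma square_integrable_inner:
  fixes f g :: "'b \<Rightarrow> 'a::euclidean_space"
  assumes "square_integrable M f" "square_integrable M g"
  shows "integrable M (\<lambda>x. f x \<bullet> g x)"
proof (rule Bochner_Integration.integrable_bound)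
  note [measurable] = square_integrableD(1)[OF assms(1)] square_integrableD(1)[OF assms(2)]
  show "integrable M (\<lambda>x. (norm (f x))\<^sup>2 + (norm (g x))\<^sup>2)"
    using assms by (simp add: square_integrable_def)
  show "(\<lambda>x. f x \<bullet> g x) \<in> borel_measurable M" by measurable
  have "\<bar>a \<bullet> b\<bar> \<le> (norm a)\<^sup>2 + (norm b)\<^sup>2" for a b :: 'a
  proof -
    have "0 \<le> norm a * norm b" by simp
    then show ?thesis
      using Cauchy_Schwarz_ineq2[of a b] sum_squares_bound[of "norm a" "norm b"] by linarith
  qed
  then show "AE x in M. norm (f x \<bullet> g x) \<le> norm ((norm (f x))\<^sup>2 + (norm (g x))\<^sup>2)"
    by (auto intro!: AE_I2)
qed

lemma square_integrable_integrable:
  assumes "square_integrable M f" "finite_measure M"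
  shows "integrable M f"
proof (rule Bochner_Integration.integrable_bound)
  interpret finite_measure M by fact
  show "integrable M (\<lambda>x. 1 + (norm (f x))\<^sup>2)"
    using assms by (simp add: square_integrable_def)
  show "f \<in> borel_measurable M" using assms by (simp add: square_integrable_def)
  have "a \<le> 1 + a\<^sup>2" for a :: real
    using zero_le_power2[of "a - 1/2"] by (simp add: power2_eq_square algebra_simps)
  then show "AE x in M. norm (f x) \<le> norm (1 + (norm (f x))\<^sup>2)"
    by (auto intro!: AE_I2)
qed

text \<open>Cauchy-Schwarz against the constant 1: the integral of (|f| - c)^2 is a quadratic in c
  that is nonnegative for every real c.\<close>

lemma integral_norm_sq_le:
  assumes "square_integrable M f" "finite_measure M"
  shows "(\<integral>x. norm (f x) \<partial>M)\<^sup>2 \<le> measure M (space M) * (\<integral>x. (norm (f x))\<^sup>2 \<partial>M)"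
proof -
  interpret finite_measure M by fact
  define m where "m = measure M (space M)"
  define I where "I = (\<integral>x. norm (f x) \<partial>M)"
  define Q where "Q = (\<integral>x. (norm (f x))\<^sup>2 \<partial>M)"
  have int: "integrable M (\<lambda>x. norm (f x))" "integrable M (\<lambda>x. (norm (f x))\<^sup>2)"
    using square_integrable_integrable[OF assms] assms by (auto simp: square_integrable_def)
  have key: "0 \<le> Q - 2 * c * I + c\<^sup>2 * m" for c
  proof -
    have "0 \<le> (\<integral>x. (norm (f x) - c)\<^sup>2 \<partial>M)" by simp
    also have "\<dots> = (\<integral>x. (norm (f x))\<^sup>2 - 2 * c * norm (f x) + c\<^sup>2 \<partial>M)"
      by (simp add: power2_diff algebra_simps)
    also have "\<dots> = Q - 2 * c * I + c\<^sup>2 * m"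
      using int by (simp add: Q_def I_def m_def)
    finally show ?thesis .
  qed
  have "m \<ge> 0" by (simp add: m_def)
  have Q0: "Q \<ge> 0" unfolding Q_def by simp
  show ?thesis
  proof (cases "m = 0")
    case True
    have "I = 0"
    proof (rule ccontr)
      assume "I \<noteq> 0"
      \<comment> \<open>For m = 0 the quadratic is affine in c, and this c gives it the value - Q -
        2.\<close>
      then show False using key[of "(Q + 1) / I"] True Q0 by simp
    qed
    then show ?thesis using True by (simp add: m_def I_def)
  next
    case False
    then have "m > 0" using \<open>m \<ge> 0\<close> by simp
    \<comment> \<open>c = I / m minimises the quadratic.\<close>
    then have "0 \<le> m * (Q - 2 * (I/m) * I + (I/m)\<^sup>2 * m)"
      using key[of "I/m"] by simp
    also have "\<dots> = m * Q - I\<^sup>2" using \<open>m > 0\<close> by (simp add: field_simps power2_eq_square)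
    finally show ?thesis by (simp add: m_def I_def Q_def)
  qed
qed

section \<open>The interval (0, L) as a finite measure space\<close>

locale interval =
  fixes L :: real
  assumes L_pos: "0 < L"
begin

abbreviation N :: "real measure" where "N \<equiv> restrict_space lborel {0<..<L}"

lemma finite_measure_N: "finite_measure N"
  by (rule finite_measureI) (use L_pos in \<open>simp add: space_restrict_space emeasure_restrict_space\<close>)

lemma measure_N: "measure N (space N) = L"
  using L_pos by (simp add: space_restrict_space measure_restrict_space)

lemma space_N [simp]: "space N = {0<..<L}"
  by (simp add: space_restrict_space)

lemma sigma_finite_N: "sigma_finite_measure N"
  by (rule finite_measure.axioms(1)[OF finite_measure_N])

lemma continuous_integrable:
  fixes f :: "real \<Rightarrow> 'a::euclidean_space"
  assumes "continuous_on {0..L} f"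
  shows "integrable N f" "integral\<^sup>L N f = integral {0..L} f"
proof -
  have "set_integrable lborel {0..L} f" using assms by (rule borel_integrable_atLeastAtMost')
  then have *: "set_integrable lborel {0<..<L} f"
    by (rule set_integrable_subset) auto
  then show "integrable N f" by (simp add: set_integrable_def integrable_restrict_space)
  have "integral\<^sup>L N f = (LINT x:{0<..<L}|lborel. f x)"
    by (simp add: set_integral_restrict_space)
  also have "\<dots> = integral {0<..<L} f" using * by (rule set_borel_integral_eq_integral)
  also have "\<dots> = integral {0..L} f"
    using integral_open_interval[of 0 L f] by (simp add: box_real)
  finally show "integral\<^sup>L N f = integral {0..L} f" .
qed

lemma continuous_measurable:
  fixes f :: "real \<Rightarrow> 'a::euclidean_space"
  shows "continuous_on {0..L} f \<Longrightarrow> f \<in> borel_measurable N"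
  by (rule borel_measurable_integrable[OF continuous_integrable(1)])

lemma continuous_square_integrable:
  fixes f :: "real \<Rightarrow> 'a::euclidean_space"
  assumes "continuous_on {0..L} f"
  shows "square_integrable N f"
  unfolding square_integrable_def
  by (intro conjI continuous_measurable continuous_integrable(1) continuous_intros assms)

lemma integral_derivative:
  fixes f :: "real \<Rightarrow> 'a::euclidean_space"
  assumes "\<And>x. x \<in> {0..L} \<Longrightarrow> (F has_vector_derivative f x) (at x)" "continuous_on {0..L} f"
  shows "integral\<^sup>L N f = F L - F 0"
proof -
  have "(f has_integral (F L - F 0)) {0..L}"
    using assms L_pos
    by (intro fundamental_theorem_of_calculus) (auto intro: has_vector_derivative_at_within)
  then show ?thesis using continuous_integrable(2)[OF assms(2)] by (simp add: integral_unique)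
qed

section \<open>Orthogonality of the trigonometric systems\<close>

lemma integral_cos:
  "(\<integral>x. cos (of_int n * pi * x / L) \<partial>N) = (if n = 0 then L else 0)"
proof (cases "n = 0")
  case True
  then show ?thesis using measure_N by (simp del: space_N)
next
  case False
  have "(\<integral>x. cos (of_int n * pi * x / L) \<partial>N) =
     L / (of_int n * pi) * sin (of_int n * pi * L / L) - L / (of_int n * pi) * sin (of_int n * pi * 0 / L)"
  proof (rule integral_derivative)
    show "((\<lambda>x. L / (of_int n * pi) * sin (of_int n * pi * x / L)) has_vector_derivative
       cos (of_int n * pi * x / L)) (at x)" for x
      unfolding has_real_derivative_iff_has_vector_derivative[symmetric]
      using False L_pos by (auto intro!: derivative_eq_intros simp: field_simps)
  qed (use L_pos in \<open>intro continuous_intros, auto\<close>)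
  also have "\<dots> = 0" using L_pos by (simp add: sin_times_pi_eq_0)
  finally show ?thesis using False by simp
qed

lemma cos_div_integrable: "integrable N (\<lambda>x. cos (a * x / L))"
  using L_pos by (intro continuous_integrable continuous_intros) auto

lemma integral_cos_cos:
  "(\<integral>x. cos (real i * pi / L * x) * cos (real j * pi / L * x) \<partial>N) =
     (if i = j then if i = 0 then L else L / 2 else 0)"
proof -
  \<comment> \<open>Product-to-sum formula; the frequencies are taken as integers because i - j may
    be negative.\<close>
  have "(\<integral>x. cos (real i * pi / L * x) * cos (real j * pi / L * x) \<partial>N) =
    (\<integral>x. 1/2 * cos (of_int (int i - int j) * pi * x / L) + 1/2 * cos (of_int (int i + int j) * pi * x / L) \<partial>N)"
    by (intro Bochner_Integration.integral_cong)
      (auto simp: cos_times_cos add_divide_distrib[symmetric] algebra_simps diff_divide_distrib)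
  also have "\<dots> = 1/2 * (\<integral>x. cos (of_int (int i - int j) * pi * x / L) \<partial>N) +
     1/2 * (\<integral>x. cos (of_int (int i + int j) * pi * x / L) \<partial>N)"
    by (subst Bochner_Integration.integral_add)
     (use L_pos in \<open>auto intro!: integrable_mult_right cos_div_integrable simp del: of_int_diff of_int_add\<close>)
  also have "\<dots> = (if i = j then if i = 0 then L else L / 2 else 0)"
    by (subst (1 2) integral_cos) auto
  finally show ?thesis .
qed

lemma integral_sin_sin:
  "(\<integral>x. sin (real i * pi / L * x) * sin (real j * pi / L * x) \<partial>N) =
     (if i = j \<and> i \<noteq> 0 then L / 2 else 0)"
proof -
  have "(\<integral>x. sin (real i * pi / L * x) * sin (real j * pi / L * x) \<partial>N) =
    (\<integral>x. 1/2 * cos (of_int (int i - int j) * pi * x / L) - 1/2 * cos (of_int (int i + int j) * pi * x / L) \<partial>N)"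
    by (intro Bochner_Integration.integral_cong)
      (auto simp: sin_times_sin add_divide_distrib[symmetric] algebra_simps diff_divide_distrib)
  also have "\<dots> = 1/2 * (\<integral>x. cos (of_int (int i - int j) * pi * x / L) \<partial>N) -
     1/2 * (\<integral>x. cos (of_int (int i + int j) * pi * x / L) \<partial>N)"
    by (subst Bochner_Integration.integral_diff)
     (use L_pos in \<open>auto intro!: integrable_mult_right cos_div_integrable simp del: of_int_diff of_int_add\<close>)
  also have "\<dots> = (if i = j \<and> i \<noteq> 0 then L / 2 else 0)"
    by (subst (1 2) integral_cos) auto
  finally show ?thesis .
qed

section \<open>Density of cosine polynomials in L^2(0, L)\<close>

definition cos_poly :: "(nat \<Rightarrow> 'a::euclidean_space) \<Rightarrow> nat \<Rightarrow> real \<Rightarrow> 'a" where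
  "cos_poly a n x = (\<Sum>j\<le>n. cos (real j * pi / L * x) *\<^sub>R a j)"

lemma continuous_cos_poly: "continuous_on S (cos_poly a n)"
  unfolding cos_poly_def by (intro continuous_intros)

text \<open>Membership in the L^2 closure of the cosine polynomials, with the error measured by the
  squared norm. The class is enlarged from continuous functions to indicators, simple functions and
  finally all of L^2.\<close>

definition cos_approximable :: "(real \<Rightarrow> 'a::euclidean_space) \<Rightarrow> bool" where
  "cos_approximable f \<longleftrightarrow> square_integrable N f \<and>
     (\<forall>e>0. \<exists>a n. (\<integral>x. (norm (f x - cos_poly a n x))\<^sup>2 \<partial>N) \<le> e)"

lemma cos_poly_add:
  fixes a b :: "nat \<Rightarrow> 'a::euclidean_space"
  shows "\<exists>c k. \<forall>x. cos_poly a n x + cos_poly b m x = cos_poly c k x"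
proof -
  let ?t = "\<lambda>a n j. if j \<le> n then a j else 0"
  have *: "cos_poly a n x = cos_poly (?t a n) (max n m) x" if "n \<le> k" "k = max n m" for a :: "nat \<Rightarrow> 'a" and n m k x
    unfolding cos_poly_def by (rule sum.mono_neutral_cong_left) auto
  have "cos_poly a n x + cos_poly b m x =
      cos_poly (\<lambda>j. ?t a n j + ?t b m j) (max n m) x" for x
    using *[of n "max n m" m a x] *[of m "max n m" n b x]
    by (simp add: cos_poly_def sum.distrib scaleR_add_right max.commute)
  then show ?thesis by blast
qed

lemma cos_approximable_limit:
  assumes f: "square_integrable N f"
    and g: "\<And>e. e > 0 \<Longrightarrow> \<exists>g. cos_approximable g \<and> (\<integral>x. (norm (f x - g x))\<^sup>2 \<partial>N) \<le> e"
  shows "cos_approximable f"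
  unfolding cos_approximable_def
proof (intro conjI allI impI f)
  fix e :: real assume "e > 0"
  \<comment> \<open>The bound |a + b|^2 \<le> 2 |a|^2 + 2 |b|^2 doubles each of the two errors, so
    each is kept below e / 4.\<close>
  then obtain g where g: "cos_approximable g" "(\<integral>x. (norm (f x - g x))\<^sup>2 \<partial>N) \<le> e/4"
    using g[of "e/4"] by auto
  moreover have "e/4 > 0" using \<open>e > 0\<close> by simp
  ultimately obtain a n where an: "(\<integral>x. (norm (g x - cos_poly a n x))\<^sup>2 \<partial>N) \<le> e/4"
    unfolding cos_approximable_def by blast
  have p: "square_integrable N (cos_poly a n)"
    by (intro continuous_square_integrable continuous_cos_poly)
  have gs: "square_integrable N g" using g by (simp add: cos_approximable_def)
  note i = square_integrableD(2)[OF square_integrable_diff[OF f gs]]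
    square_integrableD(2)[OF square_integrable_diff[OF gs p]]
    square_integrableD(2)[OF square_integrable_diff[OF f p]]
  have "(\<integral>x. (norm (f x - cos_poly a n x))\<^sup>2 \<partial>N) \<le>
     (\<integral>x. 2 * (norm (f x - g x))\<^sup>2 + 2 * (norm (g x - cos_poly a n x))\<^sup>2 \<partial>N)"
  proof (rule integral_mono)
    show "(norm (f x - cos_poly a n x))\<^sup>2 \<le> 2 * (norm (f x - g x))\<^sup>2 + 2 * (norm (g x - cos_poly a n x))\<^sup>2" for x
      using norm_add_sq_le[of "f x - g x" "g x - cos_poly a n x"] by simp
  qed (use i in auto)
  also have "\<dots> \<le> e" using i g an by simp
  finally show "\<exists>a n. (\<integral>x. (norm (f x - cos_poly a n x))\<^sup>2 \<partial>N) \<le> e" by blast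
qed

lemma cos_approximable_add:
  assumes "cos_approximable f" "cos_approximable g"
  shows "cos_approximable (\<lambda>x. f x + g x)"
  unfolding cos_approximable_def
proof (intro conjI allI impI)
  have fs: "square_integrable N f" "square_integrable N g"
    using assms by (auto simp: cos_approximable_def)
  then show "square_integrable N (\<lambda>x. f x + g x)" by (rule square_integrable_add)
  fix e :: real assume "e > 0"
  then have "e/4 > 0" by simp
  then obtain a n b m where an: "(\<integral>x. (norm (f x - cos_poly a n x))\<^sup>2 \<partial>N) \<le> e/4"
    and bm: "(\<integral>x. (norm (g x - cos_poly b m x))\<^sup>2 \<partial>N) \<le> e/4"
    using assms unfolding cos_approximable_def by blast
  obtain c k where ck: "\<And>x. cos_poly a n x + cos_poly b m x = cos_poly c k x"
    using cos_poly_add by blast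
  have p: "square_integrable N (cos_poly a n)" for a :: "nat \<Rightarrow> 'a" and n
    by (intro continuous_square_integrable continuous_cos_poly)
  note i = square_integrableD(2)[OF square_integrable_diff[OF fs(1) p]]
    square_integrableD(2)[OF square_integrable_diff[OF fs(2) p]]
    square_integrableD(2)[OF square_integrable_diff[OF square_integrable_add[OF fs] p]]
  have "(\<integral>x. (norm (f x + g x - cos_poly c k x))\<^sup>2 \<partial>N) \<le>
     (\<integral>x. 2 * (norm (f x - cos_poly a n x))\<^sup>2 + 2 * (norm (g x - cos_poly b m x))\<^sup>2 \<partial>N)"
  proof (rule integral_mono)
    show "(norm (f x + g x - cos_poly c k x))\<^sup>2 \<le> 2 * (norm (f x - cos_poly a n x))\<^sup>2 + 2 * (norm (g x - cos_poly b m x))\<^sup>2" for x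
      using norm_add_sq_le[of "f x - cos_poly a n x" "g x - cos_poly b m x"]
      by (simp add: ck[symmetric] algebra_simps)
  qed (use i in auto)
  also have "\<dots> \<le> e" using i an bm by simp
  finally show "\<exists>a n. (\<integral>x. (norm (f x + g x - cos_poly a n x))\<^sup>2 \<partial>N) \<le> e" by blast
qed

lemma cos_approximable_zero: "cos_approximable (\<lambda>x. 0)"
  unfolding cos_approximable_def square_integrable_def
proof (intro conjI allI impI)
  fix e :: real assume "e > 0"
  have "cos_poly (\<lambda>_. 0) 0 x = (0::'a)" for x by (simp add: cos_poly_def)
  then show "\<exists>a n. (\<integral>x. (norm (0 - cos_poly a n x :: 'a))\<^sup>2 \<partial>N) \<le> e"
    using \<open>e > 0\<close> by (intro exI[of _ "\<lambda>_. 0"] exI[of _ 0]) simp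
qed auto

lemma cos_approximable_sum:
  "(\<And>i. i \<in> I \<Longrightarrow> cos_approximable (f i)) \<Longrightarrow> cos_approximable (\<lambda>x. \<Sum>i\<in>I. f i x)"
  by (induction I rule: infinite_finite_induct)
    (auto intro: cos_approximable_add cos_approximable_zero)

lemma cos_approximable_scaleR:
  fixes f :: "real \<Rightarrow> real" and v :: "'a::euclidean_space"
  assumes "cos_approximable f"
  shows "cos_approximable (\<lambda>x. f x *\<^sub>R v)"
  unfolding cos_approximable_def
proof (intro conjI allI impI)
  have fs: "square_integrable N f" using assms by (auto simp: cos_approximable_def)
  then show "square_integrable N (\<lambda>x. f x *\<^sub>R v)"
    by (rule square_integrable_bound[where C = "norm v"]) (use fs in \<open>auto simp: square_integrable_def\<close>)
  fix e :: real assume "e > 0"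
  define M where "M = (norm v)\<^sup>2 + 1"
  have M: "M > 0" "(norm v)\<^sup>2 \<le> M" by (auto simp: M_def add_nonneg_pos)
  have "e / M > 0" using \<open>e > 0\<close> M by simp
  then obtain a n where an: "(\<integral>x. (norm (f x - cos_poly a n x))\<^sup>2 \<partial>N) \<le> e / M"
    using assms unfolding cos_approximable_def by blast
  have eq: "f x *\<^sub>R v - cos_poly (\<lambda>j. a j *\<^sub>R v) n x = (f x - cos_poly a n x) *\<^sub>R v" for x
    by (simp add: cos_poly_def scaleR_diff_left scaleR_sum_left)
  have "(\<integral>x. (norm (f x *\<^sub>R v - cos_poly (\<lambda>j. a j *\<^sub>R v) n x))\<^sup>2 \<partial>N) =
      (norm v)\<^sup>2 * (\<integral>x. (norm (f x - cos_poly a n x))\<^sup>2 \<partial>N)"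
    by (simp add: eq power_mult_distrib mult.commute)
  also have "\<dots> \<le> M * (e / M)" using an M by (intro mult_mono) auto
  also have "\<dots> = e" using M by simp
  finally show "\<exists>a n. (\<integral>x. (norm (f x *\<^sub>R v - cos_poly a n x))\<^sup>2 \<partial>N) \<le> e" by blast
qed

text \<open>Dominated convergence for the squared error, followed by closedness under L^2 limits.
  Pointwise convergence with a majorant is then enough for the extensions below.\<close>

lemma cos_approximable_dominated:
  assumes s: "\<And>i. cos_approximable (s i)" and f: "square_integrable N f"
    and g: "square_integrable N g" 
    and lim: "\<And>x. x \<in> {0<..<L} \<Longrightarrow> (\<lambda>i. s i x) \<longlonglongrightarrow> f x"
    and bd: "\<And>i x. x \<in> {0<..<L} \<Longrightarrow> norm (f x - s i x) \<le> norm (g x)"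
  shows "cos_approximable f"
proof (rule cos_approximable_limit[OF f])
  fix e :: real assume "e > 0"
  have "(\<lambda>i. \<integral>x. (norm (f x - s i x))\<^sup>2 \<partial>N) \<longlonglongrightarrow> (\<integral>x. 0 \<partial>N)"
  proof (rule integral_dominated_convergence)
    show "integrable N (\<lambda>x. (norm (g x))\<^sup>2)" using g by (simp add: square_integrable_def)
    show "AE x in N. (\<lambda>i. (norm (f x - s i x))\<^sup>2) \<longlonglongrightarrow> 0"
    proof (rule AE_I2)
      fix x assume "x \<in> space N"
      then have "(\<lambda>i. (norm (f x - s i x))\<^sup>2) \<longlonglongrightarrow> (norm (f x - f x))\<^sup>2"
        by (intro tendsto_intros lim) simp
      then show "(\<lambda>i. (norm (f x - s i x))\<^sup>2) \<longlonglongrightarrow> 0" by simp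
    qed
    show "AE x in N. norm ((norm (f x - s i x))\<^sup>2) \<le> (norm (g x))\<^sup>2" for i
      using bd by (auto intro!: AE_I2 power_mono)
    have [measurable]: "f \<in> borel_measurable N" "s i \<in> borel_measurable N" for i
      using f s by (auto simp: square_integrable_def cos_approximable_def)
    show "(\<lambda>x. (norm (f x - s i x))\<^sup>2) \<in> borel_measurable N" for i by measurable
  qed auto
  then have "\<forall>\<^sub>F i in sequentially. (\<integral>x. (norm (f x - s i x))\<^sup>2 \<partial>N) < e"
    using \<open>e > 0\<close> by (intro order_tendstoD(2)[of _ 0]) auto
  then obtain i where "(\<integral>x. (norm (f x - s i x))\<^sup>2 \<partial>N) < e"
    by (auto simp: eventually_sequentially)
  then show "\<exists>g. cos_approximable g \<and> (\<integral>x. (norm (f x - g x))\<^sup>2 \<partial>N) \<le> e"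
    using s by (intro exI[of _ "s i"]) auto
qed

lemma cos_times_cos_poly:
  fixes a :: "nat \<Rightarrow> real"
  shows "\<exists>c k. \<forall>x. cos (real i * pi / L * x) * cos_poly a n x = cos_poly c k x"
proof (induction n)
  have one: "\<exists>c k. \<forall>x. cos (real i * pi / L * x) * (cos (real j * pi / L * x) * y) = cos_poly c k x" for j and y :: real
  proof -
    \<comment> \<open>The cosine is even, so the frequency i - j may be replaced by its absolute
      value, a natural number.\<close>
    define d where "d = (if i \<le> j then j - i else i - j)"
    let ?u = "\<lambda>(d::nat) k. (if k = d then y / 2 else 0)"
    have u: "cos_poly (?u d) d x = cos (real d * pi / L * x) * (y / 2)" for d x
      unfolding cos_poly_def by (subst sum.remove[of _ d]) auto
    have h1: "cos (real i * pi / L * x - real j * pi / L * x) = cos (real d * pi / L * x)" for x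
    proof (cases "i \<le> j")
      case True
      then have "real i * pi / L * x - real j * pi / L * x = - (real d * pi / L * x)"
        by (simp add: d_def of_nat_diff algebra_simps diff_divide_distrib)
      then show ?thesis by simp
    next
      case False
      then have "real i * pi / L * x - real j * pi / L * x = (real d * pi / L * x)"
        by (simp add: d_def of_nat_diff algebra_simps diff_divide_distrib)
      then show ?thesis by simp
    qed
    have h2: "real i * pi / L * x + real j * pi / L * x = real (i + j) * pi / L * x" for x
      by (simp add: algebra_simps add_divide_distrib)
    have "cos (real i * pi / L * x) * (cos (real j * pi / L * x) * y) =
      cos_poly (?u d) d x + cos_poly (?u (i + j)) (i + j) x" for x
    proof -
      have "cos (real i * pi / L * x) * (cos (real j * pi / L * x) * y) =
          (cos (real i * pi / L * x) * cos (real j * pi / L * x)) * y" by simp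
      also have "\<dots> = (cos (real d * pi / L * x) + cos (real (i + j) * pi / L * x)) / 2 * y"
        by (simp only: cos_times_cos h1 h2)
      also have "\<dots> = cos_poly (?u d) d x + cos_poly (?u (i + j)) (i + j) x"
        by (simp only: u) (simp add: algebra_simps)
      finally show ?thesis .
    qed
    then show ?thesis using cos_poly_add[of "?u d" d "?u (i + j)" "i + j"] by presburger
  qed
  {
    case 0
    then show ?case using one[of 0 "a 0"] by (simp add: cos_poly_def)
  next
    case (Suc n)
    obtain c k where ck: "\<And>x. cos (real i * pi / L * x) * cos_poly a n x = cos_poly c k x"
      using Suc by blast
    obtain c' k' where ck': "\<And>x. cos (real i * pi / L * x) * (cos (real (Suc n) * pi / L * x) * a (Suc n)) = cos_poly c' k' x"
      using one[of "Suc n" "a (Suc n)"] by blast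
    have "cos_poly a (Suc n) x = cos_poly a n x + cos (real (Suc n) * pi / L * x) * a (Suc n)" for x
      by (simp add: cos_poly_def)
    then have "cos (real i * pi / L * x) * cos_poly a (Suc n) x = cos_poly c k x + cos_poly c' k' x" for x
      using ck ck' by (simp only: distrib_left)
    then show ?case using cos_poly_add[of c k c' k'] by presburger
  }
qed

text \<open>Powers of cos(pi x / L) are cosine polynomials by repeated use of the product-to-sum
  formula. This is the bridge from Weierstrass approximation to Fourier sums.\<close>

lemma polynomial_cos_poly:
  "\<exists>c k. \<forall>x. (\<Sum>i\<le>n. a i * cos (pi / L * x) ^ i) = cos_poly (c :: nat \<Rightarrow> real) k x"
proof -
  have pow: "\<exists>c k. \<forall>x. y * cos (pi / L * x) ^ i = cos_poly (c :: nat \<Rightarrow> real) k x" for i and y :: real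
  proof (induction i)
    case 0
    show ?case by (rule exI[of _ "\<lambda>_. y"], rule exI[of _ 0]) (simp add: cos_poly_def)
  next
    case (Suc i)
    then obtain c :: "nat \<Rightarrow> real" and k where "\<And>x. y * cos (pi / L * x) ^ i = cos_poly c k x" by blast
    then have "y * cos (pi / L * x) ^ Suc i = cos (real 1 * pi / L * x) * cos_poly c k x" for x
      by (simp add: mult.left_commute[symmetric] flip: \<open>\<And>x. y * cos (pi / L * x) ^ i = cos_poly c k x\<close>)
    then show ?case using cos_times_cos_poly[of 1 c k] by presburger
  qed
  show ?thesis
  proof (induction n)
    case 0
    then show ?case using pow[of "a 0" 0] by simp
  next
    case (Suc n)
    then obtain c :: "nat \<Rightarrow> real" and k where "\<And>x. (\<Sum>i\<le>n. a i * cos (pi / L * x) ^ i) = cos_poly c k x" by blast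
    moreover obtain c' :: "nat \<Rightarrow> real" and k' where "\<And>x. a (Suc n) * cos (pi / L * x) ^ Suc n = cos_poly c' k' x"
      using pow by blast
    ultimately have "(\<Sum>i\<le>Suc n. a i * cos (pi / L * x) ^ i) = cos_poly c k x + cos_poly c' k' x" for x
      by simp
    then show ?case using cos_poly_add[of c k c' k'] by presburger
  qed
qed

text \<open>The substitution y = cos(pi x / L) maps [0, L] homeomorphically onto [-1, 1], so
  polynomials in y that approximate f((L / pi) arccos y) uniformly become cosine polynomials
  approximating f uniformly. Unlike sines, cosines impose no boundary values.\<close>

lemma cos_approximable_continuous:
  fixes f :: "real \<Rightarrow> real"
  assumes "continuous_on {0..L} f"
  shows "cos_approximable f"
  unfolding cos_approximable_def
proof (intro conjI allI impI)
  show fs: "square_integrable N f" using assms by (rule continuous_square_integrable)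
  fix e :: real assume "e > 0"
  \<comment> \<open>A uniform error d costs at most d^2 L in the squared L^2 norm.\<close>
  define d where "d = sqrt (e / L)"
  have d: "d > 0" "d\<^sup>2 * L = e" using \<open>e > 0\<close> L_pos by (auto simp: d_def)
  have "continuous_on {-1..1} (\<lambda>y. f (L / pi * arccos y))"
    using L_pos
    by (intro continuous_on_compose2[OF assms] continuous_intros)
      (auto simp: arccos_lbound field_simps arccos_ubound)
  then obtain q where q: "real_polynomial_function q"
      "\<And>y. y \<in> {-1..1} \<Longrightarrow> \<bar>f (L / pi * arccos y) - q y\<bar> < d"
    using Stone_Weierstrass_real_polynomial_function[of "{-1..1::real}" _ d] d by blast
  then obtain a n where "q = (\<lambda>x. \<Sum>i\<le>n. a i * x ^ i)"
    using real_polynomial_function_iff_sum by blast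
  then obtain c k where ck: "\<And>x. q (cos (pi / L * x)) = cos_poly c k x"
    using polynomial_cos_poly[of a n] by auto
  have bd: "(norm (f x - cos_poly c k x))\<^sup>2 \<le> d\<^sup>2" if x: "x \<in> {0<..<L}" for x
  proof -
    have "arccos (cos (pi / L * x)) = pi / L * x"
      using x L_pos by (intro arccos_cos) (auto simp: field_simps)
    then have "\<bar>f x - cos_poly c k x\<bar> < d"
      using q(2)[of "cos (pi / L * x)"] L_pos by (simp add: ck[symmetric])
    then show ?thesis by (intro power_mono) auto
  qed
  have "(\<integral>x. (norm (f x - cos_poly c k x))\<^sup>2 \<partial>N) \<le> (\<integral>x. d\<^sup>2 \<partial>N)"
  proof (rule integral_mono)
    show "integrable N (\<lambda>x. (norm (f x - cos_poly c k x))\<^sup>2)"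
      using assms by (intro continuous_integrable continuous_intros continuous_cos_poly)
    show "integrable N (\<lambda>x. d\<^sup>2)" by (intro continuous_integrable continuous_intros)
  qed (use bd in auto)
  also have "\<dots> = e" using measure_N d by (simp del: space_N add: mult.commute)
  finally show "\<exists>a n. (\<integral>x. (norm (f x - cos_poly a n x))\<^sup>2 \<partial>N) \<le> e" by blast
qed

lemma square_integrable_bounded:
  fixes f :: "real \<Rightarrow> 'a::euclidean_space"
  assumes "f \<in> borel_measurable N" "\<And>x. x \<in> {0<..<L} \<Longrightarrow> norm (f x) \<le> C"
  shows "square_integrable N f"
proof (rule square_integrable_bound[of N "\<lambda>x. 1 :: real" f C])
  show "square_integrable N (\<lambda>x. 1 :: real)" by (intro continuous_square_integrable continuous_intros)
qed (use assms in auto)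

text \<open>Sets with approximable indicator include the half-lines and are closed under complements
  and countable disjoint unions; half-lines being stable under intersection, Dynkin's theorem yields
  all Borel sets.\<close>

lemma cos_approximable_indicator:
  assumes "A \<in> sets borel"
  shows "cos_approximable (indicat_real A)"
proof -
  have sq: "square_integrable N (indicat_real B)" if "B \<in> sets borel" for B
  proof (rule square_integrable_bounded[where C = 1])
    show "indicat_real B \<in> borel_measurable N"
      using that by (intro measurable_restrict_space1 borel_measurable_indicator) simp
  qed (simp add: indicator_def)
  have one: "square_integrable N (\<lambda>x. 1 :: real)" by (intro continuous_square_integrable continuous_intros)
  have "Int_stable (range atMost :: real set set)"
    by (rule Int_stableI) (auto simp: Int_atMost)
  moreover have "range atMost \<subseteq> Pow (UNIV :: real set)" by simp
  moreover have "A \<in> sigma_sets UNIV (range atMost)"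
    using assms by (simp add: borel_eq_atMost)
  ultimately show ?thesis
  proof (induction A rule: sigma_sets_induct_disjoint)
    case (basic A)
    then obtain a where A: "A = {..a}" by auto
    show ?case
    proof (rule cos_approximable_dominated[where g = "\<lambda>_. 1 :: real"])
      \<comment> \<open>Continuous ramps: equal to 1 up to a, then falling linearly to 0 within
        distance 1 / i.\<close>
      let ?s = "\<lambda>i x. max 0 (min 1 (1 - real i * (x - a)))"
      show "cos_approximable (?s i)" for i
        by (intro cos_approximable_continuous continuous_intros)
      show "(\<lambda>i. ?s i x) \<longlonglongrightarrow> indicat_real A x" for x
      proof (cases "x \<le> a")
        case True
        then have "real i * (x - a) \<le> 0" for i by (intro mult_nonneg_nonpos) auto
        then have "?s i x = 1" for i by (simp add: min_absorb1 max_absorb2 del: mult_le_0_iff)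
        then show ?thesis using True A by simp
      next
        case False
        obtain n where n: "1 < real n * (x - a)" using False ex_less_of_nat_mult[of "x - a" 1] by auto
        have "?s i x = 0" if "n \<le> i" for i
        proof -
          have "real n * (x - a) \<le> real i * (x - a)" using that False by (intro mult_right_mono) auto
          then show ?thesis using n by simp
        qed
        then have "\<forall>\<^sub>F i in sequentially. ?s i x = indicat_real A x"
          using False A by (auto simp: eventually_sequentially)
        then show ?thesis by (rule tendsto_eventually)
      qed
      show "norm (indicat_real A x - ?s i x) \<le> norm (1::real)" for i x
      proof -
        have "0 \<le> ?s i x" "?s i x \<le> 1" by simp_all
        then show ?thesis by (cases "x \<in> A") (simp_all del: min_le_iff_disj le_max_iff_disj)
      qed
      show "square_integrable N (indicat_real A)" by (rule sq) (simp add: A)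
      show "square_integrable N (\<lambda>x. 1 :: real)" by (rule one)
    qed
  next
    case empty then show ?case using cos_approximable_zero by simp
  next
    case (compl A)
    have "cos_approximable (\<lambda>x. 1 + indicat_real A x *\<^sub>R (-1::real))"
      by (rule cos_approximable_add[OF cos_approximable_continuous[OF continuous_on_const]
            cos_approximable_scaleR[OF compl(2)]])
    moreover have "(\<lambda>x. 1 + indicat_real A x *\<^sub>R (-1::real)) = indicat_real (UNIV - A)"
      by (auto simp: indicator_def)
    ultimately show ?case by simp
  next
    case (union A)
    have meas: "A i \<in> sets borel" for i using union(2) by (auto simp: borel_eq_atMost)
    show ?case
    proof (rule cos_approximable_dominated[where g = "\<lambda>_. 1 :: real"])
      show "cos_approximable (\<lambda>x. \<Sum>i<n. indicat_real (A i) x)" for n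
        using union by (intro cos_approximable_sum) auto
      have eq: "(\<Sum>i<n. indicat_real (A i) x) = indicat_real (\<Union>i<n. A i) x" for n x
        using union(1) by (subst indicator_UN_disjoint) (auto intro: disjoint_family_on_mono)
      show "(\<lambda>n. \<Sum>i<n. indicat_real (A i) x) \<longlonglongrightarrow> indicat_real (\<Union>(range A)) x" for x
        unfolding eq by (rule LIMSEQ_indicator_UN)
      show "norm (indicat_real (\<Union>(range A)) x - (\<Sum>i<n. indicat_real (A i) x)) \<le> norm (1::real)" for n x
        unfolding eq by (auto simp: indicator_def)
      show "square_integrable N (indicat_real (\<Union>(range A)))" by (rule sq) (use meas in auto)
      show "square_integrable N (\<lambda>x. 1 :: real)" by (rule one)
    qed
  qed
qed

proposition cos_approximable:
  assumes f: "square_integrable N f"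
  shows "cos_approximable f"
proof -
  have fm: "f \<in> borel_measurable N" using f by (simp add: square_integrable_def)
  obtain s where s: "\<forall>i. simple_function N (s i)"
    and s_lim: "\<forall>x\<in>space N. (\<lambda>i. s i x) \<longlonglongrightarrow> f x"
    and s_bd: "\<forall>i. \<forall>x\<in>space N. dist (s i x) 0 \<le> 2 * dist (f x) 0"
    using borel_measurable_implies_sequence_metric[OF fm, of 0] by (elim exE conjE) rule
  define s' where "s' i x = (\<Sum>y\<in>s i ` space N. indicat_real (s i -` {y} \<inter> space N) x *\<^sub>R y)" for i x
  have s': "s' i x = s i x" if "x \<in> space N" for i x
    unfolding s'_def by (rule simple_function_indicator_representation_banach[OF s[rule_format] that, symmetric])
  have ms: "s i -` {y} \<inter> space N \<in> sets borel" for i y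
  proof -
    have "s i -` {y} \<inter> space N \<in> sets N" by (rule simple_functionD(2)[OF s[rule_format]])
    then show ?thesis by (subst (asm) sets_restrict_space_iff) simp_all
  qed
  have app: "cos_approximable (s' i)" for i
    unfolding s'_def
    by (rule cos_approximable_sum, rule cos_approximable_scaleR, rule cos_approximable_indicator, rule ms)
  show ?thesis
  \<comment> \<open>The approximating simple functions satisfy |s i| \<le> 2 |f|, hence the majorant
    3 |f| for the difference.\<close>
  proof (rule cos_approximable_dominated[OF app f square_integrable_scaleR[OF f, of 3]])
    show "norm (f x - s' i x) \<le> norm (3 *\<^sub>R f x)" if "x \<in> {0<..<L}" for i x
    proof -
      have "norm (s i x) \<le> 2 * norm (f x)" using s_bd[rule_format, of x i] that by simp
      then have "norm (f x - s i x) \<le> 3 * norm (f x)"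
        using norm_triangle_ineq4[of "f x" "s i x"] by linarith
      then show ?thesis using that by (simp add: s')
    qed
    show "(\<lambda>i. s' i x) \<longlonglongrightarrow> f x" if "x \<in> {0<..<L}" for x
      using s_lim[rule_format, of x] that by (simp add: s')
  qed
qed

end

section \<open>The Parseval identity for cosine expansions\<close>

context interval begin

text \<open>The squared L^2 norm of the j-th cosine; the constant function has twice the mass of the
  others.\<close>

definition cos_weight :: "nat \<Rightarrow> real" where
  "cos_weight j = (if j = 0 then L else L / 2)"

definition cos_coeff :: "(real \<Rightarrow> 'a::euclidean_space) \<Rightarrow> nat \<Rightarrow> 'a" where
  "cos_coeff v j = (1 / cos_weight j) *\<^sub>R (\<integral>x. cos (real j * pi / L * x) *\<^sub>R v x \<partial>N)"

lemma cos_weight_pos: "cos_weight j > 0"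
  using L_pos by (simp add: cos_weight_def)

lemma continuous_mult_square_integrable:
  fixes g :: "real \<Rightarrow> real" and v :: "real \<Rightarrow> 'a::euclidean_space"
  assumes "continuous_on {0..L} g" "square_integrable N v"
  shows "square_integrable N (\<lambda>x. g x *\<^sub>R v x)"
proof -
  obtain C where C: "\<And>x. x \<in> {0..L} \<Longrightarrow> norm (g x) \<le> C"
    using compact_imp_bounded[OF compact_continuous_image[OF assms(1) compact_Icc]]
    unfolding bounded_iff by blast
  show ?thesis
  proof (rule square_integrable_bound[OF assms(2), of _ C])
    show "(\<lambda>x. g x *\<^sub>R v x) \<in> borel_measurable N"
      by (rule borel_measurable_scaleR[OF continuous_measurable[OF assms(1)] square_integrableD(1)[OF assms(2)]])
    show "norm (g x *\<^sub>R v x) \<le> C * norm (v x)" if "x \<in> space N" for x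
      using C[of x] that by (auto intro!: mult_right_mono)
  qed
qed

lemma integrable_N: "square_integrable N v \<Longrightarrow> integrable N v"
  by (rule square_integrable_integrable[OF _ finite_measure_N])

lemma integral_inner_cos_poly:
  assumes v: "square_integrable N v"
  shows "(\<integral>x. v x \<bullet> cos_poly a n x \<partial>N) = (\<Sum>j\<le>n. cos_weight j * (cos_coeff v j \<bullet> a j))"
proof -
  have i: "integrable N (\<lambda>x. cos (real j * pi / L * x) *\<^sub>R v x)" for j
    by (intro integrable_N continuous_mult_square_integrable continuous_intros v)
  have "(\<integral>x. v x \<bullet> cos_poly a n x \<partial>N) = (\<integral>x. (\<Sum>j\<le>n. (cos (real j * pi / L * x) *\<^sub>R v x) \<bullet> a j) \<partial>N)"
    by (simp add: cos_poly_def inner_sum_right)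
  also have "\<dots> = (\<Sum>j\<le>n. \<integral>x. (cos (real j * pi / L * x) *\<^sub>R v x) \<bullet> a j \<partial>N)"
    by (rule Bochner_Integration.integral_sum, rule integrable_inner_left, rule i)
  also have "\<dots> = (\<Sum>j\<le>n. (\<integral>x. cos (real j * pi / L * x) *\<^sub>R v x \<partial>N) \<bullet> a j)"
    by (intro sum.cong refl integral_inner_left i)
  also have "\<dots> = (\<Sum>j\<le>n. cos_weight j * (cos_coeff v j \<bullet> a j))"
  proof (rule sum.cong[OF refl])
    fix j show "(\<integral>x. cos (real j * pi / L * x) *\<^sub>R v x \<partial>N) \<bullet> a j = cos_weight j * (cos_coeff v j \<bullet> a j)"
      using cos_weight_pos[of j] by (simp add: cos_coeff_def)
  qed
  finally show ?thesis .
qed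

lemma cos_coeff_cos_poly:
  "cos_coeff (cos_poly a n) j = (if j \<le> n then a j else 0)"
proof -
  have i: "integrable N (\<lambda>x. (cos (real j * pi / L * x) * cos (real i * pi / L * x)) *\<^sub>R a i)" for i
    by (intro continuous_integrable continuous_intros)
  have "(\<integral>x. cos (real j * pi / L * x) *\<^sub>R cos_poly a n x \<partial>N) =
     (\<integral>x. (\<Sum>i\<le>n. (cos (real j * pi / L * x) * cos (real i * pi / L * x)) *\<^sub>R a i) \<partial>N)"
    by (simp add: cos_poly_def scaleR_sum_right)
  also have "\<dots> = (\<Sum>i\<le>n. \<integral>x. (cos (real j * pi / L * x) * cos (real i * pi / L * x)) *\<^sub>R a i \<partial>N)"
    by (rule Bochner_Integration.integral_sum, rule i)
  also have "\<dots> = (\<Sum>i\<le>n. (\<integral>x. cos (real j * pi / L * x) * cos (real i * pi / L * x) \<partial>N) *\<^sub>R a i)"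
    by (intro sum.cong refl integral_scaleR_left continuous_integrable continuous_intros)
  also have "\<dots> = (\<Sum>i\<le>n. if i = j then cos_weight j *\<^sub>R a j else 0)"
    by (rule sum.cong[OF refl], subst integral_cos_cos) (auto simp: cos_weight_def)
  also have "\<dots> = (if j \<le> n then cos_weight j *\<^sub>R a j else 0)"
    by simp
  finally have *: "(\<integral>x. cos (real j * pi / L * x) *\<^sub>R cos_poly a n x \<partial>N) = (if j \<le> n then cos_weight j *\<^sub>R a j else 0)" .
  show ?thesis unfolding cos_coeff_def * using cos_weight_pos[of j] by auto
qed

text \<open>Completing the square: the trial coefficients \<open>a\<close> enter only through the
  last sum, which vanishes exactly at the Fourier coefficients. Both Bessel's inequality and the
  best-approximation property follow.\<close>

lemma integral_diff_cos_poly: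
  assumes v: "square_integrable N v"
  shows "(\<integral>x. (norm (v x - cos_poly a n x))\<^sup>2 \<partial>N) = (\<integral>x. (norm (v x))\<^sup>2 \<partial>N)
     - (\<Sum>j\<le>n. cos_weight j * (norm (cos_coeff v j))\<^sup>2)
     + (\<Sum>j\<le>n. cos_weight j * (norm (a j - cos_coeff v j))\<^sup>2)"
proof -
  have p: "square_integrable N (cos_poly a n)"
    by (intro continuous_square_integrable continuous_cos_poly)
  have "(norm (v x - cos_poly a n x))\<^sup>2 =
      (norm (v x))\<^sup>2 - 2 * (v x \<bullet> cos_poly a n x) + cos_poly a n x \<bullet> cos_poly a n x" for x
    by (simp add: power2_norm_eq_inner algebra_simps inner_commute)
  then have "(\<integral>x. (norm (v x - cos_poly a n x))\<^sup>2 \<partial>N) =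
      (\<integral>x. (norm (v x))\<^sup>2 - 2 * (v x \<bullet> cos_poly a n x) + cos_poly a n x \<bullet> cos_poly a n x \<partial>N)"
    by simp
  also have "\<dots> = (\<integral>x. (norm (v x))\<^sup>2 \<partial>N) - 2 * (\<integral>x. v x \<bullet> cos_poly a n x \<partial>N)
      + (\<integral>x. cos_poly a n x \<bullet> cos_poly a n x \<partial>N)"
    using square_integrableD(2)[OF v] square_integrable_inner[OF v p] square_integrable_inner[OF p p]
    by simp
  also have "\<dots> = (\<integral>x. (norm (v x))\<^sup>2 \<partial>N) - 2 * (\<Sum>j\<le>n. cos_weight j * (cos_coeff v j \<bullet> a j))
      + (\<Sum>j\<le>n. cos_weight j * (a j \<bullet> a j))"
    unfolding integral_inner_cos_poly[OF v] integral_inner_cos_poly[OF p] cos_coeff_cos_poly by simp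
  also have "\<dots> = (\<integral>x. (norm (v x))\<^sup>2 \<partial>N)
     - (\<Sum>j\<le>n. cos_weight j * (norm (cos_coeff v j))\<^sup>2)
     + (\<Sum>j\<le>n. cos_weight j * (norm (a j - cos_coeff v j))\<^sup>2)"
    by (simp add: power2_norm_eq_inner algebra_simps inner_commute sum.distrib sum_subtractf sum_distrib_left)
  finally show ?thesis .
qed

text \<open>Bessel bounds the partial sums from above. Density supplies some cosine polynomial close
  to \<open>v\<close>, and by best approximation the Fourier partial sum of the same degree is at
  least as close.\<close>

theorem cos_parseval:
  assumes v: "square_integrable N v"
  shows "(\<lambda>j. cos_weight j * (norm (cos_coeff v j))\<^sup>2) sums (\<integral>x. (norm (v x))\<^sup>2 \<partial>N)"
proof -
  let ?t = "\<lambda>j. cos_weight j * (norm (cos_coeff v j))\<^sup>2"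
  let ?Q = "\<integral>x. (norm (v x))\<^sup>2 \<partial>N"
  have pos: "?t j \<ge> 0" for j using cos_weight_pos[of j] by simp
  have upper: "(\<Sum>j\<le>n. ?t j) \<le> ?Q" for n
  proof -
    have "0 \<le> (\<integral>x. (norm (v x - cos_poly (cos_coeff v) n x))\<^sup>2 \<partial>N)" by simp
    then show ?thesis unfolding integral_diff_cos_poly[OF v] by simp
  qed
  have "(\<lambda>n. \<Sum>j\<le>n. ?t j) \<longlonglongrightarrow> ?Q"
  proof (rule LIMSEQ_I)
    fix e :: real assume "e > 0"
    then have "e / 2 > 0" by simp
    then obtain a n where an: "(\<integral>x. (norm (v x - cos_poly a n x))\<^sup>2 \<partial>N) \<le> e / 2"
      using cos_approximable[OF v] unfolding cos_approximable_def by blast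
    have "0 \<le> (\<Sum>j\<le>n. cos_weight j * (norm (a j - cos_coeff v j))\<^sup>2)"
      using cos_weight_pos by (intro sum_nonneg mult_nonneg_nonneg) (auto simp: less_imp_le)
    with an have *: "?Q - (\<Sum>j\<le>n. ?t j) \<le> e / 2" unfolding integral_diff_cos_poly[OF v] by linarith
    have "norm ((\<Sum>j\<le>m. ?t j) - ?Q) < e" if "n \<le> m" for m
    proof -
      have "(\<Sum>j\<le>n. ?t j) \<le> (\<Sum>j\<le>m. ?t j)" using that pos by (intro sum_mono2) auto
      with * upper[of m] \<open>e > 0\<close> show ?thesis unfolding real_norm_def by linarith
    qed
    then show "\<exists>no. \<forall>m\<ge>no. norm ((\<Sum>j\<le>m. ?t j) - ?Q) < e" by blast
  qed
  then show ?thesis unfolding sums_def_le .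
qed

section \<open>Primitives of L^2 functions and integration by parts\<close>

lemma singleton_integral:
  fixes c :: "'a::{banach,second_countable_topology}"
  shows "integrable lborel (\<lambda>s. indicat_real {a::real} s *\<^sub>R c)"
    by (rule integrable_scaleR_left) simp

text \<open>\<open>has_H1_deriv\<close> integrates over closed intervals while its L^2 condition
  refers to the open one; the two endpoints are added as null contributions.\<close>

lemma L2_set_integrable:
  assumes "square_integrable N v" "A \<in> sets borel" "A \<subseteq> {0..L}"
  shows "set_integrable lborel A v"
proof -
  have "integrable lborel (\<lambda>s. indicat_real {0<..<L} s *\<^sub>R v s)"
    using integrable_N[OF assms(1)] by (simp add: integrable_restrict_space)
  then have "integrable lborel (\<lambda>s. indicat_real {0<..<L} s *\<^sub>R v s
      + indicat_real {0} s *\<^sub>R v 0 + indicat_real {L} s *\<^sub>R v L)"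
    by (intro Bochner_Integration.integrable_add singleton_integral)
  also have "(\<lambda>s. indicat_real {0<..<L} s *\<^sub>R v s
      + indicat_real {0} s *\<^sub>R v 0 + indicat_real {L} s *\<^sub>R v L) = (\<lambda>s. indicat_real {0..L} s *\<^sub>R v s)"
    using L_pos by (auto simp: indicator_def fun_eq_iff)
  finally have "set_integrable lborel {0..L} v" by (simp add: set_integrable_def)
  then show ?thesis by (rule set_integrable_subset) (use assms in auto)
qed

lemma primitive_N:
  assumes v: "square_integrable N v" and x: "x \<in> {0..L}"
  shows "(LINT s:{0..x}|lborel. v s) = (\<integral>s. (if s \<le> x then v s else 0) \<partial>N)"
proof -
  have 1: "integrable lborel (\<lambda>s. indicat_real {0..x} s *\<^sub>R v s)"
    using L2_set_integrable[OF v, of "{0..x}"] x by (simp add: set_integrable_def)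
  have 2: "integrable lborel (\<lambda>s. indicat_real ({0<..<L} \<inter> {..x}) s *\<^sub>R v s)"
    unfolding set_integrable_def[symmetric] by (rule L2_set_integrable[OF v]) auto
  have "(LINT s:{0..x}|lborel. v s) = (\<integral>s. indicat_real ({0<..<L} \<inter> {..x}) s *\<^sub>R v s \<partial>lborel)"
    unfolding set_lebesgue_integral_def
  proof (rule integral_cong_AE)
    show "AE s in lborel. indicat_real {0..x} s *\<^sub>R v s = indicat_real ({0<..<L} \<inter> {..x}) s *\<^sub>R v s"
    proof (rule AE_I')
      show "{0, L} \<in> null_sets lborel" by (intro finite_imp_null_set_lborel) simp
      show "{s \<in> space lborel. \<not> (indicat_real {0..x} s *\<^sub>R v s = indicat_real ({0<..<L} \<inter> {..x}) s *\<^sub>R v s)} \<subseteq> {0, L}"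
        using x by (auto simp: indicator_def split: if_splits)
    qed
  qed (rule borel_measurable_integrable[OF 1] borel_measurable_integrable[OF 2])+
  also have "\<dots> = (\<integral>s. indicat_real {0<..<L} s *\<^sub>R (if s \<le> x then v s else 0) \<partial>lborel)"
    by (rule Bochner_Integration.integral_cong) (auto simp: indicator_def)
  also have "\<dots> = (\<integral>s. (if s \<le> x then v s else 0) \<partial>N)"
    by (simp add: integral_restrict_space)
  finally show ?thesis .
qed

lemma has_H1_derivD:
  assumes "has_H1_deriv L u v"
  shows "square_integrable N v"
    and "\<And>x. x \<in> {0..L} \<Longrightarrow> u x = u 0 + (LINT s:{0..x}|lborel. v s)"
    and "\<And>x. x \<in> {0..L} \<Longrightarrow> u x = u 0 + (\<integral>s. (if s \<le> x then v s else 0) \<partial>N)"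
    and "continuous_on {0..L} u"
proof -
  show v: "square_integrable N v"
    using assms by (simp add: has_H1_deriv_def L2_on_iff)
  show 1: "\<And>x. x \<in> {0..L} \<Longrightarrow> u x = u 0 + (LINT s:{0..x}|lborel. v s)"
    using assms unfolding has_H1_deriv_def by blast
  show "u x = u 0 + (\<integral>s. (if s \<le> x then v s else 0) \<partial>N)" if "x \<in> {0..L}" for x
    unfolding primitive_N[OF v that, symmetric] by (rule 1[OF that])
  have si: "set_integrable lborel {0..x} v" if "x \<in> {0..L}" for x
    by (rule L2_set_integrable[OF v]) (use that in auto)
  have "continuous_on {0..L} (\<lambda>x. u 0 + integral {0..x} v)"
    using si[of L] L_pos
    by (intro continuous_on_add continuous_on_const indefinite_integral_continuous_1)
      (simp add: set_borel_integral_eq_integral(1))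
  then show "continuous_on {0..L} u"
  proof (rule continuous_on_eq)
    fix x assume x: "x \<in> {0..L}"
    show "u 0 + integral {0..x} v = u x"
      unfolding set_borel_integral_eq_integral(2)[OF si[OF x], symmetric] by (rule 1[OF x, symmetric])
  qed
qed

lemma H1_by_parts:
  fixes u :: "real \<Rightarrow> 'a::euclidean_space"
  assumes H1: "has_H1_deriv L u v"
    and der: "\<And>x. (\<psi> has_real_derivative \<psi>' x) (at x)" and cont: "continuous_on UNIV \<psi>'"
  shows "(\<integral>x. \<psi> x *\<^sub>R v x \<partial>N) = \<psi> L *\<^sub>R u L - \<psi> 0 *\<^sub>R u 0 - (\<integral>x. \<psi>' x *\<^sub>R u x \<partial>N)"
proof -
  interpret pair_sigma_finite N N by (simp add: pair_sigma_finite_def sigma_finite_N)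
  note v = has_H1_derivD(1)[OF H1]
  have contL: "continuous_on {0..L} \<psi>'" using cont by (rule continuous_on_subset) simp
  have cont\<psi>: "continuous_on {0..L} \<psi>"
    using der by (auto intro!: continuous_at_imp_continuous_on DERIV_isCont)
  obtain C where C: "\<And>x. x \<in> {0..L} \<Longrightarrow> norm (\<psi>' x) \<le> C"
    using compact_imp_bounded[OF compact_continuous_image[OF contL compact_Icc]]
    unfolding bounded_iff by blast
  have C0: "C \<ge> 0" using C[of 0] L_pos norm_ge_zero[of "\<psi>' 0"] by auto
  \<comment> \<open>Integrating in s gives \<psi>' x times (u x - u 0); integrating in x gives
    (\<psi> L - \<psi> s) times v s.\<close>
  define f where "f = (\<lambda>x s. if s \<le> x then \<psi>' x *\<^sub>R v s else 0)"
  have vm: "v \<in> borel_measurable N" by (rule square_integrableD(1)[OF v])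
  have idm: "(\<lambda>x. x) \<in> borel_measurable N" by (intro continuous_measurable continuous_intros)
  have pm: "\<psi>' \<in> borel_measurable N" by (intro continuous_measurable contL)
  note m = measurable_compose[OF measurable_fst pm] measurable_compose[OF measurable_snd vm]
     measurable_compose[OF measurable_fst idm] measurable_compose[OF measurable_snd idm]
  have meas: "(\<lambda>(x, s). f x s) \<in> borel_measurable (N \<Otimes>\<^sub>M N)"
    unfolding f_def split_beta
    by (intro measurable_If borel_measurable_scaleR borel_measurable_le measurable_const m) (use m in auto)
  have bd: "norm (f x s) \<le> C * norm (v s)" if "x \<in> space N" for x s
    using C[of x] that C0 by (auto simp: f_def intro!: mult_right_mono)
  have nv: "integrable N (\<lambda>s. C * norm (v s))"
    by (intro integrable_mult_right integrable_norm integrable_N v)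
  have fi: "integrable N (f x)" if "x \<in> space N" for x
  proof (rule Bochner_Integration.integrable_bound[OF nv])
    show "f x \<in> borel_measurable N"
      using measurable_Pair2[OF meas that] by simp
    show "AE s in N. norm (f x s) \<le> norm (C * norm (v s))"
      unfolding real_norm_def by (intro AE_I2 order_trans[OF bd[OF that] abs_ge_self])
  qed
  have int: "integrable (N \<Otimes>\<^sub>M N) (\<lambda>(x, s). f x s)"
  proof (rule Fubini_integrable[OF meas])
    show "integrable N (\<lambda>x. \<integral>s. norm (case (x, s) of (x, s) \<Rightarrow> f x s) \<partial>N)"
    proof (rule finite_measure.integrable_const_bound[OF finite_measure_N])
      show "AE x in N. norm (\<integral>s. norm (case (x, s) of (x, s) \<Rightarrow> f x s) \<partial>N) \<le> (\<integral>s. C * norm (v s) \<partial>N)"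
      proof (rule AE_I2)
        fix x assume x: "x \<in> space N"
        have "(\<integral>s. norm (f x s) \<partial>N) \<le> (\<integral>s. C * norm (v s) \<partial>N)"
          by (rule integral_mono[OF integrable_norm[OF fi[OF x]] nv bd[OF x]])
        moreover have "0 \<le> (\<integral>s. norm (f x s) \<partial>N)" by simp
        ultimately show "norm (\<integral>s. norm (case (x, s) of (x, s) \<Rightarrow> f x s) \<partial>N) \<le> (\<integral>s. C * norm (v s) \<partial>N)"
          by simp
      qed
      show "(\<lambda>x. \<integral>s. norm (case (x, s) of (x, s) \<Rightarrow> f x s) \<partial>N) \<in> borel_measurable N"
        using meas by (intro sigma_finite_measure.borel_measurable_lebesgue_integral[OF sigma_finite_N]) (simp add: split_beta)
    qed
    show "AE x in N. integrable N (\<lambda>s. case (x, s) of (x, s) \<Rightarrow> f x s)"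
      using fi by (intro AE_I2) simp
  qed
  have inner: "(\<integral>x. f x s \<partial>N) = (\<psi> L - \<psi> s) *\<^sub>R v s" if "s \<in> space N" for s
  proof -
    have s: "0 < s" "s < L" using that by auto
    have "(\<integral>x. f x s \<partial>N) = (\<integral>x. (if s \<le> x then \<psi>' x else 0) *\<^sub>R v s \<partial>N)"
      by (rule Bochner_Integration.integral_cong) (auto simp: f_def)
    also have "\<dots> = (\<integral>x. (if s \<le> x then \<psi>' x else 0) \<partial>N) *\<^sub>R v s"
    proof (rule integral_scaleR_left)
      show "integrable N (\<lambda>x. if s \<le> x then \<psi>' x else 0)"
      proof (rule Bochner_Integration.integrable_bound[OF continuous_integrable(1)[OF contL]])
        show "(\<lambda>x. if s \<le> x then \<psi>' x else 0) \<in> borel_measurable N"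
          by (intro measurable_If borel_measurable_le pm measurable_const) (use idm in auto)
      qed auto
    qed
    also have "(\<integral>x. (if s \<le> x then \<psi>' x else 0) \<partial>N) =
      (\<integral>x. indicat_real {0<..<L} x *\<^sub>R (if s \<le> x then \<psi>' x else 0) \<partial>lborel)"
      by (simp add: integral_restrict_space)
    also have "\<dots> = (\<integral>x. indicat_real {s..L} x *\<^sub>R \<psi>' x \<partial>lborel)"
    proof (rule integral_cong_AE)
      have si: "set_integrable lborel {0..L} \<psi>'" by (rule borel_integrable_atLeastAtMost'[OF contL])
      have 1: "set_integrable lborel {s..L} \<psi>'" "set_integrable lborel {s..<L} \<psi>'"
        by (rule set_integrable_subset[OF si]; use s in force)+
      then show "(\<lambda>x. indicat_real {s..L} x *\<^sub>R \<psi>' x) \<in> borel_measurable lborel"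
        unfolding set_integrable_def by (intro borel_measurable_integrable)
      have "(\<lambda>x. indicat_real {0<..<L} x *\<^sub>R (if s \<le> x then \<psi>' x else 0)) = (\<lambda>x. indicat_real {s..<L} x *\<^sub>R \<psi>' x)"
        using s by (auto simp: indicator_def)
      then show "(\<lambda>x. indicat_real {0<..<L} x *\<^sub>R (if s \<le> x then \<psi>' x else 0)) \<in> borel_measurable lborel"
        using borel_measurable_integrable[OF 1(2)[unfolded set_integrable_def]] by simp
      show "AE x in lborel. indicat_real {0<..<L} x *\<^sub>R (if s \<le> x then \<psi>' x else 0) = indicat_real {s..L} x *\<^sub>R \<psi>' x"
      proof (rule AE_I')
        show "{L} \<in> null_sets lborel" by (intro finite_imp_null_set_lborel) simp
      qed (use s in \<open>auto simp: indicator_def split: if_splits\<close>)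
    qed
    also have "\<dots> = \<psi> L - \<psi> s"
      using s by (intro integral_FTC_Icc continuous_on_subset[OF cont])
        (auto intro: has_vector_derivative_at_within der[unfolded has_real_derivative_iff_has_vector_derivative])
    finally show ?thesis .
  qed
  have i1: "integrable N (\<lambda>x. \<psi>' x *\<^sub>R u 0)" by (intro continuous_integrable continuous_intros contL)
  have uc: "continuous_on {0..L} u" by (rule has_H1_derivD(4)[OF H1])
  have i2: "integrable N (\<lambda>x. \<psi>' x *\<^sub>R (u x - u 0))" by (intro continuous_integrable continuous_intros contL uc)
  have uL: "u L = u 0 + (\<integral>s. v s \<partial>N)"
  proof -
    have "(\<integral>s. (if s \<le> L then v s else 0) \<partial>N) = (\<integral>s. v s \<partial>N)"
      by (rule Bochner_Integration.integral_cong) auto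
    then show ?thesis using has_H1_derivD(3)[OF H1, of L] L_pos by simp
  qed
  have "(\<integral>x. \<psi>' x *\<^sub>R u x \<partial>N) = (\<integral>x. \<psi>' x *\<^sub>R u 0 + \<psi>' x *\<^sub>R (u x - u 0) \<partial>N)"
    by (simp add: algebra_simps)
  also have "\<dots> = (\<integral>x. \<psi>' x *\<^sub>R u 0 \<partial>N) + (\<integral>x. \<psi>' x *\<^sub>R (u x - u 0) \<partial>N)"
    by (rule Bochner_Integration.integral_add[OF i1 i2])
  also have "(\<integral>x. \<psi>' x *\<^sub>R u 0 \<partial>N) = (\<psi> L - \<psi> 0) *\<^sub>R u 0"
  proof -
    have "(\<integral>x. \<psi>' x \<partial>N) = \<psi> L - \<psi> 0"
      by (rule integral_derivative[OF _ contL]) (use der in \<open>simp add: has_real_derivative_iff_has_vector_derivative\<close>)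
    then show ?thesis by (subst integral_scaleR_left) (auto intro: continuous_integrable contL)
  qed
  also have "(\<integral>x. \<psi>' x *\<^sub>R (u x - u 0) \<partial>N) = (\<integral>x. \<integral>s. f x s \<partial>N \<partial>N)"
  proof (rule Bochner_Integration.integral_cong[OF refl])
    fix x assume x: "x \<in> space N"
    then have "u x - u 0 = (\<integral>s. (if s \<le> x then v s else 0) \<partial>N)" using has_H1_derivD(3)[OF H1, of x] by simp
    then have "\<psi>' x *\<^sub>R (u x - u 0) = (\<integral>s. \<psi>' x *\<^sub>R (if s \<le> x then v s else 0) \<partial>N)" by simp
    also have "\<dots> = (\<integral>s. f x s \<partial>N)" by (rule Bochner_Integration.integral_cong) (auto simp: f_def)
    finally show "\<psi>' x *\<^sub>R (u x - u 0) = (\<integral>s. f x s \<partial>N)" .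
  qed
  also have "\<dots> = (\<integral>s. \<integral>x. f x s \<partial>N \<partial>N)"
    by (rule Fubini_integral[OF int, symmetric])
  also have "\<dots> = (\<integral>s. \<psi> L *\<^sub>R v s - \<psi> s *\<^sub>R v s \<partial>N)"
    by (rule Bochner_Integration.integral_cong[OF refl], subst inner) (auto simp: scaleR_diff_left)
  also have "\<dots> = \<psi> L *\<^sub>R (\<integral>s. v s \<partial>N) - (\<integral>s. \<psi> s *\<^sub>R v s \<partial>N)"
    by (subst Bochner_Integration.integral_diff)
      (simp_all add: integrable_N v continuous_mult_square_integrable[OF cont\<psi>])
  finally show ?thesis unfolding uL by (simp add: algebra_simps)
qed

end

section \<open>Sine expansions in \<open>H\<^sup>1\<^sub>0\<close>\<close>

context interval begin

lemma if_integrable: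
  assumes "square_integrable N v"
  shows "integrable N (\<lambda>s. if s \<le> x then v s else 0)"
proof (rule Bochner_Integration.integrable_bound[OF integrable_N[OF assms]])
  have idm: "(\<lambda>x. x) \<in> borel_measurable N" by (intro continuous_measurable continuous_intros)
  show "(\<lambda>s. if s \<le> x then v s else 0) \<in> borel_measurable N"
    by (intro measurable_If borel_measurable_le idm measurable_const square_integrableD(1)[OF assms])
      simp_all
qed (simp add: AE_I2)

lemma has_H1_derivI:
  assumes "square_integrable N v"
    and "\<And>x. x \<in> {0..L} \<Longrightarrow> u x = u 0 + (\<integral>s. (if s \<le> x then v s else 0) \<partial>N)"
  shows "has_H1_deriv L u v"
  unfolding has_H1_deriv_def
proof (intro conjI ballI)
  show "v \<in> L2_on {0<..<L}" using assms(1) by (simp add: L2_on_iff)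
  show "u x = u 0 + (LINT s:{0..x}|lborel. v s)" if "x \<in> {0..L}" for x
    unfolding primitive_N[OF assms(1) that] by (rule assms(2)[OF that])
qed

lemma square_integrable_linear:
  assumes "bounded_linear T" "square_integrable M v"
  shows "square_integrable M (\<lambda>x. T (v x))"
proof -
  obtain K where K: "\<And>x. norm (T x) \<le> norm x * K"
    using bounded_linear.bounded[OF assms(1)] by blast
  show ?thesis
  proof (rule square_integrable_bound[OF assms(2)])
    show "(\<lambda>x. T (v x)) \<in> borel_measurable M"
      by (rule measurable_compose[OF square_integrableD(1)[OF assms(2)]
            borel_measurable_continuous_onI[OF linear_continuous_on[OF assms(1)]]])
    show "norm (T (v x)) \<le> K * norm (v x)" for x using K[of "v x"] by (simp add: mult.commute)
  qed
qed

lemma has_H1_deriv_linear: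
  assumes "bounded_linear T" "has_H1_deriv L u v"
  shows "has_H1_deriv L (\<lambda>x. T (u x)) (\<lambda>x. T (v x))"
proof (rule has_H1_derivI)
  note v = has_H1_derivD(1)[OF assms(2)]
  interpret T: bounded_linear T by fact
  show "square_integrable N (\<lambda>x. T (v x))" by (rule square_integrable_linear[OF assms(1) v])
  fix x assume x: "x \<in> {0..L}"
  have "T (u x) = T (u 0 + (\<integral>s. (if s \<le> x then v s else 0) \<partial>N))"
    using has_H1_derivD(3)[OF assms(2) x] by (rule arg_cong)
  also have "\<dots> = T (u 0) + T (\<integral>s. (if s \<le> x then v s else 0) \<partial>N)" by (rule T.add)
  also have "T (\<integral>s. (if s \<le> x then v s else 0) \<partial>N) = (\<integral>s. T (if s \<le> x then v s else 0) \<partial>N)"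
    by (rule integral_bounded_linear[OF assms(1) if_integrable[OF v], symmetric])
  also have "\<dots> = (\<integral>s. (if s \<le> x then T (v s) else 0) \<partial>N)"
    by (rule Bochner_Integration.integral_cong) (auto simp: T.zero)
  finally show "T (u x) = T (u 0) + (\<integral>s. (if s \<le> x then T (v s) else 0) \<partial>N)" .
qed

lemma has_H1_deriv_add:
  assumes "has_H1_deriv L u v" "has_H1_deriv L u' v'"
  shows "has_H1_deriv L (\<lambda>x. u x + u' x) (\<lambda>x. v x + v' x)"
proof (rule has_H1_derivI)
  note v = has_H1_derivD(1)[OF assms(1)] has_H1_derivD(1)[OF assms(2)]
  show "square_integrable N (\<lambda>x. v x + v' x)" by (rule square_integrable_add[OF v])
  fix x assume x: "x \<in> {0..L}"
  have "(\<integral>s. (if s \<le> x then v s + v' s else 0) \<partial>N) =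
      (\<integral>s. (if s \<le> x then v s else 0) + (if s \<le> x then v' s else 0) \<partial>N)"
    by (rule Bochner_Integration.integral_cong) auto
  also have "\<dots> = (\<integral>s. (if s \<le> x then v s else 0) \<partial>N) + (\<integral>s. (if s \<le> x then v' s else 0) \<partial>N)"
    by (rule Bochner_Integration.integral_add[OF if_integrable[OF v(1)] if_integrable[OF v(2)]])
  finally show "u x + u' x = u 0 + u' 0 + (\<integral>s. (if s \<le> x then v s + v' s else 0) \<partial>N)"
    using has_H1_derivD(3)[OF assms(1) x] has_H1_derivD(3)[OF assms(2) x] by (simp add: algebra_simps)
qed

text \<open>The pair \<open>u'\<close>, \<open>v'\<close> has to agree with the C^1 pair only on
  [0, L], because elements of \<open>H10\<close> are cut off outside it and are not differentiable
  on the whole line.\<close>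

lemma has_H1_deriv_C1:
  fixes u :: "real \<Rightarrow> 'a::euclidean_space"
  assumes "\<And>x. (u has_vector_derivative v x) (at x)" "continuous_on UNIV v"
    and "\<And>x. x \<in> {0..L} \<Longrightarrow> u' x = u x" "\<And>x. x \<in> {0..L} \<Longrightarrow> v' x = v x"
  shows "has_H1_deriv L u' v'"
  unfolding has_H1_deriv_def
proof (intro conjI ballI)
  have "continuous_on {0..L} v" using assms(2) by (rule continuous_on_subset) simp
  then have "continuous_on {0..L} v'" by (subst continuous_on_cong[OF refl assms(4)])
  then show "v' \<in> L2_on {0<..<L}" by (simp add: L2_on_iff continuous_square_integrable)
  fix x assume x: "x \<in> {0..L}"
  have "(LINT s:{0..x}|lborel. v' s) = (LINT s:{0..x}|lborel. v s)"
    unfolding set_lebesgue_integral_def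
    by (rule Bochner_Integration.integral_cong) (use x assms(4) in \<open>auto simp: indicator_def\<close>)
  also have "\<dots> = u x - u 0"
    unfolding set_lebesgue_integral_def
    by (rule integral_FTC_Icc)
      (use x in \<open>auto intro: has_vector_derivative_at_within assms(1) continuous_on_subset[OF assms(2)]\<close>)
  finally show "u' x = u' 0 + (LINT s:{0..x}|lborel. v' s)"
    using assms(3)[OF x] assms(3)[of 0] L_pos by simp
qed

section \<open>Sine modes and sine coefficients\<close>

definition freq :: "nat \<Rightarrow> real" where
  "freq k = real (Suc k) * pi / L"

definition sine_coeff :: "(real \<Rightarrow> 'a::euclidean_space) \<Rightarrow> nat \<Rightarrow> 'a" where
  "sine_coeff u k = (2 / L) *\<^sub>R (\<integral>x. sin (freq k * x) *\<^sub>R u x \<partial>N)"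

definition mode :: "nat \<Rightarrow> 'a::euclidean_space \<Rightarrow> real \<Rightarrow> 'a" where
  "mode k w x = (if x \<in> {0..L} then sin (freq k * x) *\<^sub>R w else 0)"

lemma freq_pos: "freq k > 0"
  using L_pos by (simp add: freq_def)

lemma sin_freq_L [simp]: "sin (freq k * L) = 0"
proof -
  have "freq k * L = real (Suc k) * pi" using L_pos by (simp add: freq_def)
  then show ?thesis by (simp only: sin_npi)
qed

lemma H10_boundary: "u \<in> H10 L \<Longrightarrow> u 0 = 0" "u \<in> H10 L \<Longrightarrow> u L = 0"
    "u \<in> H10 L \<Longrightarrow> x \<notin> {0..L} \<Longrightarrow> u x = 0"
  by (auto simp: H10_def)

lemma H10_deriv: "u \<in> H10 L \<Longrightarrow> \<exists>v. has_H1_deriv L u v"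
  by (simp add: H10_def)

lemma H10_continuous: "u \<in> H10 L \<Longrightarrow> continuous_on {0..L} u"
  using H10_deriv has_H1_derivD(4) by blast

lemma H10_square_integrable: "u \<in> H10 L \<Longrightarrow> square_integrable N u"
  by (rule continuous_square_integrable[OF H10_continuous])

lemma H10_linear:
  assumes "bounded_linear T" "u \<in> H10 L"
  shows "(\<lambda>x. T (u x)) \<in> H10 L"
proof -
  obtain v where "has_H1_deriv L u v" using H10_deriv[OF assms(2)] by blast
  then have "has_H1_deriv L (\<lambda>x. T (u x)) (\<lambda>x. T (v x))" by (rule has_H1_deriv_linear[OF assms(1)])
  then show ?thesis using assms(2) linear_simps(3)[OF assms(1)] by (auto simp: H10_def)
qed

lemma H10_add:
  assumes "u \<in> H10 L" "u' \<in> H10 L"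
  shows "(\<lambda>x. u x + u' x) \<in> H10 L"
proof -
  obtain v v' where "has_H1_deriv L u v" "has_H1_deriv L u' v'" using H10_deriv assms by blast
  then have "has_H1_deriv L (\<lambda>x. u x + u' x) (\<lambda>x. v x + v' x)" by (rule has_H1_deriv_add)
  then show ?thesis using assms by (auto simp: H10_def)
qed

lemma H10_diff:
  assumes "u \<in> H10 L" "u' \<in> H10 L"
  shows "(\<lambda>x. u x - u' x) \<in> H10 L"
  using H10_add[OF assms(1) H10_linear[OF bounded_linear_scaleR_right[of "-1"] assms(2)]] by simp

lemma H10_zero: "(\<lambda>x. 0) \<in> H10 L"
proof -
  have "has_H1_deriv L (\<lambda>x. 0) (\<lambda>x. 0 :: 'a)" by (rule has_H1_deriv_C1[of "\<lambda>x. 0" "\<lambda>x. 0"]) auto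
  then show ?thesis by (auto simp: H10_def)
qed

lemma H10_sum: "(\<And>i. i \<in> I \<Longrightarrow> u i \<in> H10 L) \<Longrightarrow> (\<lambda>x. \<Sum>i\<in>I. u i x) \<in> H10 L"
  by (induction I rule: infinite_finite_induct) (auto intro: H10_add H10_zero)

lemma mode_deriv:
  "has_H1_deriv L (mode k w) (\<lambda>x. (freq k * cos (freq k * x)) *\<^sub>R w)"
  by (rule has_H1_deriv_C1[where u = "\<lambda>x. sin (freq k * x) *\<^sub>R w" and v = "\<lambda>x. (freq k * cos (freq k * x)) *\<^sub>R w"])
    (auto simp: mode_def intro!: derivative_eq_intros continuous_intros)

lemma mode_H10: "mode k w \<in> H10 L"
  using mode_deriv[of k w] by (auto simp: H10_def mode_def)

lemma mode_laplacian:
  "dirichlet_laplacian L (mode k w) (\<lambda>x. (- (freq k)\<^sup>2) *\<^sub>R mode k w x)"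
proof -
  have "has_H1_deriv L (\<lambda>x. (freq k * cos (freq k * x)) *\<^sub>R w) (\<lambda>x. (- (freq k)\<^sup>2) *\<^sub>R mode k w x)"
    by (rule has_H1_deriv_C1[where u = "\<lambda>x. (freq k * cos (freq k * x)) *\<^sub>R w"
          and v = "\<lambda>x. (- (freq k)\<^sup>2 * sin (freq k * x)) *\<^sub>R w"])
     (auto simp: mode_def power2_eq_square intro!: derivative_eq_intros continuous_intros)
  then show ?thesis using mode_H10 mode_deriv unfolding dirichlet_laplacian_def by blast
qed

lemma sine_coeff_mode: "sine_coeff (mode k w) l = (if l = k then w else 0)"
proof -
  have "(\<integral>x. sin (freq l * x) *\<^sub>R mode k w x \<partial>N) = (\<integral>x. (sin (freq l * x) * sin (freq k * x)) *\<^sub>R w \<partial>N)"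
    by (rule Bochner_Integration.integral_cong) (auto simp: mode_def)
  also have "\<dots> = (\<integral>x. sin (freq l * x) * sin (freq k * x) \<partial>N) *\<^sub>R w"
    by (intro integral_scaleR_left continuous_integrable continuous_intros)
  also have "\<dots> = (if l = k then (L / 2) *\<^sub>R w else 0)"
    unfolding freq_def integral_sin_sin by simp
  finally show ?thesis using L_pos by (simp add: sine_coeff_def)
qed

lemma sin_mult_square_integrable:
  "square_integrable N u \<Longrightarrow> square_integrable N (\<lambda>x. sin (a * x) *\<^sub>R u x)"
  by (intro continuous_mult_square_integrable continuous_intros)

lemma sine_coeff_linear:
  assumes "bounded_linear T" "square_integrable N u"
  shows "sine_coeff (\<lambda>x. T (u x)) k = T (sine_coeff u k)"
proof -
  interpret T: bounded_linear T by fact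
  have "(\<integral>x. sin (freq k * x) *\<^sub>R T (u x) \<partial>N) = (\<integral>x. T (sin (freq k * x) *\<^sub>R u x) \<partial>N)"
    by (simp add: T.scaleR)
  also have "\<dots> = T (\<integral>x. sin (freq k * x) *\<^sub>R u x \<partial>N)"
    by (intro integral_bounded_linear assms(1) integrable_N sin_mult_square_integrable assms(2))
  finally show ?thesis by (simp add: sine_coeff_def T.scaleR)
qed

lemma sine_coeff_add:
  assumes "square_integrable N u" "square_integrable N v"
  shows "sine_coeff (\<lambda>x. u x + v x) k = sine_coeff u k + sine_coeff v k"
proof -
  have "(\<integral>x. sin (freq k * x) *\<^sub>R (u x + v x) \<partial>N) =
     (\<integral>x. sin (freq k * x) *\<^sub>R u x \<partial>N) + (\<integral>x. sin (freq k * x) *\<^sub>R v x \<partial>N)"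
    unfolding scaleR_add_right
    by (intro Bochner_Integration.integral_add integrable_N sin_mult_square_integrable assms)
  then show ?thesis by (simp add: sine_coeff_def scaleR_add_right)
qed

lemma sine_coeff_diff:
  assumes "square_integrable N u" "square_integrable N v"
  shows "sine_coeff (\<lambda>x. u x - v x) k = sine_coeff u k - sine_coeff v k"
  using sine_coeff_add[OF assms(1) square_integrable_scaleR[OF assms(2), of "-1"], of k]
    sine_coeff_linear[OF bounded_linear_scaleR_right[of "-1"] assms(2), of k] by simp

lemma sine_coeff_zero: "sine_coeff (\<lambda>x. 0) k = 0"
  by (simp add: sine_coeff_def)

lemma sine_coeff_sum:
  "(\<And>i. i \<in> I \<Longrightarrow> square_integrable N (u i)) \<Longrightarrow>
    sine_coeff (\<lambda>x. \<Sum>i\<in>I. u i x) k = (\<Sum>i\<in>I. sine_coeff (u i) k)"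
  by (induction I rule: infinite_finite_induct)
    (simp_all add: sine_coeff_add square_integrable_sum sine_coeff_zero)

text \<open>Sine coefficients are continuous in L^2, by Cauchy-Schwarz and |sin| \<le> 1. This
  carries the L^2 difference quotients of the adjoint problem over to each mode.\<close>

lemma sine_coeff_bound:
  assumes "square_integrable N u"
  shows "norm (sine_coeff u k) \<le> (2 / L) * sqrt L * L2_norm {0<..<L} u"
proof -
  have "norm (\<integral>x. sin (freq k * x) *\<^sub>R u x \<partial>N) \<le> (\<integral>x. norm (sin (freq k * x) *\<^sub>R u x) \<partial>N)"
    by (rule integral_norm_bound)
  also have "\<dots> \<le> (\<integral>x. norm (u x) \<partial>N)"
  proof (rule integral_mono)
    show "integrable N (\<lambda>x. norm (sin (freq k * x) *\<^sub>R u x))" "integrable N (\<lambda>x. norm (u x))"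
      by (intro integrable_norm integrable_N sin_mult_square_integrable assms)+
    show "norm (sin (freq k * x) *\<^sub>R u x) \<le> norm (u x)" for x
      using mult_right_mono[OF abs_sin_le_one norm_ge_zero, of "freq k * x" "u x"] by simp
  qed
  also have "\<dots> \<le> sqrt (L * (\<integral>x. (norm (u x))\<^sup>2 \<partial>N))"
    by (rule real_le_rsqrt) (use integral_norm_sq_le[OF assms finite_measure_N] in \<open>simp only: measure_N\<close>)
  finally show ?thesis using L_pos
    by (simp add: sine_coeff_def L2_norm_restrict_space real_sqrt_mult divide_right_mono)
qed

lemma cos_coeff_Suc:
  "cos_coeff v (Suc k) = (2 / L) *\<^sub>R (\<integral>x. cos (freq k * x) *\<^sub>R v x \<partial>N)"
  by (simp add: cos_coeff_def cos_weight_def freq_def del: of_nat_Suc)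

text \<open>Integration by parts moves the derivative to the cosine, and the boundary values of
  \<open>u\<close> vanish. The index shifts by one because cosines include the constant function,
  whose coefficient is a multiple of u L - u 0.\<close>

lemma cos_coeff_deriv:
  assumes "has_H1_deriv L u v" "u 0 = 0" "u L = 0"
  shows "cos_coeff v 0 = 0" "cos_coeff v (Suc k) = freq k *\<^sub>R sine_coeff u k"
proof -
  have "(\<integral>x. 1 *\<^sub>R v x \<partial>N) = 1 *\<^sub>R u L - 1 *\<^sub>R u 0 - (\<integral>x. 0 *\<^sub>R u x \<partial>N)"
    by (rule H1_by_parts[OF assms(1)]) auto
  then show "cos_coeff v 0 = 0" using assms by (simp add: cos_coeff_def)
  have "(\<integral>x. cos (freq k * x) *\<^sub>R v x \<partial>N) = cos (freq k * L) *\<^sub>R u L - cos (freq k * 0) *\<^sub>R u 0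
      - (\<integral>x. (- freq k * sin (freq k * x)) *\<^sub>R u x \<partial>N)"
    by (rule H1_by_parts[OF assms(1)]) (auto intro!: derivative_eq_intros continuous_intros)
  also have "\<dots> = - (\<integral>x. (- freq k) *\<^sub>R sin (freq k * x) *\<^sub>R u x \<partial>N)"
    using assms by simp
  also have "\<dots> = freq k *\<^sub>R (\<integral>x. sin (freq k * x) *\<^sub>R u x \<partial>N)"
    by (subst integral_scaleR_right) simp
  finally have *: "(\<integral>x. cos (freq k * x) *\<^sub>R v x \<partial>N) = freq k *\<^sub>R (\<integral>x. sin (freq k * x) *\<^sub>R u x \<partial>N)" .
  then show "cos_coeff v (Suc k) = freq k *\<^sub>R sine_coeff u k"
    by (simp add: cos_coeff_Suc sine_coeff_def)
qed

text \<open>Two integrations by parts. Nothing is known about \<open>p\<close> at the endpoints, but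
  there the first boundary term dies with the sine; the second one dies with
  \<open>u\<close>.\<close>

lemma sine_coeff_laplacian:
  assumes "has_H1_deriv L u p" "has_H1_deriv L p f" "u 0 = 0" "u L = 0"
  shows "sine_coeff f k = - (freq k)\<^sup>2 *\<^sub>R sine_coeff u k"
proof -
  have "(\<integral>x. sin (freq k * x) *\<^sub>R f x \<partial>N) = sin (freq k * L) *\<^sub>R p L - sin (freq k * 0) *\<^sub>R p 0
      - (\<integral>x. (freq k * cos (freq k * x)) *\<^sub>R p x \<partial>N)"
    by (rule H1_by_parts[OF assms(2)]) (auto intro!: derivative_eq_intros continuous_intros)
  also have "\<dots> = - (\<integral>x. freq k *\<^sub>R cos (freq k * x) *\<^sub>R p x \<partial>N)" by simp
  also have "\<dots> = - (freq k *\<^sub>R (\<integral>x. cos (freq k * x) *\<^sub>R p x \<partial>N))"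
    by (subst integral_scaleR_right) simp
  also have "(\<integral>x. cos (freq k * x) *\<^sub>R p x \<partial>N) = (L / 2) *\<^sub>R cos_coeff p (Suc k)"
    using L_pos by (simp add: cos_coeff_Suc)
  also have "cos_coeff p (Suc k) = freq k *\<^sub>R sine_coeff u k" by (rule cos_coeff_deriv(2)[OF assms(1,3,4)])
  finally show ?thesis using L_pos by (simp add: sine_coeff_def power2_eq_square)
qed

section \<open>Parseval identity and pointwise expansion in H^1_0\<close>

lemma H10_norm_eq:
  assumes "u \<in> H10 L"
  obtains v where "has_H1_deriv L u v" "(H10_norm L u)\<^sup>2 = (\<integral>x. (norm (v x))\<^sup>2 \<partial>N)"
proof -
  define v where "v = (SOME v. has_H1_deriv L u v)"
  have "has_H1_deriv L u v" unfolding v_def by (rule someI_ex[OF H10_deriv[OF assms]])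
  moreover have "(H10_norm L u)\<^sup>2 = (\<integral>x. (norm (v x))\<^sup>2 \<partial>N)"
    unfolding H10_norm_def v_def[symmetric] by (simp add: L2_norm_restrict_space)
  ultimately show ?thesis by (rule that)
qed

lemma H10_norm_nonneg: "H10_norm L u \<ge> 0"
  unfolding H10_norm_def by (simp add: L2_norm_restrict_space)

text \<open>Cosine Parseval for the weak derivative. Its constant coefficient is zero, so the series
  starts at the first true cosine, and the common weight L / 2 of the remaining terms gives the
  factor 2 / L.\<close>

theorem H10_parseval:
  assumes "u \<in> H10 L"
  shows "(\<lambda>k. (freq k)\<^sup>2 * (norm (sine_coeff u k))\<^sup>2) sums (2 / L * (H10_norm L u)\<^sup>2)"
proof -
  obtain v where v: "has_H1_deriv L u v" "(H10_norm L u)\<^sup>2 = (\<integral>x. (norm (v x))\<^sup>2 \<partial>N)"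
    using H10_norm_eq[OF assms] .
  note c = cos_coeff_deriv[OF v(1) H10_boundary(1,2)[OF assms]]
  have "(\<lambda>j. cos_weight j * (norm (cos_coeff v j))\<^sup>2) sums (H10_norm L u)\<^sup>2"
    using cos_parseval[OF has_H1_derivD(1)[OF v(1)]] unfolding v(2) .
  then have "(\<lambda>k. cos_weight (Suc k) * (norm (cos_coeff v (Suc k)))\<^sup>2) sums (H10_norm L u)\<^sup>2"
    by (subst sums_Suc_iff) (simp add: c(1))
  then have "(\<lambda>k. 2 / L * (cos_weight (Suc k) * (norm (cos_coeff v (Suc k)))\<^sup>2)) sums (2 / L * (H10_norm L u)\<^sup>2)"
    by (rule sums_mult)
  then show ?thesis unfolding c(2) using L_pos by (simp add: cos_weight_def power_mult_distrib)
qed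

text \<open>One-dimensional Sobolev inequality, from u(0) = 0 and Cauchy-Schwarz; it turns
  convergence in the H^1_0 norm into pointwise convergence.\<close>

lemma H10_norm_bound:
  assumes "u \<in> H10 L"
  shows "norm (u x) \<le> sqrt L * H10_norm L u"
proof (cases "x \<in> {0..L}")
  case True
  obtain v where v: "has_H1_deriv L u v" "(H10_norm L u)\<^sup>2 = (\<integral>x. (norm (v x))\<^sup>2 \<partial>N)"
    using H10_norm_eq[OF assms] .
  note vs = has_H1_derivD(1)[OF v(1)]
  have "norm (u x) = norm (\<integral>s. (if s \<le> x then v s else 0) \<partial>N)"
    using has_H1_derivD(3)[OF v(1) True] H10_boundary(1)[OF assms] by simp
  also have "\<dots> \<le> (\<integral>s. norm (if s \<le> x then v s else 0) \<partial>N)"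
    by (rule integral_norm_bound)
  also have "\<dots> \<le> (\<integral>s. norm (v s) \<partial>N)"
    by (rule integral_mono[OF integrable_norm[OF if_integrable[OF vs]] integrable_norm[OF integrable_N[OF vs]]]) simp
  also have "\<dots> \<le> sqrt (L * (\<integral>x. (norm (v x))\<^sup>2 \<partial>N))"
    by (rule real_le_rsqrt) (use integral_norm_sq_le[OF vs finite_measure_N] in \<open>simp only: measure_N\<close>)
  also have "\<dots> = sqrt L * H10_norm L u"
    unfolding v(2)[symmetric] by (simp add: real_sqrt_mult H10_norm_nonneg)
  finally show ?thesis .
next
  case False
  then show ?thesis using H10_boundary(3)[OF assms False] L_pos H10_norm_nonneg[of u] by simp
qed

text \<open>The remainder keeps exactly the coefficients of \<open>u\<close> from index n on, so
  Parseval expresses its norm as the tail of a convergent series.\<close>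

lemma H10_tail_sums:
  assumes "u \<in> H10 L"
  defines "r \<equiv> \<lambda>n x. u x - (\<Sum>k<n. mode k (sine_coeff u k) x)"
  shows "r n \<in> H10 L" "sine_coeff (r n) l = (if l < n then 0 else sine_coeff u l)"
    "(\<lambda>n. H10_norm L (r n)) \<longlonglongrightarrow> 0"
proof -
  have S: "(\<lambda>x. \<Sum>k<n. mode k (sine_coeff u k) x) \<in> H10 L" for n
    by (intro H10_sum mode_H10)
  show r: "r n \<in> H10 L" for n unfolding r_def by (rule H10_diff[OF assms(1) S])
  show c: "sine_coeff (r n) l = (if l < n then 0 else sine_coeff u l)" for n l
  proof -
    have "sine_coeff (r n) l = sine_coeff u l - (\<Sum>k<n. sine_coeff (mode k (sine_coeff u k)) l)"
      unfolding r_def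
      by (subst sine_coeff_diff[OF H10_square_integrable H10_square_integrable])
        (auto simp: assms(1) S sine_coeff_sum H10_square_integrable mode_H10)
    then show ?thesis by (simp add: sine_coeff_mode)
  qed
  let ?a = "\<lambda>k. (freq k)\<^sup>2 * (norm (sine_coeff u k))\<^sup>2"
  let ?A = "2 / L * (H10_norm L u)\<^sup>2"
  have a: "?a sums ?A" by (rule H10_parseval[OF assms(1)])
  have sq: "2 / L * (H10_norm L (r n))\<^sup>2 = ?A - (\<Sum>k<n. ?a k)" for n
  proof -
    have "(\<lambda>k. ?a k - (if k \<in> {..<n} then ?a k else 0)) sums (?A - (\<Sum>k<n. ?a k))"
      by (intro sums_diff a sums_If_finite_set) simp
    moreover have "(\<lambda>k. ?a k - (if k \<in> {..<n} then ?a k else 0)) = (\<lambda>k. (freq k)\<^sup>2 * (norm (sine_coeff (r n) k))\<^sup>2)"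
      by (auto simp: c)
    ultimately have "(\<lambda>k. (freq k)\<^sup>2 * (norm (sine_coeff (r n) k))\<^sup>2) sums (?A - (\<Sum>k<n. ?a k))"
      by (simp only:)
    then show ?thesis by (rule sums_unique2[OF H10_parseval[OF r]])
  qed
  then have eq: "H10_norm L (r n) = sqrt (L / 2 * (?A - (\<Sum>k<n. ?a k)))" for n
    unfolding sq[symmetric] using L_pos H10_norm_nonneg[of "r n"] by simp
  have "(\<lambda>n. sqrt (L / 2 * (?A - (\<Sum>k<n. ?a k)))) \<longlonglongrightarrow> sqrt (L / 2 * (?A - ?A))"
    using a unfolding sums_def by (intro tendsto_intros)
  then show "(\<lambda>n. H10_norm L (r n)) \<longlonglongrightarrow> 0" unfolding eq by simp
qed

theorem H10_expansion:
  assumes "u \<in> H10 L" "x \<in> {0..L}"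
  shows "(\<lambda>k. sin (freq k * x) *\<^sub>R sine_coeff u k) sums u x"
proof -
  define r where "r n x = u x - (\<Sum>k<n. mode k (sine_coeff u k) x)" for n x
  note t = H10_tail_sums[OF assms(1), folded r_def]
  have "(\<lambda>n. r n x) \<longlonglongrightarrow> 0"
  proof (rule Lim_null_comparison)
    show "\<forall>\<^sub>F n in sequentially. norm (r n x) \<le> sqrt L * H10_norm L (r n)"
      using H10_norm_bound[OF t(1)] by (intro always_eventually) blast
    show "(\<lambda>n. sqrt L * H10_norm L (r n)) \<longlonglongrightarrow> 0"
      using tendsto_mult_right_zero[OF t(3)] by simp
  qed
  then have "(\<lambda>n. u x - r n x) \<longlonglongrightarrow> u x - 0" by (intro tendsto_intros)
  then show ?thesis using assms(2) by (simp add: sums_def r_def mode_def)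
qed

lemma summable_inverse_freq: "2 \<le> n \<Longrightarrow> summable (\<lambda>k. 1 / (freq k) ^ n)"
proof -
  assume n: "2 \<le> n"
  have "summable (\<lambda>k. inverse (real (Suc k) ^ n))"
    using inverse_power_summable[OF n, where 'a = real] by (subst summable_Suc_iff)
  then have "summable (\<lambda>k. (L / pi) ^ n * inverse (real (Suc k) ^ n))" by (rule summable_mult)
  also have "(\<lambda>k. (L / pi) ^ n * inverse (real (Suc k) ^ n)) = (\<lambda>k. 1 / (freq k) ^ n)"
    by (simp add: freq_def power_divide power_mult_distrib divide_simps mult.commute del: of_nat_Suc)
  finally show ?thesis .
qed

text \<open>2 |c| \<le> freq^-2 + freq^2 |c|^2, and both terms on the right are summable.\<close>

lemma H10_coeff_summable:
  assumes "summable (\<lambda>k. (freq k)\<^sup>2 * (norm (c k))\<^sup>2)"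
  shows "summable (\<lambda>k. norm (c k))"
proof (rule summable_comparison_test'[where N = 0])
  show "summable (\<lambda>k. 1 / (freq k)\<^sup>2 + (freq k)\<^sup>2 * (norm (c k))\<^sup>2)"
    by (intro summable_add summable_inverse_freq assms) simp
  show "norm (norm (c k)) \<le> 1 / (freq k)\<^sup>2 + (freq k)\<^sup>2 * (norm (c k))\<^sup>2" for k
  proof -
    have "2 * (1 / freq k) * (freq k * norm (c k)) \<le> (1 / freq k)\<^sup>2 + (freq k * norm (c k))\<^sup>2"
      by (rule sum_squares_bound)
    moreover have "2 * (1 / freq k) * (freq k * norm (c k)) = 2 * norm (c k)"
      using freq_pos[of k] by simp
    ultimately show ?thesis using norm_ge_zero[of "c k"]
      by (simp add: power_mult_distrib power_divide del: norm_ge_zero)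
  qed
qed

lemma H10_coeff_nonzero:
  assumes "u \<in> H10 L" "u \<noteq> (\<lambda>x. 0)"
  shows "\<exists>k. sine_coeff u k \<noteq> 0"
proof (rule ccontr)
  assume "\<not> ?thesis"
  then have "sine_coeff u k = 0" for k by blast
  then have "(\<lambda>k. 0) sums (2 / L * (H10_norm L u)\<^sup>2)" using H10_parseval[OF assms(1)] by simp
  then have "0 = 2 / L * (H10_norm L u)\<^sup>2" by (rule sums_unique2[OF sums_zero])
  then have "H10_norm L u = 0" using L_pos by simp
  then have "u x = 0" for x using H10_norm_bound[OF assms(1), of x] by simp
  then show False using assms(2) by auto
qed

end

section \<open>Sine expansions in \<open>H\<^sup>-\<^sup>1\<close>\<close>

lemma norm_complex_vec: "norm v = L2_set (\<lambda>i. cmod (v $ i)) UNIV" for v :: "complex^'n"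
  by (simp add: norm_vec_def)

lemma norm_smult: "norm (c *s v) = cmod c * norm v" for v :: "complex^'n"
  by (simp add: norm_complex_vec norm_mult L2_set_right_distrib)

lemma scaleR_smult: "r *\<^sub>R v = complex_of_real r *s v" for v :: "complex^'n"
  unfolding vec_eq_iff vector_scaleR_component vector_smult_component
  by (simp add: scaleR_conv_of_real)

lemma bounded_linear_smult: "bounded_linear (\<lambda>v :: complex^'n. c *s v)"
  by (rule bounded_linear_intro[where K = "cmod c"])
    (simp_all add: vec_eq_iff algebra_simps norm_smult)

lemma bounded_linear_matrix: "bounded_linear (\<lambda>v :: complex^'n. (M :: complex^'n^'m) *v v)"
proof -
  have "linear (\<lambda>v :: complex^'n. M *v v)"
    by (rule linearI) (simp_all add: matrix_vector_mult_def vec_eq_iff algebra_simps sum.distrib scaleR_sum_right)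
  then show ?thesis by (simp add: linear_conv_bounded_linear)
qed

lemma matrix_smult: "M *v (c *s v) = c *s (M *v v)" for v :: "complex^'n"
  by (simp add: matrix_vector_mult_def vec_eq_iff sum_distrib_left mult.left_commute)

lemma cdot_add_left: "cdot (u + v) w = cdot u w + cdot v w"
  by (simp add: cdot_def algebra_simps sum.distrib)

lemma cdot_add_right: "cdot w (u + v) = cdot w u + cdot w v"
  by (simp add: cdot_def algebra_simps sum.distrib)

lemma cdot_smult_left: "cdot (c *s v) w = c * cdot v w"
  by (simp add: cdot_def sum_distrib_left mult.assoc)

lemma cdot_smult_right: "cdot v (c *s w) = cnj c * cdot v w"
  by (simp add: cdot_def sum_distrib_left mult.left_commute)

lemma cdot_commute: "cdot w v = cnj (cdot v w)"
  by (simp add: cdot_def mult.commute)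

lemma cdot_self: "cdot v v = complex_of_real ((norm v)\<^sup>2)"
  unfolding cdot_def norm_complex_vec L2_set_def
  by (subst real_sqrt_pow2) (auto simp: sum_nonneg complex_norm_square[symmetric])

text \<open>The Euclidean inner product is the real part of the Hermitian pairing; real-variable
  results on derivatives, continuity and orthogonality enter through this identity.\<close>

lemma Re_cdot: "Re (cdot v w) = v \<bullet> w"
  by (simp add: cdot_def inner_vec_def inner_complex_def)

lemma norm_cdot_le: "cmod (cdot v w) \<le> norm v * norm w"
proof -
  have "cmod (cdot v w) \<le> (\<Sum>i\<in>UNIV. cmod (v $ i * cnj (w $ i)))"
    unfolding cdot_def by (rule norm_sum)
  also have "\<dots> = (\<Sum>i\<in>UNIV. \<bar>cmod (v $ i)\<bar> * \<bar>cmod (w $ i)\<bar>)"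
    by (simp add: norm_mult)
  also have "\<dots> \<le> norm v * norm w"
    unfolding norm_complex_vec by (rule L2_set_mult_ineq)
  finally show ?thesis .
qed

lemma bounded_bilinear_cdot: "bounded_bilinear cdot"
proof
  show "cdot (r *\<^sub>R a) b = r *\<^sub>R cdot a b" for r and a b :: "complex^'a"
    by (simp add: scaleR_smult cdot_smult_left scaleR_conv_of_real)
  show "cdot a (r *\<^sub>R b) = r *\<^sub>R cdot a b" for r and a b :: "complex^'a"
    by (simp add: scaleR_smult cdot_smult_right scaleR_conv_of_real)
  show "\<exists>K. \<forall>a b :: complex^'a. cmod (cdot a b) \<le> norm a * norm b * K"
    by (rule exI[of _ 1]) (simp add: norm_cdot_le)
qed (rule cdot_add_left cdot_add_right)+

lemmas bounded_linear_cdot_left = bounded_bilinear.bounded_linear_left[OF bounded_bilinear_cdot]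
lemmas bounded_linear_cdot_right = bounded_bilinear.bounded_linear_right[OF bounded_bilinear_cdot]
lemmas cdot_zero_left [simp] = bounded_bilinear.zero_left[OF bounded_bilinear_cdot]
lemmas cdot_zero_right [simp] = bounded_bilinear.zero_right[OF bounded_bilinear_cdot]
lemmas cdot_diff_left = bounded_bilinear.diff_left[OF bounded_bilinear_cdot]
lemmas cdot_diff_right = bounded_bilinear.diff_right[OF bounded_bilinear_cdot]
lemmas cdot_scaleR_left = bounded_bilinear.scaleR_left[OF bounded_bilinear_cdot]
lemmas cdot_scaleR_right = bounded_bilinear.scaleR_right[OF bounded_bilinear_cdot]
lemmas tendsto_cdot [tendsto_intros] = bounded_bilinear.tendsto[OF bounded_bilinear_cdot]
lemmas continuous_on_cdot [continuous_intros] = bounded_bilinear.continuous_on[OF bounded_bilinear_cdot]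

lemma cdot_conj_transpose: "cdot (M *v v) w = cdot v (conj_transpose M *v w)"
proof -
  have "cdot (M *v v) w = (\<Sum>i\<in>UNIV. \<Sum>j\<in>UNIV. M $ i $ j * v $ j * cnj (w $ i))"
    by (simp add: cdot_def matrix_vector_mult_def sum_distrib_right)
  also have "\<dots> = (\<Sum>j\<in>UNIV. \<Sum>i\<in>UNIV. M $ i $ j * v $ j * cnj (w $ i))"
    by (rule sum.swap)
  also have "\<dots> = cdot v (conj_transpose M *v w)"
    by (simp add: cdot_def matrix_vector_mult_def conj_transpose_def sum_distrib_left algebra_simps)
  finally show ?thesis .
qed

lemma Cauchy_Schwarz_series:
  fixes a b :: "nat \<Rightarrow> real"
  assumes "summable (\<lambda>k. (a k)\<^sup>2)" "summable (\<lambda>k. (b k)\<^sup>2)"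
  shows "summable (\<lambda>k. \<bar>a k\<bar> * \<bar>b k\<bar>)"
    "(\<Sum>k. \<bar>a k\<bar> * \<bar>b k\<bar>) \<le> sqrt (\<Sum>k. (a k)\<^sup>2) * sqrt (\<Sum>k. (b k)\<^sup>2)"
proof -
  have bd: "(\<Sum>k<n. \<bar>a k\<bar> * \<bar>b k\<bar>) \<le> sqrt (\<Sum>k. (a k)\<^sup>2) * sqrt (\<Sum>k. (b k)\<^sup>2)" for n
  proof -
    have "(\<Sum>k<n. \<bar>a k\<bar> * \<bar>b k\<bar>) \<le> L2_set a {..<n} * L2_set b {..<n}" by (rule L2_set_mult_ineq)
    also have "\<dots> \<le> sqrt (\<Sum>k. (a k)\<^sup>2) * sqrt (\<Sum>k. (b k)\<^sup>2)"
      unfolding L2_set_def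
      by (intro mult_mono real_sqrt_le_mono sum_le_suminf assms) (auto intro: sum_nonneg suminf_nonneg assms)
    finally show ?thesis .
  qed
  show s: "summable (\<lambda>k. \<bar>a k\<bar> * \<bar>b k\<bar>)"
    by (rule summableI_nonneg_bounded[OF _ bd]) simp
  show "(\<Sum>k. \<bar>a k\<bar> * \<bar>b k\<bar>) \<le> sqrt (\<Sum>k. (a k)\<^sup>2) * sqrt (\<Sum>k. (b k)\<^sup>2)"
    by (rule suminf_le_const[OF s bd])
qed

context interval begin

lemma mode_add: "mode k (v + w) x = mode k v x + mode k w x"
  by (simp add: mode_def scaleR_add_right)

lemma mode_zero: "mode k 0 x = 0"
  by (simp add: mode_def)

lemma mode_smult: "mode k (c *s w) x = c *s mode k w x" for w :: "complex^'n"
  by (simp add: mode_def vec_eq_iff algebra_simps)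

lemma H10_smult: "u \<in> H10 L \<Longrightarrow> (\<lambda>x. c *s u x) \<in> H10 L" for u :: "real \<Rightarrow> complex^'n"
  by (rule H10_linear[OF bounded_linear_smult])

lemma sine_coeff_smult: "square_integrable N u \<Longrightarrow> sine_coeff (\<lambda>x. c *s u x) k = c *s sine_coeff u k"
  for u :: "real \<Rightarrow> complex^'n"
  by (rule sine_coeff_linear[OF bounded_linear_smult])

text \<open>\<open>H10_norm\<close> is defined through a chosen weak derivative. Computing it from
  the sine coefficients removes the choice and makes, for instance, homogeneity a statement about
  series.\<close>

lemma H10_norm_eqI:
  assumes "u \<in> H10 L" "(\<lambda>k. (freq k)\<^sup>2 * (norm (sine_coeff u k))\<^sup>2) sums S"
  shows "H10_norm L u = sqrt (L / 2 * S)"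
proof -
  have "2 / L * (H10_norm L u)\<^sup>2 = S" by (rule sums_unique2[OF H10_parseval[OF assms(1)] assms(2)])
  then have "(H10_norm L u)\<^sup>2 = L / 2 * S" using L_pos by (simp add: field_simps)
  then show ?thesis using H10_norm_nonneg[of u] by (metis real_sqrt_unique)
qed

lemma H10_norm_smult:
  fixes u :: "real \<Rightarrow> complex^'n"
  assumes "u \<in> H10 L"
  shows "H10_norm L (\<lambda>x. c *s u x) = cmod c * H10_norm L u"
proof -
  have "(\<lambda>k. (cmod c)\<^sup>2 * ((freq k)\<^sup>2 * (norm (sine_coeff u k))\<^sup>2)) sums ((cmod c)\<^sup>2 * (2 / L * (H10_norm L u)\<^sup>2))"
    by (rule sums_mult[OF H10_parseval[OF assms]])
  also have "(\<lambda>k. (cmod c)\<^sup>2 * ((freq k)\<^sup>2 * (norm (sine_coeff u k))\<^sup>2)) =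
      (\<lambda>k. (freq k)\<^sup>2 * (norm (sine_coeff (\<lambda>x. c *s u x) k))\<^sup>2)"
    by (simp add: sine_coeff_smult H10_square_integrable assms norm_smult power_mult_distrib algebra_simps)
  finally have "H10_norm L (\<lambda>x. c *s u x) = sqrt (L / 2 * ((cmod c)\<^sup>2 * (2 / L * (H10_norm L u)\<^sup>2)))"
    by (rule H10_norm_eqI[OF H10_smult[OF assms]])
  also have "\<dots> = cmod c * H10_norm L u"
    using L_pos H10_norm_nonneg[of u] by (simp add: real_sqrt_mult)
  finally show ?thesis .
qed

lemma H10_norm_zero: "H10_norm L (\<lambda>x. 0) = 0"
  by (subst H10_norm_eqI[OF H10_zero, of 0]) (simp_all add: sine_coeff_zero sums_zero)

section \<open>Functionals in H^-1 and their coefficient sequences\<close>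

lemma Hm1_add: "F \<in> Hm1 L \<Longrightarrow> u \<in> H10 L \<Longrightarrow> v \<in> H10 L \<Longrightarrow> F (\<lambda>x. u x + v x) = F u + F v"
  by (simp add: Hm1_def)

lemma Hm1_smult: "F \<in> Hm1 L \<Longrightarrow> u \<in> H10 L \<Longrightarrow> F (\<lambda>x. c *s u x) = cnj c * F u"
  by (simp add: Hm1_def)

lemma Hm1_zero: "F \<in> Hm1 L \<Longrightarrow> F (\<lambda>x. 0) = 0"
  using Hm1_smult[OF _ H10_zero, of F 0] by simp

lemma Hm1_minus: "F \<in> Hm1 L \<Longrightarrow> u \<in> H10 L \<Longrightarrow> v \<in> H10 L \<Longrightarrow> F (\<lambda>x. u x - v x) = F u - F v"
  using Hm1_add[OF _ _ H10_smult[of v "-1"], of F u] Hm1_smult[of F v "-1"]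
  by (simp add: scaleR_smult[symmetric])

lemma Hm1_sum: "F \<in> Hm1 L \<Longrightarrow> (\<And>i. i \<in> I \<Longrightarrow> u i \<in> H10 L) \<Longrightarrow> F (\<lambda>x. \<Sum>i\<in>I. u i x) = (\<Sum>i\<in>I. F (u i))"
proof (induction I rule: infinite_finite_induct)
  case (insert a I)
  have "F (\<lambda>x. u a x + (\<Sum>i\<in>I. u i x)) = F (u a) + F (\<lambda>x. \<Sum>i\<in>I. u i x)"
    by (rule Hm1_add[OF insert.prems(1)]) (use insert.prems in \<open>auto intro: H10_sum\<close>)
  then show ?case using insert by simp
qed (simp_all add: Hm1_zero)

lemma Hm1_bounded:
  assumes "F \<in> Hm1 L"
  obtains C where "C \<ge> 0" "\<And>u. u \<in> H10 L \<Longrightarrow> cmod (F u) \<le> C * H10_norm L u"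
proof -
  obtain C where C: "\<forall>u\<in>H10 L. cmod (F u) \<le> C * H10_norm L u"
    using assms unfolding Hm1_def by blast
  have "cmod (F u) \<le> \<bar>C\<bar> * H10_norm L u" if "u \<in> H10 L" for u
    using C[rule_format, OF that] mult_right_mono[OF abs_ge_self H10_norm_nonneg, of C u] by linarith
  then show ?thesis by (intro that[of "\<bar>C\<bar>"]) auto
qed

lemma Hm1_diff: "F \<in> Hm1 L \<Longrightarrow> G \<in> Hm1 L \<Longrightarrow> (\<lambda>u. F u - G u) \<in> Hm1 L"
proof -
  assume FG: "F \<in> Hm1 L" "G \<in> Hm1 L"
  obtain C where C: "\<And>u. u \<in> H10 L \<Longrightarrow> cmod (F u) \<le> C * H10_norm L u" using Hm1_bounded[OF FG(1)] by metis
  obtain D where D: "\<And>u. u \<in> H10 L \<Longrightarrow> cmod (G u) \<le> D * H10_norm L u" using Hm1_bounded[OF FG(2)] by metis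
  have "cmod (F u - G u) \<le> (C + D) * H10_norm L u" if "u \<in> H10 L" for u
    using norm_triangle_ineq4[of "F u" "G u"] C[OF that] D[OF that] unfolding distrib_right by linarith
  then show ?thesis unfolding Hm1_def
    by (intro CollectI conjI ballI allI exI[of _ "C + D"])
      (simp_all add: Hm1_add[OF FG(1)] Hm1_add[OF FG(2)] Hm1_smult[OF FG(1)] Hm1_smult[OF FG(2)] algebra_simps)
qed

lemma Hm1_norm_le:
  fixes F :: "('n::finite) functional"
  assumes "\<And>u. u \<in> H10 L \<Longrightarrow> cmod (F u) \<le> K * H10_norm L u" "K \<ge> 0"
  shows "Hm1_norm L F \<le> K"
  unfolding Hm1_norm_def
proof (rule cSUP_least)
  have "(\<lambda>x. 0) \<in> {u \<in> H10 L. H10_norm L u \<le> 1}" by (simp add: H10_zero H10_norm_zero)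
  then show "{u \<in> H10 L. H10_norm L u \<le> 1} \<noteq> {}" by blast
  fix u :: "real \<Rightarrow> complex^'n" assume u: "u \<in> {u \<in> H10 L. H10_norm L u \<le> 1}"
  then have "cmod (F u) \<le> K * H10_norm L u" using assms by simp
  also have "\<dots> \<le> K * 1" using u assms(2) by (intro mult_left_mono) auto
  finally show "cmod (F u) \<le> K" by simp
qed

lemma Hm1_norm_bound:
  fixes F :: "('n::finite) functional"
  assumes F: "F \<in> Hm1 L" and u: "u \<in> H10 L"
  shows "cmod (F u) \<le> Hm1_norm L F * H10_norm L u"
proof -
  obtain C where C: "C \<ge> 0" "\<And>u. u \<in> H10 L \<Longrightarrow> cmod (F u) \<le> C * H10_norm L u" by (rule Hm1_bounded[OF F]) blast
  show ?thesis
  proof (cases "H10_norm L u = 0")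
    case True
    then show ?thesis using C(2)[OF u] by simp
  next
    case False
    define h where "h = H10_norm L u"
    have h: "h > 0" using False H10_norm_nonneg[of u] unfolding h_def by linarith
    define v where "v = (\<lambda>x. complex_of_real (1 / h) *s u x)"
    have v: "v \<in> H10 L" unfolding v_def by (rule H10_smult[OF u])
    have nv: "H10_norm L v = 1" unfolding v_def H10_norm_smult[OF u] using h h_def
      by (simp add: norm_divide)
    have bdd: "bdd_above ((\<lambda>u. cmod (F u)) ` {u \<in> H10 L. H10_norm L u \<le> 1})"
    proof (rule bdd_aboveI2)
      fix u :: "real \<Rightarrow> complex^'n" assume u: "u \<in> {u \<in> H10 L. H10_norm L u \<le> 1}"
      have "cmod (F u) \<le> C * H10_norm L u" using C(2) u by simp
      also have "\<dots> \<le> C * 1" using u C(1) by (intro mult_left_mono) auto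
      finally show "cmod (F u) \<le> C" by simp
    qed
    have "cmod (F v) \<le> Hm1_norm L F"
      unfolding Hm1_norm_def by (rule cSUP_upper[OF _ bdd]) (use v nv in simp)
    moreover have "F v = complex_of_real (1 / h) * F u"
      unfolding v_def by (simp add: Hm1_smult[OF F u])
    ultimately have "cmod (F u) / h \<le> Hm1_norm L F" using h by (simp add: norm_mult norm_divide)
    then show ?thesis using h unfolding h_def[symmetric] by (simp add: field_simps)
  qed
qed

text \<open>The vector that represents the restriction of F to mode k. Unlike
  \<open>sine_coeff\<close> it carries no factor 2 / L, so that \<open>F u\<close> is the plain sum
  of the pairings of the two coefficient sequences.\<close>

definition hm_coeff :: "('n::finite) functional \<Rightarrow> nat \<Rightarrow> complex^'n" where
  "hm_coeff F k = (\<chi> i. F (mode k (axis i 1)))"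

lemma Hm1_mode:
  assumes "F \<in> Hm1 L"
  shows "F (mode k w) = cdot (hm_coeff F k) w"
proof -
  have "mode k w = mode k (\<Sum>i\<in>UNIV. (w $ i) *s axis i 1)"
    by (simp only: basis_expansion)
  also have "\<dots> = (\<lambda>x. \<Sum>i\<in>UNIV. (w $ i) *s mode k (axis i 1) x)"
  proof
    fix x
    have "mode k (\<Sum>i\<in>I. (w $ i) *s axis i 1) x = (\<Sum>i\<in>I. (w $ i) *s mode k (axis i 1) x)" for I
      by (induction I rule: infinite_finite_induct) (simp_all add: mode_add mode_smult mode_zero)
    then show "mode k (\<Sum>i\<in>UNIV. (w $ i) *s axis i 1) x = (\<Sum>i\<in>UNIV. (w $ i) *s mode k (axis i 1) x)" .
  qed
  finally have "F (mode k w) = F (\<lambda>x. \<Sum>i\<in>UNIV. (w $ i) *s mode k (axis i 1) x)"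
    by (rule arg_cong)
  also have "\<dots> = (\<Sum>i\<in>UNIV. F (\<lambda>x. (w $ i) *s mode k (axis i 1) x))"
    by (rule Hm1_sum[OF assms H10_smult[OF mode_H10]])
  also have "\<dots> = cdot (hm_coeff F k) w"
    unfolding Hm1_smult[OF assms mode_H10] by (simp add: cdot_def hm_coeff_def mult.commute)
  finally show ?thesis .
qed

text \<open>Boundedness makes the value of \<open>F\<close> on the remainder of the sine expansion
  tend to 0, while on a partial sum \<open>F\<close> equals the partial sum of the pairings.\<close>

theorem Hm1_expansion:
  assumes F: "F \<in> Hm1 L" and u: "u \<in> H10 L"
  shows "(\<lambda>k. cdot (hm_coeff F k) (sine_coeff u k)) sums F u"
proof -
  define r where "r n x = u x - (\<Sum>k<n. mode k (sine_coeff u k) x)" for n x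
  note t = H10_tail_sums[OF u, folded r_def]
  obtain C where C: "C \<ge> 0" "\<And>u. u \<in> H10 L \<Longrightarrow> cmod (F u) \<le> C * H10_norm L u" by (rule Hm1_bounded[OF F]) blast
  have eq: "F (r n) = F u - (\<Sum>k<n. cdot (hm_coeff F k) (sine_coeff u k))" for n
  proof -
    have "F (r n) = F u - F (\<lambda>x. \<Sum>k<n. mode k (sine_coeff u k) x)"
      unfolding r_def by (rule Hm1_minus[OF F u]) (intro H10_sum mode_H10)
    also have "F (\<lambda>x. \<Sum>k<n. mode k (sine_coeff u k) x) = (\<Sum>k<n. F (mode k (sine_coeff u k)))"
      by (rule Hm1_sum[OF F mode_H10])
    finally show ?thesis by (simp add: Hm1_mode[OF F])
  qed
  have "(\<lambda>n. F (r n)) \<longlonglongrightarrow> 0"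
  proof (rule Lim_null_comparison)
    show "\<forall>\<^sub>F n in sequentially. norm (F (r n)) \<le> C * H10_norm L (r n)"
      using C(2)[OF t(1)] by (intro always_eventually) blast
    show "(\<lambda>n. C * H10_norm L (r n)) \<longlonglongrightarrow> 0"
      using tendsto_mult_right_zero[OF t(3)] by simp
  qed
  then have "(\<lambda>n. F u - F (r n)) \<longlonglongrightarrow> F u - 0" by (intro tendsto_intros)
  then show ?thesis by (simp add: sums_def eq)
qed

text \<open>Coefficient sequences of H^-1: the weighted l^2 condition dual to the one in
  \<open>H10_parseval\<close>.\<close>

definition hm_seq :: "(nat \<Rightarrow> complex^'n) \<Rightarrow> bool" where
  "hm_seq Y \<longleftrightarrow> summable (\<lambda>k. (norm (Y k) / freq k)\<^sup>2)"

text \<open>\<open>F\<close> is tested on its truncated Riesz representative, with coefficients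
  \<open>hm_coeff F k\<close> divided by freq^2. Then \<open>F u\<close> is the partial sum S and
  the norm of \<open>u\<close> is sqrt(L S / 2), so boundedness reads S \<le> C sqrt(L S / 2), which
  bounds S independently of n.\<close>

lemma hm_seq_coeff:
  assumes F: "F \<in> Hm1 L"
  shows "hm_seq (hm_coeff F)"
proof -
  obtain C where C: "C \<ge> 0" "\<And>u. u \<in> H10 L \<Longrightarrow> cmod (F u) \<le> C * H10_norm L u" by (rule Hm1_bounded[OF F]) blast
  have "(\<Sum>k<n. (norm (hm_coeff F k) / freq k)\<^sup>2) \<le> C\<^sup>2 * (L / 2)" for n
  proof -
    let ?S = "\<Sum>k<n. (norm (hm_coeff F k) / freq k)\<^sup>2"
    let ?w = "\<lambda>k. (1 / (freq k)\<^sup>2) *\<^sub>R hm_coeff F k"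
    define u where "u = (\<lambda>x. \<Sum>k<n. mode k (?w k) x)"
    have u: "u \<in> H10 L" unfolding u_def by (intro H10_sum mode_H10)
    have c: "sine_coeff u l = (if l < n then ?w l else 0)" for l
      unfolding u_def by (subst sine_coeff_sum) (auto simp: H10_square_integrable mode_H10 sine_coeff_mode)
    have S0: "?S \<ge> 0" by (simp add: sum_nonneg)
    have "(\<lambda>k. if k \<in> {..<n} then (norm (hm_coeff F k) / freq k)\<^sup>2 else 0) sums ?S"
      by (rule sums_If_finite_set) simp
    moreover have "(\<lambda>k. if k \<in> {..<n} then (norm (hm_coeff F k) / freq k)\<^sup>2 else 0) = (\<lambda>k. (freq k)\<^sup>2 * (norm (sine_coeff u k))\<^sup>2)"
    proof
      fix k show "(if k \<in> {..<n} then (norm (hm_coeff F k) / freq k)\<^sup>2 else 0) = (freq k)\<^sup>2 * (norm (sine_coeff u k))\<^sup>2"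
        using freq_pos[of k] by (simp add: c power_divide power2_eq_square)
    qed
    ultimately have nu: "H10_norm L u = sqrt (L / 2 * ?S)" by (intro H10_norm_eqI[OF u]) simp
    have "F u = (\<Sum>k<n. cdot (hm_coeff F k) (?w k))"
      unfolding u_def by (subst Hm1_sum[OF F mode_H10]) (simp add: Hm1_mode[OF F])
    also have "\<dots> = complex_of_real ?S"
      unfolding cdot_scaleR_right cdot_self by (simp add: power_divide scaleR_conv_of_real)
    finally have "?S = cmod (F u)" using S0 by (simp del: of_real_sum)
    also have "\<dots> \<le> C * sqrt (L / 2 * ?S)" using C(2)[OF u] unfolding nu .
    finally have "?S\<^sup>2 \<le> (C * sqrt (L / 2 * ?S))\<^sup>2" using S0 by (intro power_mono) auto
    also have "\<dots> = C\<^sup>2 * (L / 2) * ?S" using S0 L_pos by (simp add: power_mult_distrib)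
    finally have "?S * ?S \<le> (C\<^sup>2 * (L / 2)) * ?S" by (simp add: power2_eq_square)
    then show ?thesis
    proof (cases "?S = 0")
      case True then show ?thesis using L_pos by simp
    next
      case False
      with S0 have "?S > 0" by linarith
      with \<open>?S * ?S \<le> (C\<^sup>2 * (L / 2)) * ?S\<close> show ?thesis by (rule mult_right_le_imp_le)
    qed
  qed
  note bd = this
  show ?thesis unfolding hm_seq_def by (rule summableI_nonneg_bounded[OF _ bd]) simp
qed

definition hm_functional :: "(nat \<Rightarrow> complex^'n) \<Rightarrow> 'n functional" where
  "hm_functional Y u = (\<Sum>k. cdot (Y k) (sine_coeff u k))"

text \<open>Cauchy-Schwarz after moving one factor \<open>freq k\<close> from the first sequence to
  the second.\<close>

lemma hm_pairing:
  fixes Y :: "nat \<Rightarrow> complex^'n"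
  assumes Y: "hm_seq Y" and c: "summable (\<lambda>k. (freq k)\<^sup>2 * (norm (c k))\<^sup>2)"
  shows "summable (\<lambda>k. norm (Y k) * norm (c k))" 
    "(\<Sum>k. norm (Y k) * norm (c k)) \<le> sqrt (\<Sum>k. (norm (Y k) / freq k)\<^sup>2) * sqrt (\<Sum>k. (freq k)\<^sup>2 * (norm (c k))\<^sup>2)"
    "summable (\<lambda>k. cmod (cdot (Y k) (c k)))"
    "cmod (\<Sum>k. cdot (Y k) (c k)) \<le> sqrt (\<Sum>k. (norm (Y k) / freq k)\<^sup>2) * sqrt (\<Sum>k. (freq k)\<^sup>2 * (norm (c k))\<^sup>2)"
proof -
  have eq: "\<bar>norm (Y k) / freq k\<bar> * \<bar>freq k * norm (c k)\<bar> = norm (Y k) * norm (c k)" for k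
    using freq_pos[of k] by (simp add: abs_mult)
  have c': "summable (\<lambda>k. (freq k * norm (c k))\<^sup>2)" using c by (simp add: power_mult_distrib)
  note cs = Cauchy_Schwarz_series[OF Y[unfolded hm_seq_def] c', unfolded eq]
  show s: "summable (\<lambda>k. norm (Y k) * norm (c k))" by (rule cs(1))
  show le: "(\<Sum>k. norm (Y k) * norm (c k)) \<le> sqrt (\<Sum>k. (norm (Y k) / freq k)\<^sup>2) * sqrt (\<Sum>k. (freq k)\<^sup>2 * (norm (c k))\<^sup>2)"
    using cs(2) by (simp add: power_mult_distrib)
  show s': "summable (\<lambda>k. cmod (cdot (Y k) (c k)))"
    by (rule summable_comparison_test'[OF s, where N = 0]) (simp add: norm_cdot_le)
  have "cmod (\<Sum>k. cdot (Y k) (c k)) \<le> (\<Sum>k. cmod (cdot (Y k) (c k)))" by (rule summable_norm[OF s'])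
  also have "\<dots> \<le> (\<Sum>k. norm (Y k) * norm (c k))"
    by (rule suminf_le[OF norm_cdot_le s' s])
  finally show "cmod (\<Sum>k. cdot (Y k) (c k)) \<le> sqrt (\<Sum>k. (norm (Y k) / freq k)\<^sup>2) * sqrt (\<Sum>k. (freq k)\<^sup>2 * (norm (c k))\<^sup>2)"
    using le by linarith
qed

lemma hm_functional_sums:
  assumes "hm_seq Y" "u \<in> H10 L"
  shows "(\<lambda>k. cdot (Y k) (sine_coeff u k)) sums hm_functional Y u"
  unfolding hm_functional_def
  by (rule summable_sums[OF summable_norm_cancel[OF hm_pairing(3)[OF assms(1)
      sums_summable[OF H10_parseval[OF assms(2)]]]]])

lemma hm_functional_bound:
  assumes "hm_seq Y" "u \<in> H10 L"
  shows "cmod (hm_functional Y u) \<le> sqrt (2 / L * (\<Sum>k. (norm (Y k) / freq k)\<^sup>2)) * H10_norm L u"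
proof -
  note p = H10_parseval[OF assms(2)]
  have "cmod (hm_functional Y u) \<le> sqrt (\<Sum>k. (norm (Y k) / freq k)\<^sup>2) * sqrt (2 / L * (H10_norm L u)\<^sup>2)"
    using hm_pairing(4)[OF assms(1) sums_summable[OF p]]
    unfolding hm_functional_def[symmetric] sums_unique[OF p, symmetric] .
  also have "\<dots> = sqrt (2 / L * (\<Sum>k. (norm (Y k) / freq k)\<^sup>2)) * H10_norm L u"
    using H10_norm_nonneg[of u] by (simp add: real_sqrt_mult real_sqrt_divide)
  finally show ?thesis .
qed

lemma hm_functional_Hm1:
  fixes Y :: "nat \<Rightarrow> complex^'n"
  assumes Y: "hm_seq Y"
  shows "hm_functional Y \<in> Hm1 L"
  unfolding Hm1_def
proof (intro CollectI conjI ballI allI)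
  fix u v :: "real \<Rightarrow> complex^'n" assume u: "u \<in> H10 L" and v: "v \<in> H10 L"
  have "(\<lambda>k. cdot (Y k) (sine_coeff u k) + cdot (Y k) (sine_coeff v k)) sums (hm_functional Y u + hm_functional Y v)"
    by (intro sums_add hm_functional_sums Y u v)
  then have "(\<lambda>k. cdot (Y k) (sine_coeff (\<lambda>x. u x + v x) k)) sums (hm_functional Y u + hm_functional Y v)"
    by (simp add: sine_coeff_add H10_square_integrable u v cdot_add_right)
  then show "hm_functional Y (\<lambda>x. u x + v x) = hm_functional Y u + hm_functional Y v"
    by (rule sums_unique2[OF hm_functional_sums[OF Y H10_add[OF u v]]])
next
  fix c and u :: "real \<Rightarrow> complex^'n" assume u: "u \<in> H10 L"
  have "(\<lambda>k. cnj c * cdot (Y k) (sine_coeff u k)) sums (cnj c * hm_functional Y u)"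
    by (intro sums_mult hm_functional_sums Y u)
  then have "(\<lambda>k. cdot (Y k) (sine_coeff (\<lambda>x. c *s u x) k)) sums (cnj c * hm_functional Y u)"
    by (simp add: sine_coeff_smult H10_square_integrable u cdot_smult_right)
  then show "hm_functional Y (\<lambda>x. c *s u x) = cnj c * hm_functional Y u"
    by (rule sums_unique2[OF hm_functional_sums[OF Y H10_smult[OF u]]])
next
  show "\<exists>C. \<forall>u\<in>H10 L. cmod (hm_functional Y u) \<le> C * H10_norm L u"
    using hm_functional_bound[OF Y] by blast
qed

lemma hm_seq_nonneg: "hm_seq Y \<Longrightarrow> (\<Sum>k. (norm (Y k) / freq k)\<^sup>2) \<ge> 0"
  unfolding hm_seq_def by (rule suminf_nonneg) auto

text \<open>Equality with \<open>hm_functional Y\<close> is asked on \<open>H10 L\<close> only,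
  since functionals carry arbitrary values elsewhere.\<close>

lemma Hm1_norm_eq_le:
  assumes Y: "hm_seq Y" and "\<And>u. u \<in> H10 L \<Longrightarrow> F u = hm_functional Y u"
  shows "Hm1_norm L F \<le> sqrt (2 / L * (\<Sum>k. (norm (Y k) / freq k)\<^sup>2))"
  by (rule Hm1_norm_le) (use assms hm_functional_bound[OF Y] hm_seq_nonneg[OF Y] L_pos in auto)

lemma hm_seq_add:
  assumes "hm_seq Y" "hm_seq Z"
  shows "hm_seq (\<lambda>k. Y k + Z k)"
  unfolding hm_seq_def
proof (rule summable_comparison_test'[where N = 0])
  show "summable (\<lambda>k. 2 * (norm (Y k) / freq k)\<^sup>2 + 2 * (norm (Z k) / freq k)\<^sup>2)"
    by (intro summable_add summable_mult assms[unfolded hm_seq_def])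
  show "norm ((norm (Y k + Z k) / freq k)\<^sup>2) \<le> 2 * (norm (Y k) / freq k)\<^sup>2 + 2 * (norm (Z k) / freq k)\<^sup>2" for k
    using divide_right_mono[OF norm_add_sq_le[of "Y k" "Z k"], of "(freq k)\<^sup>2"]
    by (simp add: power_divide add_divide_distrib)
qed

lemma hm_seq_bound:
  assumes "hm_seq Y" "\<And>k. norm (Z k) \<le> C * norm (Y k)"
  shows "hm_seq Z"
  unfolding hm_seq_def
proof (rule summable_comparison_test'[where N = 0])
  show "summable (\<lambda>k. C\<^sup>2 * (norm (Y k) / freq k)\<^sup>2)"
    by (intro summable_mult assms(1)[unfolded hm_seq_def])
  show "norm ((norm (Z k) / freq k)\<^sup>2) \<le> C\<^sup>2 * (norm (Y k) / freq k)\<^sup>2" for k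
  proof -
    have "(norm (Z k))\<^sup>2 \<le> (C * norm (Y k))\<^sup>2" by (intro power_mono assms(2)) simp
    then show ?thesis by (simp add: power_divide power_mult_distrib divide_right_mono)
  qed
qed

lemma hm_seq_diff: "hm_seq Y \<Longrightarrow> hm_seq Z \<Longrightarrow> hm_seq (\<lambda>k. Y k - Z k)"
  using hm_seq_add[of Y "\<lambda>k. - Z k"] hm_seq_bound[of Z "\<lambda>k. - Z k" 1] by simp

end

section \<open>The exponential of a matrix\<close>

text \<open>exp(w M) applied to v, as a series of vectors. The time \<open>w\<close> is complex
  because observations are later continued to a half-plane.\<close>

definition mexp :: "complex^'n^'n \<Rightarrow> complex \<Rightarrow> complex^'n \<Rightarrow> complex^'n" where
  "mexp M w v = (\<Sum>m. (w ^ m / fact m) *s (((*v) M ^^ m) v))"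

definition mnorm :: "complex^'n^'n \<Rightarrow> real" where
  "mnorm M = onorm ((*v) M)"

lemma mnorm: "norm (M *v v) \<le> mnorm M * norm v"
  unfolding mnorm_def by (rule onorm[OF bounded_linear_matrix])

lemma mnorm_nonneg: "mnorm M \<ge> 0"
  unfolding mnorm_def by (rule onorm_pos_le[OF bounded_linear_matrix])

lemma mpow_bound: "norm (((*v) M ^^ m) v) \<le> mnorm M ^ m * norm v"
proof (induction m)
  case (Suc m)
  have "norm (((*v) M ^^ Suc m) v) \<le> mnorm M * norm (((*v) M ^^ m) v)" by (simp add: mnorm)
  also have "\<dots> \<le> mnorm M * (mnorm M ^ m * norm v)" by (rule mult_left_mono[OF Suc mnorm_nonneg])
  finally show ?case by simp
qed simp

lemma mexp_term_bound:
  "norm ((w ^ m / fact m) *s (((*v) M ^^ m) v)) \<le> (mnorm M * cmod w) ^ m /\<^sub>R fact m * norm v"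
proof -
  have "norm ((w ^ m / fact m) *s (((*v) M ^^ m) v)) = cmod w ^ m / fact m * norm (((*v) M ^^ m) v)"
    by (simp add: norm_smult norm_divide norm_power)
  also have "\<dots> \<le> cmod w ^ m / fact m * (mnorm M ^ m * norm v)"
    by (intro mult_left_mono mpow_bound) simp
  finally show ?thesis by (simp add: power_mult_distrib divide_inverse mult_ac)
qed

lemma mexp_bound_summable: "summable (\<lambda>m. (mnorm M * cmod w) ^ m /\<^sub>R fact m * norm v)"
  by (intro summable_mult2 summable_exp_generic)

lemma mexp_norm_summable: "summable (\<lambda>m. norm ((w ^ m / fact m) *s (((*v) M ^^ m) v)))"
  for M :: "complex^'n^'n"
proof (rule summable_comparison_test'[OF mexp_bound_summable[of M w v], where N = 0])
  show "norm (norm ((w ^ m / fact m) *s (((*v) M ^^ m) v))) \<le> (mnorm M * cmod w) ^ m /\<^sub>R fact m * norm v" for m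
    unfolding real_norm_def abs_norm_cancel by (rule mexp_term_bound)
qed

lemma mexp_sums: "(\<lambda>m. (w ^ m / fact m) *s (((*v) M ^^ m) v)) sums mexp M w v"
  unfolding mexp_def by (rule summable_sums[OF summable_norm_cancel[OF mexp_norm_summable]])

lemma mexp_norm_le: "norm (mexp M w v) \<le> exp (mnorm M * cmod w) * norm v"
proof -
  have "norm (mexp M w v) \<le> (\<Sum>m. norm ((w ^ m / fact m) *s (((*v) M ^^ m) v)))"
    unfolding mexp_def by (rule summable_norm[OF mexp_norm_summable])
  also have "\<dots> \<le> (\<Sum>m. (mnorm M * cmod w) ^ m /\<^sub>R fact m * norm v)"
    by (rule suminf_le[OF mexp_term_bound mexp_norm_summable mexp_bound_summable])
  also have "\<dots> = exp (mnorm M * cmod w) * norm v"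
    unfolding exp_def by (rule suminf_mult2[OF summable_exp_generic, symmetric])
  finally show ?thesis .
qed

lemma mpow_add: "((*v) M ^^ m) (u + v) = ((*v) M ^^ m) u + ((*v) M ^^ m) v" for M :: "complex^'n^'n"
  by (induction m) (simp_all add: matrix_vector_right_distrib)

lemma mpow_smult: "((*v) M ^^ m) (c *s v) = c *s ((*v) M ^^ m) v" for M :: "complex^'n^'n"
  by (induction m) (simp_all add: matrix_smult)

lemma mexp_add: "mexp M w (u + v) = mexp M w u + mexp M w v"
proof -
  have "(\<lambda>m. (w ^ m / fact m) *s (((*v) M ^^ m) u) + (w ^ m / fact m) *s (((*v) M ^^ m) v)) sums (mexp M w u + mexp M w v)"
    by (intro sums_add mexp_sums)
  then have "(\<lambda>m. (w ^ m / fact m) *s (((*v) M ^^ m) (u + v))) sums (mexp M w u + mexp M w v)"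
    by (simp add: mpow_add vector_add_ldistrib)
  then show ?thesis by (rule sums_unique2[OF mexp_sums])
qed

lemma mexp_smult: "mexp M w (c *s v) = c *s mexp M w v"
proof -
  have "(\<lambda>m. c *s ((w ^ m / fact m) *s (((*v) M ^^ m) v))) sums (c *s mexp M w v)"
    by (rule bounded_linear.sums[OF bounded_linear_smult mexp_sums])
  then have "(\<lambda>m. (w ^ m / fact m) *s (((*v) M ^^ m) (c *s v))) sums (c *s mexp M w v)"
    by (simp add: mpow_smult vector_smult_assoc mult.commute)
  then show ?thesis by (rule sums_unique2[OF mexp_sums])
qed

lemma mexp_zero_time: "mexp M 0 v = v"
proof -
  have "(\<lambda>m. (0 ^ m / fact m) *s (((*v) M ^^ m) v)) sums (\<Sum>m\<in>{0}. (0 ^ m / fact m) *s (((*v) M ^^ m) v))"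
    by (rule sums_finite) (auto simp: power_0_left)
  then show ?thesis by (subst sums_unique2[OF mexp_sums]) auto
qed

lemma mexp_matrix: "M *v mexp M w v = mexp M w (M *v v)"
proof -
  have "(\<lambda>m. M *v ((w ^ m / fact m) *s (((*v) M ^^ m) v))) sums (M *v mexp M w v)"
    by (rule bounded_linear.sums[OF bounded_linear_matrix mexp_sums])
  then have "(\<lambda>m. (w ^ m / fact m) *s (((*v) M ^^ m) (M *v v))) sums (M *v mexp M w v)"
    by (simp add: matrix_smult funpow_swap1)
  then show ?thesis by (rule sums_unique2[OF _ mexp_sums])
qed

text \<open>Each component is an entire power series in \<open>w\<close>, differentiated term by
  term; passing to the coefficients \<open>diffs c\<close> amounts to replacing \<open>v\<close> by
  \<open>M *v v\<close>.\<close>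

lemma mexp_component_derivative:
  "((\<lambda>w. mexp M w v $ i) has_field_derivative mexp M w (M *v v) $ i) (at w)"
proof -
  define c where "c m = (((*v) M ^^ m) v) $ i / fact m" for m
  have comp: "(\<lambda>m. (((*v) M ^^ m) u) $ i / fact m * w ^ m) sums (mexp M w u $ i)" for u w
  proof -
    have "(\<lambda>m. ((w ^ m / fact m) *s (((*v) M ^^ m) u)) $ i) sums (mexp M w u $ i)"
      by (rule bounded_linear.sums[OF bounded_linear_vec_nth mexp_sums])
    then show ?thesis by (simp add: mult.commute)
  qed
  have "((\<lambda>w. \<Sum>m. c m * w ^ m) has_field_derivative (\<Sum>m. diffs c m * w ^ m)) (at w)"
    by (rule termdiffs_strong_converges_everywhere) (use comp[of v] in \<open>auto simp: c_def sums_iff\<close>)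
  moreover have "(\<Sum>m. c m * w ^ m) = mexp M w v $ i" for w
    using comp[of v] by (simp add: c_def sums_iff)
  moreover have "(\<Sum>m. diffs c m * w ^ m) = mexp M w (M *v v) $ i"
  proof -
    have "diffs c m = (((*v) M ^^ m) (M *v v)) $ i / fact m" for m
      by (simp add: diffs_def c_def funpow_swap1[symmetric] del: of_nat_Suc)
    then show ?thesis using comp[of "M *v v" w] by (simp add: sums_iff)
  qed
  ultimately show ?thesis by simp
qed

lemma cdot_mexp_derivative:
  "((\<lambda>w. cdot (mexp M w v) u) has_field_derivative cdot (mexp M w (M *v v)) u) (at w)"
  unfolding cdot_def by (intro DERIV_sum DERIV_cmult_right mexp_component_derivative)

lemma mexp_vector_derivative:
  "((\<lambda>t. mexp M (complex_of_real t) v) has_vector_derivative mexp M (complex_of_real t) (M *v v)) (at t within S)"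
  unfolding has_vector_derivative_def
proof (subst has_derivative_componentwise_within, intro ballI)
  fix b :: "complex^'a"
  have "((\<lambda>t. cdot (mexp M (complex_of_real t) v) b) has_vector_derivative
      cdot (mexp M (complex_of_real t) (M *v v)) b) (at t within S)"
    by (rule has_vector_derivative_real_field[OF cdot_mexp_derivative])
  then have "((\<lambda>t. Re (cdot (mexp M (complex_of_real t) v) b)) has_vector_derivative
      Re (cdot (mexp M (complex_of_real t) (M *v v)) b)) (at t within S)"
    by (rule bounded_linear.has_vector_derivative[OF bounded_linear_Re])
  then show "((\<lambda>t. mexp M (complex_of_real t) v \<bullet> b) has_derivative
     (\<lambda>x. x *\<^sub>R mexp M (complex_of_real t) (M *v v) \<bullet> b)) (at t within S)"
    unfolding Re_cdot has_vector_derivative_def by simp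
qed

text \<open>Stated for real time: the second slot of \<open>cdot\<close> is conjugate-linear, so a
  complex time would be conjugated in passing over.\<close>

lemma cdot_mexp_adjoint:
  "cdot (mexp M (complex_of_real t) v) u = cdot v (mexp (conj_transpose M) (complex_of_real t) u)"
proof -
  have p: "cdot (((*v) M ^^ m) v) u = cdot v (((*v) (conj_transpose M) ^^ m) u)" for m
    by (induction m arbitrary: v) (simp_all add: cdot_conj_transpose funpow_swap1)
  have "(\<lambda>m. cdot ((complex_of_real t ^ m / fact m) *s (((*v) M ^^ m) v)) u) sums cdot (mexp M (complex_of_real t) v) u"
    by (rule bounded_linear.sums[OF bounded_linear_cdot_left mexp_sums])
  moreover have "(\<lambda>m. cdot v ((complex_of_real t ^ m / fact m) *s (((*v) (conj_transpose M) ^^ m) u)))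
      sums cdot v (mexp (conj_transpose M) (complex_of_real t) u)"
    by (rule bounded_linear.sums[OF bounded_linear_cdot_right mexp_sums])
  moreover have "cdot ((complex_of_real t ^ m / fact m) *s (((*v) M ^^ m) v)) u =
      cdot v ((complex_of_real t ^ m / fact m) *s (((*v) (conj_transpose M) ^^ m) u))" for m
    by (simp add: cdot_smult_left cdot_smult_right p)
  ultimately show ?thesis using sums_unique2 by simp
qed

lemma mexp_eigenvector:
  assumes "M *v v = \<theta> *s v"
  shows "mexp M w v = exp (\<theta> * w) *s v"
proof -
  have p: "((*v) M ^^ m) v = \<theta> ^ m *s v" for m
    by (induction m) (simp_all add: assms matrix_smult vector_smult_assoc mult.commute)
  have "bounded_linear (\<lambda>c. c *s v)"
    by (rule bounded_linear_intro[where K = "norm v"])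
      (simp_all add: vec_eq_iff algebra_simps norm_smult)
  then have "(\<lambda>m. ((\<theta> * w) ^ m /\<^sub>R fact m) *s v) sums (exp (\<theta> * w) *s v)"
    by (rule bounded_linear.sums[OF _ exp_converges])
  moreover have "((\<theta> * w) ^ m /\<^sub>R fact m) *s v = (w ^ m / fact m) *s (((*v) M ^^ m) v)" for m
    by (simp add: p vector_smult_assoc power_mult_distrib scaleR_conv_of_real divide_inverse mult_ac)
  ultimately show ?thesis using mexp_sums[of w M v] sums_unique2 by simp
qed

text \<open>exp(t (M - l)) applied to v. With \<open>l\<close> the square of a frequency it
  propagates one Fourier mode; each mode being finite-dimensional, negative t is allowed.\<close>

definition heat :: "complex^'n^'n \<Rightarrow> real \<Rightarrow> real \<Rightarrow> complex^'n \<Rightarrow> complex^'n" where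
  "heat M l t v = exp (- l * t) *\<^sub>R mexp M (complex_of_real t) v"

lemma heat_zero_time [simp]: "heat M l 0 v = v"
  by (simp add: heat_def mexp_zero_time)

lemma heat_add: "heat M l t (u + v) = heat M l t u + heat M l t v"
  by (simp add: heat_def mexp_add scaleR_add_right)

lemma heat_smult: "heat M l t (c *s v) = c *s heat M l t v"
  by (simp add: heat_def mexp_smult scaleR_smult vector_smult_assoc mult.commute)

lemma heat_scaleR: "heat M l t (r *\<^sub>R v) = r *\<^sub>R heat M l t v"
  by (simp only: scaleR_smult heat_smult)

lemma heat_minus: "heat M l t (u - v) = heat M l t u - heat M l t v"
  using heat_add[of M l t u "(-1) *\<^sub>R v"] heat_scaleR[of M l t "-1" v] by simp

lemma heat_zero [simp]: "heat M l t 0 = 0"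
  using heat_minus[of M l t 0 0] by simp

lemma heat_norm_le: "norm (heat M l t v) \<le> exp (mnorm M * \<bar>t\<bar> - l * t) * norm v"
  using mult_left_mono[OF mexp_norm_le[of M "complex_of_real t" v], of "exp (- l * t)"]
  by (simp add: heat_def exp_diff exp_minus field_simps)

lemma heat_matrix: "M *v heat M l t v = heat M l t (M *v v)"
  by (simp add: heat_def scaleR_smult matrix_smult mexp_matrix)

lemma heat_derivative:
  "((\<lambda>t. heat M l t v) has_vector_derivative heat M l t (M *v v - l *\<^sub>R v)) (at t within S)"
proof -
  have "((\<lambda>t. exp (- l * t)) has_real_derivative exp (- l * t) * (- l)) (at t within S)"
    by (auto intro!: derivative_eq_intros)
  then have "((\<lambda>t. heat M l t v) has_vector_derivative
     (exp (- l * t) *\<^sub>R mexp M (complex_of_real t) (M *v v) + (exp (- l * t) * (- l)) *\<^sub>R mexp M (complex_of_real t) v)) (at t within S)"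
    unfolding heat_def by (intro has_vector_derivative_scaleR mexp_vector_derivative)
  also have "exp (- l * t) *\<^sub>R mexp M (complex_of_real t) (M *v v) + (exp (- l * t) * (- l)) *\<^sub>R mexp M (complex_of_real t) v
     = heat M l t (M *v v - l *\<^sub>R v)"
    unfolding heat_minus heat_scaleR by (simp add: heat_def)
  finally show ?thesis .
qed

lemma heat_continuous: "continuous_on S (\<lambda>t. heat M l t v)"
  using heat_derivative by (intro continuous_on_vector_derivative) blast

lemma cdot_heat_adjoint: "cdot (heat M l t v) u = cdot v (heat (conj_transpose M) l t u)"
  by (simp add: heat_def cdot_scaleR_left cdot_scaleR_right cdot_mexp_adjoint)

lemma cdot_heat_derivative:
  assumes "(f has_vector_derivative f') (at t within S)"
  shows "((\<lambda>s. cdot (f s) (heat M l (c - s) v)) has_vector_derivative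
     (cdot f' (heat M l (c - t) v) - cdot (f t) (heat M l (c - t) (M *v v - l *\<^sub>R v)))) (at t within S)"
proof -
  have "((\<lambda>s. c - s) has_vector_derivative - 1) (at t within S)"
    by (auto intro!: derivative_eq_intros)
  then have "((\<lambda>s. heat M l (c - s) v) has_vector_derivative (- 1) *\<^sub>R heat M l (c - t) (M *v v - l *\<^sub>R v)) (at t within S)"
    using vector_diff_chain_within[OF _ heat_derivative, of "\<lambda>s. c - s" "-1" t S M l v]
    by (simp add: o_def)
  from bounded_bilinear.has_vector_derivative[OF bounded_bilinear_cdot assms this]
  show ?thesis by (rule has_vector_derivative_eq_rhs) (simp add: cdot_diff_right[of _ 0, simplified])
qed

text \<open>The pairing of the flow at time s with the adjoint flow at time c - s has zero
  derivative in s. Comparing its values at s and at 0 gives the group law for all real times,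
  without multiplying exponential series.\<close>

lemma heat_semigroup: "heat M l (c - s) (heat M l s v) = heat M l c v"
proof -
  let ?g = "\<lambda>u s. cdot (heat M l s v) (heat (conj_transpose M) l (c - s) u)"
  have "(?g u has_vector_derivative 0) (at t)" for u t
  proof -
    have "cdot (heat M l t (M *v v - l *\<^sub>R v)) (heat (conj_transpose M) l (c - t) u) =
      cdot (heat M l t v) (heat (conj_transpose M) l (c - t) (conj_transpose M *v u - l *\<^sub>R u))"
      unfolding heat_minus heat_scaleR heat_matrix[symmetric]
      by (simp add: cdot_diff_left cdot_diff_right cdot_scaleR_left cdot_scaleR_right cdot_conj_transpose)
    moreover have "((\<lambda>s. heat M l s v) has_vector_derivative heat M l t (M *v v - l *\<^sub>R v)) (at t within UNIV)"
      by (rule heat_derivative)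
    note cdot_heat_derivative[OF this, where M = "conj_transpose M" and l = l and c = c and v = u]
    ultimately show ?thesis by simp
  qed
  then obtain k where k: "\<And>u t. ?g u t = k u"
    using has_vector_derivative_zero_constant[OF convex_UNIV, of "?g _"] by (metis UNIV_I)
  have "cdot (heat M l (c - s) (heat M l s v) - heat M l c v) u = 0" for u
    using k[of s u] k[of 0 u] by (simp add: cdot_diff_left cdot_heat_adjoint)
  then have "cdot (heat M l (c - s) (heat M l s v) - heat M l c v) (heat M l (c - s) (heat M l s v) - heat M l c v) = 0"
    by blast
  then show ?thesis unfolding cdot_self by simp
qed

text \<open>Backward uniqueness for the linear system that the Fourier coefficients satisfy: along a
  solution, propagating the value at time \<open>s\<close> back to time \<open>t\<close> does not depend on \<open>s\<close>.\<close>

lemma heat_backward_unique: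
  fixes z :: "real \<Rightarrow> complex^'n"
  assumes der: "\<And>s. s \<in> {0..<\<tau>} \<Longrightarrow> (z has_vector_derivative (l *\<^sub>R z s - M *v z s)) (at s within {0..\<tau>})"
    and cont: "(z \<longlongrightarrow> z \<tau>) (at \<tau> within {0..\<tau>})" and t: "t \<in> {0..\<tau>}"
  shows "z t = heat M l (\<tau> - t) (z \<tau>)"
proof -
  have "cdot (z t) u = cdot (heat M l (\<tau> - t) (z \<tau>)) u" for u
  proof -
    \<comment> \<open>The solution is paired with the adjoint flow run from t to s; in the
      derivative the two generators cancel.\<close>
    define g where "g s = cdot (z s) (heat (conj_transpose M) l (- (t - s)) u)" for s
    have g': "(g has_vector_derivative 0) (at s within {0..\<tau>})" if s: "s \<in> {0..<\<tau>}" for s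
    proof -
      have "((\<lambda>s. s - t) has_vector_derivative 1) (at s within {0..\<tau>})"
        by (auto intro!: derivative_eq_intros)
      then have "((\<lambda>s. heat (conj_transpose M) l (s - t) u) has_vector_derivative
          heat (conj_transpose M) l (s - t) (conj_transpose M *v u - l *\<^sub>R u)) (at s within {0..\<tau>})"
        using vector_diff_chain_within[OF _ heat_derivative, of "\<lambda>s. s - t" 1 s "{0..\<tau>}" "conj_transpose M" l u]
        by (simp add: o_def)
      from bounded_bilinear.has_vector_derivative[OF bounded_bilinear_cdot der[OF s] this]
      have "(g has_vector_derivative (cdot (z s) (heat (conj_transpose M) l (s - t) (conj_transpose M *v u - l *\<^sub>R u)) +
         cdot (l *\<^sub>R z s - M *v z s) (heat (conj_transpose M) l (s - t) u))) (at s within {0..\<tau>})"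
        by (simp add: g_def[abs_def])
      then show ?thesis
        by (rule has_vector_derivative_eq_rhs)
         (simp add: heat_minus heat_scaleR heat_matrix[symmetric] cdot_diff_left cdot_diff_right
           cdot_scaleR_left cdot_scaleR_right cdot_conj_transpose)
    qed
    have gc: "continuous_on {0..\<tau>} g"
      unfolding continuous_on_eq_continuous_within
    proof
      fix s assume s: "s \<in> {0..\<tau>}"
      show "continuous (at s within {0..\<tau>}) g"
      proof (cases "s = \<tau>")
        case True
        have h: "((\<lambda>s. heat (conj_transpose M) l (s - t) u) \<longlongrightarrow> heat (conj_transpose M) l (\<tau> - t) u) (at \<tau> within {0..\<tau>})"
        proof -
          have "continuous_on {0..\<tau>} (\<lambda>s. heat (conj_transpose M) l (s - t) u)"
            by (rule continuous_on_compose2[OF heat_continuous[of UNIV]]) (auto intro!: continuous_intros)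
          then show ?thesis using s True unfolding continuous_on_def by blast
        qed
        show ?thesis unfolding True continuous_within g_def using tendsto_cdot[OF cont h] by simp
      next
        case False
        then have "s \<in> {0..<\<tau>}" using s by auto
        then show ?thesis by (rule has_vector_derivative_continuous[OF g'])
      qed
    qed
    have "g t = g \<tau>"
    proof (cases "t = \<tau>")
      case False
      then have tt: "t < \<tau>" "0 \<le> t" using t by auto
      show ?thesis
      \<comment> \<open>The differential equation is known only for s < \<tau>. At \<tau> continuity
        suffices, with \<tau> as the single exceptional point.\<close>
      proof (rule has_derivative_zero_unique_strong_interval[where k = "{\<tau>}", symmetric, of t \<tau>])
        show "continuous_on {t..\<tau>} g" by (rule continuous_on_subset[OF gc]) (use tt in auto)
        show "(g has_derivative (\<lambda>h. 0)) (at x within {t..\<tau>})" if "x \<in> {t..\<tau>} - {\<tau>}" for x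
          using has_vector_derivative_within_subset[OF g', of x "{t..\<tau>}"] that tt
          unfolding has_vector_derivative_def by auto
      qed (use tt in auto)
    qed simp
    then show ?thesis by (simp add: g_def cdot_heat_adjoint)
  qed
  then have "cdot (z t - heat M l (\<tau> - t) (z \<tau>)) u = 0" for u by (simp add: cdot_diff_left)
  from this[of "z t - heat M l (\<tau> - t) (z \<tau>)"] show ?thesis unfolding cdot_self by simp
qed

section \<open>Fourier coefficients of the adjoint system\<close>

text \<open>Adjoint solutions are defined through norms of difference quotients. The equivalence
  serves in both directions: to extract the mode equations from such a solution, and to verify an
  explicit one.\<close>

lemma has_vector_derivative_quotient_iff:
  fixes f :: "real \<Rightarrow> 'a::real_normed_vector"
  shows "((\<lambda>y. norm ((1 / (y - x)) *\<^sub>R (f y - f x) - f')) \<longlongrightarrow> 0) (at x within S) \<longleftrightarrow>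
    (f has_vector_derivative f') (at x within S)"
proof -
  have "norm ((1 / (y - x)) *\<^sub>R (f y - f x) - f') = norm (f y - f x - (y - x) *\<^sub>R f') / norm (y - x)"
    if "y \<noteq> x" for y
  proof -
    have "(1 / (y - x)) *\<^sub>R (f y - f x) - f' = (1 / (y - x)) *\<^sub>R (f y - f x - (y - x) *\<^sub>R f')"
      using that by (simp add: scaleR_diff_right)
    then show ?thesis by (simp add: divide_inverse abs_inverse)
  qed
  then have "\<forall>\<^sub>F y in at x within S. norm ((1 / (y - x)) *\<^sub>R (f y - f x) - f') =
      norm (f y - f x - (y - x) *\<^sub>R f') / norm (y - x)"
    by (auto simp: eventually_at_filter)
  then have "((\<lambda>y. norm ((1 / (y - x)) *\<^sub>R (f y - f x) - f')) \<longlongrightarrow> 0) (at x within S) \<longleftrightarrow>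
      ((\<lambda>y. norm (f y - f x - (y - x) *\<^sub>R f') / norm (y - x)) \<longlongrightarrow> 0) (at x within S)"
    by (rule tendsto_cong)
  then show ?thesis
    unfolding has_vector_derivative_def has_derivative_iff_norm by (simp add: bounded_linear_scaleR_left)
qed

text \<open>The cube of x / 3 \<le> exp(x / 3). The third power is what leaves summable powers of
  \<open>freq\<close> in the series estimates that use it.\<close>

lemma exp_minus_le: "0 < x \<Longrightarrow> exp (- x) \<le> 27 / x ^ 3" for x :: real
proof -
  assume x: "0 < x"
  have "x / 3 \<le> exp (x / 3)" using exp_ge_add_one_self[of "x / 3"] by linarith
  then have "(x / 3) ^ 3 \<le> exp (x / 3) ^ 3" using x by (intro power_mono) auto
  also have "exp (x / 3) ^ 3 = exp x" by (simp flip: exp_of_nat_mult)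
  finally show ?thesis using x by (simp add: exp_minus field_simps)
qed

context interval begin

lemma freq_ge: "freq 0 \<le> freq k"
  using L_pos by (simp add: freq_def divide_right_mono mult_right_mono)

lemma H10_sine_coeff_bound:
  assumes "u \<in> H10 L"
  shows "norm (sine_coeff u k) \<le> sqrt (2 / L) / freq k * H10_norm L u"
proof -
  note p = H10_parseval[OF assms]
  have "(\<Sum>j\<in>{k}. (freq j)\<^sup>2 * (norm (sine_coeff u j))\<^sup>2) \<le> (\<Sum>j. (freq j)\<^sup>2 * (norm (sine_coeff u j))\<^sup>2)"
    by (rule sum_le_suminf[OF sums_summable[OF p]]) auto
  then have "(freq k * norm (sine_coeff u k))\<^sup>2 \<le> 2 / L * (H10_norm L u)\<^sup>2"
    by (simp add: power_mult_distrib sums_unique[OF p, symmetric])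
  then have "freq k * norm (sine_coeff u k) \<le> sqrt (2 / L * (H10_norm L u)\<^sup>2)"
    by (rule real_le_rsqrt)
  also have "\<dots> = sqrt (2 / L) * H10_norm L u" by (simp only: real_sqrt_mult real_sqrt_abs abs_of_nonneg[OF H10_norm_nonneg])
  finally show ?thesis using freq_pos[of k] by (simp add: field_simps)
qed

text \<open>Taking the k-th sine coefficient is continuous in L^2 and turns the Laplacian into
  multiplication by - freq^2, so the coefficient solves a linear ODE for t < \<tau>. Continuity in
  H^1_0 supplies the terminal value, and \<open>heat_backward_unique\<close> the formula.\<close>

theorem adjoint_solution_coeff:
  fixes A :: "complex^'n^'n"
  assumes z: "adjoint_solution L A \<tau> \<zeta> z" and t: "t \<in> {0..\<tau>}"
  shows "sine_coeff (z t) k = heat (conj_transpose A) ((freq k)\<^sup>2) (\<tau> - t) (sine_coeff \<zeta> k)"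
proof -
  have zH: "\<And>t. t \<in> {0..\<tau>} \<Longrightarrow> z t \<in> H10 L"
    and zc: "\<And>t. t \<in> {0..\<tau>} \<Longrightarrow> ((\<lambda>s. H10_norm L (\<lambda>x. z s x - z t x)) \<longlongrightarrow> 0) (at t within {0..\<tau>})"
    and zf: "z \<tau> = \<zeta>"
    and zd: "\<And>t. t \<in> {0..<\<tau>} \<Longrightarrow> \<exists>f. dirichlet_laplacian L (z t) f \<and>
        ((\<lambda>s. L2_norm {0<..<L} (\<lambda>x. (1 / (s - t)) *\<^sub>R (z s x - z t x) + (f x + conj_transpose A *v z t x)))
          \<longlongrightarrow> 0) (at t within {0..\<tau>})"
    using z unfolding adjoint_solution_def by blast+
  let ?l = "(freq k)\<^sup>2" and ?M = "conj_transpose A"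
  let ?c = "\<lambda>s. sine_coeff (z s) k"
  have "?c t = heat ?M ?l (\<tau> - t) (?c \<tau>)"
  proof (rule heat_backward_unique[OF _ _ t])
    fix s assume s: "s \<in> {0..<\<tau>}"
    then have s': "s \<in> {0..\<tau>}" by simp
    obtain f where f: "dirichlet_laplacian L (z s) f"
      and lim: "((\<lambda>r. L2_norm {0<..<L} (\<lambda>x. (1 / (r - s)) *\<^sub>R (z r x - z s x) + (f x + ?M *v z s x)))
          \<longlongrightarrow> 0) (at s within {0..\<tau>})"
      using zd[OF s] by blast
    obtain p where p: "has_H1_deriv L (z s) p" "has_H1_deriv L p f"
      using f unfolding dirichlet_laplacian_def by blast
    have fs: "square_integrable N f" by (rule has_H1_derivD(1)[OF p(2)])
    have fc: "sine_coeff f k = - ?l *\<^sub>R ?c s"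
      by (rule sine_coeff_laplacian[OF p H10_boundary(1,2)[OF zH[OF s']]])
    have Mz: "square_integrable N (\<lambda>x. ?M *v z s x)"
      by (rule square_integrable_linear[OF bounded_linear_matrix H10_square_integrable[OF zH[OF s']]])
    \<comment> \<open>The residual whose L^2 norm tends to 0 by definition of an adjoint solution;
      its k-th coefficient is the error of the difference quotient of \<open>?c\<close>.\<close>
    define D where "D r x = (1 / (r - s)) *\<^sub>R (z r x - z s x) + (f x + ?M *v z s x)" for r x
    have Dq: "norm ((1 / (r - s)) *\<^sub>R (?c r - ?c s) - (?l *\<^sub>R ?c s - ?M *v ?c s)) \<le> 2 / L * sqrt L * L2_norm {0<..<L} (D r)"
      if r: "r \<in> {0..\<tau>}" for r
    proof -
      note zz = H10_square_integrable[OF zH[OF r]] H10_square_integrable[OF zH[OF s']]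
      have d1: "square_integrable N (\<lambda>x. (1 / (r - s)) *\<^sub>R (z r x - z s x))"
        by (intro square_integrable_scaleR square_integrable_diff zz)
      have d2: "square_integrable N (\<lambda>x. f x + ?M *v z s x)" by (intro square_integrable_add fs Mz)
      have "sine_coeff (D r) k = (1 / (r - s)) *\<^sub>R (?c r - ?c s) + (- ?l *\<^sub>R ?c s + ?M *v ?c s)"
        unfolding D_def
        by (simp only: sine_coeff_add[OF d1 d2] sine_coeff_add[OF fs Mz] fc
            sine_coeff_linear[OF bounded_linear_matrix zz(2)]
            sine_coeff_linear[OF bounded_linear_scaleR_right square_integrable_diff[OF zz]]
            sine_coeff_diff[OF zz])
      moreover have "norm (sine_coeff (D r) k) \<le> 2 / L * sqrt L * L2_norm {0<..<L} (D r)"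
        by (rule sine_coeff_bound) (unfold D_def, rule square_integrable_add[OF d1 d2])
      moreover have "(1 / (r - s)) *\<^sub>R (?c r - ?c s) + (- ?l *\<^sub>R ?c s + ?M *v ?c s) =
          (1 / (r - s)) *\<^sub>R (?c r - ?c s) - (?l *\<^sub>R ?c s - ?M *v ?c s)" by simp
      ultimately show ?thesis by (simp only:)
    qed
    show "(?c has_vector_derivative (?l *\<^sub>R ?c s - ?M *v ?c s)) (at s within {0..\<tau>})"
    proof (rule iffD1[OF has_vector_derivative_quotient_iff], rule Lim_null_comparison)
      show "((\<lambda>r. 2 / L * sqrt L * L2_norm {0<..<L} (D r)) \<longlongrightarrow> 0) (at s within {0..\<tau>})"
        using tendsto_mult_right_zero[OF lim] unfolding D_def .
      show "\<forall>\<^sub>F r in at s within {0..\<tau>}. norm (norm ((1 / (r - s)) *\<^sub>R (?c r - ?c s) - (?l *\<^sub>R ?c s - ?M *v ?c s)))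
          \<le> 2 / L * sqrt L * L2_norm {0<..<L} (D r)"
        unfolding real_norm_def abs_norm_cancel using Dq by (auto simp: eventually_at_filter)
    qed
  next
    have t\<tau>: "\<tau> \<in> {0..\<tau>}" using t by simp
    show "(?c \<longlongrightarrow> ?c \<tau>) (at \<tau> within {0..\<tau>})"
    proof (rule Lim_null[THEN iffD2], rule Lim_null_comparison)
      show "((\<lambda>s. sqrt (2 / L) / freq k * H10_norm L (\<lambda>x. z s x - z \<tau> x)) \<longlongrightarrow> 0) (at \<tau> within {0..\<tau>})"
        by (rule tendsto_mult_right_zero[OF zc[OF t\<tau>]])
      have "norm (?c s - ?c \<tau>) \<le> sqrt (2 / L) / freq k * H10_norm L (\<lambda>x. z s x - z \<tau> x)" if "s \<in> {0..\<tau>}" for s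
        using H10_sine_coeff_bound[OF H10_diff[OF zH[OF that] zH[OF t\<tau>]], of k]
        unfolding sine_coeff_diff[OF H10_square_integrable[OF zH[OF that]] H10_square_integrable[OF zH[OF t\<tau>]]] .
      then show "\<forall>\<^sub>F s in at \<tau> within {0..\<tau>}. norm (?c s - ?c \<tau>) \<le> sqrt (2 / L) / freq k * H10_norm L (\<lambda>x. z s x - z \<tau> x)"
        by (auto simp: eventually_at_filter)
    qed
  qed
  then show ?thesis by (simp add: zf)
qed

lemma freq_weight_summable:
  assumes "summable (\<lambda>k. (freq k)\<^sup>2 * norm (c k))"
  shows "summable (\<lambda>k. norm (freq k *\<^sub>R c k))"
proof (rule summable_comparison_test'[where N = 0])
  show "summable (\<lambda>k. (1 / freq 0) * ((freq k)\<^sup>2 * norm (c k)))" by (rule summable_mult[OF assms])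
  show "norm (norm (freq k *\<^sub>R c k)) \<le> (1 / freq 0) * ((freq k)\<^sup>2 * norm (c k))" for k
  proof -
    have "freq k * freq 0 \<le> freq k * freq k" using freq_ge[of k] freq_pos[of k] by simp
    then have "freq k \<le> (1 / freq 0) * (freq k)\<^sup>2" using freq_pos[of 0] by (simp add: field_simps power2_eq_square)
    then have "freq k * norm (c k) \<le> (1 / freq 0) * (freq k)\<^sup>2 * norm (c k)"
      by (rule mult_right_mono) simp
    then show ?thesis using freq_pos[of k] by simp
  qed
qed

text \<open>Only the derivative at 0 is wanted, so the bound |sin y - y| \<le> y^2 takes the place
  of termwise differentiation, at the price of the weight freq^2 in the assumption. The minus sign
  comes from the outward normal at 0.\<close>

lemma normal_deriv_zero:
  fixes u :: "real \<Rightarrow> complex^'n"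
  assumes u: "u \<in> H10 L" and s2: "summable (\<lambda>k. (freq k)\<^sup>2 * norm (sine_coeff u k))"
  shows "summable (\<lambda>k. norm (freq k *\<^sub>R sine_coeff u k))"
    "normal_deriv L u 0 = - (\<Sum>k. freq k *\<^sub>R sine_coeff u k)"
proof -
  let ?c = "sine_coeff u"
  show s1: "summable (\<lambda>k. norm (freq k *\<^sub>R ?c k))" by (rule freq_weight_summable[OF s2])
  define D where "D = (\<Sum>k. freq k *\<^sub>R ?c k)"
  have Ds: "(\<lambda>k. freq k *\<^sub>R ?c k) sums D" unfolding D_def by (rule summable_sums[OF summable_norm_cancel[OF s1]])
  define S where "S = (\<Sum>k. (freq k)\<^sup>2 * norm (?c k))"
  have bd: "norm (u x - x *\<^sub>R D) \<le> x\<^sup>2 * S" if x: "x \<in> {0..L}" for x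
  proof -
    have sm: "(\<lambda>k. sin (freq k * x) *\<^sub>R ?c k - x *\<^sub>R freq k *\<^sub>R ?c k) sums (u x - x *\<^sub>R D)"
      by (intro sums_diff H10_expansion[OF u x] bounded_linear.sums[OF bounded_linear_scaleR_right Ds])
    have ss: "summable (\<lambda>k. x\<^sup>2 * ((freq k)\<^sup>2 * norm (?c k)))" by (rule summable_mult[OF s2])
    have le: "norm (sin (freq k * x) *\<^sub>R ?c k - x *\<^sub>R freq k *\<^sub>R ?c k) \<le> x\<^sup>2 * ((freq k)\<^sup>2 * norm (?c k))" for k
    proof -
      let ?y = "freq k * x"
      have "\<bar>sin ?y - ?y\<bar> \<le> inverse (fact 2) * \<bar>?y\<bar> ^ 2"
        using Maclaurin_sin_bound[of ?y 2] by (simp add: numeral_2_eq_2 Transcendental.sin_coeff_def)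
      also have "\<dots> \<le> ?y\<^sup>2" by (simp add: fact_numeral)
      finally have "\<bar>sin ?y - ?y\<bar> * norm (?c k) \<le> ?y\<^sup>2 * norm (?c k)" by (rule mult_right_mono) simp
      moreover have "sin ?y *\<^sub>R ?c k - x *\<^sub>R freq k *\<^sub>R ?c k = (sin ?y - ?y) *\<^sub>R ?c k"
        by (simp add: scaleR_diff_left mult.commute)
      ultimately show ?thesis by (simp add: power_mult_distrib mult_ac)
    qed
    have "norm (\<Sum>k. sin (freq k * x) *\<^sub>R ?c k - x *\<^sub>R freq k *\<^sub>R ?c k) \<le> (\<Sum>k. x\<^sup>2 * ((freq k)\<^sup>2 * norm (?c k)))"
      by (rule norm_suminf_le[OF le ss])
    then show ?thesis unfolding S_def suminf_mult[OF s2] sums_unique[OF sm, symmetric] .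
  qed
  have "(u has_vector_derivative D) (at 0 within {0..L})"
    unfolding has_vector_derivative_def
  proof (rule has_derivativeI_sandwich[of 1])
    show "bounded_linear (\<lambda>x. x *\<^sub>R D)" by (rule bounded_linear_scaleR_left)
    show "((\<lambda>y. \<bar>y\<bar> * S) \<longlongrightarrow> 0) (at 0 within {0..L})"
      by (rule tendsto_eq_intros refl)+ simp
    show "norm (u y - u 0 - (y - 0) *\<^sub>R D) / norm (y - 0) \<le> \<bar>y\<bar> * S" if "y \<in> {0..L}" "y \<noteq> 0" for y
    proof -
      have "norm (u y - y *\<^sub>R D) / \<bar>y\<bar> \<le> y\<^sup>2 * S / \<bar>y\<bar>" by (rule divide_right_mono[OF bd]) (use that in auto)
      also have "y\<^sup>2 * S / \<bar>y\<bar> = \<bar>y\<bar> * S" using that by (simp add: power2_eq_square)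
      finally show ?thesis using H10_boundary(1)[OF u] by simp
    qed
  qed simp
  moreover have "at 0 within {0..L} \<noteq> bot" using L_pos by (simp add: at_within_Icc_at_right)
  ultimately show "normal_deriv L u 0 = - D"
    unfolding normal_deriv_def by (simp add: vector_derivative_within)
qed

text \<open>By the cubic decay bound the terms are at most a constant times freq^2 * freq^-6 * freq
  = freq^-3. Coefficients of H^1_0 and of H^-1 both grow at most linearly in \<open>freq\<close>, so
  both cases are covered.\<close>

lemma heat_summable:
  assumes c: "\<And>k. norm (c k) \<le> C * freq k" and \<sigma>: "\<sigma> > 0"
  shows "summable (\<lambda>k. (freq k)\<^sup>2 * norm (heat M ((freq k)\<^sup>2) \<sigma> (c k)))"
proof (rule summable_comparison_test'[where N = 0])
  let ?K = "exp (mnorm M * \<sigma>) * (C * (27 / \<sigma> ^ 3))"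
  show "summable (\<lambda>k. ?K * (1 / freq k ^ 3))"
    by (intro summable_mult summable_inverse_freq) simp
  show "norm ((freq k)\<^sup>2 * norm (heat M ((freq k)\<^sup>2) \<sigma> (c k))) \<le> ?K * (1 / freq k ^ 3)" for k
  proof -
    note f = freq_pos[of k]
    have C0: "0 \<le> C * freq k" using c[of k] norm_ge_zero[of "c k"] by linarith
    have "norm (heat M ((freq k)\<^sup>2) \<sigma> (c k)) \<le> exp (mnorm M * \<sigma>) * exp (- ((freq k)\<^sup>2 * \<sigma>)) * norm (c k)"
      using heat_norm_le[of M "(freq k)\<^sup>2" \<sigma> "c k"] \<sigma> by (simp add: exp_diff exp_minus divide_inverse)
    also have "\<dots> \<le> exp (mnorm M * \<sigma>) * (27 / ((freq k)\<^sup>2 * \<sigma>) ^ 3) * (C * freq k)"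
      using C0 f \<sigma> by (intro mult_mono exp_minus_le c) auto
    finally have "(freq k)\<^sup>2 * norm (heat M ((freq k)\<^sup>2) \<sigma> (c k)) \<le>
        (freq k)\<^sup>2 * (exp (mnorm M * \<sigma>) * (27 / ((freq k)\<^sup>2 * \<sigma>) ^ 3) * (C * freq k))"
      by (rule mult_left_mono) simp
    also have "\<dots> = ?K * (1 / freq k ^ 3)"
      using f \<sigma> by (simp add: field_simps power2_eq_square power3_eq_cube)
    finally show ?thesis using f by (simp add: abs_mult)
  qed
qed

lemma H10_coeff_freq_bound:
  assumes "summable (\<lambda>k. (freq k)\<^sup>2 * (norm (c k))\<^sup>2)"
  obtains C where "\<And>k. norm (c k) \<le> C * freq k"
proof -
  obtain B where B: "\<And>k. norm (c k) \<le> B"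
    using summable_imp_bounded[OF H10_coeff_summable[OF assms]] unfolding bounded_iff by auto
  have "norm (c k) \<le> (B / freq 0) * freq k" for k
  proof -
    have "B \<ge> 0" using B[of 0] norm_ge_zero[of "c 0"] by linarith
    then have "B * freq 0 \<le> B * freq k" using freq_ge[of k] by (rule mult_left_mono[rotated])
    then have "B \<le> (B / freq 0) * freq k" using freq_pos[of 0] by (simp add: field_simps)
    then show ?thesis using B[of k] by linarith
  qed
  then show ?thesis by (rule that)
qed

lemma hm_seq_freq_bound:
  assumes "hm_seq Y"
  obtains C where "\<And>k. norm (Y k) \<le> C * freq k"
proof -
  obtain B where B: "\<And>k. (norm (Y k) / freq k)\<^sup>2 \<le> B"
    using summable_imp_bounded[OF assms[unfolded hm_seq_def]] unfolding bounded_iff by auto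
  have "norm (Y k) \<le> sqrt B * freq k" for k
    using real_le_rsqrt[OF B[of k]] freq_pos[of k] by (simp add: field_simps)
  then show ?thesis by (rule that)
qed

end

section \<open>Fourier coefficients of the controlled state\<close>

text \<open>Testing against a fixed vector moves the time-dependent propagator to the other side of
  the pairing, which leaves a pairing of two continuous maps.\<close>

lemma heat_continuous_joint:
  fixes f :: "real \<Rightarrow> complex^'n"
  assumes "continuous_on S g" "continuous_on S f"
  shows "continuous_on S (\<lambda>s. heat M l (g s) (f s))"
proof (subst continuous_on_componentwise, intro ballI)
  fix i :: "complex^'n"
  have "continuous_on S (\<lambda>s. heat (conj_transpose M) l (g s) i)"
    by (rule continuous_on_compose2[OF heat_continuous[of UNIV] assms(1)]) simp
  then have "continuous_on S (\<lambda>s. Re (cdot (f s) (heat (conj_transpose M) l (g s) i)))"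
    by (intro continuous_on_Re continuous_on_cdot assms(2))
  then show "continuous_on S (\<lambda>s. heat M l (g s) (f s) \<bullet> i)"
    by (simp add: cdot_heat_adjoint flip: Re_cdot)
qed

text \<open>The factor 1 / l is the gain from integrating the heat decay over time; with l = freq^2
  it is worth two powers of the frequency.\<close>

lemma exp_integral:
  fixes l t :: real
  assumes "l > 0" "t \<ge> 0"
  shows "(\<lambda>s. exp (- (l * (t - s)))) integrable_on {0..t}"
    "integral {0..t} (\<lambda>s. exp (- (l * (t - s)))) \<le> 1 / l"
proof -
  have "((\<lambda>s. exp (- (l * (t - s)))) has_integral (exp (- (l * (t - t))) / l - exp (- (l * (t - 0))) / l)) {0..t}"
  proof (rule fundamental_theorem_of_calculus[OF assms(2)])
    show "((\<lambda>s. exp (- (l * (t - s))) / l) has_vector_derivative exp (- (l * (t - x)))) (at x within {0..t})" for x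
      unfolding has_real_derivative_iff_has_vector_derivative[symmetric]
      using assms(1) by (auto intro!: derivative_eq_intros)
  qed
  then show "(\<lambda>s. exp (- (l * (t - s)))) integrable_on {0..t}"
    "integral {0..t} (\<lambda>s. exp (- (l * (t - s)))) \<le> 1 / l"
    using assms by (auto simp: has_integral_integrable integral_unique field_simps)
qed

lemma heat_decay_le:
  assumes "0 \<le> r" "r \<le> T"
  shows "norm (heat M l r v) \<le> exp (mnorm M * T) * exp (- (l * r)) * norm v"
proof -
  have "exp (mnorm M * \<bar>r\<bar> - l * r) \<le> exp (mnorm M * T - l * r)"
    using assms mult_left_mono[OF assms(2) mnorm_nonneg[of M]] by simp
  then have "exp (mnorm M * \<bar>r\<bar> - l * r) * norm v \<le> exp (mnorm M * T - l * r) * norm v"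
    by (rule mult_right_mono) simp
  also have "exp (mnorm M * T - l * r) = exp (mnorm M * T) * exp (- (l * r))"
    by (simp flip: exp_add)
  finally show ?thesis using heat_norm_le[of M l r v] by linarith
qed

lemma heat_bounded:
  assumes "0 \<le> r" "r \<le> T" "l \<ge> 0"
  shows "norm (heat M l r v) \<le> exp (mnorm M * T) * norm v"
proof -
  have "exp (mnorm M * T) * exp (- (l * r)) * norm v \<le> exp (mnorm M * T) * norm v"
    using assms by (intro mult_right_mono mult_left_le) auto
  then show ?thesis by (rule order_trans[OF heat_decay_le[OF assms(1,2)]])
qed

context interval begin

lemma Hm1_norm_nonneg:
  fixes F :: "('n::finite) functional"
  assumes "F \<in> Hm1 L"
  shows "Hm1_norm L F \<ge> 0"
proof -
  define w :: "complex^'n" where "w = (\<chi> i. 1)"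
  have w: "w \<noteq> 0" by (simp add: w_def vec_eq_iff)
  have "H10_norm L (mode 0 w) \<noteq> 0"
    using H10_sine_coeff_bound[OF mode_H10, of 0 w 0] w by (auto simp: sine_coeff_mode)
  then have "H10_norm L (mode 0 w) > 0" using H10_norm_nonneg[of "mode 0 w"] by linarith
  moreover have "0 \<le> Hm1_norm L F * H10_norm L (mode 0 w)"
    by (rule order_trans[OF norm_ge_zero Hm1_norm_bound[OF assms mode_H10]])
  ultimately show ?thesis by (simp add: zero_le_mult_iff)
qed

end

text \<open>\<open>\<gamma>\<close> is the scalar control and \<open>b\<close> its direction. C^1
  regularity permits an integration by parts in time, in which \<open>\<gamma> 0 = 0\<close> removes
  the term at time 0. The assumptions speak of \<open>\<gamma>\<close> and \<open>\<gamma>'\<close>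
  alone, so the locale predicate takes L and these two functions as its arguments.\<close>

locale boundary_control = interval +
  fixes A :: "complex^'n^'n" and b :: "complex^'n" and \<gamma> \<gamma>' :: "real \<Rightarrow> complex"
  assumes \<gamma>_deriv: "(\<gamma> has_vector_derivative \<gamma>' t) (at t)"
    and \<gamma>'_continuous: "continuous_on UNIV \<gamma>'"
    and \<gamma>_zero: "\<gamma> 0 = 0"
begin

lemma \<gamma>_continuous: "continuous_on S \<gamma>"
  using \<gamma>_deriv by (intro continuous_on_vector_derivative) (blast intro: has_vector_derivative_at_within)

lemma continuous_on_smult: "continuous_on S f \<Longrightarrow> continuous_on S (\<lambda>s. f s *s (v :: complex^'n))"
  unfolding vector_scalar_mult_def by (intro continuous_on_vec_lambda continuous_intros)

lemma \<gamma>b_deriv: "((\<lambda>t. \<gamma> t *s b) has_vector_derivative \<gamma>' t *s b) (at t within S)"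
proof -
  have "bounded_linear (\<lambda>c. c *s b)"
    by (rule bounded_linear_intro[where K = "norm b"])
      (simp_all add: vec_eq_iff algebra_simps norm_smult)
  then show ?thesis
    by (rule bounded_linear.has_vector_derivative) (rule has_vector_derivative_at_within[OF \<gamma>_deriv])
qed

text \<open>The integrand that remains under the propagator after integrating freq^2 exp((A -
  freq^2)(t - s)) \<gamma>(s) b by parts in s.\<close>

definition source :: "real \<Rightarrow> complex^'n" where
  "source s = \<gamma> s *s (A *v b) - \<gamma>' s *s b"

lemma source_continuous: "continuous_on S source"
  unfolding source_def[abs_def]
  by (intro continuous_on_diff continuous_on_smult \<gamma>_continuous continuous_on_subset[OF \<gamma>'_continuous]) simp

text \<open>Duhamel integral of \<open>source\<close>, with the propagator over t - s split into one
  over t and one over - s. The integrand is then independent of t, and continuity in t is that of an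
  indefinite integral.\<close>

definition response :: "nat \<Rightarrow> real \<Rightarrow> complex^'n" where
  "response k t = heat A ((freq k)\<^sup>2) t (integral {0..t} (\<lambda>s. heat A ((freq k)\<^sup>2) (- s) (source s)))"

lemma response_continuous: "continuous_on {0..T} (response k)"
  unfolding response_def[abs_def]
  by (intro heat_continuous_joint continuous_on_id indefinite_integral_continuous_1
      integrable_continuous_interval continuous_on_minus source_continuous)

lemma cdot_response:
  "cdot (response k t) v = integral {0..t} (\<lambda>s. cdot (source s) (heat (conj_transpose A) ((freq k)\<^sup>2) (t - s) v))"
proof -
  let ?l = "(freq k)\<^sup>2" and ?A = "conj_transpose A"
  have int: "(\<lambda>s. heat A ?l (- s) (source s)) integrable_on {0..t}"
    by (intro integrable_continuous_interval heat_continuous_joint continuous_on_minus source_continuous continuous_on_id)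
  have "cdot (response k t) v = cdot (integral {0..t} (\<lambda>s. heat A ?l (- s) (source s))) (heat ?A ?l t v)"
    unfolding response_def cdot_heat_adjoint by simp
  also have "\<dots> = integral {0..t} (\<lambda>s. cdot (heat A ?l (- s) (source s)) (heat ?A ?l t v))"
    using integral_linear[OF int bounded_linear_cdot_left, of "heat ?A ?l t v"] by (simp add: o_def)
  also have "\<dots> = integral {0..t} (\<lambda>s. cdot (source s) (heat ?A ?l (t - s) v))"
  proof (rule Henstock_Kurzweil_Integration.integral_cong)
    fix s
    have "heat ?A ?l (- s) (heat ?A ?l t v) = heat ?A ?l (t - s) v"
      using heat_semigroup[of ?A ?l "t - s" t v] by simp
    then show "cdot (heat A ?l (- s) (source s)) (heat ?A ?l t v) = cdot (source s) (heat ?A ?l (t - s) v)"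
      by (simp add: cdot_heat_adjoint)
  qed
  finally show ?thesis .
qed

lemma heat_reversed_continuous: "continuous_on S (\<lambda>s. heat M l (t - s) v)"
  by (intro heat_continuous_joint continuous_on_diff continuous_on_const continuous_on_id)

text \<open>Duality estimate: pairing the response with itself bounds its squared norm by K / freq^2
  times its norm, through the time integral of the heat decay. One constant serves all modes and all
  times in [0, T].\<close>

lemma response_bound:
  obtains K where "K \<ge> 0" "\<And>k t. t \<in> {0..T} \<Longrightarrow> norm (response k t) \<le> K / (freq k)\<^sup>2"
proof -
  obtain R where R: "\<And>s. s \<in> {0..T} \<Longrightarrow> norm (source s) \<le> R"
    using compact_imp_bounded[OF compact_continuous_image[OF source_continuous compact_Icc]]
    unfolding bounded_iff by blast
  define K where "K = \<bar>R\<bar> * exp (mnorm (conj_transpose A) * T)"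
  have "norm (response k t) \<le> K / (freq k)\<^sup>2" if t: "t \<in> {0..T}" for k t
  proof -
    let ?l = "(freq k)\<^sup>2" and ?A = "conj_transpose A" and ?r = "response k t"
    have l: "?l > 0" using freq_pos[of k] by simp
    have t0: "t \<ge> 0" using t by simp
    have "cmod (integral {0..t} (\<lambda>s. cdot (source s) (heat ?A ?l (t - s) ?r))) \<le>
      integral {0..t} (\<lambda>s. (K * norm ?r) * exp (- (?l * (t - s))))"
    proof (rule Henstock_Kurzweil_Integration.integral_norm_bound_integral)
      show "(\<lambda>s. cdot (source s) (heat ?A ?l (t - s) ?r)) integrable_on {0..t}"
        by (intro integrable_continuous_interval continuous_on_cdot source_continuous heat_reversed_continuous)
      show "(\<lambda>s. (K * norm ?r) * exp (- (?l * (t - s)))) integrable_on {0..t}"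
        by (intro integrable_on_mult_right exp_integral(1) l t0)
      fix s assume s: "s \<in> {0..t}"
      have "cmod (cdot (source s) (heat ?A ?l (t - s) ?r)) \<le> norm (source s) * norm (heat ?A ?l (t - s) ?r)"
        by (rule norm_cdot_le)
      also have "\<dots> \<le> \<bar>R\<bar> * (exp (mnorm ?A * T) * exp (- (?l * (t - s))) * norm ?r)"
      proof (rule mult_mono)
        show "norm (source s) \<le> \<bar>R\<bar>" using R[of s] s t by auto
        show "norm (heat ?A ?l (t - s) ?r) \<le> exp (mnorm ?A * T) * exp (- (?l * (t - s))) * norm ?r"
          by (rule heat_decay_le) (use s t in auto)
      qed auto
      finally show "cmod (cdot (source s) (heat ?A ?l (t - s) ?r)) \<le> (K * norm ?r) * exp (- (?l * (t - s)))"
        by (simp add: K_def mult_ac)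
    qed
    also have "\<dots> = (K * norm ?r) * integral {0..t} (\<lambda>s. exp (- (?l * (t - s))))"
      by (rule integral_mult_right)
    also have "\<dots> \<le> (K * norm ?r) * (1 / ?l)"
      by (rule mult_left_mono[OF exp_integral(2)[OF l t0]]) (simp add: K_def)
    finally have "cmod (cdot ?r ?r) \<le> (K * norm ?r) * (1 / ?l)" unfolding cdot_response .
    then have le: "norm ?r * norm ?r \<le> (K / ?l) * norm ?r"
      unfolding cdot_self norm_of_real by (simp add: power2_eq_square)
    show ?thesis
    proof (cases "?r = 0")
      case True
      then show ?thesis by (simp add: K_def)
    next
      case False
      then show ?thesis by (intro mult_right_le_imp_le[OF le]) simp
    qed
  qed
  note bound = this
  have "K \<ge> 0" by (simp add: K_def)
  then show ?thesis by (rule that[OF _ bound])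
qed

text \<open>This is freq times the Duhamel integral of \<gamma> b after integration by parts in
  time; \<open>cdot_forced\<close> establishes the equality. The form separates the slowly decaying
  trace part from a remainder of order freq^-3.\<close>

definition forced :: "nat \<Rightarrow> real \<Rightarrow> complex^'n" where
  "forced k t = (1 / freq k) *\<^sub>R (\<gamma> t *s b + response k t)"

lemma cdot_forced:
  assumes "t \<ge> 0"
  shows "cdot (forced k t) v = integral {0..t} (\<lambda>s. freq k *\<^sub>R cdot (\<gamma> s *s b) (heat (conj_transpose A) ((freq k)\<^sup>2) (t - s) v))"
proof -
  let ?l = "(freq k)\<^sup>2" and ?A = "conj_transpose A"
  define e where "e s = cdot (\<gamma> s *s b) (heat ?A ?l (t - s) v)" for s
  have ec: "continuous_on {0..t} e"
    unfolding e_def by (intro continuous_on_cdot continuous_on_smult \<gamma>_continuous heat_reversed_continuous)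
  have "(e has_vector_derivative (?l *\<^sub>R e s - cdot (source s) (heat ?A ?l (t - s) v))) (at s within {0..t})" for s
    unfolding e_def
    by (rule has_vector_derivative_eq_rhs[OF cdot_heat_derivative[OF \<gamma>b_deriv]])
      (simp add: heat_minus heat_scaleR heat_matrix[symmetric] cdot_diff_left cdot_diff_right
        cdot_scaleR_right source_def cdot_conj_transpose[symmetric] cdot_smult_left matrix_smult)
  then have "((\<lambda>s. ?l *\<^sub>R e s - cdot (source s) (heat ?A ?l (t - s) v)) has_integral (e t - e 0)) {0..t}"
    by (intro fundamental_theorem_of_calculus assms)
  then have "integral {0..t} (\<lambda>s. ?l *\<^sub>R e s - cdot (source s) (heat ?A ?l (t - s) v)) = e t - e 0"
    by (rule integral_unique)
  moreover have "integral {0..t} (\<lambda>s. ?l *\<^sub>R e s - cdot (source s) (heat ?A ?l (t - s) v)) =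
      integral {0..t} (\<lambda>s. ?l *\<^sub>R e s) - integral {0..t} (\<lambda>s. cdot (source s) (heat ?A ?l (t - s) v))"
    by (intro Henstock_Kurzweil_Integration.integral_diff integrable_continuous_interval
        continuous_on_scaleR continuous_on_const ec continuous_on_cdot source_continuous heat_reversed_continuous)
  ultimately have "?l *\<^sub>R integral {0..t} e = cdot (\<gamma> t *s b) v + cdot (response k t) v"
    by (simp add: cdot_response e_def[abs_def] \<gamma>_zero algebra_simps)
  then have "(1 / freq k) *\<^sub>R (?l *\<^sub>R integral {0..t} e) = cdot (forced k t) v"
    by (simp add: forced_def cdot_scaleR_left cdot_add_left)
  moreover have "(1 / freq k) *\<^sub>R (?l *\<^sub>R integral {0..t} e) = freq k *\<^sub>R integral {0..t} e"
    using freq_pos[of k] by (simp add: power2_eq_square)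
  ultimately show ?thesis unfolding e_def by (simp add: e_def[abs_def])
qed

text \<open>Sum over modes and integral over time may be exchanged: the time integral of the k-th
  term is at most a constant times |c k| / freq, and |c k| is summable. Up to the sign of the
  outward normal, the right-hand side is the boundary term of the transposition identity.\<close>

theorem forced_pairing:
  assumes c: "summable (\<lambda>k. (freq k)\<^sup>2 * (norm (c k))\<^sup>2)" and \<tau>: "\<tau> > 0"
  shows "(\<lambda>k. cdot (forced k \<tau>) (c k)) sums
     (LINT s:{0<..<\<tau>}|lborel. cdot (\<gamma> s *s b) (\<Sum>k. freq k *\<^sub>R heat (conj_transpose A) ((freq k)\<^sup>2) (\<tau> - s) (c k)))"
proof -
  interpret T: interval \<tau> by (unfold_locales) (rule \<tau>)
  let ?A = "conj_transpose A"
  let ?N = "restrict_space lborel {0<..<\<tau>}"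
  define f where "f k s = freq k *\<^sub>R cdot (\<gamma> s *s b) (heat ?A ((freq k)\<^sup>2) (\<tau> - s) (c k))" for k s
  obtain C where C: "\<And>k. norm (c k) \<le> C * freq k" using H10_coeff_freq_bound[OF c] by blast
  have fc: "continuous_on {0..\<tau>} (f k)" for k
    unfolding f_def
    by (intro continuous_on_scaleR continuous_on_const continuous_on_cdot continuous_on_smult \<gamma>_continuous heat_reversed_continuous)
  have int: "integral\<^sup>L ?N (f k) = cdot (forced k \<tau>) (c k)" for k
    unfolding T.continuous_integrable(2)[OF fc] f_def by (rule cdot_forced[symmetric]) (use \<tau> in simp)
  have sm: "summable (\<lambda>k. norm (freq k *\<^sub>R heat ?A ((freq k)\<^sup>2) (\<tau> - s) (c k)))" if "s \<in> {0<..<\<tau>}" for s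
    by (rule freq_weight_summable[OF heat_summable[OF C]]) (use that in auto)
  obtain G where G: "\<And>s. s \<in> {0..\<tau>} \<Longrightarrow> norm (\<gamma> s *s b) \<le> G"
    using compact_imp_bounded[OF compact_continuous_image[OF continuous_on_smult[OF \<gamma>_continuous] compact_Icc]]
    unfolding bounded_iff by blast
  have G0: "G \<ge> 0" by (rule order_trans[OF norm_ge_zero G[of 0]]) (use \<tau> in simp)
  have "(\<lambda>k. integral\<^sup>L ?N (f k)) sums (\<integral>s. (\<Sum>k. f k s) \<partial>?N)"
  proof (rule sums_integral)
    show "integrable ?N (f k)" for k by (rule T.continuous_integrable(1)[OF fc])
    show "AE s in ?N. summable (\<lambda>k. norm (f k s))"
    proof (rule AE_I2)
      fix s assume "s \<in> space ?N"
      then have s: "s \<in> {0<..<\<tau>}" by simp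
      show "summable (\<lambda>k. norm (f k s))"
      proof (rule summable_comparison_test'[OF summable_mult[OF sm[OF s], of "norm (\<gamma> s *s b)"], where N = 0])
        show "norm (norm (f k s)) \<le> norm (\<gamma> s *s b) * norm (freq k *\<^sub>R heat ?A ((freq k)\<^sup>2) (\<tau> - s) (c k))" for k
          unfolding f_def cdot_scaleR_right[symmetric] real_norm_def abs_norm_cancel by (rule norm_cdot_le)
      qed
    qed
    let ?K = "G * exp (mnorm ?A * \<tau>) / freq 0"
    show "summable (\<lambda>k. \<integral>s. norm (f k s) \<partial>?N)"
    proof (rule summable_comparison_test'[where N = 0])
      show "summable (\<lambda>k. ?K * norm (c k))" by (rule summable_mult[OF H10_coeff_summable[OF c]])
      fix k :: nat
      let ?l = "(freq k)\<^sup>2"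
      have l: "?l > 0" using freq_pos[of k] by simp
      let ?B = "freq k * G * exp (mnorm ?A * \<tau>) * norm (c k)"
      have "(\<integral>s. norm (f k s) \<partial>?N) \<le> (\<integral>s. ?B * exp (- (?l * (\<tau> - s))) \<partial>?N)"
      proof (rule integral_mono)
        show "integrable ?N (\<lambda>s. norm (f k s))" by (intro T.continuous_integrable continuous_on_norm fc)
        show "integrable ?N (\<lambda>s. ?B * exp (- (?l * (\<tau> - s))))" by (intro T.continuous_integrable continuous_intros)
        fix s assume "s \<in> space ?N"
        then have s: "0 < s" "s < \<tau>" by auto
        have "cmod (cdot (\<gamma> s *s b) (heat ?A ?l (\<tau> - s) (c k))) \<le> norm (\<gamma> s *s b) * norm (heat ?A ?l (\<tau> - s) (c k))"
          by (rule norm_cdot_le)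
        also have "\<dots> \<le> G * (exp (mnorm ?A * \<tau>) * exp (- (?l * (\<tau> - s))) * norm (c k))"
          by (intro mult_mono G heat_decay_le) (use s G0 in auto)
        finally have "freq k * cmod (cdot (\<gamma> s *s b) (heat ?A ?l (\<tau> - s) (c k))) \<le>
            freq k * (G * (exp (mnorm ?A * \<tau>) * exp (- (?l * (\<tau> - s))) * norm (c k)))"
          by (rule mult_left_mono) (use freq_pos[of k] in simp)
        then show "norm (f k s) \<le> ?B * exp (- (?l * (\<tau> - s)))"
          using freq_pos[of k] by (simp add: f_def mult_ac)
      qed
      also have "\<dots> = ?B * integral {0..\<tau>} (\<lambda>s. exp (- (?l * (\<tau> - s))))"
        by (subst T.continuous_integrable(2)) (auto intro!: continuous_intros)
      also have "\<dots> \<le> ?B * (1 / ?l)"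
        by (rule mult_left_mono[OF exp_integral(2)[OF l]]) (use \<tau> G0 freq_pos[of k] in auto)
      also have "\<dots> = G * exp (mnorm ?A * \<tau>) * norm (c k) * (1 / freq k)"
        using freq_pos[of k] by (simp add: power2_eq_square)
      also have "\<dots> \<le> G * exp (mnorm ?A * \<tau>) * norm (c k) * (1 / freq 0)"
        by (rule mult_left_mono) (use freq_ge[of k] freq_pos[of 0] freq_pos[of k] G0 in \<open>auto simp: frac_le\<close>)
      finally show "norm (\<integral>s. norm (f k s) \<partial>?N) \<le> ?K * norm (c k)" by simp
    qed
  qed
  also have "(\<lambda>k. integral\<^sup>L ?N (f k)) = (\<lambda>k. cdot (forced k \<tau>) (c k))" by (simp add: int)
  also have "(\<integral>s. (\<Sum>k. f k s) \<partial>?N) = (\<integral>s. cdot (\<gamma> s *s b) (\<Sum>k. freq k *\<^sub>R heat ?A ((freq k)\<^sup>2) (\<tau> - s) (c k)) \<partial>?N)"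
  proof (rule Bochner_Integration.integral_cong[OF refl])
    fix s assume "s \<in> space ?N"
    then have s: "s \<in> {0<..<\<tau>}" by simp
    show "(\<Sum>k. f k s) = cdot (\<gamma> s *s b) (\<Sum>k. freq k *\<^sub>R heat ?A ((freq k)\<^sup>2) (\<tau> - s) (c k))"
      unfolding f_def cdot_scaleR_right[symmetric]
      by (rule bounded_linear.suminf[OF bounded_linear_cdot_right summable_norm_cancel[OF sm[OF s]], symmetric])
  qed
  finally show ?thesis by (simp add: set_integral_restrict_space)
qed

text \<open>Coefficients in the normalisation of \<open>hm_coeff\<close>, that is, tested against
  the unnormalised sines; a boundary value at 0 then enters the mode equation with the factor
  \<open>freq k\<close> alone.\<close>

definition state :: "(nat \<Rightarrow> complex^'n) \<Rightarrow> real \<Rightarrow> nat \<Rightarrow> complex^'n" where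
  "state y0 t k = heat A ((freq k)\<^sup>2) t (y0 k) + forced k t"

lemma state_bound:
  obtains K where "K \<ge> 0"
    "\<And>y0 t k. t \<in> {0..T} \<Longrightarrow> norm (state y0 t k) \<le> K * (norm (y0 k) + 1 / freq k)"
proof -
  obtain K1 where K1: "K1 \<ge> 0" "\<And>k t. t \<in> {0..T} \<Longrightarrow> norm (response k t) \<le> K1 / (freq k)\<^sup>2"
    using response_bound[of T] by blast
  obtain G where G: "\<And>s. s \<in> {0..T} \<Longrightarrow> norm (\<gamma> s *s b) \<le> G"
    using compact_imp_bounded[OF compact_continuous_image[OF continuous_on_smult[OF \<gamma>_continuous] compact_Icc]]
    unfolding bounded_iff by blast
  define K where "K = exp (mnorm A * T) + (\<bar>G\<bar> + K1 / (freq 0)\<^sup>2)"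
  have K0: "K \<ge> 0" using K1 by (simp add: K_def)
  have "norm (state y0 t k) \<le> K * (norm (y0 k) + 1 / freq k)" if t: "t \<in> {0..T}" for y0 t k
  proof -
    note f = freq_pos[of k]
    have "norm (heat A ((freq k)\<^sup>2) t (y0 k)) \<le> exp (mnorm A * T) * norm (y0 k)"
      by (rule heat_bounded) (use t in auto)
    also have "\<dots> \<le> K * norm (y0 k)" by (rule mult_right_mono) (use K1 in \<open>auto simp: K_def\<close>)
    finally have 1: "norm (heat A ((freq k)\<^sup>2) t (y0 k)) \<le> K * norm (y0 k)" .
    have "K1 / (freq k)\<^sup>2 \<le> K1 / (freq 0)\<^sup>2"
      using K1(1) freq_ge[of k] freq_pos[of 0] f by (intro divide_left_mono power_mono mult_pos_pos) auto
    then have "norm (\<gamma> t *s b + response k t) \<le> \<bar>G\<bar> + K1 / (freq 0)\<^sup>2"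
      using norm_triangle_ineq[of "\<gamma> t *s b" "response k t"] G[OF t] K1(2)[OF t, of k] by linarith
    also have "\<dots> \<le> K" by (simp add: K_def)
    finally have "norm (forced k t) \<le> K * (1 / freq k)"
      unfolding forced_def using f by (simp add: divide_right_mono)
    with 1 show ?thesis
      unfolding state_def distrib_left using norm_triangle_ineq[of "heat A ((freq k)\<^sup>2) t (y0 k)" "forced k t"] by linarith
  qed
  with K0 show ?thesis by (rule that)
qed

lemma hm_majorant:
  assumes "hm_seq y0"
  shows "summable (\<lambda>k. ((norm (y0 k) + 1 / freq k) / freq k)\<^sup>2)"
proof (rule summable_comparison_test'[where N = 0])
  show "summable (\<lambda>k. 2 * (norm (y0 k) / freq k)\<^sup>2 + 2 * (1 / freq k ^ 4))"
    by (intro summable_add summable_mult assms[unfolded hm_seq_def] summable_inverse_freq) simp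
  show "norm (((norm (y0 k) + 1 / freq k) / freq k)\<^sup>2) \<le> 2 * (norm (y0 k) / freq k)\<^sup>2 + 2 * (1 / freq k ^ 4)" for k
  proof -
    have "2 * (1 / freq k ^ 4) = 2 * (norm ((1 / freq k) / freq k))\<^sup>2"
      by (simp add: power_divide power_mult_distrib flip: power_mult)
    then show ?thesis
      using norm_add_sq_le[of "norm (y0 k) / freq k" "(1 / freq k) / freq k"] freq_pos[of k]
      by (simp add: add_divide_distrib)
  qed
qed

lemma hm_seq_state:
  assumes "hm_seq y0" "t \<ge> 0"
  shows "hm_seq (state y0 t)"
proof -
  obtain K where K: "K \<ge> 0" "\<And>y0 s k. s \<in> {0..t} \<Longrightarrow> norm (state y0 s k) \<le> K * (norm (y0 k) + 1 / freq k)"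
    using state_bound[of t] by blast
  show ?thesis
    unfolding hm_seq_def
  proof (rule summable_comparison_test'[OF summable_mult[OF hm_majorant[OF assms(1)], of "K\<^sup>2"], where N = 0])
    fix k :: nat
    have "(norm (state y0 t k) / freq k)\<^sup>2 \<le> (K * (norm (y0 k) + 1 / freq k) / freq k)\<^sup>2"
      using K(2)[of t y0 k] assms(2) freq_pos[of k] by (intro power_mono divide_right_mono) auto
    then show "norm ((norm (state y0 t k) / freq k)\<^sup>2) \<le> K\<^sup>2 * ((norm (y0 k) + 1 / freq k) / freq k)\<^sup>2"
      by (simp add: power_mult_distrib power_divide)
  qed
qed

lemma state_continuous: "continuous_on {0..T} (\<lambda>t. state y0 t k)"
  unfolding state_def forced_def
  by (intro continuous_on_add heat_continuous continuous_on_scaleR continuous_on_const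
      continuous_on_smult \<gamma>_continuous response_continuous)

text \<open>On [0, T] the weighted squared distance of the coefficients is a series of continuous
  functions of time with a summable majorant independent of time. It is therefore continuous,
  vanishes at s = t, and dominates the squared H^-1 distance.\<close>

lemma state_tendsto:
  assumes y0: "hm_seq y0" and t: "t \<in> {0..T}"
  shows "((\<lambda>s. Hm1_norm L (\<lambda>\<zeta>. hm_functional (state y0 s) \<zeta> - hm_functional (state y0 t) \<zeta>)) \<longlongrightarrow> 0) (at t within {0..T})"
proof -
  obtain K where K: "K \<ge> 0" "\<And>y0 s k. s \<in> {0..T} \<Longrightarrow> norm (state y0 s k) \<le> K * (norm (y0 k) + 1 / freq k)"
    using state_bound[of T] by blast
  let ?d = "\<lambda>s k. (norm (state y0 s k - state y0 t k) / freq k)\<^sup>2"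
  have st: "hm_seq (state y0 s)" if "s \<in> {0..T}" for s using hm_seq_state[OF y0] that by simp
  have "uniform_limit {0..T} (\<lambda>n s. \<Sum>k<n. ?d s k) (\<lambda>s. \<Sum>k. ?d s k) sequentially"
  proof (rule Weierstrass_m_test)
    show "summable (\<lambda>k. (2 * K)\<^sup>2 * ((norm (y0 k) + 1 / freq k) / freq k)\<^sup>2)"
      by (rule summable_mult[OF hm_majorant[OF y0]])
    show "norm (?d s k) \<le> (2 * K)\<^sup>2 * ((norm (y0 k) + 1 / freq k) / freq k)\<^sup>2" if "s \<in> {0..T}" for k s
    proof -
      have "norm (state y0 s k - state y0 t k) \<le> 2 * K * (norm (y0 k) + 1 / freq k)"
        using norm_triangle_ineq4[of "state y0 s k" "state y0 t k"] K(2)[OF that, of y0 k] K(2)[OF t, of y0 k] by linarith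
      then have "?d s k \<le> (2 * K * (norm (y0 k) + 1 / freq k) / freq k)\<^sup>2"
        using freq_pos[of k] by (intro power_mono divide_right_mono) auto
      also have "\<dots> = (2 * K)\<^sup>2 * ((norm (y0 k) + 1 / freq k) / freq k)\<^sup>2"
        by (simp only: power_mult_distrib[symmetric] times_divide_eq_right)
      finally show ?thesis by simp
    qed
  qed
  then have "continuous_on {0..T} (\<lambda>s. \<Sum>k. ?d s k)"
  proof (rule uniform_limit_theorem[rotated])
    show "\<forall>\<^sub>F n in sequentially. continuous_on {0..T} (\<lambda>s. \<Sum>k<n. ?d s k)"
      using freq_pos by (intro always_eventually allI continuous_on_sum continuous_on_power continuous_on_divide
          continuous_on_norm continuous_on_diff state_continuous continuous_on_const) (auto simp: less_le)
  qed simp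
  then have "((\<lambda>s. \<Sum>k. ?d s k) \<longlongrightarrow> (\<Sum>k. ?d t k)) (at t within {0..T})"
    using t unfolding continuous_on_def by blast
  then have "((\<lambda>s. sqrt (2 / L * (\<Sum>k. ?d s k))) \<longlongrightarrow> sqrt (2 / L * (\<Sum>k. ?d t k))) (at t within {0..T})"
    by (intro tendsto_intros)
  then have lim: "((\<lambda>s. sqrt (2 / L * (\<Sum>k. ?d s k))) \<longlongrightarrow> 0) (at t within {0..T})" by simp
  have bd: "norm (Hm1_norm L (\<lambda>\<zeta>. hm_functional (state y0 s) \<zeta> - hm_functional (state y0 t) \<zeta>)) \<le> sqrt (2 / L * (\<Sum>k. ?d s k))"
    if s: "s \<in> {0..T}" for s
  proof -
    let ?F = "\<lambda>\<zeta>. hm_functional (state y0 s) \<zeta> - hm_functional (state y0 t) \<zeta>"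
    have "?F u = hm_functional (\<lambda>k. state y0 s k - state y0 t k) u" if u: "u \<in> H10 L" for u
      using sums_unique2[OF sums_diff[OF hm_functional_sums[OF st[OF s] u] hm_functional_sums[OF st[OF t] u]]
          hm_functional_sums[OF hm_seq_diff[OF st[OF s] st[OF t]] u, unfolded cdot_diff_left]] .
    then have "Hm1_norm L ?F \<le> sqrt (2 / L * (\<Sum>k. ?d s k))"
      by (rule Hm1_norm_eq_le[OF hm_seq_diff[OF st[OF s] st[OF t]]])
    moreover have "0 \<le> Hm1_norm L ?F"
      by (intro Hm1_norm_nonneg Hm1_diff hm_functional_Hm1 st s t)
    ultimately show ?thesis by simp
  qed
  show ?thesis
    by (rule Lim_null_comparison[OF _ lim]) (use bd in \<open>auto simp: eventually_at_filter\<close>)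
qed

text \<open>Mode by mode, the adjoint propagator carries the contribution of \<open>y0\<close> to
  \<open>y0 (z 0)\<close>, which cancels. What is left is \<open>forced_pairing\<close>, whose inner
  series is the normal derivative of \<open>z\<close> up to sign.\<close>

theorem state_duality:
  fixes y0 :: "'n functional"
  assumes y0: "y0 \<in> Hm1 L" and \<tau>: "\<tau> \<ge> 0" and \<zeta>: "\<zeta> \<in> H10 L" and z: "adjoint_solution L A \<tau> \<zeta> z"
  shows "hm_functional (state (hm_coeff y0) \<tau>) \<zeta> - y0 (z 0) =
    - (LINT t:{0<..<\<tau>}|lborel. cdot (\<gamma> t *s b) (normal_deriv L (z t) 0))"
proof -
  let ?A = "conj_transpose A"
  let ?c = "sine_coeff \<zeta>"
  have zH: "\<And>t. t \<in> {0..\<tau>} \<Longrightarrow> z t \<in> H10 L" using z unfolding adjoint_solution_def by blast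
  note zc = adjoint_solution_coeff[OF z]
  note c = sums_summable[OF H10_parseval[OF \<zeta>]]
  have "(\<lambda>k. cdot (hm_coeff y0 k) (heat ?A ((freq k)\<^sup>2) \<tau> (?c k))) sums y0 (z 0)"
    using Hm1_expansion[OF y0 zH[of 0]] \<tau> by (simp add: zc)
  then have s1: "(\<lambda>k. cdot (heat A ((freq k)\<^sup>2) \<tau> (hm_coeff y0 k)) (?c k)) sums y0 (z 0)"
    by (simp add: cdot_heat_adjoint)
  have s3: "(\<lambda>k. cdot (state (hm_coeff y0) \<tau> k) (?c k)) sums hm_functional (state (hm_coeff y0) \<tau>) \<zeta>"
    by (rule hm_functional_sums[OF hm_seq_state[OF hm_seq_coeff[OF y0] \<tau>] \<zeta>])
  have s2: "(\<lambda>k. cdot (forced k \<tau>) (?c k)) sums (hm_functional (state (hm_coeff y0) \<tau>) \<zeta> - y0 (z 0))"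
    using sums_diff[OF s3 s1] by (simp add: state_def cdot_add_left)
  show ?thesis
  \<comment> \<open>For \<tau> = 0 the integral is empty, and \<open>forced_pairing\<close> asks for
    positive time.\<close>
  proof (cases "\<tau> = 0")
    case True
    have "forced k 0 = 0" for k
      using cdot_forced[of 0 k "forced k 0"] by (simp add: cdot_self)
    then show ?thesis using sums_unique2[OF s2 sums_zero[THEN sums_cong[THEN iffD1, rotated]]] True
      by (simp add: set_lebesgue_integral_def)
  next
    case False
    then have \<tau>': "\<tau> > 0" using \<tau> by simp
    obtain C where C: "\<And>k. norm (?c k) \<le> C * freq k" using H10_coeff_freq_bound[OF c] by blast
    have nd: "normal_deriv L (z t) 0 = - (\<Sum>k. freq k *\<^sub>R heat ?A ((freq k)\<^sup>2) (\<tau> - t) (?c k))" if t: "t \<in> {0<..<\<tau>}" for t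
    proof -
      have t': "t \<in> {0..\<tau>}" using t by simp
      have "summable (\<lambda>k. (freq k)\<^sup>2 * norm (sine_coeff (z t) k))"
        unfolding zc[OF t'] by (rule heat_summable[OF C]) (use t in simp)
      then show ?thesis using normal_deriv_zero(2)[OF zH[OF t']] by (simp add: zc[OF t'])
    qed
    have "(LINT t:{0<..<\<tau>}|lborel. cdot (\<gamma> t *s b) (normal_deriv L (z t) 0)) =
       - (LINT t:{0<..<\<tau>}|lborel. cdot (\<gamma> t *s b) (\<Sum>k. freq k *\<^sub>R heat ?A ((freq k)\<^sup>2) (\<tau> - t) (?c k)))"
      unfolding set_lebesgue_integral_def
      by (subst Bochner_Integration.integral_minus[symmetric], rule Bochner_Integration.integral_cong)
        (auto simp: indicator_def nd cdot_diff_right[of _ 0, simplified])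
    then show ?thesis using sums_unique2[OF s2 forced_pairing[OF c \<tau>']] by simp
  qed
qed

end

section \<open>Square integrability of the controlled state\<close>

context interval begin

section \<open>Absolutely convergent sine series\<close>

definition sine_series :: "(nat \<Rightarrow> 'a::euclidean_space) \<Rightarrow> real \<Rightarrow> 'a" where
  "sine_series a x = (\<Sum>k. sin (freq k * x) *\<^sub>R a k)"

lemma sine_term_le: "norm (sin (freq k * x) *\<^sub>R a) \<le> norm a"
  using mult_right_mono[OF abs_sin_le_one norm_ge_zero, of "freq k * x" a] by simp

lemma sine_series_uniform:
  assumes "summable (\<lambda>k. norm (a k))"
  shows "uniform_limit S (\<lambda>n x. \<Sum>k<n. sin (freq k * x) *\<^sub>R a k) (sine_series a) sequentially"
  unfolding sine_series_def[abs_def] by (rule Weierstrass_m_test[OF sine_term_le assms])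

lemma sine_series_continuous:
  assumes "summable (\<lambda>k. norm (a k))"
  shows "continuous_on S (sine_series a)"
  by (rule uniform_limit_theorem[OF _ sine_series_uniform[OF assms]])
    (intro always_eventually allI continuous_intros, simp)

lemma sine_series_pairing:
  fixes a :: "nat \<Rightarrow> complex^'n"
  assumes a: "summable (\<lambda>k. norm (a k))" and w: "continuous_on {0..L} w"
  shows "(\<lambda>k. (L / 2) *\<^sub>R cdot (a k) (sine_coeff w k)) sums (\<integral>x. cdot (sine_series a x) (w x) \<partial>N)"
proof -
  define f where "f k x = cdot (sin (freq k * x) *\<^sub>R a k) (w x)" for k x
  have fc: "continuous_on {0..L} (f k)" for k
    unfolding f_def by (intro continuous_on_cdot w continuous_intros)
  obtain W where W: "\<And>x. x \<in> {0..L} \<Longrightarrow> norm (w x) \<le> W"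
    using compact_imp_bounded[OF compact_continuous_image[OF w compact_Icc]]
    unfolding bounded_iff by blast
  have bd: "norm (f k x) \<le> norm (a k) * W" if "x \<in> {0..L}" for k x
    unfolding f_def
    by (rule order_trans[OF norm_cdot_le mult_mono[OF sine_term_le W[OF that]]]) auto
  have sm: "summable (\<lambda>k. norm (a k) * W)" by (rule summable_mult2[OF a])
  have "(\<lambda>k. integral\<^sup>L N (f k)) sums (\<integral>x. (\<Sum>k. f k x) \<partial>N)"
  proof (rule sums_integral)
    show "integrable N (f k)" for k by (rule continuous_integrable(1)[OF fc])
    show "AE x in N. summable (\<lambda>k. norm (f k x))"
    proof (rule AE_I2)
      fix x assume "x \<in> space N"
      then have "x \<in> {0..L}" by simp
      then show "summable (\<lambda>k. norm (f k x))"
        by (intro summable_comparison_test'[OF sm, where N = 0]) (unfold real_norm_def abs_norm_cancel, rule bd)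
    qed
    show "summable (\<lambda>k. \<integral>x. norm (f k x) \<partial>N)"
    proof (rule summable_comparison_test'[OF summable_mult2[OF sm, of L], where N = 0])
      fix k :: nat
      have "(\<integral>x. norm (f k x) \<partial>N) \<le> (\<integral>x. norm (a k) * W \<partial>N)"
        by (rule integral_mono)
          (auto intro!: continuous_integrable continuous_on_norm fc continuous_on_const bd)
      also have "\<dots> = norm (a k) * W * L" using measure_N by (simp del: space_N)
      finally show "norm (\<integral>x. norm (f k x) \<partial>N) \<le> norm (a k) * W * L" by simp
    qed
  qed
  also have "(\<lambda>k. integral\<^sup>L N (f k)) = (\<lambda>k. (L / 2) *\<^sub>R cdot (a k) (sine_coeff w k))"
  proof
    fix k
    have i: "integrable N (\<lambda>x. sin (freq k * x) *\<^sub>R w x)"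
      by (intro continuous_integrable continuous_on_scaleR w continuous_intros)
    have "integral\<^sup>L N (f k) = (\<integral>x. cdot (a k) (sin (freq k * x) *\<^sub>R w x) \<partial>N)"
      by (simp add: f_def[abs_def] cdot_scaleR_left cdot_scaleR_right)
    also have "\<dots> = cdot (a k) (\<integral>x. sin (freq k * x) *\<^sub>R w x \<partial>N)"
      by (rule integral_bounded_linear[OF bounded_linear_cdot_right i])
    also have "(\<integral>x. sin (freq k * x) *\<^sub>R w x \<partial>N) = (L / 2) *\<^sub>R sine_coeff w k"
      using L_pos by (simp add: sine_coeff_def)
    finally show "integral\<^sup>L N (f k) = (L / 2) *\<^sub>R cdot (a k) (sine_coeff w k)"
      by (simp add: cdot_scaleR_right)
  qed
  also have "(\<integral>x. (\<Sum>k. f k x) \<partial>N) = (\<integral>x. cdot (sine_series a x) (w x) \<partial>N)"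
  proof -
    have "summable (\<lambda>k. sin (freq k * x) *\<^sub>R a k)" for x
      by (rule summable_norm_cancel[OF summable_comparison_test'[OF a, where N = 0]])
        (unfold real_norm_def abs_norm_cancel, rule sine_term_le)
    then have "(\<Sum>k. f k x) = cdot (sine_series a x) (w x)" for x
      unfolding f_def sine_series_def by (rule bounded_linear.suminf[OF bounded_linear_cdot_left, symmetric])
    then show ?thesis by simp
  qed
  finally show ?thesis .
qed

lemma sine_series_coeff:
  fixes a :: "nat \<Rightarrow> complex^'n"
  assumes a: "summable (\<lambda>k. norm (a k))"
  shows "sine_coeff (sine_series a) k = a k"
proof -
  note c = sine_series_continuous[OF a]
  have "cdot (sine_coeff (sine_series a) k) v = cdot (a k) v" for v
  proof -
    have i: "integrable N (\<lambda>x. sin (freq k * x) *\<^sub>R sine_series a x)"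
      by (intro continuous_integrable continuous_on_scaleR c continuous_intros)
    have "(\<lambda>l. (L / 2) *\<^sub>R cdot (a l) (sine_coeff (mode k v) l)) sums (\<integral>x. cdot (sine_series a x) (mode k v x) \<partial>N)"
      by (rule sine_series_pairing[OF a H10_continuous[OF mode_H10]])
    moreover have "(\<lambda>l. (L / 2) *\<^sub>R cdot (a l) (sine_coeff (mode k v) l)) sums (\<Sum>l\<in>{k}. (L / 2) *\<^sub>R cdot (a l) (sine_coeff (mode k v) l))"
      by (rule sums_finite) (simp_all add: sine_coeff_mode)
    ultimately have "(\<integral>x. cdot (sine_series a x) (mode k v x) \<partial>N) = (L / 2) *\<^sub>R cdot (a k) v"
      using sums_unique2 by (fastforce simp: sine_coeff_mode)
    moreover have "(\<integral>x. cdot (sine_series a x) (mode k v x) \<partial>N) = (\<integral>x. cdot (sin (freq k * x) *\<^sub>R sine_series a x) v \<partial>N)"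
      by (rule Bochner_Integration.integral_cong) (auto simp: mode_def cdot_scaleR_left cdot_scaleR_right)
    moreover have "\<dots> = cdot (\<integral>x. sin (freq k * x) *\<^sub>R sine_series a x \<partial>N) v"
      by (rule integral_bounded_linear[OF bounded_linear_cdot_left i])
    ultimately have X: "cdot (\<integral>x. sin (freq k * x) *\<^sub>R sine_series a x \<partial>N) v = (L / 2) *\<^sub>R cdot (a k) v"
      by (simp only:)
    show ?thesis using L_pos by (simp add: sine_coeff_def cdot_scaleR_left X)
  qed
  then have "cdot (sine_coeff (sine_series a) k - a k) v = 0" for v by (simp add: cdot_diff_left)
  from this[of "sine_coeff (sine_series a) k - a k"] show ?thesis unfolding cdot_self by simp
qed

text \<open>The series is paired with itself. Absolute summability of the coefficients need not put
  the sum in H^1_0, so \<open>H10_parseval\<close> does not apply here.\<close>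

lemma sine_series_norm:
  fixes a :: "nat \<Rightarrow> complex^'n"
  assumes a: "summable (\<lambda>k. norm (a k))"
  shows "(\<lambda>k. (L / 2) * (norm (a k))\<^sup>2) sums (\<integral>x. (norm (sine_series a x))\<^sup>2 \<partial>N)"
proof -
  have "(\<lambda>k. (L / 2) *\<^sub>R cdot (a k) (a k)) sums (\<integral>x. cdot (sine_series a x) (sine_series a x) \<partial>N)"
    using sine_series_pairing[OF a sine_series_continuous[OF a]] by (simp add: sine_series_coeff[OF a])
  then have "(\<lambda>k. Re ((L / 2) *\<^sub>R cdot (a k) (a k))) sums Re (\<integral>x. cdot (sine_series a x) (sine_series a x) \<partial>N)"
    by (rule bounded_linear.sums[OF bounded_linear_Re])
  moreover have "(\<integral>x. cdot (sine_series a x) (sine_series a x) \<partial>N) = complex_of_real (\<integral>x. (norm (sine_series a x))\<^sup>2 \<partial>N)"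
    unfolding cdot_self by (rule integral_complex_of_real)
  ultimately show ?thesis by (simp add: cdot_self flip: of_real_power)
qed

text \<open>The affine function with value w at 0 and 0 at L lifts the boundary value. Its
  coefficients match the trace part of \<open>forced\<close>, up to the factor 2 / L between the two
  normalisations.\<close>

lemma sine_coeff_lift:
  fixes w :: "complex^'n"
  shows "sine_coeff (\<lambda>x. (1 - x / L) *\<^sub>R w) k = (2 / (L * freq k)) *\<^sub>R w"
proof -
  note f = freq_pos[of k]
  have "(\<integral>x. sin (freq k * x) * (1 - x / L) \<partial>N) =
     (- (1 - L / L) * cos (freq k * L) / freq k - sin (freq k * L) / ((freq k)\<^sup>2 * L)) -
     (- (1 - 0 / L) * cos (freq k * 0) / freq k - sin (freq k * 0) / ((freq k)\<^sup>2 * L))"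
  proof (rule integral_derivative)
    show "((\<lambda>x. - (1 - x / L) * cos (freq k * x) / freq k - sin (freq k * x) / ((freq k)\<^sup>2 * L))
        has_vector_derivative sin (freq k * x) * (1 - x / L)) (at x)" for x
      unfolding has_real_derivative_iff_has_vector_derivative[symmetric]
      using f L_pos by (auto intro!: derivative_eq_intros simp: field_simps power2_eq_square)
    show "continuous_on {0..L} (\<lambda>x. sin (freq k * x) * (1 - x / L))"
      using L_pos by (intro continuous_intros) auto
  qed
  then have *: "(\<integral>x. sin (freq k * x) * (1 - x / L) \<partial>N) = 1 / freq k" using L_pos by simp
  have "(\<integral>x. sin (freq k * x) *\<^sub>R (1 - x / L) *\<^sub>R w \<partial>N) = (\<integral>x. sin (freq k * x) * (1 - x / L) \<partial>N) *\<^sub>R w"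
    unfolding scaleR_scaleR
    by (intro integral_scaleR_left continuous_integrable continuous_intros) (use L_pos in auto)
  then show ?thesis by (simp add: sine_coeff_def *)
qed

text \<open>The coefficients of the lift decay only like 1 / freq, those of \<zeta> are absolutely
  summable. The expansion is therefore made on the side of \<zeta> and the identity
  conjugated.\<close>

lemma lift_pairing:
  fixes w :: "complex^'n"
  assumes \<zeta>: "\<zeta> \<in> H10 L"
  shows "(\<lambda>k. cdot ((1 / freq k) *\<^sub>R w) (sine_coeff \<zeta> k)) sums (\<integral>x. cdot ((1 - x / L) *\<^sub>R w) (\<zeta> x) \<partial>N)"
proof -
  have a: "summable (\<lambda>k. norm (sine_coeff \<zeta> k))"
    by (rule H10_coeff_summable[OF sums_summable[OF H10_parseval[OF \<zeta>]]])
  have wc: "continuous_on {0..L} (\<lambda>x. (1 - x / L) *\<^sub>R w)"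
    using L_pos by (intro continuous_intros) auto
  have "(\<lambda>k. cnj ((L / 2) *\<^sub>R cdot (sine_coeff \<zeta> k) (sine_coeff (\<lambda>x. (1 - x / L) *\<^sub>R w) k))) sums
      cnj (\<integral>x. cdot (sine_series (sine_coeff \<zeta>) x) ((1 - x / L) *\<^sub>R w) \<partial>N)"
    by (rule bounded_linear.sums[OF bounded_linear_cnj sine_series_pairing[OF a wc]])
  moreover have "cnj ((L / 2) *\<^sub>R cdot (sine_coeff \<zeta> k) (sine_coeff (\<lambda>x. (1 - x / L) *\<^sub>R w) k)) =
      cdot ((1 / freq k) *\<^sub>R w) (sine_coeff \<zeta> k)" for k
    using L_pos freq_pos[of k]
    by (simp add: sine_coeff_lift cdot_scaleR_right cdot_scaleR_left cdot_commute[of w "sine_coeff \<zeta> k"] del: complex_cnj_cnj)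
  moreover have "cnj (\<integral>x. cdot (sine_series (sine_coeff \<zeta>) x) ((1 - x / L) *\<^sub>R w) \<partial>N) =
      (\<integral>x. cdot ((1 - x / L) *\<^sub>R w) (\<zeta> x) \<partial>N)"
  proof -
    have "cnj (\<integral>x. cdot (sine_series (sine_coeff \<zeta>) x) ((1 - x / L) *\<^sub>R w) \<partial>N) =
      (\<integral>x. cnj (cdot (sine_series (sine_coeff \<zeta>) x) ((1 - x / L) *\<^sub>R w)) \<partial>N)"
      by (rule Bochner_Integration.integral_cnj[symmetric])
    also have "\<dots> = (\<integral>x. cdot ((1 - x / L) *\<^sub>R w) (\<zeta> x) \<partial>N)"
    proof (rule Bochner_Integration.integral_cong[OF refl])
      fix x assume "x \<in> space N"
      then have "sine_series (sine_coeff \<zeta>) x = \<zeta> x"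
        unfolding sine_series_def by (intro sums_unique[symmetric] H10_expansion[OF \<zeta>]) simp
      then show "cnj (cdot (sine_series (sine_coeff \<zeta>) x) ((1 - x / L) *\<^sub>R w)) = cdot ((1 - x / L) *\<^sub>R w) (\<zeta> x)"
        by (simp add: cdot_commute[of "(1 - x / L) *\<^sub>R w" "\<zeta> x"])
    qed
    finally show ?thesis .
  qed
  ultimately show ?thesis by simp
qed

end

context boundary_control begin

text \<open>The trace of the solution at \<open>0\<close> is \<open>\<gamma> t *s b\<close>. Subtracting the affine extension of this
  boundary value leaves Fourier coefficients that are absolutely summable for \<open>t > 0\<close>.\<close>

definition lifted :: "(nat \<Rightarrow> complex^'n) \<Rightarrow> real \<Rightarrow> nat \<Rightarrow> complex^'n" where
  "lifted y0 t k = heat A ((freq k)\<^sup>2) t (y0 k) + (1 / freq k) *\<^sub>R response k t"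

lemma state_lifted: "state y0 t k = (1 / freq k) *\<^sub>R (\<gamma> t *s b) + lifted y0 t k"
  by (simp add: state_def forced_def lifted_def scaleR_add_right)

text \<open>Initial data in H^-1 become summable through positive time: the propagator then decays
  faster than any power of freq, and the response contributes freq^-3.\<close>

lemma lifted_summable:
  assumes "hm_seq y0" "t > 0"
  shows "summable (\<lambda>k. norm (lifted y0 t k))"
proof -
  obtain C where C: "\<And>k. norm (y0 k) \<le> C * freq k" using hm_seq_freq_bound[OF assms(1)] by blast
  obtain K where K: "K \<ge> 0" "\<And>k s. s \<in> {0..t} \<Longrightarrow> norm (response k s) \<le> K / (freq k)\<^sup>2"
    using response_bound[of t] by blast
  have 1: "summable (\<lambda>k. (1 / (freq 0)\<^sup>2) * ((freq k)\<^sup>2 * norm (heat A ((freq k)\<^sup>2) t (y0 k))))"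
    by (rule summable_mult[OF heat_summable[OF C assms(2)]])
  have 2: "summable (\<lambda>k. K * (1 / freq k ^ 3))" by (intro summable_mult summable_inverse_freq) simp
  show ?thesis
  proof (rule summable_comparison_test'[OF summable_add[OF 1 2], where N = 0])
    fix k :: nat
    note f = freq_pos[of k]
    have "(freq 0)\<^sup>2 \<le> (freq k)\<^sup>2" using freq_ge[of k] freq_pos[of 0] by (intro power_mono) auto
    then have "(freq 0)\<^sup>2 * norm (heat A ((freq k)\<^sup>2) t (y0 k)) \<le> (freq k)\<^sup>2 * norm (heat A ((freq k)\<^sup>2) t (y0 k))"
      by (rule mult_right_mono) simp
    then have a: "norm (heat A ((freq k)\<^sup>2) t (y0 k)) \<le> (1 / (freq 0)\<^sup>2) * ((freq k)\<^sup>2 * norm (heat A ((freq k)\<^sup>2) t (y0 k)))"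
      using freq_pos[of 0] by (simp add: field_simps)
    have "norm ((1 / freq k) *\<^sub>R response k t) = (1 / freq k) * norm (response k t)" using f by simp
    also have "\<dots> \<le> (1 / freq k) * (K / (freq k)\<^sup>2)"
      by (rule mult_left_mono[OF K(2)]) (use assms(2) f in auto)
    also have "\<dots> = K * (1 / freq k ^ 3)" by (simp add: power2_eq_square power3_eq_cube)
    finally show "norm (norm (lifted y0 t k)) \<le> (1 / (freq 0)\<^sup>2) * ((freq k)\<^sup>2 * norm (heat A ((freq k)\<^sup>2) t (y0 k))) + K * (1 / freq k ^ 3)"
      using a norm_triangle_ineq[of "heat A ((freq k)\<^sup>2) t (y0 k)" "(1 / freq k) *\<^sub>R response k t"]
      unfolding lifted_def real_norm_def abs_norm_cancel by linarith
  qed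
qed

text \<open>The state as a function of (t, x). Dividing by the squared norm L / 2 of the sines turns
  tested coefficients into amplitudes, hence the factor 2 / L.\<close>

definition profile :: "(nat \<Rightarrow> complex^'n) \<Rightarrow> real \<times> real \<Rightarrow> complex^'n" where
  "profile y0 = (\<lambda>(t, x). (1 - x / L) *\<^sub>R (\<gamma> t *s b) + (2 / L) *\<^sub>R sine_series (lifted y0 t) x)"

lemma profile_slice:
  assumes y0: "hm_seq y0" and t: "t > 0"
  shows "continuous_on {0..L} (\<lambda>x. profile y0 (t, x))"
    "\<zeta> \<in> H10 L \<Longrightarrow> hm_functional (state y0 t) \<zeta> = (\<integral>x. cdot (profile y0 (t, x)) (\<zeta> x) \<partial>N)"
    "(\<integral>x. (norm (profile y0 (t, x)))\<^sup>2 \<partial>N) \<le>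
       2 * L * (norm (\<gamma> t *s b))\<^sup>2 + (4 / L) * (\<Sum>k. (norm (lifted y0 t k))\<^sup>2)"
    "summable (\<lambda>k. (norm (lifted y0 t k))\<^sup>2)"
proof -
  note a = lifted_summable[OF y0 t]
  have wc: "continuous_on {0..L} (\<lambda>x. (1 - x / L) *\<^sub>R (\<gamma> t *s b))"
    using L_pos by (intro continuous_intros) auto
  have sc: "continuous_on {0..L} (\<lambda>x. (2 / L) *\<^sub>R sine_series (lifted y0 t) x)"
    by (intro continuous_on_scaleR continuous_on_const sine_series_continuous a)
  show pc: "continuous_on {0..L} (\<lambda>x. profile y0 (t, x))"
    unfolding profile_def split_conv by (intro continuous_on_add wc sc)
  {
    assume \<zeta>: "\<zeta> \<in> H10 L"
    have "(\<lambda>k. (2 / L) *\<^sub>R (L / 2) *\<^sub>R cdot (lifted y0 t k) (sine_coeff \<zeta> k)) sums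
       ((2 / L) *\<^sub>R (\<integral>x. cdot (sine_series (lifted y0 t) x) (\<zeta> x) \<partial>N))"
      by (rule bounded_linear.sums[OF bounded_linear_scaleR_right sine_series_pairing[OF a H10_continuous[OF \<zeta>]]])
    then have "(\<lambda>k. cdot (lifted y0 t k) (sine_coeff \<zeta> k)) sums
       ((2 / L) *\<^sub>R (\<integral>x. cdot (sine_series (lifted y0 t) x) (\<zeta> x) \<partial>N))"
      using L_pos by simp
    from sums_add[OF lift_pairing[OF \<zeta>, of "\<gamma> t *s b"] this]
    have s: "(\<lambda>k. cdot (state y0 t k) (sine_coeff \<zeta> k)) sums
      ((\<integral>x. cdot ((1 - x / L) *\<^sub>R (\<gamma> t *s b)) (\<zeta> x) \<partial>N) + (2 / L) *\<^sub>R (\<integral>x. cdot (sine_series (lifted y0 t) x) (\<zeta> x) \<partial>N))"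
      by (simp add: state_lifted cdot_add_left)
    have "(\<integral>x. cdot (profile y0 (t, x)) (\<zeta> x) \<partial>N) =
      (\<integral>x. cdot ((1 - x / L) *\<^sub>R (\<gamma> t *s b)) (\<zeta> x) + (2 / L) *\<^sub>R cdot (sine_series (lifted y0 t) x) (\<zeta> x) \<partial>N)"
      by (simp add: profile_def cdot_add_left cdot_scaleR_left)
    also have "\<dots> = (\<integral>x. cdot ((1 - x / L) *\<^sub>R (\<gamma> t *s b)) (\<zeta> x) \<partial>N) + (\<integral>x. (2 / L) *\<^sub>R cdot (sine_series (lifted y0 t) x) (\<zeta> x) \<partial>N)"
      by (rule Bochner_Integration.integral_add)
       (intro continuous_integrable continuous_on_cdot wc H10_continuous[OF \<zeta>] continuous_on_scaleR continuous_on_const sine_series_continuous a)+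
    also have "\<dots> = (\<integral>x. cdot ((1 - x / L) *\<^sub>R (\<gamma> t *s b)) (\<zeta> x) \<partial>N) + (2 / L) *\<^sub>R (\<integral>x. cdot (sine_series (lifted y0 t) x) (\<zeta> x) \<partial>N)"
      by (subst integral_scaleR_right) simp
    finally show "hm_functional (state y0 t) \<zeta> = (\<integral>x. cdot (profile y0 (t, x)) (\<zeta> x) \<partial>N)"
      unfolding hm_functional_def using sums_unique[OF s] by simp
  }
  have sn: "(\<lambda>k. (L / 2) * (norm (lifted y0 t k))\<^sup>2) sums (\<integral>x. (norm (sine_series (lifted y0 t) x))\<^sup>2 \<partial>N)"
    by (rule sine_series_norm[OF a])
  show s2: "summable (\<lambda>k. (norm (lifted y0 t k))\<^sup>2)"
    using summable_mult[OF sums_summable[OF sn], of "2 / L"] L_pos by simp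
  have "(\<integral>x. (norm (profile y0 (t, x)))\<^sup>2 \<partial>N) \<le>
     (\<integral>x. 2 * (norm (\<gamma> t *s b))\<^sup>2 + 2 * (2 / L)\<^sup>2 * (norm (sine_series (lifted y0 t) x))\<^sup>2 \<partial>N)"
  proof (rule integral_mono)
    show "integrable N (\<lambda>x. (norm (profile y0 (t, x)))\<^sup>2)"
      by (intro continuous_integrable continuous_on_power continuous_on_norm pc)
    show "integrable N (\<lambda>x. 2 * (norm (\<gamma> t *s b))\<^sup>2 + 2 * (2 / L)\<^sup>2 * (norm (sine_series (lifted y0 t) x))\<^sup>2)"
      by (intro continuous_integrable continuous_on_add continuous_on_mult continuous_on_const continuous_on_power
          continuous_on_norm sine_series_continuous a)
    fix x assume "x \<in> space N"
    then have x: "0 < x" "x < L" by auto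
    have "\<bar>1 - x / L\<bar> \<le> 1" using x L_pos by (simp add: abs_le_iff field_simps)
    then have "\<bar>1 - x / L\<bar> * norm (\<gamma> t *s b) \<le> 1 * norm (\<gamma> t *s b)" by (rule mult_right_mono) simp
    then have "(norm ((1 - x / L) *\<^sub>R (\<gamma> t *s b)))\<^sup>2 \<le> (norm (\<gamma> t *s b))\<^sup>2" by (intro power_mono) auto
    moreover have "(norm ((2 / L) *\<^sub>R sine_series (lifted y0 t) x))\<^sup>2 = (2 / L)\<^sup>2 * (norm (sine_series (lifted y0 t) x))\<^sup>2"
      by (simp add: power_mult_distrib power_divide)
    ultimately show "(norm (profile y0 (t, x)))\<^sup>2 \<le> 2 * (norm (\<gamma> t *s b))\<^sup>2 + 2 * (2 / L)\<^sup>2 * (norm (sine_series (lifted y0 t) x))\<^sup>2"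
      using norm_add_sq_le[of "(1 - x / L) *\<^sub>R (\<gamma> t *s b)" "(2 / L) *\<^sub>R sine_series (lifted y0 t) x"]
      unfolding profile_def split_conv by linarith
  qed
  also have "\<dots> = 2 * (norm (\<gamma> t *s b))\<^sup>2 * L + 2 * (2 / L)\<^sup>2 * (\<integral>x. (norm (sine_series (lifted y0 t) x))\<^sup>2 \<partial>N)"
  proof -
    have "integrable N (\<lambda>x. (norm (sine_series (lifted y0 t) x))\<^sup>2)"
      by (intro continuous_integrable continuous_on_power continuous_on_norm sine_series_continuous a)
    moreover have "integrable N (\<lambda>x. 2 * (norm (\<gamma> t *s b))\<^sup>2)"
      by (intro continuous_integrable continuous_on_const)
    ultimately show ?thesis using measure_N by (simp del: space_N)
  qed
  also have "\<dots> = 2 * L * (norm (\<gamma> t *s b))\<^sup>2 + (4 / L) * (\<Sum>k. (norm (lifted y0 t k))\<^sup>2)"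
  proof -
    have "(\<integral>x. (norm (sine_series (lifted y0 t) x))\<^sup>2 \<partial>N) = (L / 2) * (\<Sum>k. (norm (lifted y0 t k))\<^sup>2)"
      using sums_unique2[OF sn sums_mult[OF summable_sums[OF s2]]] .
    then show ?thesis using L_pos by (simp only:) (simp add: power2_eq_square)
  qed
  finally show "(\<integral>x. (norm (profile y0 (t, x)))\<^sup>2 \<partial>N) \<le>
       2 * L * (norm (\<gamma> t *s b))\<^sup>2 + (4 / L) * (\<Sum>k. (norm (lifted y0 t k))\<^sup>2)" .
qed

lemma lifted_continuous: "continuous_on {0..T} (\<lambda>t. lifted y0 t k)"
  unfolding lifted_def
  by (intro continuous_on_add heat_continuous continuous_on_scaleR continuous_on_const response_continuous)

text \<open>A pointwise limit of functions continuous on the open rectangle, where t > 0 makes the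
  series converge.\<close>

lemma profile_measurable:
  assumes y0: "hm_seq y0"
  shows "profile y0 \<in> borel_measurable (restrict_space lborel ({0<..<T} \<times> {0<..<L}))"
proof -
  let ?S = "{0<..<T} \<times> {0<..<L}"
  define f where "f n p = (1 - snd p / L) *\<^sub>R (\<gamma> (fst p) *s b) +
     (2 / L) *\<^sub>R (\<Sum>k<n. sin (freq k * snd p) *\<^sub>R lifted y0 (fst p) k)" for n :: nat and p
  have "continuous_on ?S (\<lambda>p. lifted y0 (fst p) k)" for k
    by (rule continuous_on_compose2[OF lifted_continuous[of T]]) (auto intro!: continuous_on_fst continuous_on_id)
  moreover have "continuous_on ?S (\<lambda>p. \<gamma> (fst p) *s b)"
    by (rule continuous_on_compose2[OF continuous_on_smult[OF \<gamma>_continuous, of UNIV]]) (auto intro!: continuous_on_fst continuous_on_id)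
  ultimately have "continuous_on ?S (f n)" for n
    unfolding f_def using L_pos by (intro continuous_intros) auto
  then have fm: "f n \<in> borel_measurable (restrict_space borel ?S)" for n
    by (rule borel_measurable_continuous_on_restrict)
  have "profile y0 \<in> borel_measurable (restrict_space borel ?S)"
  proof (rule borel_measurable_LIMSEQ_metric[OF fm])
    fix p assume "p \<in> space (restrict_space borel ?S :: (real \<times> real) measure)"
    then have p: "fst p > 0" by (auto simp: space_restrict_space)
    have "(\<lambda>n. \<Sum>k<n. sin (freq k * snd p) *\<^sub>R lifted y0 (fst p) k) \<longlonglongrightarrow> sine_series (lifted y0 (fst p)) (snd p)"
      using sine_series_uniform[OF lifted_summable[OF y0 p], of UNIV] by (rule tendsto_uniform_limitI) simp
    then have "(\<lambda>n. f n p) \<longlonglongrightarrow> (1 - snd p / L) *\<^sub>R (\<gamma> (fst p) *s b) + (2 / L) *\<^sub>R sine_series (lifted y0 (fst p)) (snd p)"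
      unfolding f_def by (intro tendsto_intros)
    then show "(\<lambda>n. f n p) \<longlonglongrightarrow> profile y0 p" by (simp add: profile_def split_beta)
  qed
  then show ?thesis by (simp only: measurable_cong_sets[OF restrict_space_sets_cong[OF refl sets_lborel] refl])
qed

text \<open>Integrating exp(- 2 freq^2 t) over time gains freq^-2 and turns |y0|^2 into the summand
  of the squared H^-1 norm. This is how initial data in H^-1 give a state in L^2 of space and
  time.\<close>

lemma lifted_norm_sq_le:
  assumes "hm_seq y0"
  obtains q B where "\<And>k t. t \<in> {0<..<T} \<Longrightarrow> (norm (lifted y0 t k))\<^sup>2 \<le> q k t" "\<And>k t. 0 \<le> q k t"
    "\<And>k. continuous_on UNIV (q k)" "\<And>k. integral {0..T} (q k) \<le> B k" "summable B"
proof (cases "T > 0")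
  case True
  obtain K where K: "K \<ge> 0" "\<And>k s. s \<in> {0..T} \<Longrightarrow> norm (response k s) \<le> K / (freq k)\<^sup>2"
    using response_bound[of T] by blast
  define E where "E = exp (mnorm A * T)"
  define q where "q k t = 2 * E\<^sup>2 * (norm (y0 k))\<^sup>2 * exp (- (2 * (freq k)\<^sup>2) * t) + 2 * (K\<^sup>2 / freq k ^ 6)" for k t
  define B where "B k = E\<^sup>2 * (norm (y0 k) / freq k)\<^sup>2 + 2 * T * K\<^sup>2 * (1 / freq k ^ 6)" for k
  show ?thesis
  proof (rule that[of q B])
    show "0 \<le> q k t" for k t unfolding q_def by simp
    show "continuous_on UNIV (q k)" for k unfolding q_def by (intro continuous_intros)
    show "summable B" unfolding B_def
      by (intro summable_add summable_mult assms[unfolded hm_seq_def] summable_inverse_freq) simp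
    show "(norm (lifted y0 t k))\<^sup>2 \<le> q k t" if t: "t \<in> {0<..<T}" for k t
    proof -
      note f = freq_pos[of k]
      have "norm (heat A ((freq k)\<^sup>2) t (y0 k)) \<le> E * exp (- ((freq k)\<^sup>2 * t)) * norm (y0 k)"
        unfolding E_def by (rule heat_decay_le) (use t in auto)
      then have "(norm (heat A ((freq k)\<^sup>2) t (y0 k)))\<^sup>2 \<le> (E * exp (- ((freq k)\<^sup>2 * t)) * norm (y0 k))\<^sup>2"
        by (rule power_mono) simp
      also have "\<dots> = E\<^sup>2 * (norm (y0 k))\<^sup>2 * exp (- (2 * (freq k)\<^sup>2) * t)"
        by (simp add: power_mult_distrib mult_ac flip: exp_of_nat_mult)
      finally have 1: "(norm (heat A ((freq k)\<^sup>2) t (y0 k)))\<^sup>2 \<le> E\<^sup>2 * (norm (y0 k))\<^sup>2 * exp (- (2 * (freq k)\<^sup>2) * t)" .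
      have "norm ((1 / freq k) *\<^sub>R response k t) = (1 / freq k) * norm (response k t)" using f by simp
      also have "\<dots> \<le> (1 / freq k) * (K / (freq k)\<^sup>2)"
        by (rule mult_left_mono[OF K(2)]) (use t f in auto)
      finally have "(norm ((1 / freq k) *\<^sub>R response k t))\<^sup>2 \<le> ((1 / freq k) * (K / (freq k)\<^sup>2))\<^sup>2"
        by (rule power_mono) simp
      also have "\<dots> = K\<^sup>2 / freq k ^ 6" by (simp add: power_mult_distrib power_divide flip: power_mult power_add)
      finally show ?thesis
        using 1 norm_add_sq_le[of "heat A ((freq k)\<^sup>2) t (y0 k)" "(1 / freq k) *\<^sub>R response k t"]
        unfolding lifted_def q_def by linarith
    qed
    show "integral {0..T} (q k) \<le> B k" for k
    proof -
      note f = freq_pos[of k]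
      \<comment> \<open>The product d l is the amplitude 2 E^2 |y0 k|^2 of the exponential in q, so
        - d exp(- l t) is its primitive.\<close>
      define d where "d = E\<^sup>2 * (norm (y0 k))\<^sup>2 / (freq k)\<^sup>2"
      define l where "l = 2 * (freq k)\<^sup>2"
      define p where "p = 2 * (K\<^sup>2 / freq k ^ 6)"
      have q_eq: "q k t = d * l * exp (- l * t) + p" for t
        using f by (simp add: q_def d_def l_def p_def)
      let ?F = "\<lambda>t. - d * exp (- l * t) + p * t"
      have "(q k has_integral (?F T - ?F 0)) {0..T}"
      proof (rule fundamental_theorem_of_calculus)
        show "(?F has_vector_derivative q k t) (at t within {0..T})" for t
          unfolding has_real_derivative_iff_has_vector_derivative[symmetric] q_eq
          by (auto intro!: derivative_eq_intros)
      qed (use True in simp)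
      then have "integral {0..T} (q k) = ?F T - ?F 0" by (rule integral_unique)
      also have "\<dots> \<le> B k"
      proof -
        have "0 \<le> d * exp (- l * T)" by (simp add: d_def)
        moreover have "B k = d + p * T" using f by (simp add: B_def d_def p_def power_divide)
        ultimately show ?thesis by simp
      qed
      finally show ?thesis .
    qed
  qed
next
  case False
  show ?thesis
    by (rule that[of "\<lambda>_ _. 0" "\<lambda>_. 0"]) (use False in auto)
qed

text \<open>Tonelli with extended nonnegative integrals: each spatial slice is bounded through
  \<open>profile_slice\<close> by \<gamma> and the squared lifted coefficients, and the sum over
  modes is exchanged with the time integral.\<close>

theorem profile_square_integrable:
  assumes y0: "hm_seq y0" and T: "T > 0"
  shows "profile y0 \<in> L2_on ({0<..<T} \<times> {0<..<L})"
proof -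
  interpret T: interval T by (unfold_locales) (rule T)
  let ?S = "{0<..<T} \<times> {0<..<L}"
  let ?NT = "restrict_space lborel {0<..<T} :: real measure"
  have S: "?S \<in> sets (borel :: (real \<times> real) measure)" by (intro borel_open open_Times) auto
  note pm = profile_measurable[OF y0, of T]
  obtain q B where q: "\<And>k t. t \<in> {0<..<T} \<Longrightarrow> (norm (lifted y0 t k))\<^sup>2 \<le> q k t" "\<And>k t. 0 \<le> q k t"
    "\<And>k. continuous_on UNIV (q k)" "\<And>k. integral {0..T} (q k) \<le> B k" "summable B"
    using lifted_norm_sq_le[OF y0, of T] by blast
  obtain G where G: "\<And>s. s \<in> {0..T} \<Longrightarrow> norm (\<gamma> s *s b) \<le> G"
    using compact_imp_bounded[OF compact_continuous_image[OF continuous_on_smult[OF \<gamma>_continuous] compact_Icc]]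
    unfolding bounded_iff by blast
  have qc: "continuous_on {0..T} (q k)" for k using q(3) by (rule continuous_on_subset) simp
  have B0: "B k \<ge> 0" for k
    by (rule order_trans[OF Henstock_Kurzweil_Integration.integral_nonneg q(4)])
      (intro integrable_continuous_interval qc q(2))+
  define F where "F p = ennreal (indicat_real ?S p * (norm (profile y0 p))\<^sup>2)" for p
  have Fm: "F \<in> borel_measurable (lborel \<Otimes>\<^sub>M lborel)"
  proof -
    have "(\<lambda>p. indicat_real ?S p *\<^sub>R (norm (profile y0 p))\<^sup>2) \<in> borel_measurable lborel"
      using S measurable_compose[OF pm, of "\<lambda>v. (norm v)\<^sup>2" borel]
      by (subst borel_measurable_restrict_space_iff[symmetric]) (auto simp: o_def)
    then show ?thesis unfolding F_def lborel_prod by simp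
  qed
  define c where "c = 2 * L * G\<^sup>2"
  have c0: "c \<ge> 0" using L_pos by (simp add: c_def)
  have slice: "(\<integral>\<^sup>+ x. F (t, x) \<partial>lborel) \<le> indicator {0<..<T} t * (ennreal c + ennreal (4 / L) * (\<Sum>k. ennreal (q k t)))" for t
  proof (cases "t \<in> {0<..<T}")
    case True
    then have t: "t > 0" "t \<in> {0..T}" by auto
    note ps = profile_slice[OF y0 t(1)]
    have "(\<integral>\<^sup>+ x. F (t, x) \<partial>lborel) = (\<integral>\<^sup>+ x. ennreal ((norm (profile y0 (t, x)))\<^sup>2) * indicator {0<..<L} x \<partial>lborel)"
      by (rule nn_integral_cong) (use True in \<open>auto simp: F_def indicator_def\<close>)
    also have "\<dots> = (\<integral>\<^sup>+ x. ennreal ((norm (profile y0 (t, x)))\<^sup>2) \<partial>N)"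
      by (simp add: nn_integral_restrict_space)
    also have "\<dots> = ennreal (\<integral>x. (norm (profile y0 (t, x)))\<^sup>2 \<partial>N)"
      by (intro nn_integral_eq_integral continuous_integrable continuous_on_power continuous_on_norm ps(1)) simp
    also have "\<dots> \<le> ennreal (c + (4 / L) * (\<Sum>k. (norm (lifted y0 t k))\<^sup>2))"
    proof (rule ennreal_leI, rule order_trans[OF ps(3)])
      have "(norm (\<gamma> t *s b))\<^sup>2 \<le> G\<^sup>2" by (intro power_mono G t) simp
      then show "2 * L * (norm (\<gamma> t *s b))\<^sup>2 + (4 / L) * (\<Sum>k. (norm (lifted y0 t k))\<^sup>2) \<le> c + (4 / L) * (\<Sum>k. (norm (lifted y0 t k))\<^sup>2)"
        unfolding c_def using L_pos by simp
    qed
    also have "\<dots> = ennreal c + ennreal (4 / L) * ennreal (\<Sum>k. (norm (lifted y0 t k))\<^sup>2)"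
    proof -
      have s0: "0 \<le> (\<Sum>k. (norm (lifted y0 t k))\<^sup>2)" by (rule suminf_nonneg[OF ps(4)]) simp
      have "ennreal (c + (4 / L) * (\<Sum>k. (norm (lifted y0 t k))\<^sup>2)) = ennreal c + ennreal ((4 / L) * (\<Sum>k. (norm (lifted y0 t k))\<^sup>2))"
        by (rule ennreal_plus[OF c0 mult_nonneg_nonneg[OF _ s0]]) (use L_pos in simp)
      also have "ennreal ((4 / L) * (\<Sum>k. (norm (lifted y0 t k))\<^sup>2)) = ennreal (4 / L) * ennreal (\<Sum>k. (norm (lifted y0 t k))\<^sup>2)"
        by (rule ennreal_mult[OF _ s0]) (use L_pos in simp)
      finally show ?thesis .
    qed
    also have "ennreal (\<Sum>k. (norm (lifted y0 t k))\<^sup>2) = (\<Sum>k. ennreal ((norm (lifted y0 t k))\<^sup>2))"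
      by (rule suminf_ennreal2[OF _ ps(4), symmetric]) simp
    also have "\<dots> \<le> (\<Sum>k. ennreal (q k t))"
      by (intro suminf_le ennreal_leI q(1) True summableI)
    finally show ?thesis using True by (simp add: mult_left_mono add_left_mono)
  next
    case False
    then have "F (t, x) = 0" for x by (auto simp: F_def indicator_def)
    then show ?thesis by simp
  qed
  have qi: "(\<integral>\<^sup>+ t. ennreal (q k t) \<partial>?NT) \<le> ennreal (B k)" for k
  proof -
    have "(\<integral>\<^sup>+ t. ennreal (q k t) \<partial>?NT) = ennreal (\<integral>t. q k t \<partial>?NT)"
      by (intro nn_integral_eq_integral T.continuous_integrable qc) (simp add: q(2))
    also have "\<dots> \<le> ennreal (B k)" by (rule ennreal_leI) (simp add: T.continuous_integrable(2)[OF qc] q(4))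
    finally show ?thesis .
  qed
  have qm: "(\<lambda>t. ennreal (q k t)) \<in> borel_measurable ?NT" for k
    using T.continuous_measurable[OF qc[of k]] by measurable
  have "(\<integral>\<^sup>+ p. F p \<partial>(lborel \<Otimes>\<^sub>M lborel)) = (\<integral>\<^sup>+ t. \<integral>\<^sup>+ x. F (t, x) \<partial>lborel \<partial>lborel)"
    by (rule lborel.nn_integral_fst[OF Fm, symmetric])
  also have "\<dots> \<le> (\<integral>\<^sup>+ t. indicator {0<..<T} t * (ennreal c + ennreal (4 / L) * (\<Sum>k. ennreal (q k t))) \<partial>lborel)"
    by (rule nn_integral_mono) (rule slice)
  also have "\<dots> = (\<integral>\<^sup>+ t. ennreal c + ennreal (4 / L) * (\<Sum>k. ennreal (q k t)) \<partial>?NT)"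
    by (simp add: nn_integral_restrict_space mult.commute)
  also have "\<dots> = (\<integral>\<^sup>+ t. ennreal c \<partial>?NT) + ennreal (4 / L) * (\<Sum>k. \<integral>\<^sup>+ t. ennreal (q k t) \<partial>?NT)"
    using qm by (subst nn_integral_add, simp_all add: nn_integral_cmult nn_integral_suminf)
  also have "\<dots> \<le> ennreal c * emeasure ?NT (space ?NT) + ennreal (4 / L) * (\<Sum>k. ennreal (B k))"
    by (intro add_mono mult_left_mono suminf_le summableI qi) simp_all
  also have "\<dots> < \<infinity>"
  proof -
    have "emeasure ?NT (space ?NT) < \<infinity>"
      using finite_measure.emeasure_finite[OF T.finite_measure_N] by (simp add: top.not_eq_extremum)
    moreover have "(\<Sum>k. ennreal (B k)) = ennreal (\<Sum>k. B k)" by (rule suminf_ennreal2[OF B0 q(5)])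
    ultimately show ?thesis by (simp add: ennreal_mult_less_top)
  qed
  finally have fin: "(\<integral>\<^sup>+ p. F p \<partial>lborel) < \<infinity>" unfolding lborel_prod .
  have "integrable (restrict_space lborel ?S) (\<lambda>p. (norm (profile y0 p))\<^sup>2)"
  proof (rule integrableI_bounded)
    show "(\<lambda>p. (norm (profile y0 p))\<^sup>2) \<in> borel_measurable (restrict_space lborel ?S)"
      using pm by measurable
    have "(\<integral>\<^sup>+ p. ennreal (norm ((norm (profile y0 p))\<^sup>2)) \<partial>restrict_space lborel ?S) =
       (\<integral>\<^sup>+ p. ennreal ((norm (profile y0 p))\<^sup>2) * indicator ?S p \<partial>lborel)"
      using S by (simp add: nn_integral_restrict_space)
    also have "\<dots> = (\<integral>\<^sup>+ p. F p \<partial>lborel)"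
      by (rule nn_integral_cong) (auto simp: F_def indicator_def)
    finally show "(\<integral>\<^sup>+ p. ennreal (norm ((norm (profile y0 p))\<^sup>2)) \<partial>restrict_space lborel ?S) < \<infinity>"
      using fin by simp
  qed
  then show ?thesis using pm S by (simp add: L2_on_iff square_integrable_def)
qed

end

section \<open>Dense subspaces of sequences\<close>

definition l2_sq :: "(nat \<Rightarrow> 'a::real_inner) \<Rightarrow> real" where
  "l2_sq f = (\<Sum>k. (norm (f k))\<^sup>2)"

definition in_l2 :: "(nat \<Rightarrow> 'a::real_inner) \<Rightarrow> bool" where
  "in_l2 f \<longleftrightarrow> summable (\<lambda>k. (norm (f k))\<^sup>2)"

definition l2_inner :: "(nat \<Rightarrow> 'a::real_inner) \<Rightarrow> (nat \<Rightarrow> 'a) \<Rightarrow> real" where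
  "l2_inner f g = (\<Sum>k. f k \<bullet> g k)"

lemma l2_sq_nonneg: "in_l2 f \<Longrightarrow> l2_sq f \<ge> 0"
  unfolding l2_sq_def in_l2_def by (rule suminf_nonneg) auto

lemma l2_inner_summable:
  assumes "in_l2 f" "in_l2 g"
  shows "summable (\<lambda>k. f k \<bullet> g k)" "\<bar>l2_inner f g\<bar> \<le> sqrt (l2_sq f) * sqrt (l2_sq g)"
proof -
  note cs = Cauchy_Schwarz_series[OF assms[unfolded in_l2_def]]
  have le: "norm (f k \<bullet> g k) \<le> \<bar>norm (f k)\<bar> * \<bar>norm (g k)\<bar>" for k
    using Cauchy_Schwarz_ineq2[of "f k" "g k"] by simp
  then show s: "summable (\<lambda>k. f k \<bullet> g k)"
    by (intro summable_comparison_test'[OF cs(1), where N = 0])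
  have "\<bar>l2_inner f g\<bar> \<le> (\<Sum>k. \<bar>norm (f k)\<bar> * \<bar>norm (g k)\<bar>)"
    unfolding l2_inner_def real_norm_def[symmetric] by (rule norm_suminf_le[OF le[unfolded real_norm_def[symmetric]] cs(1)[unfolded real_norm_def[symmetric]]])
  then show "\<bar>l2_inner f g\<bar> \<le> sqrt (l2_sq f) * sqrt (l2_sq g)"
    using cs(2) unfolding l2_sq_def by linarith
qed

lemma l2_expand:
  assumes "in_l2 f" "in_l2 g"
  shows "in_l2 (\<lambda>k. f k + c *\<^sub>R g k)"
    "l2_sq (\<lambda>k. f k + c *\<^sub>R g k) = l2_sq f + 2 * c * l2_inner f g + c\<^sup>2 * l2_sq g"
proof -
  have "(norm (f k + c *\<^sub>R g k))\<^sup>2 = (norm (f k))\<^sup>2 + 2 * c * (f k \<bullet> g k) + c\<^sup>2 * (norm (g k))\<^sup>2" for k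
    unfolding power2_norm_eq_inner by (simp add: algebra_simps inner_commute power2_eq_square)
  moreover have "(\<lambda>k. (norm (f k))\<^sup>2 + 2 * c * (f k \<bullet> g k) + c\<^sup>2 * (norm (g k))\<^sup>2) sums
      (l2_sq f + 2 * c * l2_inner f g + c\<^sup>2 * l2_sq g)"
    unfolding l2_sq_def l2_inner_def
    by (intro sums_add sums_mult summable_sums assms[unfolded in_l2_def] l2_inner_summable(1)[OF assms])
  ultimately have "(\<lambda>k. (norm (f k + c *\<^sub>R g k))\<^sup>2) sums (l2_sq f + 2 * c * l2_inner f g + c\<^sup>2 * l2_sq g)"
    by simp
  then show "in_l2 (\<lambda>k. f k + c *\<^sub>R g k)"
    "l2_sq (\<lambda>k. f k + c *\<^sub>R g k) = l2_sq f + 2 * c * l2_inner f g + c\<^sup>2 * l2_sq g"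
    by (auto simp: in_l2_def l2_sq_def[of "\<lambda>k. f k + c *\<^sub>R g k"] sums_iff)
qed

lemma in_l2_diff: "in_l2 f \<Longrightarrow> in_l2 g \<Longrightarrow> in_l2 (\<lambda>k. f k - g k)"
  using l2_expand(1)[of f g "-1"] by simp

lemma l2_component_le: "in_l2 f \<Longrightarrow> (norm (f k))\<^sup>2 \<le> l2_sq f"
  unfolding in_l2_def l2_sq_def using sum_le_suminf[of "\<lambda>k. (norm (f k))\<^sup>2" "{k}"] by simp

lemma l2_sq_fatou:
  assumes lim: "\<And>k. (\<lambda>n. f n k) \<longlonglongrightarrow> g k" and f: "\<And>n. in_l2 (f n)"
    and bd: "\<And>n. l2_sq (f n) \<le> B n" and B: "B \<longlonglongrightarrow> b"
  shows "in_l2 g" "l2_sq g \<le> b"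
proof -
  have part: "(\<Sum>k<K. (norm (g k))\<^sup>2) \<le> b" for K
  proof (rule LIMSEQ_le)
    show "(\<lambda>n. \<Sum>k<K. (norm (f n k))\<^sup>2) \<longlonglongrightarrow> (\<Sum>k<K. (norm (g k))\<^sup>2)"
      by (intro tendsto_intros lim)
    show "B \<longlonglongrightarrow> b" by fact
    have "(\<Sum>k<K. (norm (f n k))\<^sup>2) \<le> B n" for n
      using sum_le_suminf[OF f[of n, unfolded in_l2_def], of "{..<K}"] bd[of n] unfolding l2_sq_def by simp
    then show "\<exists>N. \<forall>n\<ge>N. (\<Sum>k<K. (norm (f n k))\<^sup>2) \<le> B n" by blast
  qed
  then show "in_l2 g" unfolding in_l2_def by (intro summableI_nonneg_bounded[of _ b]) auto
  then show "l2_sq g \<le> b" unfolding in_l2_def l2_sq_def by (rule suminf_le_const[OF _ part])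
qed

text \<open>Projection argument on a subspace that need not be closed. Residuals of a minimising
  sequence are Cauchy by the parallelogram law; their limit is orthogonal to V by the first
  variation, hence zero by assumption, so the residuals become small. Scalars are real, matching
  real combinations of controls.\<close>

theorem l2_subspace_dense:
  fixes V :: "(nat \<Rightarrow> 'a::{real_inner,complete_space}) set"
  assumes V: "\<And>x. x \<in> V \<Longrightarrow> in_l2 x" and zero: "(\<lambda>k. 0) \<in> V"
    and lin: "\<And>x y c. x \<in> V \<Longrightarrow> y \<in> V \<Longrightarrow> (\<lambda>k. x k + c *\<^sub>R y k) \<in> V"
    and orth: "\<And>r k. in_l2 r \<Longrightarrow> (\<And>x. x \<in> V \<Longrightarrow> l2_inner r x = 0) \<Longrightarrow> r k = 0"
    and d: "in_l2 d" and e: "e > 0"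
  shows "\<exists>x\<in>V. l2_sq (\<lambda>k. d k - x k) \<le> e"
proof -
  let ?D = "\<lambda>x k. d k - x k"
  have Dl: "in_l2 (?D x)" if "x \<in> V" for x by (rule in_l2_diff[OF d V[OF that]])
  define \<delta> where "\<delta> = (INF x\<in>V. l2_sq (?D x))"
  have bdd: "bdd_below ((\<lambda>x. l2_sq (?D x)) ` V)"
    by (rule bdd_belowI2[of _ 0]) (rule l2_sq_nonneg[OF Dl])
  have \<delta>_le: "\<delta> \<le> l2_sq (?D x)" if "x \<in> V" for x
    unfolding \<delta>_def by (rule cINF_lower[OF bdd that])
  have "\<exists>x\<in>V. l2_sq (?D x) < \<delta> + 1 / real (Suc n)" for n
  proof (rule ccontr)
    assume "\<not> ?thesis"
    then have "\<delta> + 1 / real (Suc n) \<le> \<delta>"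
      unfolding \<delta>_def by (intro cINF_greatest) (use zero in \<open>auto simp: not_less \<delta>_def\<close>)
    then show False by simp
  qed
  then obtain x where x: "\<And>n. x n \<in> V" "\<And>n. l2_sq (?D (x n)) < \<delta> + 1 / real (Suc n)" by metis
  define r where "r n = ?D (x n)" for n
  have rl: "in_l2 (r n)" for n unfolding r_def by (rule Dl[OF x(1)])
  have rQ: "l2_sq (r n) \<le> \<delta> + 1 / real (Suc n)" for n using x(2)[of n] by (simp add: r_def)
  have close: "l2_sq (\<lambda>k. r n k - r m k) \<le> 2 / real (Suc n) + 2 / real (Suc m)" for n m
  proof -
    \<comment> \<open>The midpoint of \<open>x n\<close> and \<open>x m\<close> lies in V and its
      residual is the mean of the two residuals; its distance to d is at least \<delta>, which is
      the input of the parallelogram law.\<close>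
    have "(\<lambda>k. x n k + (1/2) *\<^sub>R (x m k + (-1) *\<^sub>R x n k)) \<in> V" by (intro lin x)
    from \<delta>_le[OF this]
    have "\<delta> \<le> l2_sq (?D (\<lambda>k. x n k + (1/2) *\<^sub>R (x m k + (-1) *\<^sub>R x n k)))" .
    also have "?D (\<lambda>k. x n k + (1/2) *\<^sub>R (x m k + (-1) *\<^sub>R x n k)) = (\<lambda>k. 0 + (1/2) *\<^sub>R (r n k + 1 *\<^sub>R r m k))"
    proof
      fix k
      have "2 *\<^sub>R (d k - (x n k + (1/2) *\<^sub>R (x m k + (-1) *\<^sub>R x n k))) = 2 *\<^sub>R (0 + (1/2) *\<^sub>R (r n k + 1 *\<^sub>R r m k))"
        unfolding r_def by (simp add: scaleR_add_right scaleR_diff_right scaleR_2)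
      from scaleR_left_imp_eq[OF _ this] show "d k - (x n k + (1/2) *\<^sub>R (x m k + (-1) *\<^sub>R x n k)) = 0 + (1/2) *\<^sub>R (r n k + 1 *\<^sub>R r m k)"
        by simp
    qed
    also have "l2_sq (\<lambda>k. 0 + (1/2) *\<^sub>R (r n k + 1 *\<^sub>R r m k)) = (1/4) * l2_sq (\<lambda>k. r n k + 1 *\<^sub>R r m k)"
      by (subst l2_expand(2)[OF _ l2_expand(1)[OF rl rl]])
        (simp_all add: in_l2_def l2_sq_def l2_inner_def power2_eq_square)
    also have "\<dots> = (1/4) * (l2_sq (r n) + 2 * l2_inner (r n) (r m) + l2_sq (r m))"
      by (subst l2_expand(2)[OF rl rl]) simp
    finally have "4 * \<delta> \<le> l2_sq (r n) + 2 * l2_inner (r n) (r m) + l2_sq (r m)" by simp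
    moreover have "l2_sq (\<lambda>k. r n k - r m k) = l2_sq (r n) - 2 * l2_inner (r n) (r m) + l2_sq (r m)"
      using l2_expand(2)[OF rl rl, of n "-1" m] by simp
    ultimately show ?thesis using rQ[of n] rQ[of m] by simp
  qed
  have rd: "in_l2 (\<lambda>k. r n k - r m k)" for n m by (rule in_l2_diff[OF rl rl])
  have lim0: "(\<lambda>n. 2 / real (Suc n)) \<longlonglongrightarrow> 0"
    using tendsto_mult_right_zero[OF LIMSEQ_inverse_real_of_nat, of 2] by (simp add: divide_inverse)
  have "Cauchy (\<lambda>n. r n k)" for k
  proof (rule metric_CauchyI)
    fix \<epsilon> :: real assume \<epsilon>: "\<epsilon> > 0"
    then have "\<forall>\<^sub>F n in sequentially. 2 / real (Suc n) < \<epsilon>\<^sup>2 / 2"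
      by (intro order_tendstoD(2)[OF lim0]) simp
    then obtain M where M: "\<And>n. n \<ge> M \<Longrightarrow> 2 / real (Suc n) < \<epsilon>\<^sup>2 / 2" by (auto simp: eventually_sequentially)
    have "dist (r n k) (r m k) < \<epsilon>" if "n \<ge> M" "m \<ge> M" for n m
    proof -
      have "(norm (r n k - r m k))\<^sup>2 \<le> 2 / real (Suc n) + 2 / real (Suc m)"
        using l2_component_le[OF rd, of n k m] close[of n m] by linarith
      then have "(norm (r n k - r m k))\<^sup>2 < \<epsilon>\<^sup>2" using M[OF that(1)] M[OF that(2)] by linarith
      then have "norm (r n k - r m k) < \<epsilon>" by (rule power2_less_imp_less) (use \<epsilon> in simp)
      then show ?thesis by (simp add: dist_norm)
    qed
    then show "\<exists>M. \<forall>m\<ge>M. \<forall>n\<ge>M. dist (r m k) (r n k) < \<epsilon>" by blast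
  qed
  then obtain r' where r': "\<And>k. (\<lambda>n. r n k) \<longlonglongrightarrow> r' k"
    unfolding Cauchy_convergent_iff convergent_def by metis
  have near: "in_l2 (\<lambda>k. r' k - r m k)" "l2_sq (\<lambda>k. r' k - r m k) \<le> 2 / real (Suc m)" for m
  proof -
    have "(\<lambda>n. 2 / real (Suc n) + 2 / real (Suc m)) \<longlonglongrightarrow> 0 + 2 / real (Suc m)"
      by (intro tendsto_add lim0 tendsto_const)
    note F = l2_sq_fatou[OF tendsto_diff[OF r' tendsto_const] rd close this]
    show "in_l2 (\<lambda>k. r' k - r m k)" by (rule F(1))
    show "l2_sq (\<lambda>k. r' k - r m k) \<le> 2 / real (Suc m)" using F(2) by simp
  qed
  have r'l: "in_l2 r'" using l2_expand(1)[OF near(1) rl, of 0 1 0] by simp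
  have "l2_inner r' y = 0" if y: "y \<in> V" for y
  proof -
    note yl = V[OF y]
    have lim: "(\<lambda>m. l2_inner (r m) y) \<longlonglongrightarrow> l2_inner r' y"
    proof (rule LIM_zero_cancel, rule Lim_null_comparison)
      have "(\<lambda>m. sqrt (2 / real (Suc m)) * sqrt (l2_sq y)) \<longlonglongrightarrow> sqrt 0 * sqrt (l2_sq y)"
        by (intro tendsto_intros lim0)
      then show "(\<lambda>m. sqrt (2 / real (Suc m)) * sqrt (l2_sq y)) \<longlonglongrightarrow> 0" by simp
      have "norm (l2_inner (r m) y - l2_inner r' y) \<le> sqrt (2 / real (Suc m)) * sqrt (l2_sq y)" for m
      proof -
        have "(\<lambda>k. r' k \<bullet> y k - r m k \<bullet> y k) sums (l2_inner r' y - l2_inner (r m) y)"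
          unfolding l2_inner_def
          by (intro sums_diff summable_sums l2_inner_summable(1) r'l rl yl)
        then have "l2_inner (\<lambda>k. r' k - r m k) y = l2_inner r' y - l2_inner (r m) y"
          unfolding l2_inner_def[of "\<lambda>k. r' k - r m k"] inner_diff_left by (rule sums_unique[symmetric])
        then have "\<bar>l2_inner r' y - l2_inner (r m) y\<bar> \<le> sqrt (l2_sq (\<lambda>k. r' k - r m k)) * sqrt (l2_sq y)"
          using l2_inner_summable(2)[OF near(1)[of m] yl] by (simp only:)
        also have "\<dots> \<le> sqrt (2 / real (Suc m)) * sqrt (l2_sq y)"
          by (intro mult_right_mono real_sqrt_le_mono near(2)) (simp add: l2_sq_nonneg[OF yl])
        finally show ?thesis by simp
      qed
      then show "\<forall>\<^sub>F m in sequentially. norm (l2_inner (r m) y - l2_inner r' y) \<le> sqrt (2 / real (Suc m)) * sqrt (l2_sq y)"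
        by simp
    qed
    \<comment> \<open>First variation in the direction y, in the limit of large m: subtracting c y
      from d - x m with the opposite sign of c corresponds to another element of V, so the squared
      distance cannot drop below \<delta>.\<close>
    have ineq: "0 \<le> 2 * c * l2_inner r' y + c\<^sup>2 * l2_sq y" for c
    proof (rule LIMSEQ_le)
      show "(\<lambda>m. - (1/2) * (2 / real (Suc m))) \<longlonglongrightarrow> 0" by (rule tendsto_mult_right_zero[OF lim0])
      show "(\<lambda>m. 2 * c * l2_inner (r m) y + c\<^sup>2 * l2_sq y) \<longlonglongrightarrow> 2 * c * l2_inner r' y + c\<^sup>2 * l2_sq y"
        by (intro tendsto_intros lim)
      have "- (1/2) * (2 / real (Suc m)) \<le> 2 * c * l2_inner (r m) y + c\<^sup>2 * l2_sq y" for m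
      proof -
        have "\<delta> \<le> l2_sq (?D (\<lambda>k. x m k + (- c) *\<^sub>R y k))" by (rule \<delta>_le[OF lin[OF x(1) y]])
        also have "?D (\<lambda>k. x m k + (- c) *\<^sub>R y k) = (\<lambda>k. r m k + c *\<^sub>R y k)"
          by (auto simp: r_def algebra_simps)
        also have "l2_sq \<dots> = l2_sq (r m) + 2 * c * l2_inner (r m) y + c\<^sup>2 * l2_sq y"
          by (rule l2_expand(2)[OF rl yl])
        finally show ?thesis using rQ[of m] by simp
      qed
      then show "\<exists>M. \<forall>m\<ge>M. - (1/2) * (2 / real (Suc m)) \<le> 2 * c * l2_inner (r m) y + c\<^sup>2 * l2_sq y" by blast
    qed
    show ?thesis
    proof (rule ccontr)
      assume nz: "l2_inner r' y \<noteq> 0"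
      \<comment> \<open>The added 1 keeps q positive even for y = 0; the choice c = - (inner
        product) / q then makes the right-hand side of \<open>ineq\<close> negative.\<close>
      define q where "q = l2_sq y + 1"
      have q: "q > 0" "l2_sq y < q" using l2_sq_nonneg[OF yl] by (auto simp: q_def)
      have sqp: "(l2_inner r' y)\<^sup>2 > 0" using nz by simp
      have "0 \<le> 2 * (- l2_inner r' y / q) * l2_inner r' y + (- l2_inner r' y / q)\<^sup>2 * l2_sq y"
        by (rule ineq)
      also have "\<dots> \<le> 2 * (- l2_inner r' y / q) * l2_inner r' y + (- l2_inner r' y / q)\<^sup>2 * q"
        using q by (intro add_left_mono mult_left_mono) auto
      also have "\<dots> = - (l2_inner r' y)\<^sup>2 / q" using q by (simp add: field_simps power2_eq_square)
      also have "\<dots> < 0" using sqp q by simp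
      finally show False by simp
    qed
  qed
  then have "r' k = 0" for k by (intro orth[OF r'l])
  then have "l2_sq (r m) \<le> 2 / real (Suc m)" for m
    using near(2)[of m] by (simp add: l2_sq_def)
  moreover obtain m where "2 / real (Suc m) < e"
    using order_tendstoD(2)[OF lim0 e] by (auto simp: eventually_sequentially)
  ultimately have "l2_sq (?D (x m)) \<le> e" unfolding r_def by (meson less_imp_le order_trans)
  then show ?thesis using x(1) by blast
qed

section \<open>Unobservable directions\<close>

definition poly_apply :: "complex^'n^'n \<Rightarrow> complex poly \<Rightarrow> complex^'n \<Rightarrow> complex^'n" where
  "poly_apply M p v = fold_coeffs (\<lambda>a w. a *s v + M *v w) p 0"

lemma poly_apply_0 [simp]: "poly_apply M 0 v = 0"
  by (simp add: poly_apply_def)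

lemma poly_apply_pCons [simp]: "poly_apply M (pCons a p) v = a *s v + M *v poly_apply M p v"
  by (cases "p = 0 \<and> a = 0") (auto simp: poly_apply_def)

lemma poly_apply_add: "poly_apply M (p + q) v = poly_apply M p v + poly_apply M q v"
  by (induction p q rule: poly_induct2)
    (simp_all add: vector_sadd_rdistrib matrix_vector_right_distrib)

lemma poly_apply_smult: "poly_apply M (smult c p) v = c *s poly_apply M p v"
  by (induction p) (simp_all add: vector_add_ldistrib matrix_smult vector_smult_assoc)

lemma poly_apply_monom: "poly_apply M (monom c i) v = c *s ((*v) M ^^ i) v"
  by (induction i) (simp_all add: monom_0 monom_Suc matrix_smult)

text \<open>The linear factor is applied to the vector before \<open>q\<close>, so that a factored
  polynomial turns into a succession of shifts.\<close>

lemma poly_apply_shift: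
  "poly_apply M ([:- s, 1:] * q) v = poly_apply M q (M *v v - s *s v)"
proof (induction q)
  case (pCons a q)
  have "[:- s, 1:] * pCons a q = smult a [:- s, 1:] + pCons 0 ([:- s, 1:] * q)"
    by (simp add: algebra_simps)
  then have "poly_apply M ([:- s, 1:] * pCons a q) v =
      poly_apply M (smult a [:- s, 1:]) v + M *v poly_apply M q (M *v v - s *s v)"
    by (simp only: poly_apply_add poly_apply_pCons pCons.IH) simp
  also have "poly_apply M (smult a [:- s, 1:]) v = a *s (M *v v - s *s v)"
    unfolding poly_apply_smult by (simp add: vec_eq_iff algebra_simps)
  finally show ?case by simp
qed simp

text \<open>The fundamental theorem of algebra splits off one root at a time. A list of roots is
  kept in place of the polynomial because the same shifts will act on whole sequences, where each
  mode sees them translated.\<close>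

lemma poly_apply_zero_roots:
  "p \<noteq> 0 \<Longrightarrow> poly_apply M p v = 0 \<Longrightarrow> \<exists>ss. fold (\<lambda>s w. M *v w - s *s w) ss v = 0"
proof (induction "degree p" arbitrary: p v)
  case 0
  then obtain c where "p = [:c:]" using degree_eq_zeroE by metis
  then have "v = 0" using 0 by simp
  then show ?case by (intro exI[of _ "[]"]) simp
next
  case (Suc n)
  have "coeff p (degree p) \<noteq> 0" "degree p \<in> {1..degree p}" using Suc(2,3) by auto
  then have "coeff p 0 = 0 \<or> (\<exists>i\<in>{1..degree p}. coeff p i \<noteq> 0)" by blast
  then obtain s where "poly p s = 0"
    unfolding poly_altdef by (rule fundamental_theorem_of_algebra)
  then obtain q where q: "p = [:- s, 1:] * q" by (auto simp: poly_eq_0_iff_dvd elim: dvdE)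
  then have "q \<noteq> 0" using Suc(3) by auto
  moreover have "degree p = Suc (degree q)" unfolding q using \<open>q \<noteq> 0\<close> by (subst degree_mult_eq) auto
  moreover have "poly_apply M q (M *v v - s *s v) = 0" using Suc(4) unfolding q poly_apply_shift .
  ultimately obtain ss where "fold (\<lambda>s w. M *v w - s *s w) ss (M *v v - s *s v) = 0"
    using Suc(1)[of q] Suc(2) by auto
  then show ?case by (intro exI[of _ "s # ss"]) simp
qed

text \<open>The Krylov vectors v, M v, M^2 v, ... up to the real dimension of the space are linearly
  dependent, which gives a nonzero polynomial in M that annihilates v.\<close>

lemma annihilating_list:
  fixes M :: "complex^'n^'n"
  shows "\<exists>ss. fold (\<lambda>s w. M *v w - s *s w) ss v = 0"
proof -
  let ?f = "\<lambda>i. ((*v) M ^^ i) v"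
  let ?D = "DIM(complex^'n)"
  show ?thesis
  \<comment> \<open>Dependence is a property of sets, so a repetition among the Krylov vectors is
    treated apart; it is itself a polynomial relation.\<close>
  proof (cases "inj_on ?f {..?D}")
    case True
    let ?S = "?f ` {..?D}"
    have "card ?S = Suc ?D" by (subst card_image[OF True]) simp
    then have "dependent ?S" by (intro dependent_biggerset) (simp only: lessI)
    then obtain u where u: "\<exists>w\<in>?S. u w \<noteq> 0" "(\<Sum>w\<in>?S. u w *\<^sub>R w) = 0"
      by (subst (asm) dependent_finite) auto
    define p where "p = (\<Sum>i\<le>?D. monom (complex_of_real (u (?f i))) i)"
    have cp: "coeff p j = (if j \<le> ?D then complex_of_real (u (?f j)) else 0)" for j
      unfolding p_def by (simp add: coeff_sum)
    have "p \<noteq> 0"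
    proof
      assume "p = 0"
      then have "u (?f j) = 0" if "j \<le> ?D" for j using cp[of j] that by simp
      then show False using u(1) by auto
    qed
    moreover have "poly_apply M p v = 0"
    proof -
      have "poly_apply M (\<Sum>i\<in>I. monom (complex_of_real (u (?f i))) i) v = (\<Sum>i\<in>I. u (?f i) *\<^sub>R ?f i)" for I
        by (induction I rule: infinite_finite_induct) (simp_all add: poly_apply_add poly_apply_monom scaleR_smult)
      then have "poly_apply M p v = (\<Sum>i\<le>?D. u (?f i) *\<^sub>R ?f i)" by (simp add: p_def)
      also have "\<dots> = (\<Sum>w\<in>?S. u w *\<^sub>R w)" by (subst sum.reindex[OF True]) (simp add: comp_def)
      finally show ?thesis using u(2) by simp
    qed
    ultimately show ?thesis by (rule poly_apply_zero_roots)
  next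
    case False
    then obtain i j where ij: "i \<noteq> j" "?f i = ?f j" by (auto simp: inj_on_def)
    define p :: "complex poly" where "p = monom 1 i + monom (- 1) j"
    have "coeff p i = 1" using ij by (simp add: p_def)
    then have "p \<noteq> 0" by auto
    moreover have "poly_apply M p v = 0"
      using ij(2) by (simp add: p_def poly_apply_add poly_apply_monom vec_eq_iff)
    ultimately show ?thesis by (rule poly_apply_zero_roots)
  qed
qed

lemma eigenvalue_norm_le:
  assumes "M *v v = \<theta> *s v" "v \<noteq> 0"
  shows "cmod \<theta> \<le> mnorm M"
proof -
  have "cmod \<theta> * norm v \<le> mnorm M * norm v" using mnorm[of M v] by (simp add: assms(1) norm_smult)
  then show ?thesis by (rule mult_right_le_imp_le) (use assms(2) in simp)
qed

section \<open>Observation of admissible sequences on the right half-plane\<close>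

context interval begin

text \<open>The unobservable directions are sequences of Fourier coefficients; admissible growth is
  chosen so that the space is invariant under the generator \<open>gen M\<close>, which acts diagonally.\<close>

definition admissible :: "(nat \<Rightarrow> complex^'n) \<Rightarrow> bool" where
  "admissible \<eta> \<longleftrightarrow> (\<forall>\<delta>>0. summable (\<lambda>k. exp (- ((freq k)\<^sup>2 * \<delta>)) * norm (\<eta> k)))"

definition gen :: "complex^'n^'n \<Rightarrow> (nat \<Rightarrow> complex^'n) \<Rightarrow> nat \<Rightarrow> complex^'n" where
  "gen M \<eta> k = M *v \<eta> k - complex_of_real ((freq k)\<^sup>2) *s \<eta> k"

definition obs_term :: "complex^'n^'n \<Rightarrow> complex^'n \<Rightarrow> (nat \<Rightarrow> complex^'n) \<Rightarrow> complex \<Rightarrow> nat \<Rightarrow> complex" where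
  "obs_term M b \<eta> \<sigma> k = exp (- (complex_of_real ((freq k)\<^sup>2) * \<sigma>)) * cdot (mexp M \<sigma> (\<eta> k)) b"

text \<open>Half of the exponential decay pays for the factor freq^2 of the generator; this is why
  admissibility asks for summability at every rate \<delta>.\<close>

lemma admissible_gen:
  assumes "admissible \<eta>"
  shows "admissible (gen M \<eta>)"
  unfolding admissible_def
proof (intro allI impI)
  fix \<delta> :: real assume \<delta>: "\<delta> > 0"
  have 1: "summable (\<lambda>k. mnorm M * (exp (- ((freq k)\<^sup>2 * \<delta>)) * norm (\<eta> k)))"
    using assms \<delta> by (intro summable_mult) (simp add: admissible_def)
  have 2: "summable (\<lambda>k. (2 / \<delta>) * (exp (- ((freq k)\<^sup>2 * (\<delta> / 2))) * norm (\<eta> k)))"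
    using assms \<delta> unfolding admissible_def by (intro summable_mult) (metis half_gt_zero)
  show "summable (\<lambda>k. exp (- ((freq k)\<^sup>2 * \<delta>)) * norm (gen M \<eta> k))"
  proof (rule summable_comparison_test'[OF summable_add[OF 1 2], where N = 0])
    fix k :: nat
    let ?l = "(freq k)\<^sup>2"
    have "?l * (\<delta> / 2) \<le> exp (?l * (\<delta> / 2))" using exp_ge_add_one_self[of "?l * (\<delta> / 2)"] by linarith
    then have "?l \<le> (2 / \<delta>) * exp (?l * (\<delta> / 2))" using \<delta> by (simp add: field_simps)
    then have "exp (- (?l * \<delta>)) * ?l \<le> exp (- (?l * \<delta>)) * ((2 / \<delta>) * exp (?l * (\<delta> / 2)))"
      by (rule mult_left_mono) simp
    also have "\<dots> = (2 / \<delta>) * exp (- (?l * (\<delta> / 2)))"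
      by (simp add: field_simps flip: exp_add)
    finally have a: "exp (- (?l * \<delta>)) * ?l * norm (\<eta> k) \<le> (2 / \<delta>) * exp (- (?l * (\<delta> / 2))) * norm (\<eta> k)"
      by (rule mult_right_mono) simp
    have "norm (gen M \<eta> k) \<le> mnorm M * norm (\<eta> k) + ?l * norm (\<eta> k)"
      using norm_triangle_ineq4[of "M *v \<eta> k" "complex_of_real ?l *s \<eta> k"] mnorm[of M "\<eta> k"]
      unfolding gen_def norm_smult norm_of_real by simp
    then have "exp (- (?l * \<delta>)) * norm (gen M \<eta> k) \<le> exp (- (?l * \<delta>)) * (mnorm M * norm (\<eta> k) + ?l * norm (\<eta> k))"
      by (rule mult_left_mono) simp
    then show "norm (exp (- (?l * \<delta>)) * norm (gen M \<eta> k)) \<le>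
        mnorm M * (exp (- (?l * \<delta>)) * norm (\<eta> k)) + (2 / \<delta>) * (exp (- (?l * (\<delta> / 2))) * norm (\<eta> k))"
      using a by (simp add: algebra_simps)
  qed
qed

lemma admissible_diff_smult:
  assumes "admissible \<eta>" "admissible \<xi>"
  shows "admissible (\<lambda>k. \<xi> k - s *s \<eta> k)"
  unfolding admissible_def
proof (intro allI impI)
  fix \<delta> :: real assume \<delta>: "\<delta> > 0"
  have s: "summable (\<lambda>k. exp (- ((freq k)\<^sup>2 * \<delta>)) * norm (\<xi> k) + cmod s * (exp (- ((freq k)\<^sup>2 * \<delta>)) * norm (\<eta> k)))"
    using assms \<delta> by (intro summable_add summable_mult) (simp_all add: admissible_def)
  show "summable (\<lambda>k. exp (- ((freq k)\<^sup>2 * \<delta>)) * norm (\<xi> k - s *s \<eta> k))"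
  proof (rule summable_comparison_test'[OF s, where N = 0])
    fix k :: nat
    have "exp (- ((freq k)\<^sup>2 * \<delta>)) * norm (\<xi> k - s *s \<eta> k) \<le> exp (- ((freq k)\<^sup>2 * \<delta>)) * (norm (\<xi> k) + cmod s * norm (\<eta> k))"
      using norm_triangle_ineq4[of "\<xi> k" "s *s \<eta> k"] by (intro mult_left_mono) (auto simp: norm_smult)
    then show "norm (exp (- ((freq k)\<^sup>2 * \<delta>)) * norm (\<xi> k - s *s \<eta> k)) \<le>
      exp (- ((freq k)\<^sup>2 * \<delta>)) * norm (\<xi> k) + cmod s * (exp (- ((freq k)\<^sup>2 * \<delta>)) * norm (\<eta> k))"
      by (simp add: algebra_simps)
  qed
qed

lemma obs_term_bound:
  assumes "Re \<sigma> \<ge> \<delta>" "cmod \<sigma> \<le> r"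
  shows "cmod (obs_term M b \<eta> \<sigma> k) \<le> exp (- ((freq k)\<^sup>2 * \<delta>)) * norm (\<eta> k) * (exp (mnorm M * r) * norm b)"
proof -
  have "cmod (obs_term M b \<eta> \<sigma> k) = exp (- ((freq k)\<^sup>2 * Re \<sigma>)) * cmod (cdot (mexp M \<sigma> (\<eta> k)) b)"
    by (simp add: obs_term_def norm_mult flip: of_real_power)
  also have "\<dots> \<le> exp (- ((freq k)\<^sup>2 * \<delta>)) * (exp (mnorm M * r) * norm (\<eta> k) * norm b)"
  proof (rule mult_mono)
    show "exp (- ((freq k)\<^sup>2 * Re \<sigma>)) \<le> exp (- ((freq k)\<^sup>2 * \<delta>))"
      using assms(1) by (simp add: mult_left_mono)
    have "norm (mexp M \<sigma> (\<eta> k)) \<le> exp (mnorm M * r) * norm (\<eta> k)"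
      by (rule order_trans[OF mexp_norm_le]) (intro mult_right_mono; use assms(2) mnorm_nonneg[of M] in \<open>simp add: mult_left_mono\<close>)
    then show "cmod (cdot (mexp M \<sigma> (\<eta> k)) b) \<le> exp (mnorm M * r) * norm (\<eta> k) * norm b"
      by (intro order_trans[OF norm_cdot_le] mult_right_mono) auto
  qed auto
  finally show ?thesis by (simp add: mult_ac)
qed

text \<open>Differentiating in time is the same as applying the generator to the sequence.
  Invariance of the unobservable space rests on this identity.\<close>

lemma obs_term_derivative:
  "((\<lambda>\<sigma>. obs_term M b \<eta> \<sigma> k) has_field_derivative obs_term M b (gen M \<eta>) \<sigma> k) (at \<sigma>)"
proof -
  have "mexp M \<sigma> (gen M \<eta> k) = mexp M \<sigma> (M *v \<eta> k) + (- complex_of_real ((freq k)\<^sup>2)) *s mexp M \<sigma> (\<eta> k)"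
    unfolding gen_def mexp_smult[symmetric] mexp_add[symmetric] by (simp add: vec_eq_iff)
  then have X: "cdot (mexp M \<sigma> (gen M \<eta> k)) b =
      cdot (mexp M \<sigma> (M *v \<eta> k)) b + (- complex_of_real ((freq k)\<^sup>2)) * cdot (mexp M \<sigma> (\<eta> k)) b"
    by (simp only: cdot_add_left cdot_smult_left)
  have "obs_term M b (gen M \<eta>) \<sigma> k =
     exp (- (complex_of_real ((freq k)\<^sup>2) * \<sigma>)) * (- complex_of_real ((freq k)\<^sup>2)) * cdot (mexp M \<sigma> (\<eta> k)) b +
     cdot (mexp M \<sigma> (M *v \<eta> k)) b * exp (- (complex_of_real ((freq k)\<^sup>2) * \<sigma>))"
    unfolding obs_term_def X by (simp add: algebra_simps)
  moreover have "((\<lambda>\<sigma>. obs_term M b \<eta> \<sigma> k) has_field_derivative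
     exp (- (complex_of_real ((freq k)\<^sup>2) * \<sigma>)) * (- complex_of_real ((freq k)\<^sup>2)) * cdot (mexp M \<sigma> (\<eta> k)) b +
     cdot (mexp M \<sigma> (M *v \<eta> k)) b * exp (- (complex_of_real ((freq k)\<^sup>2) * \<sigma>))) (at \<sigma>)"
    unfolding obs_term_def
    by (intro DERIV_mult cdot_mexp_derivative) (auto intro!: derivative_eq_intros)
  ultimately show ?thesis by simp
qed

definition obs :: "complex^'n^'n \<Rightarrow> complex^'n \<Rightarrow> (nat \<Rightarrow> complex^'n) \<Rightarrow> complex \<Rightarrow> complex" where
  "obs M b \<eta> \<sigma> = (\<Sum>k. obs_term M b \<eta> \<sigma> k)"

text \<open>On the disc of radius Re \<sigma> / 2 around \<sigma> the terms have a common summable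
  majorant with decay rate Re \<sigma> / 2, so the series of holomorphic terms may be differentiated
  term by term.\<close>

lemma obs_series:
  assumes "admissible \<eta>" "Re \<sigma> > 0"
  shows "(\<lambda>k. obs_term M b \<eta> \<sigma> k) sums obs M b \<eta> \<sigma>"
    "(obs M b \<eta> has_field_derivative obs M b (gen M \<eta>) \<sigma>) (at \<sigma>)"
proof -
  have "\<exists>g g'. \<forall>\<sigma>\<in>{\<sigma>. Re \<sigma> > 0}. (\<lambda>k. obs_term M b \<eta> \<sigma> k) sums g \<sigma> \<and>
     (\<lambda>k. obs_term M b (gen M \<eta>) \<sigma> k) sums g' \<sigma> \<and> (g has_field_derivative g' \<sigma>) (at \<sigma>)"
  proof (rule series_and_derivative_comparison_complex)
    show "open {\<sigma>. Re \<sigma> > 0}" by (rule open_halfspace_Re_gt)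
    show "((\<lambda>\<sigma>. obs_term M b \<eta> \<sigma> k) has_field_derivative obs_term M b (gen M \<eta>) \<sigma> k) (at \<sigma>)" for k \<sigma>
      by (rule obs_term_derivative)
    fix \<sigma> assume "\<sigma> \<in> {\<sigma>. Re \<sigma> > 0}"
    then have \<sigma>: "Re \<sigma> > 0" by simp
    let ?d = "Re \<sigma> / 2" and ?r = "cmod \<sigma> + Re \<sigma> / 2"
    let ?h = "\<lambda>k. exp (- ((freq k)\<^sup>2 * ?d)) * norm (\<eta> k) * (exp (mnorm M * ?r) * norm b)"
    have hs: "summable ?h"
      using assms \<sigma> unfolding admissible_def by (intro summable_mult2) (metis half_gt_zero)
    show "\<exists>d h. 0 < d \<and> summable h \<and> range h \<subseteq> \<real>\<^sub>\<ge>\<^sub>0 \<and>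
       (\<forall>\<^sub>F n in sequentially. \<forall>y\<in>ball \<sigma> d \<inter> {\<sigma>. Re \<sigma> > 0}. cmod (obs_term M b \<eta> y n) \<le> cmod (h n))"
    proof (intro exI conjI)
      show "0 < ?d" using \<sigma> by simp
      show "summable (\<lambda>k. complex_of_real (?h k))" by (rule summable_of_real[OF hs])
      show "range (\<lambda>k. complex_of_real (?h k)) \<subseteq> \<real>\<^sub>\<ge>\<^sub>0"
        by (auto simp del: of_real_mult of_real_add)
      have "cmod (obs_term M b \<eta> y n) \<le> cmod (complex_of_real (?h n))" if "y \<in> ball \<sigma> ?d" for y n
      proof -
        have "cmod (\<sigma> - y) < ?d" using that by (simp add: dist_norm)
        then have "Re y \<ge> ?d" "cmod y \<le> ?r"
          using abs_Re_le_cmod[of "\<sigma> - y"] norm_triangle_ineq3[of \<sigma> y] by (auto simp: abs_le_iff)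
        then have "cmod (obs_term M b \<eta> y n) \<le> ?h n" by (rule obs_term_bound)
        then show ?thesis by (simp only: norm_of_real)
      qed
      then show "\<forall>\<^sub>F n in sequentially. \<forall>y\<in>ball \<sigma> ?d \<inter> {\<sigma>. Re \<sigma> > 0}. cmod (obs_term M b \<eta> y n) \<le> cmod (complex_of_real (?h n))"
        by (intro always_eventually) blast
    qed
  qed
  then obtain g g' where gg: "\<forall>\<sigma>\<in>{\<sigma>. Re \<sigma> > 0}. (\<lambda>k. obs_term M b \<eta> \<sigma> k) sums g \<sigma> \<and>
     (\<lambda>k. obs_term M b (gen M \<eta>) \<sigma> k) sums g' \<sigma> \<and> (g has_field_derivative g' \<sigma>) (at \<sigma>)"
    by (elim exE) rule
  have g_eq: "g \<sigma> = obs M b \<eta> \<sigma>" if "Re \<sigma> > 0" for \<sigma>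
    unfolding obs_def by (rule sums_unique) (use bspec[OF gg, of \<sigma>] that in simp)
  have g'_eq: "g' \<sigma> = obs M b (gen M \<eta>) \<sigma>"
    unfolding obs_def by (rule sums_unique) (use bspec[OF gg, of \<sigma>] assms(2) in simp)
  show "(\<lambda>k. obs_term M b \<eta> \<sigma> k) sums obs M b \<eta> \<sigma>"
    unfolding g_eq[OF assms(2), symmetric] using bspec[OF gg, of \<sigma>] assms(2) by simp
  have "(g has_field_derivative g' \<sigma>) (at \<sigma>)" using bspec[OF gg, of \<sigma>] assms(2) by simp
  then show "(obs M b \<eta> has_field_derivative obs M b (gen M \<eta>) \<sigma>) (at \<sigma>)"
    unfolding g'_eq
    by (rule has_field_derivative_transform_within_open[OF _ open_halfspace_Re_gt[of 0]])
      (use assms(2) g_eq in simp_all)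
qed

definition unobservable :: "complex^'n^'n \<Rightarrow> complex^'n \<Rightarrow> (nat \<Rightarrow> complex^'n) set" where
  "unobservable M b = {\<eta>. admissible \<eta> \<and> (\<forall>\<sigma>. Re \<sigma> > 0 \<longrightarrow> obs M b \<eta> \<sigma> = 0)}"

text \<open>Identity theorem on the connected right half-plane; the zeros accumulate at T / 2. A
  short observation interval thus carries the same information as all positive times, where t may
  tend to infinity.\<close>

lemma unobservable_continuation:
  assumes \<eta>: "admissible \<eta>" and T: "T > 0"
    and zero: "\<And>t. 0 < t \<Longrightarrow> t < T \<Longrightarrow> obs M b \<eta> (complex_of_real t) = 0"
  shows "\<eta> \<in> unobservable M b"
proof -
  let ?S = "{\<sigma>. Re \<sigma> > 0}"
  have "obs M b \<eta> \<sigma> = 0" if \<sigma>: "Re \<sigma> > 0" for \<sigma>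
  proof (rule analytic_continuation[of "obs M b \<eta>" ?S "complex_of_real ` {0<..<T}" "complex_of_real (T / 2)"])
    show op: "open ?S" by (rule open_halfspace_Re_gt)
    show "obs M b \<eta> holomorphic_on ?S"
      unfolding holomorphic_on_open[OF op] using obs_series(2)[OF \<eta>] by blast
    show "connected ?S" by (rule convex_connected[OF convex_halfspace_Re_gt])
    show "complex_of_real ` {0<..<T} \<subseteq> ?S" by auto
    show "complex_of_real (T / 2) \<in> ?S" using T by simp
    show "complex_of_real (T / 2) islimpt complex_of_real ` {0<..<T}"
      unfolding islimpt_approachable
    proof (intro allI impI)
      fix e :: real assume e: "e > 0"
      define h where "h = min (e / 2) (T / 4)"
      have h: "0 < h" "h < e" "h < T / 2" using e T by (auto simp: h_def min_def)
      have "dist (complex_of_real (T / 2 + h)) (complex_of_real (T / 2)) = h"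
        unfolding dist_of_real using h by (simp add: dist_real_def)
      then show "\<exists>x'\<in>complex_of_real ` {0<..<T}. x' \<noteq> complex_of_real (T / 2) \<and> dist x' (complex_of_real (T / 2)) < e"
        using h by (intro bexI[of _ "complex_of_real (T / 2 + h)"] conjI imageI) (simp_all del: of_real_add of_real_divide)
    qed
    show "obs M b \<eta> z = 0" if "z \<in> complex_of_real ` {0<..<T}" for z
      using that zero by auto
    show "\<sigma> \<in> ?S" using \<sigma> by simp
  qed
  then show ?thesis unfolding unobservable_def using \<eta> by blast
qed

text \<open>The derivative of the zero function vanishes, and by \<open>obs_series\<close> it is the
  observation of \<open>gen M \<eta>\<close>.\<close>

lemma unobservable_gen:
  assumes "\<eta> \<in> unobservable M b"
  shows "(\<lambda>k. gen M \<eta> k - s *s \<eta> k) \<in> unobservable M b"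
proof -
  have \<eta>: "admissible \<eta>" and z: "\<And>\<sigma>. Re \<sigma> > 0 \<Longrightarrow> obs M b \<eta> \<sigma> = 0"
    using assms by (auto simp: unobservable_def)
  have zg: "obs M b (gen M \<eta>) \<sigma> = 0" if \<sigma>: "Re \<sigma> > 0" for \<sigma>
  proof -
    have "((\<lambda>_. 0) has_field_derivative obs M b (gen M \<eta>) \<sigma>) (at \<sigma>)"
      by (rule has_field_derivative_transform_within_open[OF obs_series(2)[OF \<eta> \<sigma>] open_halfspace_Re_gt[of 0]])
        (use \<sigma> z in simp_all)
    then show ?thesis by (rule DERIV_unique[OF _ DERIV_const])
  qed
  have "obs M b (\<lambda>k. gen M \<eta> k - s *s \<eta> k) \<sigma> = 0" if \<sigma>: "Re \<sigma> > 0" for \<sigma>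
  proof -
    have X: "mexp M \<sigma> (u - s *s v) = mexp M \<sigma> u + (- s) *s mexp M \<sigma> v" for u v
      unfolding mexp_smult[symmetric] mexp_add[symmetric] by (simp add: vec_eq_iff)
    have "obs_term M b (\<lambda>k. gen M \<eta> k - s *s \<eta> k) \<sigma> k =
      obs_term M b (gen M \<eta>) \<sigma> k + (- s) * obs_term M b \<eta> \<sigma> k" for k
      unfolding obs_term_def X cdot_add_left cdot_smult_left by (simp add: algebra_simps)
    moreover have "(\<lambda>k. obs_term M b (gen M \<eta>) \<sigma> k + (- s) * obs_term M b \<eta> \<sigma> k) sums
        (obs M b (gen M \<eta>) \<sigma> + (- s) * obs M b \<eta> \<sigma>)"
      by (intro sums_add sums_mult obs_series(1) \<eta> admissible_gen \<sigma>)
    ultimately have "(\<lambda>k. obs_term M b (\<lambda>k. gen M \<eta> k - s *s \<eta> k) \<sigma> k) sums 0"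
      by (simp add: z[OF \<sigma>] zg[OF \<sigma>])
    then show ?thesis unfolding obs_def by (rule sums_unique[symmetric])
  qed
  then show ?thesis
    unfolding unobservable_def using admissible_diff_smult[OF \<eta> admissible_gen[OF \<eta>]] by blast
qed

text \<open>On mode k the generator is M - freq^2, so a root s for the generator acts there as the
  root s + freq^2 for M.\<close>

lemma gen_fold:
  "fold (\<lambda>s \<eta> k. gen M \<eta> k - s *s \<eta> k) ss \<eta> k =
    fold (\<lambda>s w. M *v w - s *s w) (map (\<lambda>s. s + complex_of_real ((freq k)\<^sup>2)) ss) (\<eta> k)"
proof (induction ss arbitrary: \<eta>)
  case (Cons s ss)
  have "gen M \<eta> k - s *s \<eta> k = M *v \<eta> k - (s + complex_of_real ((freq k)\<^sup>2)) *s \<eta> k"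
    by (simp add: gen_def vec_eq_iff algebra_simps)
  then show ?case by (simp only: fold.simps list.map comp_apply Cons.IH)
qed simp

lemma fold_matrix_zero: "fold (\<lambda>s w. M *v w - s *s w) ss 0 = (0 :: complex^'n)"
proof (induction ss)
  case (Cons s ss)
  have "M *v 0 - s *s 0 = (0 :: complex^'n)" by (simp add: matrix_vector_mult_def vec_eq_iff)
  then show ?case using Cons.IH by (simp only: fold.simps comp_apply)
qed simp

text \<open>Modes are killed one after another: the roots that annihilate the current entry under M
  are translated to roots for the generator on mode K, and appending them keeps the earlier zeros by
  linearity.\<close>

lemma truncation_annihilated:
  "\<exists>ss. \<forall>k<K. fold (\<lambda>s \<eta> k. gen M \<eta> k - s *s \<eta> k) ss \<eta> k = 0"
proof (induction K)
  case (Suc K)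
  then obtain ss where ss: "\<forall>k<K. fold (\<lambda>s \<eta> k. gen M \<eta> k - s *s \<eta> k) ss \<eta> k = 0" by blast
  let ?\<xi> = "fold (\<lambda>s \<eta> k. gen M \<eta> k - s *s \<eta> k) ss \<eta>"
  obtain ts where ts: "fold (\<lambda>s w. M *v w - s *s w) ts (?\<xi> K) = 0" using annihilating_list by blast
  let ?us = "map (\<lambda>t. t - complex_of_real ((freq K)\<^sup>2)) ts"
  have "fold (\<lambda>s \<eta> k. gen M \<eta> k - s *s \<eta> k) (ss @ ?us) \<eta> k = 0" if "k < Suc K" for k
  proof -
    have "fold (\<lambda>s \<eta> k. gen M \<eta> k - s *s \<eta> k) (ss @ ?us) \<eta> k =
       fold (\<lambda>s w. M *v w - s *s w) (map (\<lambda>s. s + complex_of_real ((freq k)\<^sup>2)) ?us) (?\<xi> k)"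
      by (simp only: fold_append comp_apply gen_fold)
    also have "\<dots> = 0"
    proof (cases "k = K")
      case True
      then have "map (\<lambda>s. s + complex_of_real ((freq k)\<^sup>2)) ?us = ts" by (simp add: comp_def)
      then show ?thesis using ts True by simp
    next
      case False
      then show ?thesis using ss that fold_matrix_zero by simp
    qed
    finally show ?thesis .
  qed
  then show ?case by blast
qed simp

text \<open>The annihilating shifts are applied one by one up to the last iterate whose truncation
  is nonzero. The next shift kills that truncation, which is the eigenvector equation on the modes
  below K; nothing is claimed about the tail.\<close>

lemma truncated_eigenvector:
  assumes "\<eta> \<in> unobservable M b" "\<exists>k<K. \<eta> k \<noteq> 0"
  obtains \<xi> s where "\<xi> \<in> unobservable M b" "\<exists>k<K. \<xi> k \<noteq> 0"
    "\<And>k. k < K \<Longrightarrow> M *v \<xi> k = (s + complex_of_real ((freq k)\<^sup>2)) *s \<xi> k"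
proof -
  have "\<exists>\<xi> s. \<xi> \<in> unobservable M b \<and> (\<exists>k<K. \<xi> k \<noteq> 0) \<and> (\<forall>k<K. gen M \<xi> k - s *s \<xi> k = 0)"
    if "\<forall>k<K. fold (\<lambda>s \<eta> k. gen M \<eta> k - s *s \<eta> k) ss \<eta> k = 0" "\<eta> \<in> unobservable M b" "\<exists>k<K. \<eta> k \<noteq> 0" for ss \<eta>
    using that
  proof (induction ss arbitrary: \<eta>)
    case (Cons s ss)
    show ?case
    proof (cases "\<forall>k<K. gen M \<eta> k - s *s \<eta> k = 0")
      case True
      then show ?thesis using Cons.prems by blast
    next
      case False
      show ?thesis
        by (rule Cons.IH[OF _ unobservable_gen[OF Cons.prems(2), of s]]) (use Cons.prems(1) False in auto)
    qed
  qed auto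
  moreover obtain ss where "\<forall>k<K. fold (\<lambda>s \<eta> k. gen M \<eta> k - s *s \<eta> k) ss \<eta> k = 0"
    using truncation_annihilated by blast
  ultimately obtain \<xi> s where \<xi>: "\<xi> \<in> unobservable M b" "\<exists>k<K. \<xi> k \<noteq> 0" "\<forall>k<K. gen M \<xi> k - s *s \<xi> k = 0"
    using assms by blast
  show ?thesis
  proof (rule that[OF \<xi>(1,2)])
    fix k assume "k < K"
    then have "gen M \<xi> k - s *s \<xi> k = 0" using \<xi>(3) by blast
    then show "M *v \<xi> k = (s + complex_of_real ((freq k)\<^sup>2)) *s \<xi> k"
      by (simp add: gen_def vec_eq_iff algebra_simps)
  qed
qed

lemma freq_mono: "j \<le> k \<Longrightarrow> freq j \<le> freq k"
  using L_pos by (simp add: freq_def divide_right_mono mult_right_mono)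

lemma freq_gap_large: "\<exists>J\<ge>J0. (freq (Suc J))\<^sup>2 - (freq J)\<^sup>2 > a"
proof -
  have c: "(pi / L)\<^sup>2 > 0" using L_pos by simp
  obtain n :: nat where n: "a < real n * (pi / L)\<^sup>2" using ex_less_of_nat_mult[OF c] by blast
  define J where "J = max n J0"
  \<comment> \<open>(J + 2)^2 - (J + 1)^2 = 2 J + 3, the index in \<open>freq\<close> being shifted
    by one.\<close>
  have "real n * (pi / L)\<^sup>2 \<le> real (2 * J + 3) * (pi / L)\<^sup>2"
    by (rule mult_right_mono) (auto simp: J_def)
  also have "\<dots> = (freq (Suc J))\<^sup>2 - (freq J)\<^sup>2"
    by (simp add: freq_def power_divide power_mult_distrib power2_eq_square algebra_simps flip: diff_divide_distrib add_divide_distrib)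
  finally show ?thesis using n by (intro exI[of _ J]) (simp add: J_def)
qed

text \<open>The gap between consecutive Dirichlet eigenvalues eventually exceeds the diameter of the
  spectrum of \<open>M\<close>. Hence in a truncation at such a gap every eigenvalue of the generator
  dominates the tail of the series as time tends to infinity.\<close>

theorem observability:
  fixes M :: "complex^'n^'n"
  assumes eig: "\<And>v \<theta>. M *v v = \<theta> *s v \<Longrightarrow> cdot v b = 0 \<Longrightarrow> v = 0"
    and simple: "\<And>j k \<theta> \<theta>'. \<theta> \<in> eigenvalues M \<Longrightarrow> \<theta>' \<in> eigenvalues M \<Longrightarrow>
      \<theta> - complex_of_real ((freq j)\<^sup>2) = \<theta>' - complex_of_real ((freq k)\<^sup>2) \<Longrightarrow> j = k"
    and \<eta>: "\<eta> \<in> unobservable M b"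
  shows "\<eta> k = 0"
proof (rule ccontr)
  assume nz: "\<eta> k \<noteq> 0"
  \<comment> \<open>One \<open>mnorm M\<close> bounds the growth of the tail, the other the distance
    of the eigenvalue s from a point - freq^2.\<close>
  obtain J where J: "J \<ge> k" "(freq (Suc J))\<^sup>2 - (freq J)\<^sup>2 > 2 * mnorm M"
    using freq_gap_large by blast
  let ?l = "\<lambda>k. (freq k)\<^sup>2"
  have "\<exists>k<Suc J. \<eta> k \<noteq> 0" using nz J(1) by (intro exI[of _ k]) simp
  then obtain \<xi> s where \<xi>: "\<xi> \<in> unobservable M b" and "\<exists>k<Suc J. \<xi> k \<noteq> 0"
    and ev: "\<And>k. k < Suc J \<Longrightarrow> M *v \<xi> k = (s + complex_of_real (?l k)) *s \<xi> k"
    using truncated_eigenvector[OF \<eta>] by blast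
  then obtain j where j: "j < Suc J" "\<xi> j \<noteq> 0" by blast
  have ev_in: "s + complex_of_real (?l i) \<in> eigenvalues M" if "i < Suc J" "\<xi> i \<noteq> 0" for i
    using ev[OF that(1)] that(2) by (auto simp: eigenvalues_def)
  \<comment> \<open>Two nonzero entries would write the same s as an eigenvalue of M minus a squared
    frequency in two ways; the hypothesis \<open>simple\<close> excludes this.\<close>
  have only: "\<xi> i = 0" if "i < Suc J" "i \<noteq> j" for i
    using simple[of "s + complex_of_real (?l i)" "s + complex_of_real (?l j)" i j] ev_in that j by auto
  have adm: "admissible \<xi>" and "\<And>\<sigma>. Re \<sigma> > 0 \<Longrightarrow> obs M b \<xi> \<sigma> = 0"
    using \<xi> by (auto simp: unobservable_def)
  then have z: "(\<lambda>k. obs_term M b \<xi> \<sigma> k) sums 0" if "Re \<sigma> > 0" for \<sigma>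
    using obs_series(1)[OF adm that, of M b] that by simp
  define D where "D = (\<Sum>k. exp (- (?l k * 1)) * norm (\<xi> k))"
  have Ds: "summable (\<lambda>k. exp (- (?l k * 1)) * norm (\<xi> k))" using adm unfolding admissible_def by (rule allE[where x = 1]) simp
  \<comment> \<open>Exponential rate of the tail relative to exp(s t): growth at most
    \<open>mnorm M\<close>, decay at least the square of \<open>freq (Suc J)\<close>.\<close>
  let ?a = "mnorm M - ?l (Suc J) - Re s"
  have Res: "- Re s \<le> mnorm M + ?l J"
  proof -
    have "cmod (s + complex_of_real (?l j)) \<le> mnorm M" by (rule eigenvalue_norm_le[OF ev[OF j(1)] j(2)])
    then have "- Re (s + complex_of_real (?l j)) \<le> mnorm M"
      using abs_Re_le_cmod[of "s + complex_of_real (?l j)"] by linarith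
    moreover have "?l j \<le> ?l J" using j(1) freq_mono[of j J] freq_pos[of j] by (intro power_mono) auto
    ultimately show ?thesis by simp
  qed
  then have neg: "?a < 0" using J(2) by linarith
  let ?c = "exp (?l (Suc J)) * D * norm b"
  have key: "cmod (cdot (\<xi> j) b) \<le> ?c * exp (?a * t)" if t: "t \<ge> 1" for t
  proof -
    let ?\<sigma> = "complex_of_real t"
    have main: "obs_term M b \<xi> ?\<sigma> j = exp (s * ?\<sigma>) * cdot (\<xi> j) b"
    proof -
      have "mexp M ?\<sigma> (\<xi> j) = exp ((s + complex_of_real (?l j)) * ?\<sigma>) *s \<xi> j"
        by (rule mexp_eigenvector[OF ev[OF j(1)]])
      then have "obs_term M b \<xi> ?\<sigma> j =
        exp (- (complex_of_real (?l j) * ?\<sigma>)) * exp ((s + complex_of_real (?l j)) * ?\<sigma>) * cdot (\<xi> j) b"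
        by (simp add: obs_term_def cdot_smult_left)
      also have "exp (- (complex_of_real (?l j) * ?\<sigma>)) * exp ((s + complex_of_real (?l j)) * ?\<sigma>) = exp (s * ?\<sigma>)"
        unfolding exp_add[symmetric] by (simp add: algebra_simps)
      finally show ?thesis .
    qed
    have "(\<lambda>k. obs_term M b \<xi> ?\<sigma> k - (if k = j then obs_term M b \<xi> ?\<sigma> k else 0)) sums (0 - obs_term M b \<xi> ?\<sigma> j)"
      using t by (intro sums_diff z sums_single) simp
    moreover have "(\<lambda>k. obs_term M b \<xi> ?\<sigma> k - (if k = j then obs_term M b \<xi> ?\<sigma> k else 0)) =
        (\<lambda>k. if k = j then 0 else obs_term M b \<xi> ?\<sigma> k)" by auto
    ultimately have sm: "(\<lambda>k. if k = j then 0 else obs_term M b \<xi> ?\<sigma> k) sums (- obs_term M b \<xi> ?\<sigma> j)"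
      by simp
    have bd: "norm (if k = j then 0 else obs_term M b \<xi> ?\<sigma> k) \<le>
        exp (- (?l k * 1)) * norm (\<xi> k) * (exp (?l (Suc J)) * norm b * exp ((mnorm M - ?l (Suc J)) * t))" for k
    proof (cases "k < Suc J")
      case True
      then have "(if k = j then 0 else obs_term M b \<xi> ?\<sigma> k) = 0"
        using only[of k] mexp_smult[of M ?\<sigma> 0 0] by (simp add: obs_term_def)
      then show ?thesis by simp
    next
      case False
      then have "?l (Suc J) \<le> ?l k" using freq_mono[of "Suc J" k] freq_pos[of "Suc J"] by (intro power_mono) auto
      \<comment> \<open>For t \<ge> 1 the decay exp(- freq^2 t) is split: the part at time 1 keeps
        the sum over k finite, and the remaining time t - 1 is charged at the rate of the first tail
        mode, uniformly in k.\<close>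
      then have "(?l k - ?l (Suc J)) * 1 \<le> (?l k - ?l (Suc J)) * t" using t by (intro mult_left_mono) auto
      then have e: "- (?l k * t) \<le> - (?l k * 1) + (?l (Suc J) - ?l (Suc J) * t)" by (simp add: algebra_simps)
      have "cmod (obs_term M b \<xi> ?\<sigma> k) \<le> exp (- (?l k * t)) * norm (\<xi> k) * (exp (mnorm M * t) * norm b)"
        by (rule obs_term_bound) (use t in auto)
      also have "\<dots> \<le> exp (- (?l k * 1) + (?l (Suc J) - ?l (Suc J) * t)) * norm (\<xi> k) * (exp (mnorm M * t) * norm b)"
        by (intro mult_right_mono) (use e in auto)
      also have "\<dots> = exp (- (?l k * 1)) * norm (\<xi> k) * (exp (?l (Suc J)) * norm b * exp ((mnorm M - ?l (Suc J)) * t))"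
      proof -
        have e1: "exp (- (?l k * 1) + (?l (Suc J) - ?l (Suc J) * t)) =
            exp (- (?l k * 1)) * (exp (?l (Suc J)) * exp (- (?l (Suc J) * t)))" by (simp flip: exp_add)
        have e2: "exp ((mnorm M - ?l (Suc J)) * t) = exp (mnorm M * t) * exp (- (?l (Suc J) * t))"
          by (simp add: left_diff_distrib flip: exp_add)
        show ?thesis unfolding e1 e2 by (simp only: mult_ac)
      qed
      finally show ?thesis using False j by auto
    qed
    have "cmod (- obs_term M b \<xi> ?\<sigma> j) \<le> (\<Sum>k. exp (- (?l k * 1)) * norm (\<xi> k) * (exp (?l (Suc J)) * norm b * exp ((mnorm M - ?l (Suc J)) * t)))"
      unfolding sums_unique[OF sm] by (rule norm_suminf_le[OF bd summable_mult2[OF Ds]])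
    also have "\<dots> = D * (exp (?l (Suc J)) * norm b * exp ((mnorm M - ?l (Suc J)) * t))"
      unfolding D_def by (rule suminf_mult2[OF Ds, symmetric])
    finally have "exp (Re s * t) * cmod (cdot (\<xi> j) b) \<le> D * (exp (?l (Suc J)) * norm b * exp ((mnorm M - ?l (Suc J)) * t))"
      unfolding main by (simp add: norm_mult)
    then have "exp (- (Re s * t)) * (exp (Re s * t) * cmod (cdot (\<xi> j) b)) \<le>
      exp (- (Re s * t)) * (D * (exp (?l (Suc J)) * norm b * exp ((mnorm M - ?l (Suc J)) * t)))"
      by (rule mult_left_mono) simp
    also have "\<dots> = ?c * exp (?a * t)"
    proof -
      have e3: "exp (?a * t) = exp ((mnorm M - ?l (Suc J)) * t) * exp (- (Re s * t))"
        by (simp add: left_diff_distrib flip: exp_add)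
      show ?thesis unfolding e3 by (simp only: mult_ac)
    qed
    also have "exp (- (Re s * t)) * (exp (Re s * t) * cmod (cdot (\<xi> j) b)) = cmod (cdot (\<xi> j) b)"
      by (simp add: mult.assoc[symmetric] flip: exp_add)
    finally show ?thesis .
  qed
  have "((\<lambda>t. ?c * exp (?a * t)) \<longlongrightarrow> 0) at_top"
  proof (rule tendsto_mult_right_zero, rule filterlim_compose[OF exp_at_bot])
    show "LIM t at_top. ?a * t :> at_bot" by (rule filterlim_tendsto_neg_mult_at_bot[OF tendsto_const neg filterlim_ident])
  qed
  then have "cmod (cdot (\<xi> j) b) \<le> 0"
    by (rule tendsto_lowerbound) (use key in \<open>auto simp: eventually_at_top_linorder\<close>)
  then have "\<xi> j = 0" using eig[OF ev[OF j(1)]] by simp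
  then show False using j(2) by simp
qed

end

section \<open>Sufficiency\<close>

lemma max_zero_sq_deriv: "((\<lambda>x. (max 0 x)\<^sup>2) has_real_derivative 2 * max 0 x) (at x)" for x :: real
proof -
  consider "x > 0" | "x < 0" | "x = 0" by linarith
  then show ?thesis
  proof cases
    case 1
    have "((\<lambda>x. x\<^sup>2) has_real_derivative 2 * max 0 x) (at x)"
      using 1 by (auto intro!: derivative_eq_intros)
    then show ?thesis
      by (rule has_field_derivative_transform_within_open[of _ _ _ "{0<..}"]) (use 1 in auto)
  next
    case 2
    have "((\<lambda>x. 0) has_real_derivative 2 * max 0 x) (at x)"
      using 2 by (auto intro!: derivative_eq_intros)
    then show ?thesis
      by (rule has_field_derivative_transform_within_open[of _ _ _ "{..<0}"]) (use 2 in auto)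
  next
    case 3
    have "((\<lambda>h. ((max 0 (0 + h))\<^sup>2 - (max 0 0)\<^sup>2) / h) \<longlongrightarrow> 0) (at (0::real))"
    proof (rule Lim_null_comparison)
      show "((\<lambda>h. \<bar>h\<bar>) \<longlongrightarrow> 0) (at (0::real))" by (rule tendsto_rabs_zero) (rule tendsto_ident_at)
      have "norm (((max 0 (0 + h))\<^sup>2 - (max 0 0)\<^sup>2) / h) \<le> \<bar>h\<bar>" for h :: real
        by (auto simp: max_def power2_eq_square abs_mult)
      then show "\<forall>\<^sub>F h in at (0::real). norm (((max 0 (0 + h))\<^sup>2 - (max 0 0)\<^sup>2) / h) \<le> \<bar>h\<bar>" by simp
    qed
    then show ?thesis using 3 by (simp add: DERIV_def)
  qed
qed

text \<open>Squares of truncated linear functions are C^1, so their product is a bump with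
  continuous derivative at both ends of the interval as well.\<close>

lemma bump_exists:
  assumes "a < b"
  obtains \<beta> \<beta>' :: "real \<Rightarrow> real" where "\<And>t. (\<beta> has_real_derivative \<beta>' t) (at t)" "continuous_on UNIV \<beta>'"
    "\<And>t. \<beta> t \<ge> 0" "\<And>t. t \<notin> {a<..<b} \<Longrightarrow> \<beta> t = 0" "\<And>t. t \<in> {a<..<b} \<Longrightarrow> \<beta> t > 0"
proof
  let ?\<beta> = "\<lambda>t. (max 0 (t - a))\<^sup>2 * (max 0 (b - t))\<^sup>2"
  let ?\<beta>' = "\<lambda>t. (2 * max 0 (t - a)) * (max 0 (b - t))\<^sup>2 + - (2 * max 0 (b - t)) * (max 0 (t - a))\<^sup>2"
  show "(?\<beta> has_real_derivative ?\<beta>' t) (at t)" for t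
  proof (rule DERIV_mult)
    show "((\<lambda>t. (max 0 (t - a))\<^sup>2) has_real_derivative 2 * max 0 (t - a)) (at t)"
    proof -
      have "((\<lambda>t. t - a) has_real_derivative 1) (at t)" by (auto intro!: derivative_eq_intros)
      from DERIV_chain2[OF max_zero_sq_deriv this] show ?thesis by simp
    qed
    show "((\<lambda>t. (max 0 (b - t))\<^sup>2) has_real_derivative - (2 * max 0 (b - t))) (at t)"
    proof -
      have "((\<lambda>t. b - t) has_real_derivative - 1) (at t)" by (auto intro!: derivative_eq_intros)
      from DERIV_chain2[OF max_zero_sq_deriv this] show ?thesis by simp
    qed
  qed
  show "continuous_on UNIV ?\<beta>'" by (intro continuous_intros)
qed (auto simp: max_def)

context interval begin

lemma obs_heat:
  "obs M b r (complex_of_real t) = (\<Sum>k. cdot (heat M ((freq k)\<^sup>2) t (r k)) b)"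
proof -
  have "obs_term M b r (complex_of_real t) k = cdot (heat M ((freq k)\<^sup>2) t (r k)) b" for k
  proof -
    have e: "- (complex_of_real ((freq k)\<^sup>2) * complex_of_real t) = complex_of_real (- (freq k)\<^sup>2 * t)" by simp
    show ?thesis unfolding obs_term_def heat_def cdot_scaleR_left e exp_of_real
      by (rule scaleR_conv_of_real[symmetric])
  qed
  then show ?thesis by (simp add: obs_def)
qed

lemma bounded_admissible:
  assumes "\<And>k. norm (r k) \<le> B"
  shows "admissible r"
  unfolding admissible_def
proof (intro allI impI)
  fix \<delta> :: real assume \<delta>: "\<delta> > 0"
  have s: "summable (\<lambda>k. (27 / \<delta> ^ 3 * B) * (1 / freq k ^ 6))"
    by (intro summable_mult summable_inverse_freq) simp
  show "summable (\<lambda>k. exp (- ((freq k)\<^sup>2 * \<delta>)) * norm (r k))"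
  proof (rule summable_comparison_test'[OF s, where N = 0])
    fix k :: nat
    have "exp (- ((freq k)\<^sup>2 * \<delta>)) * norm (r k) \<le> (27 / ((freq k)\<^sup>2 * \<delta>) ^ 3) * B"
      using \<delta> freq_pos[of k] by (intro mult_mono exp_minus_le assms) auto
    also have "\<dots> = (27 / \<delta> ^ 3 * B) * (1 / freq k ^ 6)"
      by (simp add: power_mult_distrib flip: power_mult)
    finally show "norm (exp (- ((freq k)\<^sup>2 * \<delta>)) * norm (r k)) \<le> (27 / \<delta> ^ 3 * B) * (1 / freq k ^ 6)" by simp
  qed
qed

lemma vec_eq_cdotI: "(\<And>v. cdot x v = cdot y v) \<Longrightarrow> x = y"
proof -
  assume "\<And>v. cdot x v = cdot y v"
  then have "cdot (x - y) (x - y) = 0" by (simp add: cdot_diff_left)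
  then show ?thesis unfolding cdot_self by simp
qed

text \<open>The comparison goes through the Duhamel representation \<open>cdot_forced\<close>, in
  which the control occurs linearly and undifferentiated. It makes the reachable states a real
  vector space.\<close>

lemma forced_linear:
  assumes \<gamma>: "boundary_control L \<gamma> \<gamma>'" and \<delta>: "boundary_control L \<delta> \<delta>'" and t: "t \<ge> 0"
  shows "boundary_control L (\<lambda>t. \<gamma> t + c *\<^sub>R \<delta> t) (\<lambda>t. \<gamma>' t + c *\<^sub>R \<delta>' t)"
    "boundary_control.forced L A b (\<lambda>t. \<gamma> t + c *\<^sub>R \<delta> t) (\<lambda>t. \<gamma>' t + c *\<^sub>R \<delta>' t) k t =
       boundary_control.forced L A b \<gamma> \<gamma>' k t + c *\<^sub>R boundary_control.forced L A b \<delta> \<delta>' k t"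
proof -
  interpret g1: boundary_control L A b \<gamma> \<gamma>' by fact
  interpret g2: boundary_control L A b \<delta> \<delta>' by fact
  show sum: "boundary_control L (\<lambda>t. \<gamma> t + c *\<^sub>R \<delta> t) (\<lambda>t. \<gamma>' t + c *\<^sub>R \<delta>' t)"
  proof unfold_locales
    show "((\<lambda>t. \<gamma> t + c *\<^sub>R \<delta> t) has_vector_derivative \<gamma>' t + c *\<^sub>R \<delta>' t) (at t)" for t
      by (intro has_vector_derivative_add g1.\<gamma>_deriv bounded_linear.has_vector_derivative[OF bounded_linear_scaleR_right] g2.\<gamma>_deriv)
    show "continuous_on UNIV (\<lambda>t. \<gamma>' t + c *\<^sub>R \<delta>' t)"
      by (intro continuous_on_add continuous_on_scaleR continuous_on_const g1.\<gamma>'_continuous g2.\<gamma>'_continuous)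
  qed (simp add: g1.\<gamma>_zero g2.\<gamma>_zero)
  interpret g3: boundary_control L A b "\<lambda>t. \<gamma> t + c *\<^sub>R \<delta> t" "\<lambda>t. \<gamma>' t + c *\<^sub>R \<delta>' t" by (rule sum)
  show "g3.forced k t = g1.forced k t + c *\<^sub>R g2.forced k t"
  proof (rule vec_eq_cdotI)
    fix v
    let ?H = "\<lambda>s. heat (conj_transpose A) ((freq k)\<^sup>2) (t - s) v"
    have int: "(\<lambda>s. freq k *\<^sub>R cdot (\<phi> s *s b) (?H s)) integrable_on {0..t}"
      if "continuous_on {0..t} \<phi>" for \<phi> :: "real \<Rightarrow> complex"
      by (intro integrable_continuous_interval continuous_on_scaleR continuous_on_const continuous_on_cdot
          g1.continuous_on_smult that g1.heat_reversed_continuous)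
    have eq: "freq k *\<^sub>R cdot ((\<gamma> s + c *\<^sub>R \<delta> s) *s b) (?H s) =
       freq k *\<^sub>R cdot (\<gamma> s *s b) (?H s) + c *\<^sub>R (freq k *\<^sub>R cdot (\<delta> s *s b) (?H s))" for s
      unfolding cdot_smult_left by (simp add: scaleR_conv_of_real algebra_simps)
    have "cdot (g3.forced k t) v = integral {0..t} (\<lambda>s. freq k *\<^sub>R cdot (\<gamma> s *s b) (?H s)) +
        integral {0..t} (\<lambda>s. c *\<^sub>R (freq k *\<^sub>R cdot (\<delta> s *s b) (?H s)))"
      unfolding g3.cdot_forced[OF t] eq
      by (intro Henstock_Kurzweil_Integration.integral_add integrable_cmul int g1.\<gamma>_continuous g2.\<gamma>_continuous)
    also have "\<dots> = cdot (g1.forced k t) v + c *\<^sub>R cdot (g2.forced k t) v"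
      unfolding g1.cdot_forced[OF t] g2.cdot_forced[OF t] by simp
    finally show "cdot (g3.forced k t) v = cdot (g1.forced k t + c *\<^sub>R g2.forced k t) v"
      by (simp add: cdot_add_left cdot_scaleR_left)
  qed
qed

text \<open>If the observation were nonzero at time t, a control concentrated near the reversed time
  T - t and with a suitable phase would have a strictly positive pairing with r, against
  orthogonality.\<close>

lemma observation_zero:
  fixes A :: "complex^'n^'n"
  assumes T: "T > 0" and r: "in_l2 r" and t: "0 < t" "t < T"
    and orth: "\<And>\<gamma> \<gamma>'. boundary_control L \<gamma> \<gamma>' \<Longrightarrow>
      l2_inner r (\<lambda>k. (1 / freq k) *\<^sub>R boundary_control.forced L A b \<gamma> \<gamma>' k T) = 0"
  shows "obs (conj_transpose A) b r (complex_of_real t) = 0"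
proof (rule ccontr)
  let ?M = "conj_transpose A"
  assume nz: "obs ?M b r (complex_of_real t) \<noteq> 0"
  obtain R where R: "\<And>k. (norm (r k))\<^sup>2 \<le> R"
    using summable_imp_bounded[OF r[unfolded in_l2_def]] unfolding bounded_iff by auto
  have adm: "admissible r" by (rule bounded_admissible[of r "sqrt R"]) (rule real_le_rsqrt[OF R])
  \<comment> \<open>A control at time s acts through the adjoint flow over T - s; the conjugate
    appears because the flow sits in the second slot of \<open>cdot\<close>.\<close>
  define w where "w s = cnj (obs ?M b r (complex_of_real (T - s)))" for s
  have wc: "continuous_on {0..<T} w"
  proof -
    have "continuous_on {\<sigma>. Re \<sigma> > 0} (obs ?M b r)"
      using obs_series(2)[OF adm] by (intro continuous_at_imp_continuous_on) (blast intro: DERIV_isCont)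
    then have "continuous_on {0..<T} (\<lambda>s. obs ?M b r (complex_of_real (T - s)))"
      by (rule continuous_on_compose2) (auto intro!: continuous_intros)
    then show ?thesis unfolding w_def by (rule continuous_on_cnj)
  qed
  define s0 where "s0 = T - t"
  have s0: "0 < s0" "s0 < T" using t by (auto simp: s0_def)
  have w0: "w s0 \<noteq> 0" using nz by (simp add: w_def s0_def)
  \<comment> \<open>With this phase \<kappa> w equals |w|^2 > 0 at \<open>s0\<close>, so its real
    part stays positive nearby.\<close>
  define \<kappa> where "\<kappa> = cnj (w s0)"
  have "continuous_on {0<..<T} (\<lambda>s. Re (\<kappa> * w s))"
    by (intro continuous_on_Re continuous_on_mult continuous_on_const continuous_on_subset[OF wc]) auto
  then have "isCont (\<lambda>s. Re (\<kappa> * w s)) s0"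
    using s0 by (simp add: continuous_on_eq_continuous_at)
  moreover have pos0: "Re (\<kappa> * w s0) > 0"
    using w0 by (simp add: \<kappa>_def complex_eq_iff sum_squares_gt_zero_iff flip: power2_eq_square) (auto simp: add_pos_nonneg add_nonneg_pos)
  ultimately have "\<forall>\<^sub>F s in at s0. Re (\<kappa> * w s) > 0"
    unfolding isCont_def by (rule order_tendstoD(1))
  then obtain d where d: "d > 0" "\<And>s. s \<noteq> s0 \<Longrightarrow> dist s s0 < d \<Longrightarrow> Re (\<kappa> * w s) > 0"
    unfolding eventually_at by blast
  \<comment> \<open>Half of each margin: the closed interval around \<open>s0\<close> stays inside
    (0, T), so the control vanishes near time 0, and positivity holds on all of it.\<close>
  define \<rho> where "\<rho> = min (d / 2) (min (s0 / 2) ((T - s0) / 2))"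
  have \<rho>: "\<rho> > 0" "\<rho> < d" "\<rho> < s0" "\<rho> < T - s0"
    using d(1) s0 unfolding \<rho>_def min_def by auto
  define a c where "a = s0 - \<rho>" and "c = s0 + \<rho>"
  have ac: "0 < a" "a < s0" "s0 < c" "c < T" using \<rho> by (auto simp: a_def c_def)
  have pos: "Re (\<kappa> * w s) > 0" if "s \<in> {a..c}" for s
    using that d(2)[of s] pos0 \<rho> by (cases "s = s0") (auto simp: a_def c_def dist_real_def)
  obtain \<beta> \<beta>' where \<beta>: "\<And>t. (\<beta> has_real_derivative \<beta>' t) (at t)" "continuous_on UNIV \<beta>'"
    "\<And>t. \<beta> t \<ge> 0" "\<And>t. t \<notin> {a<..<c} \<Longrightarrow> \<beta> t = 0" "\<And>t. t \<in> {a<..<c} \<Longrightarrow> \<beta> t > 0"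
    by (rule bump_exists[of a c]) (use ac in auto)
  have \<beta>c: "continuous_on S \<beta>" for S
    by (rule DERIV_continuous_on) (rule has_field_derivative_at_within[OF \<beta>(1)])
  have bl: "bounded_linear (\<lambda>x. \<kappa> * complex_of_real x)"
    by (rule bounded_linear_compose[OF bounded_linear_mult_right bounded_linear_of_real])
  have bc: "boundary_control L (\<lambda>s. \<kappa> * complex_of_real (\<beta> s)) (\<lambda>s. \<kappa> * complex_of_real (\<beta>' s))"
  proof unfold_locales
    show "((\<lambda>s. \<kappa> * complex_of_real (\<beta> s)) has_vector_derivative \<kappa> * complex_of_real (\<beta>' s)) (at s)" for s
      by (rule bounded_linear.has_vector_derivative[OF bl]) (use \<beta>(1) in \<open>simp add: has_real_derivative_iff_has_vector_derivative\<close>)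
    show "continuous_on UNIV (\<lambda>s. \<kappa> * complex_of_real (\<beta>' s))"
      by (intro continuous_on_mult continuous_on_const continuous_on_of_real \<beta>(2))
    show "\<kappa> * complex_of_real (\<beta> 0) = 0" using \<beta>(4)[of 0] ac by simp
  qed
  interpret bc: boundary_control L A b "\<lambda>s. \<kappa> * complex_of_real (\<beta> s)" "\<lambda>s. \<kappa> * complex_of_real (\<beta>' s)" by (rule bc)
  \<comment> \<open>The H^1_0 coefficients that correspond to r; the division by
    \<open>freq k\<close> cancels the factor contributed by the normal derivative.\<close>
  let ?c = "\<lambda>k. (1 / freq k) *\<^sub>R r k"
  have cs: "summable (\<lambda>k. (freq k)\<^sup>2 * (norm (?c k))\<^sup>2)"
  proof -
    have "(freq k)\<^sup>2 * (norm (?c k))\<^sup>2 = (norm (r k))\<^sup>2" for k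
      using freq_pos[of k] by (simp add: power_divide)
    then show ?thesis using r by (simp add: in_l2_def)
  qed
  have fr: "freq k *\<^sub>R heat M l s (?c k) = heat M l s (r k)" for k M l s
    using freq_pos[of k] by (simp add: heat_scaleR)
  define h where "h s = (\<Sum>k. heat ?M ((freq k)\<^sup>2) (T - s) (r k))" for s
  have hw: "cdot b (h s) = w s" if s: "s \<in> {0<..<T}" for s
  proof -
    obtain C where C: "\<And>k. norm (?c k) \<le> C * freq k" using H10_coeff_freq_bound[OF cs] by blast
    have "summable (\<lambda>k. norm (freq k *\<^sub>R heat ?M ((freq k)\<^sup>2) (T - s) (?c k)))"
      by (rule freq_weight_summable[OF heat_summable[OF C]]) (use s in auto)
    then have sm: "summable (\<lambda>k. heat ?M ((freq k)\<^sup>2) (T - s) (r k))"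
      unfolding fr by (rule summable_norm_cancel)
    have "cdot (h s) b = obs ?M b r (complex_of_real (T - s))"
      unfolding h_def obs_heat by (rule bounded_linear.suminf[OF bounded_linear_cdot_left sm])
    then show ?thesis by (simp add: w_def cdot_commute[of b "h s"])
  qed
  have "(\<lambda>k. cdot (bc.forced k T) (?c k)) sums
     (LINT s:{0<..<T}|lborel. cdot ((\<kappa> * complex_of_real (\<beta> s)) *s b) (h s))"
    using bc.forced_pairing[OF cs T] unfolding fr h_def .
  then have "(\<lambda>k. Re (cdot (bc.forced k T) (?c k))) sums
     Re (LINT s:{0<..<T}|lborel. cdot ((\<kappa> * complex_of_real (\<beta> s)) *s b) (h s))"
    by (rule bounded_linear.sums[OF bounded_linear_Re])
  moreover have "Re (cdot (bc.forced k T) (?c k)) = r k \<bullet> ((1 / freq k) *\<^sub>R bc.forced k T)" for k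
    by (simp add: Re_cdot inner_commute)
  ultimately have "Re (LINT s:{0<..<T}|lborel. cdot ((\<kappa> * complex_of_real (\<beta> s)) *s b) (h s)) =
      l2_inner r (\<lambda>k. (1 / freq k) *\<^sub>R bc.forced k T)"
    unfolding l2_inner_def by (simp add: sums_iff)
  then have zero: "Re (LINT s:{0<..<T}|lborel. cdot ((\<kappa> * complex_of_real (\<beta> s)) *s b) (h s)) = 0"
    using orth[OF bc] by simp
  let ?F = "\<lambda>s. complex_of_real (\<beta> s) * (\<kappa> * w s)"
  have Fc: "continuous_on {a..c} ?F"
    by (intro continuous_on_mult continuous_on_of_real continuous_on_const \<beta>c continuous_on_subset[OF wc]) (use ac in auto)
  have "(LINT s:{0<..<T}|lborel. cdot ((\<kappa> * complex_of_real (\<beta> s)) *s b) (h s)) = (LINT s:{a..c}|lborel. ?F s)"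
    unfolding set_lebesgue_integral_def
  proof (rule Bochner_Integration.integral_cong[OF refl])
    fix s
    show "indicat_real {0<..<T} s *\<^sub>R cdot ((\<kappa> * complex_of_real (\<beta> s)) *s b) (h s) = indicat_real {a..c} s *\<^sub>R ?F s"
      using ac \<beta>(4)[of s] hw[of s] by (cases "s \<in> {a<..<c}") (auto simp: indicator_def cdot_smult_left)
  qed
  also have "\<dots> = integral {a..c} ?F"
    by (rule set_borel_integral_eq_integral(2)[OF borel_integrable_atLeastAtMost'[OF Fc]])
  finally have "Re (integral {a..c} ?F) = 0" using zero by simp
  then have "integral {a..c} (\<lambda>s. Re (?F s)) = 0"
    using integral_linear[OF integrable_continuous_interval[OF Fc] bounded_linear_Re] by (simp add: o_def)
  moreover have "(\<lambda>s. Re (?F s)) integrable_on {a..c}"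
    by (intro integrable_continuous_interval continuous_on_Re Fc)
  ultimately have hi: "((\<lambda>s. Re (?F s)) has_integral 0) (cbox a c)"
    by (metis cbox_interval integrable_integral)
  have cont: "continuous_on (cbox a c) (\<lambda>s. Re (?F s))" using continuous_on_Re[OF Fc] by simp
  have nonneg: "0 \<le> Re (?F s)" if "s \<in> cbox a c" for s
  proof -
    have "Re (?F s) = \<beta> s * Re (\<kappa> * w s)" by simp
    then show ?thesis using pos[of s] \<beta>(3)[of s] that by simp
  qed
  have "Re (?F s0) = 0"
    by (rule has_integral_0_cbox_imp_0[OF cont nonneg hi]) (use ac in auto)
  moreover have "Re (?F s0) = \<beta> s0 * Re (\<kappa> * w s0)" by simp
  ultimately show False using \<beta>(5)[of s0] ac pos0 by simp
qed

text \<open>Multiplication by 1 / \<open>freq k\<close> maps the H^-1 sequences onto l^2, where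
  \<open>l2_subspace_dense\<close> applies. A vector orthogonal to all reachable states has
  vanishing observation on (0, T), and \<open>unobservable_continuation\<close> with
  \<open>observability\<close> forces it to be zero.\<close>

theorem reachable_dense:
  fixes A :: "complex^'n^'n"
  assumes eig: "\<And>v \<theta>. conj_transpose A *v v = \<theta> *s v \<Longrightarrow> cdot v b = 0 \<Longrightarrow> v = 0"
    and simple: "\<And>j k \<theta> \<theta>'. \<theta> \<in> eigenvalues (conj_transpose A) \<Longrightarrow> \<theta>' \<in> eigenvalues (conj_transpose A) \<Longrightarrow>
      \<theta> - complex_of_real ((freq j)\<^sup>2) = \<theta>' - complex_of_real ((freq k)\<^sup>2) \<Longrightarrow> j = k"
    and T: "T > 0" and y: "hm_seq y" and e: "e > 0"
  shows "\<exists>\<gamma> \<gamma>'. boundary_control L \<gamma> \<gamma>' \<and>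
    (\<Sum>k. (norm (y k - boundary_control.forced L A b \<gamma> \<gamma>' k T) / freq k)\<^sup>2) \<le> e"
proof -
  let ?x = "\<lambda>\<gamma> \<gamma>' k. (1 / freq k) *\<^sub>R boundary_control.forced L A b \<gamma> \<gamma>' k T"
  define V where "V = {x. \<exists>\<gamma> \<gamma>'. boundary_control L \<gamma> \<gamma>' \<and> x = ?x \<gamma> \<gamma>'}"
  have nsq: "(norm ((1 / freq k) *\<^sub>R v))\<^sup>2 = (norm v / freq k)\<^sup>2" for k and v :: "complex^'n"
    using freq_pos[of k] by simp
  have "\<exists>x\<in>V. l2_sq (\<lambda>k. (1 / freq k) *\<^sub>R y k - x k) \<le> e"
  proof (rule l2_subspace_dense)
    show "in_l2 x" if "x \<in> V" for x
    proof -
      obtain \<gamma> \<gamma>' where "boundary_control L \<gamma> \<gamma>'" and x: "x = ?x \<gamma> \<gamma>'" using \<open>x \<in> V\<close> by (auto simp: V_def)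
      then interpret boundary_control L A b \<gamma> \<gamma>' by simp
      have "hm_seq (state (\<lambda>k. 0) T)" by (rule hm_seq_state) (use T in \<open>auto simp: hm_seq_def\<close>)
      then show ?thesis unfolding x in_l2_def nsq hm_seq_def by (simp add: state_def)
    qed
    have zc: "boundary_control L (\<lambda>t. 0) (\<lambda>t. 0)"
      by unfold_locales auto
    \<comment> \<open>The zero control is written as 0 + (-1) 0; by linearity its state equals
      itself minus itself.\<close>
    have "boundary_control.forced L A b (\<lambda>t. 0) (\<lambda>t. 0) k T = 0" for k
      using forced_linear(2)[OF zc zc, where t = T and c = "-1" and k = k and A = A and b = b] T by simp
    then show "(\<lambda>k. 0) \<in> V" using zc unfolding V_def by (intro CollectI exI[of _ "\<lambda>t. 0"]) auto
    show "(\<lambda>k. x k + c *\<^sub>R y k) \<in> V" if xy: "x \<in> V" "y \<in> V" for x y c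
    proof -
      obtain \<gamma> \<gamma>' \<delta> \<delta>' where b: "boundary_control L \<gamma> \<gamma>'" "boundary_control L \<delta> \<delta>'"
        and eq: "x = ?x \<gamma> \<gamma>'" "y = ?x \<delta> \<delta>'" using xy by (auto simp: V_def)
      note l1 = forced_linear(1)[OF b, where t = T and c = c]
      note l2 = forced_linear(2)[OF b, where t = T and c = c and A = A and b = b]
      have "(\<lambda>k. x k + c *\<^sub>R y k) = ?x (\<lambda>t. \<gamma> t + c *\<^sub>R \<delta> t) (\<lambda>t. \<gamma>' t + c *\<^sub>R \<delta>' t)"
        using T by (auto simp: eq l2 scaleR_add_right mult.commute)
      then show ?thesis using l1 T unfolding V_def by (intro CollectI exI conjI) auto
    qed
    show "r k = 0" if r: "in_l2 r" and orth: "\<And>x. x \<in> V \<Longrightarrow> l2_inner r x = 0" for r k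
    proof -
      have z: "obs (conj_transpose A) b r (complex_of_real t) = 0" if "0 < t" "t < T" for t
        by (rule observation_zero[OF T r that]) (intro orth, auto simp: V_def)
      obtain R where R: "\<And>k. (norm (r k))\<^sup>2 \<le> R"
        using summable_imp_bounded[OF r[unfolded in_l2_def]] unfolding bounded_iff by auto
      have "admissible r" by (rule bounded_admissible[of r "sqrt R"]) (rule real_le_rsqrt[OF R])
      then have "r \<in> unobservable (conj_transpose A) b"
        by (rule unobservable_continuation[OF _ T]) (rule z)
      then show ?thesis by (rule observability[rotated 2]) (fact eig, fact simple)
    qed
    show "in_l2 (\<lambda>k. (1 / freq k) *\<^sub>R y k)" using y unfolding in_l2_def nsq hm_seq_def .
  qed (rule e)
  then obtain \<gamma> \<gamma>' where bc: "boundary_control L \<gamma> \<gamma>'"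
    and le: "l2_sq (\<lambda>k. (1 / freq k) *\<^sub>R y k - ?x \<gamma> \<gamma>' k) \<le> e" by (auto simp: V_def)
  have "l2_sq (\<lambda>k. (1 / freq k) *\<^sub>R y k - ?x \<gamma> \<gamma>' k) =
     (\<Sum>k. (norm (y k - boundary_control.forced L A b \<gamma> \<gamma>' k T) / freq k)\<^sup>2)"
    unfolding l2_sq_def scaleR_diff_right[symmetric] nsq ..
  then show ?thesis using bc le by auto
qed

lemma Hm1_functional:
  assumes "F \<in> Hm1 L" "u \<in> H10 L"
  shows "F u = hm_functional (hm_coeff F) u"
  unfolding hm_functional_def by (rule sums_unique[OF Hm1_expansion[OF assms]])

text \<open>By linearity it is enough to reach, from 0, the target minus the free evolution of
  \<open>y0\<close>. The scalar control is copied into every component of \<open>g\<close>, so that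
  \<open>B *v g t x\<close> equals \<open>\<gamma> t *s b\<close>.\<close>

theorem approx_controllable_sufficient:
  fixes A :: "complex^'n^'n" and B :: "complex^'m^'n"
  defines "b \<equiv> B *v (\<chi> i. 1)"
  assumes eig: "\<And>v \<theta>. conj_transpose A *v v = \<theta> *s v \<Longrightarrow> cdot v b = 0 \<Longrightarrow> v = 0"
    and simple: "\<And>j k \<theta> \<theta>'. \<theta> \<in> eigenvalues (conj_transpose A) \<Longrightarrow> \<theta>' \<in> eigenvalues (conj_transpose A) \<Longrightarrow>
      \<theta> - complex_of_real ((freq j)\<^sup>2) = \<theta>' - complex_of_real ((freq k)\<^sup>2) \<Longrightarrow> j = k"
  shows "approx_controllable L A B"
  unfolding approx_controllable_def approx_controllable_at_def
proof (intro allI impI ballI)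
  fix T :: real and y0 y1 :: "'n functional" and \<epsilon> :: real
  assume T: "T > 0" and y0: "y0 \<in> Hm1 L" and y1: "y1 \<in> Hm1 L" and \<epsilon>: "\<epsilon> > 0"
  interpret T: interval T by unfold_locales (rule T)
  let ?Y0 = "hm_coeff y0" and ?Y1 = "hm_coeff y1"
  have h0: "hm_seq ?Y0" and h1: "hm_seq ?Y1" using hm_seq_coeff y0 y1 by auto
  have hh: "hm_seq (\<lambda>k. heat A ((freq k)\<^sup>2) T (?Y0 k))"
    by (rule hm_seq_bound[OF h0 heat_bounded[where T = T]]) (use T in auto)
  \<comment> \<open>This is the S with sqrt(2 / L * S) = \<epsilon>, the constant 2 / L being that
    of \<open>Hm1_norm_eq_le\<close>.\<close>
  have "\<epsilon>\<^sup>2 * L / 2 > 0" using \<epsilon> L_pos by simp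
  then have "\<exists>\<gamma> \<gamma>'. boundary_control L \<gamma> \<gamma>' \<and>
    (\<Sum>k. (norm (?Y1 k - heat A ((freq k)\<^sup>2) T (?Y0 k) - boundary_control.forced L A b \<gamma> \<gamma>' k T) / freq k)\<^sup>2) \<le> \<epsilon>\<^sup>2 * L / 2"
    by (rule reachable_dense[OF _ _ T hm_seq_diff[OF h1 hh], rotated 2]) (fact eig, fact simple)
  then obtain \<gamma> \<gamma>' where "boundary_control L \<gamma> \<gamma>'" and
    le: "(\<Sum>k. (norm (?Y1 k - heat A ((freq k)\<^sup>2) T (?Y0 k) - boundary_control.forced L A b \<gamma> \<gamma>' k T) / freq k)\<^sup>2) \<le> \<epsilon>\<^sup>2 * L / 2"
    by blast
  then interpret boundary_control L A b \<gamma> \<gamma>' by simp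
  define g :: "real \<Rightarrow> real \<Rightarrow> complex^'m" where "g t x = (\<chi> i. \<gamma> t)" for t x
  define y where "y t = hm_functional (state ?Y0 t)" for t
  have g: "g \<in> controls L T"
  proof -
    have "continuous_on {0..T} (\<lambda>t. (\<chi> i. \<gamma> t) :: complex^'m)"
      by (intro continuous_on_vec_lambda \<gamma>_continuous)
    then show ?thesis
      unfolding controls_def g_def by (simp add: L2_on_iff T.continuous_square_integrable)
  qed
  have Bg: "B *v g t x = \<gamma> t *s b" for t x
  proof -
    have "g t x = \<gamma> t *s (\<chi> i. 1)" by (simp add: g_def vec_eq_iff)
    then show ?thesis by (simp add: b_def matrix_smult)
  qed
  have st: "hm_seq (state ?Y0 t)" if "t \<in> {0..T}" for t by (rule hm_seq_state[OF h0]) (use that in simp)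
  have sol: "transposition_solution L T A B y0 g y"
    unfolding transposition_solution_def
  proof (intro conjI ballI allI impI)
    show "y t \<in> Hm1 L" if "t \<in> {0..T}" for t unfolding y_def by (rule hm_functional_Hm1[OF st[OF that]])
    show "((\<lambda>s. Hm1_norm L (\<lambda>\<zeta>. y s \<zeta> - y t \<zeta>)) \<longlongrightarrow> 0) (at t within {0..T})" if "t \<in> {0..T}" for t
      unfolding y_def by (rule state_tendsto[OF h0 that])
    show "\<exists>Y\<in>L2_on ({0<..<T} \<times> {0<..<L}). AE t in lborel. t \<in> {0<..<T} \<longrightarrow>
          (\<lambda>x. Y (t, x)) \<in> L2_on {0<..<L} \<and>
          (\<forall>\<zeta>\<in>H10 L. y t \<zeta> = (LINT x:{0<..<L}|lborel. cdot (Y (t, x)) (\<zeta> x)))"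
    proof (rule bexI[OF _ profile_square_integrable[OF h0 T]], rule AE_I2, intro impI conjI ballI)
      fix t assume "t \<in> {0<..<T}"
      then have t: "t > 0" by simp
      show "(\<lambda>x. profile ?Y0 (t, x)) \<in> L2_on {0<..<L}"
        by (simp add: L2_on_iff continuous_square_integrable[OF profile_slice(1)[OF h0 t]])
      show "y t \<zeta> = (LINT x:{0<..<L}|lborel. cdot (profile ?Y0 (t, x)) (\<zeta> x))" if "\<zeta> \<in> H10 L" for \<zeta>
        unfolding y_def profile_slice(2)[OF h0 t that] by (simp add: set_integral_restrict_space)
    qed
    show "y \<tau> \<zeta> - y0 (z 0) = - (LINT t:{0<..<\<tau>}|lborel. cdot (B *v g t 0) (normal_deriv L (z t) 0))"
      if "\<tau> \<in> {0..T}" "\<zeta> \<in> H10 L" "adjoint_solution L A \<tau> \<zeta> z" for \<tau> \<zeta> z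
      unfolding y_def Bg by (rule state_duality[OF y0 _ that(2,3)]) (use that(1) in simp)
  qed
  have TT: "T \<in> {0..T}" using T by simp
  have "Hm1_norm L (\<lambda>\<zeta>. y T \<zeta> - y1 \<zeta>) \<le> sqrt (2 / L * (\<Sum>k. (norm (state ?Y0 T k - ?Y1 k) / freq k)\<^sup>2))"
  proof (rule Hm1_norm_eq_le[OF hm_seq_diff[OF st[OF TT] h1]])
    fix u :: "real \<Rightarrow> complex^'n" assume u: "u \<in> H10 L"
    show "y T u - y1 u = hm_functional (\<lambda>k. state ?Y0 T k - ?Y1 k) u"
      unfolding y_def Hm1_functional[OF y1 u]
      using sums_unique2[OF sums_diff[OF hm_functional_sums[OF st[OF TT] u] hm_functional_sums[OF h1 u]]
          hm_functional_sums[OF hm_seq_diff[OF st[OF TT] h1] u, unfolded cdot_diff_left]] .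
  qed
  also have "(\<Sum>k. (norm (state ?Y0 T k - ?Y1 k) / freq k)\<^sup>2) =
     (\<Sum>k. (norm (?Y1 k - heat A ((freq k)\<^sup>2) T (?Y0 k) - forced k T) / freq k)\<^sup>2)"
  proof -
    have "norm (state ?Y0 T k - ?Y1 k) = norm (?Y1 k - heat A ((freq k)\<^sup>2) T (?Y0 k) - forced k T)" for k
      unfolding state_def by (subst norm_minus_commute) (simp add: algebra_simps)
    then show ?thesis by simp
  qed
  also have "sqrt (2 / L * \<dots>) \<le> sqrt (2 / L * (\<epsilon>\<^sup>2 * L / 2))"
    by (intro real_sqrt_le_mono mult_left_mono le) (use L_pos in simp)
  also have "\<dots> = \<epsilon>" using L_pos \<epsilon> by simp
  finally have "Hm1_norm L (\<lambda>\<zeta>. y T \<zeta> - y1 \<zeta>) \<le> \<epsilon>" .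
  then show "\<exists>g\<in>controls L T. \<exists>y. transposition_solution L T A B y0 g y \<and> Hm1_norm L (\<lambda>\<zeta>. y T \<zeta> - y1 \<zeta>) \<le> \<epsilon>"
    using g sol by blast
qed

end

section \<open>Necessity\<close>

lemma matrix_diff_eigen: "(mat \<theta> - M) *v v = \<theta> *s v - M *v v" for M :: "complex^'n^'n"
proof -
  have "mat \<theta> *v v = \<theta> *s v"
    by (simp add: mat_def matrix_vector_mult_def vec_eq_iff if_distrib if_distribR sum.delta cong: if_cong)
  then show ?thesis by (simp add: matrix_vector_mult_diff_rdistrib)
qed

context interval begin

section \<open>Explicit adjoint solutions built from eigenfunctions\<close>

lemma dirichlet_laplacian_add:
  assumes "dirichlet_laplacian L u f" "dirichlet_laplacian L v h"
  shows "dirichlet_laplacian L (\<lambda>x. u x + v x) (\<lambda>x. f x + h x)"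
proof -
  obtain p q where "has_H1_deriv L u p" "has_H1_deriv L p f" "has_H1_deriv L v q" "has_H1_deriv L q h"
    using assms unfolding dirichlet_laplacian_def by blast
  then have "has_H1_deriv L (\<lambda>x. u x + v x) (\<lambda>x. p x + q x)" "has_H1_deriv L (\<lambda>x. p x + q x) (\<lambda>x. f x + h x)"
    by (auto intro: has_H1_deriv_add)
  then show ?thesis using assms H10_add unfolding dirichlet_laplacian_def by blast
qed

lemma dirichlet_laplacian_linear:
  assumes "bounded_linear T" "dirichlet_laplacian L u f"
  shows "dirichlet_laplacian L (\<lambda>x. T (u x)) (\<lambda>x. T (f x))"
proof -
  obtain p where "has_H1_deriv L u p" "has_H1_deriv L p f"
    using assms unfolding dirichlet_laplacian_def by blast
  then have "has_H1_deriv L (\<lambda>x. T (u x)) (\<lambda>x. T (p x))" "has_H1_deriv L (\<lambda>x. T (p x)) (\<lambda>x. T (f x))"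
    by (auto intro: has_H1_deriv_linear[OF assms(1)])
  then show ?thesis using assms H10_linear[OF assms(1)] unfolding dirichlet_laplacian_def by blast
qed

text \<open>Separation of variables. Every norm in the definition factors into a scalar depending on
  time and a fixed norm of \<zeta>, so only the exponential has to be differentiated.\<close>

lemma eigenfunction_adjoint_solution:
  fixes A :: "complex^'n^'n"
  assumes lap: "dirichlet_laplacian L \<zeta> f"
    and eig: "\<And>x. x \<in> {0<..<L} \<Longrightarrow> f x + conj_transpose A *v \<zeta> x = s *s \<zeta> x"
  shows "adjoint_solution L A \<tau> \<zeta> (\<lambda>t x. exp (s * complex_of_real (\<tau> - t)) *s \<zeta> x)"
proof -
  let ?e = "\<lambda>t. exp (s * complex_of_real (\<tau> - t))"
  have \<zeta>: "\<zeta> \<in> H10 L" using lap by (simp add: dirichlet_laplacian_def)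
  have e': "(?e has_vector_derivative (- s * ?e t)) (at t within S)" for t S
  proof -
    have "((\<lambda>t. exp (s * (complex_of_real \<tau> - t))) has_field_derivative - s * exp (s * (complex_of_real \<tau> - complex_of_real t)))
        (at (complex_of_real t))"
      by (auto intro!: derivative_eq_intros)
    then show ?thesis using has_vector_derivative_real_field by fastforce
  qed
  show ?thesis
    unfolding adjoint_solution_def
  proof (intro conjI ballI)
    show "(\<lambda>x. ?e t *s \<zeta> x) \<in> H10 L" for t by (rule H10_smult[OF \<zeta>])
    show "((\<lambda>r. H10_norm L (\<lambda>x. ?e r *s \<zeta> x - ?e t *s \<zeta> x)) \<longlongrightarrow> 0) (at t within {0..\<tau>})" for t
    proof -
      have "H10_norm L (\<lambda>x. ?e r *s \<zeta> x - ?e t *s \<zeta> x) = cmod (?e r - ?e t) * H10_norm L \<zeta>" for r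
      proof -
        have "(\<lambda>x. ?e r *s \<zeta> x - ?e t *s \<zeta> x) = (\<lambda>x. (?e r - ?e t) *s \<zeta> x)"
          by (simp add: fun_eq_iff vec_eq_iff left_diff_distrib)
        then show ?thesis by (simp only: H10_norm_smult[OF \<zeta>])
      qed
      moreover have "((\<lambda>r. cmod (?e r - ?e t) * H10_norm L \<zeta>) \<longlongrightarrow> cmod (?e t - ?e t) * H10_norm L \<zeta>) (at t within {0..\<tau>})"
        by (intro tendsto_intros)
      ultimately show ?thesis by simp
    qed
    show "(\<lambda>x. ?e \<tau> *s \<zeta> x) = \<zeta>" by simp
    fix t
    have lap_t: "dirichlet_laplacian L (\<lambda>x. ?e t *s \<zeta> x) (\<lambda>x. ?e t *s f x)"
      by (rule dirichlet_laplacian_linear[OF bounded_linear_smult lap])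
    have "((\<lambda>r. norm ((1 / (r - t)) *\<^sub>R (?e r - ?e t) - (- s * ?e t)) * L2_norm {0<..<L} \<zeta>) \<longlongrightarrow> 0) (at t within {0..\<tau>})"
      by (rule tendsto_mult_left_zero) (rule iffD2[OF has_vector_derivative_quotient_iff[where f = ?e] e'])
    moreover have "L2_norm {0<..<L} (\<lambda>x. (1 / (r - t)) *\<^sub>R (?e r *s \<zeta> x - ?e t *s \<zeta> x) + (?e t *s f x + conj_transpose A *v (?e t *s \<zeta> x)))
       = norm ((1 / (r - t)) *\<^sub>R (?e r - ?e t) - (- s * ?e t)) * L2_norm {0<..<L} \<zeta>" for r
    proof -
      let ?c = "(1 / (r - t)) *\<^sub>R (?e r - ?e t) - (- s * ?e t)"
      have pt: "(1 / (r - t)) *\<^sub>R (?e r *s \<zeta> x - ?e t *s \<zeta> x) + (?e t *s f x + conj_transpose A *v (?e t *s \<zeta> x)) = ?c *s \<zeta> x"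
        if "x \<in> {0<..<L}" for x
      proof -
        have "?e t *s f x + conj_transpose A *v (?e t *s \<zeta> x) = ?e t *s (s *s \<zeta> x)"
          unfolding matrix_smult vector_add_ldistrib[symmetric] eig[OF that] ..
        moreover have "(1 / (r - t)) *\<^sub>R (?e r *s \<zeta> x - ?e t *s \<zeta> x) = ((1 / (r - t)) *\<^sub>R (?e r - ?e t)) *s \<zeta> x"
          unfolding scaleR_smult by (simp add: vec_eq_iff scaleR_conv_of_real algebra_simps)
        ultimately show ?thesis by (simp add: vec_eq_iff algebra_simps)
      qed
      have "(\<integral>x. (norm ((1 / (r - t)) *\<^sub>R (?e r *s \<zeta> x - ?e t *s \<zeta> x) + (?e t *s f x + conj_transpose A *v (?e t *s \<zeta> x))))\<^sup>2 \<partial>N) =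
          (\<integral>x. (cmod ?c)\<^sup>2 * (norm (\<zeta> x))\<^sup>2 \<partial>N)"
        by (rule Bochner_Integration.integral_cong[OF refl])
          (simp only: space_N pt norm_smult power_mult_distrib)
      also have "\<dots> = (cmod ?c)\<^sup>2 * (\<integral>x. (norm (\<zeta> x))\<^sup>2 \<partial>N)" by (rule integral_mult_right_zero)
      finally show ?thesis
        by (simp only: L2_norm_restrict_space[of "{0<..<L}"] borel_open open_greaterThanLessThan real_sqrt_mult real_sqrt_abs abs_norm_cancel)
    qed
    ultimately show "\<exists>f'. dirichlet_laplacian L (\<lambda>x. ?e t *s \<zeta> x) f' \<and>
        ((\<lambda>r. L2_norm {0<..<L} (\<lambda>x. (1 / (r - t)) *\<^sub>R (?e r *s \<zeta> x - ?e t *s \<zeta> x) + (f' x + conj_transpose A *v (?e t *s \<zeta> x))))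
          \<longlongrightarrow> 0) (at t within {0..\<tau>})"
      using lap_t by (intro exI[of _ "\<lambda>x. ?e t *s f x"]) simp
  qed
qed

lemma two_modes_coeff:
  "sine_coeff (\<lambda>x. mode j v x + mode k w x) l = (if l = j then v else 0) + (if l = k then w else 0)"
  by (simp add: sine_coeff_add H10_square_integrable mode_H10 sine_coeff_mode)

lemma normal_deriv_two_modes:
  fixes v w :: "complex^'n"
  shows "normal_deriv L (\<lambda>x. mode j v x + mode k w x) 0 = - (freq j *\<^sub>R v + freq k *\<^sub>R w)"
proof -
  let ?u = "\<lambda>x. mode j v x + mode k w x"
  have u: "?u \<in> H10 L" by (intro H10_add mode_H10)
  have s2: "summable (\<lambda>l. (freq l)\<^sup>2 * norm (sine_coeff ?u l))"
    by (rule summable_finite[of "{j, k}"]) (auto simp: two_modes_coeff)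
  have "(\<lambda>l. (if l = j then freq l *\<^sub>R v else 0) + (if l = k then freq l *\<^sub>R w else 0)) sums (freq j *\<^sub>R v + freq k *\<^sub>R w)"
    by (intro sums_add sums_single)
  moreover have "(\<lambda>l. (if l = j then freq l *\<^sub>R v else 0) + (if l = k then freq l *\<^sub>R w else 0)) = (\<lambda>l. freq l *\<^sub>R sine_coeff ?u l)"
    by (auto simp: two_modes_coeff scaleR_add_right)
  ultimately have "(\<Sum>l. freq l *\<^sub>R sine_coeff ?u l) = freq j *\<^sub>R v + freq k *\<^sub>R w"
    by (simp add: sums_iff)
  then show ?thesis using normal_deriv_zero(2)[OF u s2] by simp
qed

lemma two_modes_laplacian:
  "dirichlet_laplacian L (\<lambda>x. mode j v x + mode k w x)
    (\<lambda>x. (- (freq j)\<^sup>2) *\<^sub>R mode j v x + (- (freq k)\<^sup>2) *\<^sub>R mode k w x)"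
  by (rule dirichlet_laplacian_add[OF mode_laplacian mode_laplacian])

lemma matrix_mode: "M *v mode k v x = mode k (M *v v) x" for M :: "complex^'n^'n"
  by (simp add: mode_def scaleR_smult matrix_smult)

lemma mode_eigen:
  fixes M :: "complex^'n^'n"
  assumes "M *v v = (s + complex_of_real ((freq k)\<^sup>2)) *s v"
  shows "(- (freq k)\<^sup>2) *\<^sub>R mode k v x + M *v mode k v x = s *s mode k v x"
  unfolding matrix_mode assms mode_smult scaleR_smult by (simp add: vec_eq_iff algebra_simps)

text \<open>Along the exponential adjoint solution ending at \<zeta>, the sum of both modes, the
  boundary integrand vanishes for every control; starting from 0, \<open>y 1\<close> is therefore
  zero on \<zeta>. Approximating targets that see a single coefficient of \<zeta> forces that
  coefficient to vanish. The choice w = 0 covers a single mode.\<close>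

theorem controllable_two_modes:
  fixes A :: "complex^'n^'n" and B :: "complex^'m^'n"
  assumes ctrl: "approx_controllable L A B"
    and v: "conj_transpose A *v v = (s + complex_of_real ((freq j)\<^sup>2)) *s v"
    and w: "conj_transpose A *v w = (s + complex_of_real ((freq k)\<^sup>2)) *s w"
    and obs: "\<And>g. cdot (B *v g) (freq j *\<^sub>R v + freq k *\<^sub>R w) = 0"
  shows "(if l = j then v else 0) + (if l = k then w else 0) = 0"
proof -
  define \<zeta> where "\<zeta> = (\<lambda>x. mode j v x + mode k w x)"
  define q where "q = sine_coeff \<zeta> l"
  have \<zeta>: "\<zeta> \<in> H10 L" unfolding \<zeta>_def by (intro H10_add mode_H10)
  let ?z = "\<lambda>t x. exp (s * complex_of_real (1 - t)) *s \<zeta> x"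
  have z: "adjoint_solution L A 1 \<zeta> ?z"
  proof (rule eigenfunction_adjoint_solution)
    show "dirichlet_laplacian L \<zeta> (\<lambda>x. (- (freq j)\<^sup>2) *\<^sub>R mode j v x + (- (freq k)\<^sup>2) *\<^sub>R mode k w x)"
      unfolding \<zeta>_def by (rule two_modes_laplacian)
    fix x
    have "(- (freq j)\<^sup>2) *\<^sub>R mode j v x + (- (freq k)\<^sup>2) *\<^sub>R mode k w x + conj_transpose A *v \<zeta> x =
      ((- (freq j)\<^sup>2) *\<^sub>R mode j v x + conj_transpose A *v mode j v x) + ((- (freq k)\<^sup>2) *\<^sub>R mode k w x + conj_transpose A *v mode k w x)"
      by (simp add: \<zeta>_def matrix_vector_right_distrib)
    also have "\<dots> = s *s \<zeta> x"
      unfolding mode_eigen[OF v] mode_eigen[OF w] \<zeta>_def by (simp add: vector_add_ldistrib)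
    finally show "(- (freq j)\<^sup>2) *\<^sub>R mode j v x + (- (freq k)\<^sup>2) *\<^sub>R mode k w x + conj_transpose A *v \<zeta> x = s *s \<zeta> x" .
  qed
  have nd: "cdot (B *v g) (normal_deriv L (?z t) 0) = 0" for g t
  proof -
    let ?c = "exp (s * complex_of_real (1 - t))"
    have "?z t = (\<lambda>x. mode j (?c *s v) x + mode k (?c *s w) x)"
      by (simp add: \<zeta>_def mode_smult vector_add_ldistrib)
    then have "normal_deriv L (?z t) 0 = - (freq j *\<^sub>R (?c *s v) + freq k *\<^sub>R (?c *s w))"
      by (simp only: normal_deriv_two_modes)
    also have "\<dots> = (- ?c) *s (freq j *\<^sub>R v + freq k *\<^sub>R w)"
      unfolding scaleR_smult by (simp add: vec_eq_iff algebra_simps)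
    finally show ?thesis by (simp only: cdot_smult_right obs mult_zero_right)
  qed
  have zero: "(\<lambda>_. 0) \<in> Hm1 L" unfolding Hm1_def by (auto intro!: exI[of _ 0])
  \<comment> \<open>A target concentrated in mode l, chosen so that its value on \<zeta> is
    |q|^2.\<close>
  define Q where "Q k = (if k = l then q else 0)" for k
  have Q: "hm_seq Q" unfolding hm_seq_def by (rule summable_finite[of "{l}"]) (auto simp: Q_def)
  have Q\<zeta>: "hm_functional Q \<zeta> = complex_of_real ((norm q)\<^sup>2)"
  proof -
    have "(\<lambda>k. if k = l then cdot (Q k) (sine_coeff \<zeta> k) else 0) sums cdot (Q l) (sine_coeff \<zeta> l)"
      by (rule sums_single)
    moreover have "(\<lambda>k. if k = l then cdot (Q k) (sine_coeff \<zeta> k) else 0) = (\<lambda>k. cdot (Q k) (sine_coeff \<zeta> k))"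
      by (auto simp: Q_def)
    ultimately show ?thesis
      unfolding hm_functional_def by (simp add: sums_iff Q_def q_def[symmetric] cdot_self)
  qed
  have le: "(norm q)\<^sup>2 \<le> \<epsilon> * H10_norm L \<zeta>" if \<epsilon>: "\<epsilon> > 0" for \<epsilon>
  proof -
    have "approx_controllable_at L A B 1" using ctrl unfolding approx_controllable_def by simp
    then obtain g y where y: "transposition_solution L 1 A B (\<lambda>_. 0) g y"
      and near: "Hm1_norm L (\<lambda>\<zeta>. y 1 \<zeta> - hm_functional Q \<zeta>) \<le> \<epsilon>"
      unfolding approx_controllable_at_def using zero hm_functional_Hm1[OF Q] \<epsilon> by blast
    have yH: "y 1 \<in> Hm1 L" using y unfolding transposition_solution_def by simp
    have "y 1 \<zeta> - 0 = - (LINT t:{0<..<1}|lborel. cdot (B *v g t 0) (normal_deriv L (?z t) 0))"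
      using y z \<zeta> unfolding transposition_solution_def by simp
    then have "y 1 \<zeta> = 0" unfolding nd by (simp add: set_lebesgue_integral_def)
    then have "(norm q)\<^sup>2 = cmod (y 1 \<zeta> - hm_functional Q \<zeta>)" by (simp add: Q\<zeta> norm_power)
    also have "\<dots> \<le> Hm1_norm L (\<lambda>\<zeta>. y 1 \<zeta> - hm_functional Q \<zeta>) * H10_norm L \<zeta>"
      by (rule Hm1_norm_bound[OF Hm1_diff[OF yH hm_functional_Hm1[OF Q]] \<zeta>])
    also have "\<dots> \<le> \<epsilon> * H10_norm L \<zeta>" by (rule mult_right_mono[OF near H10_norm_nonneg])
    finally show ?thesis .
  qed
  have "q = 0"
  proof (rule ccontr)
    assume "q \<noteq> 0"
    \<comment> \<open>The added 1 keeps h positive; \<epsilon> = |q|^2 / h then contradicts the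
      estimate \<open>le\<close>.\<close>
    define h where "h = H10_norm L \<zeta> + 1"
    have h: "h > 0" "H10_norm L \<zeta> < h" using H10_norm_nonneg[of \<zeta>] by (auto simp: h_def)
    have qp: "(norm q)\<^sup>2 > 0" using \<open>q \<noteq> 0\<close> by simp
    have "(norm q)\<^sup>2 \<le> ((norm q)\<^sup>2 / h) * H10_norm L \<zeta>" by (rule le) (use qp h in simp)
    also have "\<dots> < ((norm q)\<^sup>2 / h) * h" by (rule mult_strict_left_mono) (use qp h in auto)
    also have "\<dots> = (norm q)\<^sup>2" using h by simp
    finally show False by simp
  qed
  then show ?thesis by (simp add: q_def \<zeta>_def two_modes_coeff)
qed

section \<open>Eigenvalues of the Laplacian and of the coupled system\<close>

lemma sine_coeff_AE_eq:
  fixes f h :: "real \<Rightarrow> 'a::euclidean_space"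
  assumes "square_integrable N f" "square_integrable N h"
    and "AE x in lborel. x \<in> {0<..<L} \<longrightarrow> f x = h x"
  shows "sine_coeff f k = sine_coeff h k"
proof -
  have "AE x in N. f x = h x" using assms(3) by (simp add: AE_restrict_space_iff)
  then have "(\<integral>x. sin (freq k * x) *\<^sub>R f x \<partial>N) = (\<integral>x. sin (freq k * x) *\<^sub>R h x \<partial>N)"
    by (intro integral_cong_AE square_integrableD(1) sin_mult_square_integrable assms(1,2)) auto
  then show ?thesis by (simp add: sine_coeff_def)
qed

lemma laplacian_coeff:
  assumes "dirichlet_laplacian L u f"
  shows "square_integrable N f" "sine_coeff f k = - (freq k)\<^sup>2 *\<^sub>R sine_coeff u k"
proof -
  obtain p where p: "has_H1_deriv L u p" "has_H1_deriv L p f" and u: "u \<in> H10 L"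
    using assms unfolding dirichlet_laplacian_def by blast
  show "square_integrable N f" by (rule has_H1_derivD(1)[OF p(2)])
  show "sine_coeff f k = - (freq k)\<^sup>2 *\<^sub>R sine_coeff u k"
    by (rule sine_coeff_laplacian[OF p H10_boundary(1,2)[OF u]])
qed

lemma freq_inject: "(freq j)\<^sup>2 = (freq k)\<^sup>2 \<longleftrightarrow> j = k"
proof
  assume "(freq j)\<^sup>2 = (freq k)\<^sup>2"
  then have "freq j = freq k" using freq_pos[of j] freq_pos[of k] by (simp add: power2_eq_iff_nonneg)
  then show "j = k" using L_pos by (simp add: freq_def)
qed simp

text \<open>At a nonzero sine coefficient of an eigenfunction the equation becomes \<mu> = - freq^2;
  conversely the modes are eigenfunctions.\<close>

theorem laplacian_eigenvalues_eq:
  "laplacian_eigenvalues L = range (\<lambda>k. - complex_of_real ((freq k)\<^sup>2))"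
proof
  show "laplacian_eigenvalues L \<subseteq> range (\<lambda>k. - complex_of_real ((freq k)\<^sup>2))"
  proof
    fix \<mu> assume "\<mu> \<in> laplacian_eigenvalues L"
    then obtain \<phi> f where \<phi>: "\<phi> \<noteq> (\<lambda>x. 0)" "dirichlet_laplacian L \<phi> f"
      "AE x in lborel. x \<in> {0<..<L} \<longrightarrow> f x = \<mu> * \<phi> x" by (auto simp: laplacian_eigenvalues_def)
    have H: "\<phi> \<in> H10 L" using \<phi>(2) by (simp add: dirichlet_laplacian_def)
    obtain k where k: "sine_coeff \<phi> k \<noteq> 0" using H10_coeff_nonzero[OF H \<phi>(1)] by blast
    note sq = H10_square_integrable[OF H]
    have "sine_coeff f k = sine_coeff (\<lambda>x. \<mu> * \<phi> x) k"
      by (rule sine_coeff_AE_eq[OF laplacian_coeff(1)[OF \<phi>(2)] square_integrable_linear[OF bounded_linear_mult_right sq] \<phi>(3)])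
    also have "\<dots> = \<mu> * sine_coeff \<phi> k" by (rule sine_coeff_linear[OF bounded_linear_mult_right sq])
    finally have "(- complex_of_real ((freq k)\<^sup>2)) * sine_coeff \<phi> k = \<mu> * sine_coeff \<phi> k"
      unfolding laplacian_coeff(2)[OF \<phi>(2)] by (simp add: scaleR_conv_of_real)
    then have "\<mu> = - complex_of_real ((freq k)\<^sup>2)" by (rule iffD1[OF mult_right_cancel[OF k], symmetric])
    then show "\<mu> \<in> range (\<lambda>k. - complex_of_real ((freq k)\<^sup>2))" by blast
  qed
  show "range (\<lambda>k. - complex_of_real ((freq k)\<^sup>2)) \<subseteq> laplacian_eigenvalues L"
  proof
    fix \<mu> assume "\<mu> \<in> range (\<lambda>k. - complex_of_real ((freq k)\<^sup>2))"
    then obtain k where k: "\<mu> = - complex_of_real ((freq k)\<^sup>2)" by blast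
    have "mode k (1::complex) \<noteq> (\<lambda>x. 0)"
    proof
      assume "mode k (1::complex) = (\<lambda>x. 0)"
      then have "sine_coeff (mode k (1::complex)) k = 0" by (simp add: sine_coeff_zero)
      then show False by (simp add: sine_coeff_mode)
    qed
    moreover have "(- (freq k)\<^sup>2) *\<^sub>R mode k (1::complex) x = \<mu> * mode k 1 x" for x
      by (simp add: k scaleR_conv_of_real)
    ultimately show "\<mu> \<in> laplacian_eigenvalues L"
      unfolding laplacian_eigenvalues_def using mode_laplacian[of k "1::complex"] by auto
  qed
qed

text \<open>Some sine coefficient of the eigenfunction is nonzero, and the equation projected to
  that mode is an eigenvector equation for M.\<close>

lemma system_eigenvalue_decomposition:
  assumes "s \<in> system_eigenvalues L M"
  obtains k v where "v \<noteq> 0" "M *v v = (s + complex_of_real ((freq k)\<^sup>2)) *s v"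
proof -
  obtain u f where u: "u \<noteq> (\<lambda>x. 0)" "dirichlet_laplacian L u f"
    "AE x in lborel. x \<in> {0<..<L} \<longrightarrow> f x + M *v u x = s *s u x"
    using assms by (auto simp: system_eigenvalues_def)
  have H: "u \<in> H10 L" using u(2) by (simp add: dirichlet_laplacian_def)
  obtain k where k: "sine_coeff u k \<noteq> 0" using H10_coeff_nonzero[OF H u(1)] by blast
  note sq = H10_square_integrable[OF H] and fs = laplacian_coeff(1)[OF u(2)]
  note Mq = square_integrable_linear[OF bounded_linear_matrix[of M] sq]
  have "sine_coeff (\<lambda>x. f x + M *v u x) k = sine_coeff (\<lambda>x. s *s u x) k"
    by (rule sine_coeff_AE_eq[OF square_integrable_add[OF fs Mq] square_integrable_linear[OF bounded_linear_smult sq] u(3)])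
  then have "- (freq k)\<^sup>2 *\<^sub>R sine_coeff u k + M *v sine_coeff u k = s *s sine_coeff u k"
    unfolding sine_coeff_add[OF fs Mq] laplacian_coeff(2)[OF u(2)] sine_coeff_linear[OF bounded_linear_matrix sq] sine_coeff_smult[OF sq] .
  then have "M *v sine_coeff u k = s *s sine_coeff u k + (freq k)\<^sup>2 *\<^sub>R sine_coeff u k"
    by (simp add: algebra_simps)
  also have "\<dots> = (s + complex_of_real ((freq k)\<^sup>2)) *s sine_coeff u k"
    unfolding scaleR_smult by (simp add: vec_eq_iff algebra_simps)
  finally show ?thesis using k by (intro that)
qed

lemma mode_system_eigenvalue:
  assumes "v \<noteq> 0" "M *v v = \<theta> *s v"
  shows "\<theta> - complex_of_real ((freq k)\<^sup>2) \<in> system_eigenvalues L M"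
proof -
  let ?s = "\<theta> - complex_of_real ((freq k)\<^sup>2)"
  have "mode k v \<noteq> (\<lambda>x. 0)"
  proof
    assume "mode k v = (\<lambda>x. 0)"
    then have "sine_coeff (mode k v) k = 0" by (simp add: sine_coeff_zero)
    then show False using assms(1) by (simp add: sine_coeff_mode)
  qed
  moreover have "(- (freq k)\<^sup>2) *\<^sub>R mode k v x + M *v mode k v x = ?s *s mode k v x" for x
    by (rule mode_eigen) (simp add: assms(2))
  ultimately show ?thesis
    unfolding system_eigenvalues_def using mode_laplacian[of k v] by blast
qed

text \<open>For m = 1 every \<open>B *v g\<close> is a multiple of b, so one scalar equation decides
  whether an eigenfunction is invisible to the control. Two eigenvectors in different modes of one
  eigenvalue therefore always have a nonzero invisible combination, which is why the second
  condition is necessary.\<close>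

theorem approx_controllable_iff:
  fixes A :: "complex^'n^'n" and B :: "complex^'m^'n"
  assumes card: "CARD('m) = 1"
  shows "approx_controllable L A B \<longleftrightarrow>
    (\<forall>\<theta>\<in>eigenvalues (conj_transpose A).
        ker (mat \<theta> - conj_transpose A) \<inter> ker (conj_transpose B) = {0}) \<and>
    (\<forall>s\<in>system_eigenvalues L (conj_transpose A). num_pairs L (conj_transpose A) s = 1)"
    (is "_ \<longleftrightarrow> ?kernels \<and> ?simple")
proof -
  let ?M = "conj_transpose A"
  define b where "b = B *v (\<chi> i. 1)"
  obtain i :: 'm where i: "UNIV = {i}" using card by (metis card_1_singletonE)
  have Bg: "cdot (B *v g) x = (g $ i) * cdot b x" for g x
  proof -
    have gi: "g $ i = g $ j" for j
    proof -
      have "j \<in> {i}" unfolding i[symmetric] by (rule UNIV_I)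
      then show ?thesis by simp
    qed
    have "(g $ i) *s (\<chi> i. 1) = g" unfolding vec_eq_iff by (intro allI) (simp, rule gi)
    then have "B *v g = (g $ i) *s b" unfolding b_def by (simp only: matrix_smult[symmetric])
    then show ?thesis by (simp only: cdot_smult_left)
  qed
  have kerB: "x \<in> ker (conj_transpose B) \<longleftrightarrow> cdot b x = 0" for x
  proof
    assume "x \<in> ker (conj_transpose B)"
    then have "cdot b x = 0" unfolding b_def cdot_conj_transpose by (simp add: ker_def)
    then show "cdot b x = 0" .
  next
    assume "cdot b x = 0"
    \<comment> \<open>The pairing of B B^* x with x is |B^* x|^2.\<close>
    then have "cdot (B *v (conj_transpose B *v x)) x = 0" by (simp add: Bg)
    then show "x \<in> ker (conj_transpose B)" by (simp add: cdot_conj_transpose cdot_self ker_def)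
  qed
  have pairs: "num_pairs L ?M s = card {(\<mu>, \<theta>). \<mu> \<in> range (\<lambda>k. - complex_of_real ((freq k)\<^sup>2)) \<and> \<theta> \<in> eigenvalues ?M \<and> s = \<mu> + \<theta>}" for s
    unfolding num_pairs_def laplacian_eigenvalues_eq ..
  show ?thesis
  proof
    assume ctrl: "approx_controllable L A B"
    have ?kernels
    proof
      fix \<theta> assume "\<theta> \<in> eigenvalues ?M"
      have "x = 0" if "x \<in> ker (mat \<theta> - ?M) \<inter> ker (conj_transpose B)" for x
      proof -
        \<comment> \<open>The eigenvector is placed in mode 0, which gives s = \<theta> - (freq
          0)^2; the second mode is filled with 0.\<close>
        have "?M *v x = (\<theta> - complex_of_real ((freq 0)\<^sup>2) + complex_of_real ((freq 0)\<^sup>2)) *s x"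
          using that by (simp add: ker_def matrix_diff_eigen)
        moreover have "?M *v 0 = (\<theta> - complex_of_real ((freq 0)\<^sup>2) + complex_of_real ((freq 0)\<^sup>2)) *s 0" by simp
        moreover have "cdot (B *v g) (freq 0 *\<^sub>R x + freq 0 *\<^sub>R 0) = 0" for g
          using that kerB[of x] by (simp add: Bg cdot_scaleR_right)
        ultimately have "(if (0::nat) = 0 then x else 0) + (if (0::nat) = 0 then 0 else 0) = 0"
          by (rule controllable_two_modes[OF ctrl])
        then show ?thesis by simp
      qed
      then show "ker (mat \<theta> - ?M) \<inter> ker (conj_transpose B) = {0}" by (auto simp: ker_def)
    qed
    moreover have ?simple
    proof
      fix s assume s: "s \<in> system_eigenvalues L ?M"
      let ?P = "{(\<mu>, \<theta>). \<mu> \<in> range (\<lambda>k. - complex_of_real ((freq k)\<^sup>2)) \<and> \<theta> \<in> eigenvalues ?M \<and> s = \<mu> + \<theta>}"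
      obtain k v where v: "v \<noteq> 0" "?M *v v = (s + complex_of_real ((freq k)\<^sup>2)) *s v"
        by (rule system_eigenvalue_decomposition[OF s])
      have mem: "(- complex_of_real ((freq k)\<^sup>2), s + complex_of_real ((freq k)\<^sup>2)) \<in> ?P"
        using v by (auto simp: eigenvalues_def)
      have uniq: "p = (- complex_of_real ((freq k)\<^sup>2), s + complex_of_real ((freq k)\<^sup>2))" if p: "p \<in> ?P" for p
      proof -
        obtain j \<theta> where j: "p = (- complex_of_real ((freq j)\<^sup>2), \<theta>)" "\<theta> \<in> eigenvalues ?M" "s = - complex_of_real ((freq j)\<^sup>2) + \<theta>"
          using p by auto
        then obtain w where w: "w \<noteq> 0" "?M *v w = \<theta> *s w" by (auto simp: eigenvalues_def)
        have \<theta>: "\<theta> = s + complex_of_real ((freq j)\<^sup>2)" using j(3) by simp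
        have "j = k"
        proof (rule ccontr)
          assume jk: "j \<noteq> k"
          note w' = w(2)[unfolded \<theta>]
          let ?p = "cdot b (freq j *\<^sub>R w)" and ?q = "cdot b (freq k *\<^sub>R v)"
          show False
          \<comment> \<open>If b does not see w, the mode of w alone is invisible; otherwise w is
            rescaled so that the two contributions cancel.\<close>
          proof (cases "?p = 0")
            case True
            then have obs: "cdot (B *v g) (freq j *\<^sub>R w + freq j *\<^sub>R 0) = 0" for g by (simp add: Bg)
            have "?M *v 0 = (s + complex_of_real ((freq j)\<^sup>2)) *s 0" by simp
            then have "(if j = j then w else 0) + (if j = j then 0 else 0) = 0"
              by (rule controllable_two_modes[OF ctrl w' _ obs])
            then show False using w(1) by simp
          next
            case False
            \<comment> \<open>Conjugated because c passes through the second slot of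
              \<open>cdot\<close>.\<close>
            define c where "c = cnj (- ?q / ?p)"
            have cw: "?M *v (c *s w) = (s + complex_of_real ((freq j)\<^sup>2)) *s (c *s w)"
              by (simp only: matrix_smult w' vector_smult_assoc mult.commute)
            have obs: "cdot (B *v g) (freq j *\<^sub>R (c *s w) + freq k *\<^sub>R v) = 0" for g
            proof -
              have "freq j *\<^sub>R (c *s w) = c *s (freq j *\<^sub>R w)"
                by (simp only: scaleR_smult vector_smult_assoc mult.commute)
              then have "cdot b (freq j *\<^sub>R (c *s w) + freq k *\<^sub>R v) = (- ?q / ?p) * ?p + ?q"
                by (simp only: cdot_add_right cdot_smult_right c_def complex_cnj_cnj)
              also have "\<dots> = 0" using False by simp
              finally show ?thesis by (simp add: Bg)
            qed
            \<comment> \<open>Reading off mode k, which differs from j, isolates v.\<close>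
            have "(if k = j then c *s w else 0) + (if k = k then v else 0) = 0"
              by (rule controllable_two_modes[OF ctrl cw v(2) obs])
            then show False using jk v(1) by simp
          qed
        qed
        then show ?thesis unfolding j(1) \<theta> by (simp only:)
      qed
      have "?P = {(- complex_of_real ((freq k)\<^sup>2), s + complex_of_real ((freq k)\<^sup>2))}"
        by (rule equalityI, rule subsetI, subst singleton_iff, erule uniq,
            rule insert_subset[THEN iffD2, OF conjI[OF mem empty_subsetI]])
      then show "num_pairs L ?M s = 1" unfolding pairs by (simp only: card.insert finite.emptyI empty_iff card.empty simp_thms One_nat_def if_True)
    qed
    ultimately show "?kernels \<and> ?simple" ..
  next
    assume conds: "?kernels \<and> ?simple"
    show "approx_controllable L A B"
    proof (rule approx_controllable_sufficient)
      fix v \<theta> assume v: "?M *v v = \<theta> *s v" "cdot v (B *v (\<chi> i. 1)) = 0"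
      show "v = 0"
      proof (rule ccontr)
        assume nz: "v \<noteq> 0"
        then have "\<theta> \<in> eigenvalues ?M" using v(1) by (auto simp: eigenvalues_def)
        moreover have "v \<in> ker (mat \<theta> - ?M)" by (simp add: ker_def matrix_diff_eigen v(1))
        moreover have "v \<in> ker (conj_transpose B)"
          unfolding kerB using v(2) cdot_commute[of b v] by (simp add: b_def)
        ultimately show False using conds nz by blast
      qed
    next
      fix j k \<theta> \<theta>'
      assume \<theta>: "\<theta> \<in> eigenvalues ?M" "\<theta>' \<in> eigenvalues ?M"
        and eq: "\<theta> - complex_of_real ((freq j)\<^sup>2) = \<theta>' - complex_of_real ((freq k)\<^sup>2)"
      obtain v where v: "v \<noteq> 0" "?M *v v = \<theta> *s v" using \<theta>(1) by (auto simp: eigenvalues_def)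
      let ?s = "\<theta> - complex_of_real ((freq j)\<^sup>2)"
      have "num_pairs L ?M ?s = 1" using conds mode_system_eigenvalue[OF v] by blast
      then obtain p where p: "{(\<mu>, \<theta>). \<mu> \<in> range (\<lambda>k. - complex_of_real ((freq k)\<^sup>2)) \<and> \<theta> \<in> eigenvalues ?M \<and> ?s = \<mu> + \<theta>} = {p}"
        unfolding pairs by (rule card_1_singletonE)
      have "(- complex_of_real ((freq j)\<^sup>2), \<theta>) \<in> {p}" unfolding p[symmetric] using \<theta> by auto
      moreover have "(- complex_of_real ((freq k)\<^sup>2), \<theta>') \<in> {p}" unfolding p[symmetric] eq using \<theta> by auto
      ultimately have "complex_of_real ((freq j)\<^sup>2) = complex_of_real ((freq k)\<^sup>2)" by auto
      then show "j = k" unfolding of_real_eq_iff freq_inject .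
    qed
  qed
qed

end

theorem theorem2p12:
  fixes L :: real and A :: "complex^'n^'n" and B :: "complex^'m^'n"
  assumes "L > 0" and "CARD('m) = 1"
  shows "approx_controllable L A B \<longleftrightarrow>
    (\<forall>\<theta>\<in>eigenvalues (conj_transpose A).
        ker (mat \<theta> - conj_transpose A) \<inter> ker (conj_transpose B) = {0}) \<and>
    (\<forall>s\<in>system_eigenvalues L (conj_transpose A). num_pairs L (conj_transpose A) s = 1)"
proof -
  interpret interval L by unfold_locales (rule assms(1))
  show ?thesis by (rule approx_controllable_iff[OF assms(2)])
qed

end
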